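(* For all $\beta,\eta\in\mathscr N$, $$\mathrm{dist}_q\big((\mathfrak{sa}(\mathfrak{BD}(\beta)),\mathsf L_{\beta}),(\mathfrak{sa}(\mathfrak{BD}(\eta)),\mathsf L_{\eta})\big)\le 32\,\mathsf d_{\mathscr N}(\beta,\eta);$$ that is, the map $\beta\in(\mathscr N,\mathsf d_{\mathscr N})\mapsto(\mathfrak{sa}(\mathfrak{BD}(\beta)),\mathsf L_{\beta})$ into the class of quantum metric order unit spaces equipped with $\mathrm{dist}_q$ is Lipschitz with Lipschitz constant at most $32$. Here $\mathsf L_\sigma$ is the Lip-norm on $\mathfrak{sa}(\mathfrak{BD}(\sigma))$ described in the context.
   Context: **Order unit spaces and $\mathrm{dist}_q$.** An order unit space $\mathfrak A$ is an ordered real vector space with a distinguished $1_{\mathfrak A}$ such that for each $a$ there is $\lambda>0$ with $-\lambda 1_{\mathfrak A}\le a\le\lambda 1_{\mathfrak A}$, and which is Archimedean ($a\le\lambda 1_{\mathfrak A}$ for all $\lambda>0$ implies $a\le 0$). Its norm is $\|a\|=\inf\{\lambda>0:-\lambda 1_{\mathfrak A}\le a\le\lambda 1_{\mathfrak A}\}$. Its state space $\mathscr S(\mathfrak A)$ is the set of positive linear functionals $\mathfrak A\to\mathbb R$ taking value $1$ at $1_{\mathfrak A}$. The self-adjoint part $\mathfrak{sa}(\mathfrak A)$ of a unital C*-algebra is a complete order unit space. A quantum metric order unit space $(\mathfrak A,\mathsf L)$ is a norm-complete order unit space with a seminorm $\mathsf L$ (a Lip-norm) defined on a norm-dense subspace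 $\mathrm{dom}(\mathsf L)$ (convention: $\mathsf L=\infty$ outside) such that: (1) $\{a:\mathsf L(a)=0\}=\mathbb R1_{\mathfrak A}$; (2) $\mathsf{mk}_{\mathsf L}(\varphi,\psi)=\sup\{|\varphi(a)-\psi(a)|:\mathsf L(a)\le 1\}$ is a metric inducing the weak* topology on $\mathscr S(\mathfrak A)$; (3) $\{a:\mathsf L(a)\le 1\}$ is norm-closed. For two such spaces $(\mathfrak A_1,\mathsf L_1),(\mathfrak A_2,\mathsf L_2)$, a Lip-norm $\mathsf L$ on $\mathfrak A_1\oplus\mathfrak A_2$ (coordinatewise order, unit $(1,1)$) is admissible if its quotient seminorm on $\mathfrak A_j$ (infimum of $\mathsf L$ over the other coordinate) is $\mathsf L_j$ for $j=1,2$. Rieffel's distance $\mathrm{dist}_q((\mathfrak A_1,\mathsf L_1),(\mathfrak A_2,\mathsf L_2))$ is the infimum over admissible $\mathsf L$ of the Hausdorff distance, for $\mathsf{mk}_{\mathsf L}$, between $\mathscr S(\mathfrak A_1)$ and $\mathscr S(\mathfrak A_2)$, both viewed in $\mathscr S(\mathfrak A_1\oplus\mathfrak A_2)$ via the coordinate projections. **Bunce-Deddens data.** The Baire space $\mathscr N$ is the set of sequences $\sigma=(\sigma_m)_{m\ge 1}$ of integers $\ge 2$, with metric $\mathsf d_{\mathscr N}(x,y)=0$ if $x=y$ and $2^{-\min\{m:x_m\ne y_m\}}$ otherwise. Put $\boxtimes\sigma_0=1$, $\boxtimes\sigma_m=\prod_{j=1}^m\sigma_j$. Let $z(t)=\exp(2\pi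 i t)$. For $n\ge 1$ and $1\le j,k\le n$ let $z^n_{j,k}(t)=\frac1{\sqrt n}z\big(\frac{(n-j)(t+k-1)}{n}\big)$ and $U_n(t)=(z^n_{j,k}(t))_{j,k}\in M_n(\mathbb C)$, which is unitary. For $m\ge1$, $U_{\sigma,m}(t)\in M_{\boxtimes\sigma_m}(\mathbb C)$ is the $\sigma_m\times\sigma_m$ block matrix whose $(j,k)$ block is $z^{\sigma_m}_{j,k}(t)\,I_{\boxtimes\sigma_{m-1}}$; $U_{\sigma,0}=1$. For $m\ge0$, $\mathfrak{CP}(\sigma,m)$ is the C*-algebra (sup norm) of continuous $1$-periodic functions $\mathbb R\to M_{\boxtimes\sigma_m}(\mathbb C)$. The unital *-monomorphism $\alpha_{\sigma,m}:\mathfrak{CP}(\sigma,m)\to\mathfrak{CP}(\sigma,m+1)$ is $$\alpha_{\sigma,m}(a)(t)=U_{\sigma,m+1}(t)\,\mathrm{diag}\Big(a\big(\tfrac{t}{\sigma_{m+1}}\big),a\big(\tfrac{t+1}{\sigma_{m+1}}\big),\dots,a\big(\tfrac{t+\sigma_{m+1}-1}{\sigma_{m+1}}\big)\Big)U_{\sigma,m+1}(t)^*,$$ and $\mathfrak{BD}(\sigma)=\varinjlim(\mathfrak{CP}(\sigma,m),\alpha_{\sigma,m})$ is the Bunce-Deddens algebra, with canonical unital *-monomorphisms $\alpha_\sigma^{(m)}:\mathfrak{CP}(\sigma,m)\to\mathfrak{BD}(\sigma)$. $\alpha_{\sigma,m-1}^{-1}$ denotes the inverse of $\alpha_{\sigma,m-1}$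 on its range. $\tau_{\sigma,m}$ is the composition with $\alpha^{(m)}_\sigma$ of the unique faithful tracial state of $\mathfrak{BD}(\sigma)$, i.e. $\tau_{\sigma,m}(a)=\int_0^1\frac{1}{\boxtimes\sigma_m}\mathrm{Tr}(a(t))\,dt$. For $M\in M_{\boxtimes\sigma_m}(\mathbb C)$ written as a $\sigma_m\times\sigma_m$ matrix of blocks $N_{j,k}\in M_{\boxtimes\sigma_{m-1}}(\mathbb C)$, $D_{\sigma,m}(M)=\mathrm{diag}(N_{1,1},\dots,N_{\sigma_m,\sigma_m})$. For $m\ge1$, $\mathbb E_{\sigma,m}(a)(t)=U_{\sigma,m}(t)\,D_{\sigma,m}\big(U_{\sigma,m}(t)^*a(t)U_{\sigma,m}(t)\big)U_{\sigma,m}(t)^*$ is a conditional expectation of $\mathfrak{CP}(\sigma,m)$ onto $\alpha_{\sigma,m-1}(\mathfrak{CP}(\sigma,m-1))$. For a matrix-valued function $f$ on $\mathbb R$, $l(f)=\sup_{x\ne y}\|f(x)-f(y)\|/|x-y|\in[0,\infty]$ (operator norm on matrices). For $m\ge0$, $\mathsf L_{\sigma,m}(a)=\max\{l(U_{\sigma,m}^*aU_{\sigma,m}),\ \|a-\tau_{\sigma,m}(a)1\|\}$. **The Lip-norms.** Set $k_m=\max\{1,\frac{1+2l(U_{\sigma,m-1})}{\sigma_m}\}$ for $m\ge1$, $\varkappa_0=\varkappa_1=1$, $\varkappa_n=\varkappa_{n-1}/k_n$ for $n\ge2$; $\mathsf S_{\sigma,0}=\mathsf L_{\sigma,0}$ and,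 for $m\ge1$ and $a\in\mathfrak{sa}(\mathfrak{CP}(\sigma,m))$, $\mathsf S_{\sigma,m}(a)=\max\{\varkappa_m\mathsf L_{\sigma,m}(a),\ \mathsf S_{\sigma,m-1}(\alpha_{\sigma,m-1}^{-1}(\mathbb E_{\sigma,m}(a))),\ 2^m\|a-\mathbb E_{\sigma,m}(a)\|\}$. The Lip-norm $\mathsf L_\sigma$ on $\mathfrak{sa}(\mathfrak{BD}(\sigma))$ is the one obtained from the inductive-limit construction with bridge-length bounds $\psi(n)=2^{-(n+1)}$: for $a\in\mathfrak{sa}(\mathfrak{BD}(\sigma))$, $$\mathsf L_\sigma(a)=\inf\ \sup_{n\in\mathbb N}\max\Big\{\mathsf S_{\sigma,n}(a_n),\ \frac{\|a_{n+1}-\alpha_{\sigma,n}(a_n)\|}{4\psi(n)}\Big\},$$ the infimum being over all sequences $(a_n)_{n\in\mathbb N}$ with $a_n\in\mathfrak{sa}(\mathfrak{CP}(\sigma,n))$ and $\lim_n\|\alpha_\sigma^{(n)}(a_n)-a\|=0$ (with value $\infty$ allowed). *)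

theory Defs
  imports
    "HOL-Analysis.Analysis"
    "Jordan_Normal_Form.Schur_Decomposition"
begin

hide_const (open) Finite_Cartesian_Product.vec Finite_Cartesian_Product.mat
  Polynomial.smult Multiset.mult Modules.module Order.le

section \<open>Order unit spaces\<close>

text \<open>
  An ordered real vector space with a distinguished unit. The vector space is the underlying
  \<^typ>\<open>(real, 'a) module\<close>, the order unit is its field \<^const>\<open>one\<close>, and its field
  \<^const>\<open>mult\<close> plays no role.
\<close>

record 'a ous = "(real, 'a) module" +
  le :: "'a \<Rightarrow> 'a \<Rightarrow> bool"

locale order_unit_space = module "class_ring :: real ring" A for A :: "'a ous" +
  assumes one_in_carrier: "\<one>\<^bsub>A\<^esub> \<in> carrier A"
    and le_refl: "a \<in> carrier A \<Longrightarrow> le A a a"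
    and le_antisym:
      "a \<in> carrier A \<Longrightarrow> b \<in> carrier A \<Longrightarrow> le A a b \<Longrightarrow> le A b a \<Longrightarrow> a = b"
    and le_trans:
      "a \<in> carrier A \<Longrightarrow> b \<in> carrier A \<Longrightarrow> c \<in> carrier A \<Longrightarrow> le A a b \<Longrightarrow> le A b c \<Longrightarrow> le A a c"
    and le_add:
      "a \<in> carrier A \<Longrightarrow> b \<in> carrier A \<Longrightarrow> c \<in> carrier A \<Longrightarrow> le A a b
        \<Longrightarrow> le A (a \<oplus>\<^bsub>A\<^esub> c) (b \<oplus>\<^bsub>A\<^esub> c)"
    and le_smult:
      "a \<in> carrier A \<Longrightarrow> b \<in> carrier A \<Longrightarrow> 0 \<le> r \<Longrightarrow> le A a b
        \<Longrightarrow> le A (r \<odot>\<^bsub>A\<^esub> a) (r \<odot>\<^bsub>A\<^esub> b)"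
    and order_unit:
      "a \<in> carrier A \<Longrightarrow>
        \<exists>r>0. le A ((- r) \<odot>\<^bsub>A\<^esub> \<one>\<^bsub>A\<^esub>) a \<and> le A a (r \<odot>\<^bsub>A\<^esub> \<one>\<^bsub>A\<^esub>)"
    and archimedean:
      "a \<in> carrier A \<Longrightarrow> (\<And>r. 0 < r \<Longrightarrow> le A a (r \<odot>\<^bsub>A\<^esub> \<one>\<^bsub>A\<^esub>)) \<Longrightarrow> le A a \<zero>\<^bsub>A\<^esub>"

definition ou_norm :: "'a ous \<Rightarrow> 'a \<Rightarrow> real" where
  "ou_norm A a = Inf {r. 0 < r \<and> le A ((- r) \<odot>\<^bsub>A\<^esub> \<one>\<^bsub>A\<^esub>) a \<and> le A a (r \<odot>\<^bsub>A\<^esub> \<one>\<^bsub>A\<^esub>)}"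

text \<open>The value \<open>0\<close> off the carrier is there because \<^locale>\<open>Metric_space\<close> asks for
  nonnegativity and symmetry everywhere.\<close>

definition ou_dist :: "'a ous \<Rightarrow> 'a \<Rightarrow> 'a \<Rightarrow> real" where
  "ou_dist A a b = (if a \<in> carrier A \<and> b \<in> carrier A then ou_norm A (a \<ominus>\<^bsub>A\<^esub> b) else 0)"

abbreviation ou_topology :: "'a ous \<Rightarrow> 'a topology" where
  "ou_topology A \<equiv> Metric_space.mtopology (carrier A) (ou_dist A)"

text \<open>Functionals are made extensional so that they are determined by their values on the
  carrier.\<close>

definition states :: "'a ous \<Rightarrow> ('a \<Rightarrow> real) set" where
  "states A = {\<phi> \<in> extensional (carrier A).
     (\<forall>a\<in>carrier A. \<forall>b\<in>carrier A. \<phi> (a \<oplus>\<^bsub>A\<^esub> b) = \<phi> a + \<phi> b) \<and>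
     (\<forall>r. \<forall>a\<in>carrier A. \<phi> (r \<odot>\<^bsub>A\<^esub> a) = r * \<phi> a) \<and>
     (\<forall>a\<in>carrier A. le A \<zero>\<^bsub>A\<^esub> a \<longrightarrow> 0 \<le> \<phi> a) \<and>
     \<phi> \<one>\<^bsub>A\<^esub> = 1}"

definition weak_star :: "'a ous \<Rightarrow> ('a \<Rightarrow> real) topology" where
  "weak_star A = subtopology (product_topology (\<lambda>_. euclideanreal) (carrier A)) (states A)"

definition mk :: "'a ous \<Rightarrow> ('a \<Rightarrow> ereal) \<Rightarrow> ('a \<Rightarrow> real) \<Rightarrow> ('a \<Rightarrow> real) \<Rightarrow> ereal" where
  "mk A L \<phi> \<psi> = (SUP a \<in> {a \<in> carrier A. L a \<le> 1}. ereal \<bar>\<phi> a - \<psi> a\<bar>)"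

text \<open>A Lip-norm is given as a function with value \<open>\<infinity>\<close> outside its domain, which is
  then a subspace by subadditivity and homogeneity (in \<^typ>\<open>ereal\<close>, \<open>0 * \<infinity> = 0\<close>).\<close>

locale quantum_metric_ous = order_unit_space A for A :: "'a ous" +
  fixes L :: "'a \<Rightarrow> ereal"
  assumes complete: "Metric_space.mcomplete (carrier A) (ou_dist A)"
    and L_nonneg: "a \<in> carrier A \<Longrightarrow> 0 \<le> L a"
    and L_add: "a \<in> carrier A \<Longrightarrow> b \<in> carrier A \<Longrightarrow> L (a \<oplus>\<^bsub>A\<^esub> b) \<le> L a + L b"
    and L_smult: "a \<in> carrier A \<Longrightarrow> L (r \<odot>\<^bsub>A\<^esub> a) = ereal \<bar>r\<bar> * L a"
    and L_dense: "ou_topology A closure_of {a \<in> carrier A. L a < \<infinity>} = carrier A"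
    and L_kernel: "{a \<in> carrier A. L a = 0} = range (\<lambda>r. r \<odot>\<^bsub>A\<^esub> \<one>\<^bsub>A\<^esub>)"
    and mk_finite: "\<phi> \<in> states A \<Longrightarrow> \<psi> \<in> states A \<Longrightarrow> mk A L \<phi> \<psi> < \<infinity>"
    and mk_metric: "Metric_space (states A) (\<lambda>\<phi> \<psi>. real_of_ereal (mk A L \<phi> \<psi>))"
    and mk_topology:
      "Metric_space.mtopology (states A) (\<lambda>\<phi> \<psi>. real_of_ereal (mk A L \<phi> \<psi>)) = weak_star A"
    and L_closed: "closedin (ou_topology A) {a \<in> carrier A. L a \<le> 1}"

section \<open>Rieffel's distance\<close>

definition ous_sum :: "'a ous \<Rightarrow> 'b ous \<Rightarrow> ('a \<times> 'b) ous" where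
  "ous_sum A B = \<lparr>carrier = carrier A \<times> carrier B,
     mult = undefined,
     one = (\<one>\<^bsub>A\<^esub>, \<one>\<^bsub>B\<^esub>),
     zero = (\<zero>\<^bsub>A\<^esub>, \<zero>\<^bsub>B\<^esub>),
     add = (\<lambda>x y. (fst x \<oplus>\<^bsub>A\<^esub> fst y, snd x \<oplus>\<^bsub>B\<^esub> snd y)),
     smult = (\<lambda>r x. (r \<odot>\<^bsub>A\<^esub> fst x, r \<odot>\<^bsub>B\<^esub> snd x)),
     le = (\<lambda>x y. le A (fst x) (fst y) \<and> le B (snd x) (snd y))\<rparr>"

definition admissible ::
  "'a ous \<Rightarrow> ('a \<Rightarrow> ereal) \<Rightarrow> 'b ous \<Rightarrow> ('b \<Rightarrow> ereal) \<Rightarrow> ('a \<times> 'b \<Rightarrow> ereal) \<Rightarrow> bool" where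
  "admissible A LA B LB L \<longleftrightarrow>
     quantum_metric_ous (ous_sum A B) L \<and>
     (\<forall>a\<in>carrier A. (INF b\<in>carrier B. L (a, b)) = LA a) \<and>
     (\<forall>b\<in>carrier B. (INF a\<in>carrier A. L (a, b)) = LB b)"

definition hausdorff_dist :: "('p \<Rightarrow> 'p \<Rightarrow> ereal) \<Rightarrow> 'p set \<Rightarrow> 'p set \<Rightarrow> ereal" where
  "hausdorff_dist d X Y = max (SUP x\<in>X. INF y\<in>Y. d x y) (SUP y\<in>Y. INF x\<in>X. d x y)"

definition fst_states :: "'a ous \<Rightarrow> 'b ous \<Rightarrow> ('a \<times> 'b \<Rightarrow> real) set" where
  "fst_states A B = (\<lambda>\<phi>. \<lambda>x\<in>carrier (ous_sum A B). \<phi> (fst x)) ` states A"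

definition snd_states :: "'a ous \<Rightarrow> 'b ous \<Rightarrow> ('a \<times> 'b \<Rightarrow> real) set" where
  "snd_states A B = (\<lambda>\<phi>. \<lambda>x\<in>carrier (ous_sum A B). \<phi> (snd x)) ` states B"

definition dist_q ::
  "'a ous \<Rightarrow> ('a \<Rightarrow> ereal) \<Rightarrow> 'b ous \<Rightarrow> ('b \<Rightarrow> ereal) \<Rightarrow> ereal" where
  "dist_q A LA B LB =
     (INF L \<in> {L. admissible A LA B LB L}.
        hausdorff_dist (mk (ous_sum A B) L) (fst_states A B) (snd_states A B))"

section \<open>Unital C*-algebras and their inductive limits\<close>

record 'a star_alg = "(complex, 'a) module" +
  star :: "'a \<Rightarrow> 'a"
  nrm :: "'a \<Rightarrow> real"

text \<open>Positive elements of a C*-algebra are those of the form \<open>c\<^sup>* c\<close>.\<close>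

definition sa :: "'a star_alg \<Rightarrow> 'a ous" where
  "sa A = \<lparr>carrier = {a \<in> carrier A. star A a = a},
     mult = undefined,
     one = \<one>\<^bsub>A\<^esub>,
     zero = \<zero>\<^bsub>A\<^esub>,
     add = add A,
     smult = (\<lambda>r. smult A (complex_of_real r)),
     le = (\<lambda>a b. \<exists>c\<in>carrier A. b \<ominus>\<^bsub>A\<^esub> a = star A c \<otimes>\<^bsub>A\<^esub> c)\<rparr>"

primrec connecting :: "(nat \<Rightarrow> 'a \<Rightarrow> 'a) \<Rightarrow> nat \<Rightarrow> nat \<Rightarrow> 'a \<Rightarrow> 'a" where
  "connecting \<alpha> n 0 a = a"
| "connecting \<alpha> n (Suc k) a = \<alpha> (n + k) (connecting \<alpha> n k a)"

text \<open>
  The C*-inductive limit of \<open>A\<^sub>0 \<rightarrow> A\<^sub>1 \<rightarrow> \<dots>\<close> with isometric connecting maps is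
  realised inside \<open>(\<Prod>\<^sub>n A\<^sub>n) / (\<Oplus>\<^sub>n A\<^sub>n)\<close> (bounded sequences modulo null sequences), as the
  closure of the algebraic limit. That closure consists of the classes of the sequences below:
  those whose images in the limit form a Cauchy sequence.
\<close>

definition coherent :: "(nat \<Rightarrow> 'a star_alg) \<Rightarrow> (nat \<Rightarrow> 'a \<Rightarrow> 'a) \<Rightarrow> (nat \<Rightarrow> 'a) set" where
  "coherent A \<alpha> = {x. (\<forall>n. x n \<in> carrier (A n)) \<and>
     (\<forall>\<epsilon>>0. \<exists>N. \<forall>n\<ge>N. \<forall>k.
        nrm (A (n + k)) (x (n + k) \<ominus>\<^bsub>A (n + k)\<^esub> connecting \<alpha> n k (x n)) < \<epsilon>)}"

definition lim_rel ::
  "(nat \<Rightarrow> 'a star_alg) \<Rightarrow> (nat \<Rightarrow> 'a \<Rightarrow> 'a) \<Rightarrow> ((nat \<Rightarrow> 'a) \<times> (nat \<Rightarrow> 'a)) set" where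
  "lim_rel A \<alpha> = {(x, y). x \<in> coherent A \<alpha> \<and> y \<in> coherent A \<alpha> \<and>
     (\<lambda>n. nrm (A n) (x n \<ominus>\<^bsub>A n\<^esub> y n)) \<longlonglongrightarrow> 0}"

definition ind_lim ::
  "(nat \<Rightarrow> 'a star_alg) \<Rightarrow> (nat \<Rightarrow> 'a \<Rightarrow> 'a) \<Rightarrow> (nat \<Rightarrow> 'a) set star_alg" where
  "ind_lim A \<alpha> = \<lparr>carrier = coherent A \<alpha> // lim_rel A \<alpha>,
     mult = (\<lambda>X Y. \<Union>x\<in>X. \<Union>y\<in>Y. lim_rel A \<alpha> `` {\<lambda>n. x n \<otimes>\<^bsub>A n\<^esub> y n}),
     one = lim_rel A \<alpha> `` {\<lambda>n. \<one>\<^bsub>A n\<^esub>},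
     zero = lim_rel A \<alpha> `` {\<lambda>n. \<zero>\<^bsub>A n\<^esub>},
     add = (\<lambda>X Y. \<Union>x\<in>X. \<Union>y\<in>Y. lim_rel A \<alpha> `` {\<lambda>n. x n \<oplus>\<^bsub>A n\<^esub> y n}),
     smult = (\<lambda>c X. \<Union>x\<in>X. lim_rel A \<alpha> `` {\<lambda>n. c \<odot>\<^bsub>A n\<^esub> x n}),
     star = (\<lambda>X. \<Union>x\<in>X. lim_rel A \<alpha> `` {\<lambda>n. star (A n) (x n)}),
     nrm = (\<lambda>X. the_elem ((\<lambda>x. lim (\<lambda>n. nrm (A n) (x n))) ` X))\<rparr>"

text \<open>The canonical map of the \<open>n\<close>-th algebra into the limit. The entries before the
  \<open>n\<close>-th one do not affect the class.\<close>

definition to_lim ::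
  "(nat \<Rightarrow> 'a star_alg) \<Rightarrow> (nat \<Rightarrow> 'a \<Rightarrow> 'a) \<Rightarrow> nat \<Rightarrow> 'a \<Rightarrow> (nat \<Rightarrow> 'a) set" where
  "to_lim A \<alpha> n a =
     lim_rel A \<alpha> `` {\<lambda>k. if k < n then \<zero>\<^bsub>A k\<^esub> else connecting \<alpha> n (k - n) a}"

section \<open>Bunce-Deddens algebras\<close>

text \<open>Sequences are indexed from \<open>1\<close>; extensionality fixes the unused value at \<open>0\<close>.\<close>

definition baire :: "(nat \<Rightarrow> nat) set" where
  "baire = {1..} \<rightarrow>\<^sub>E {2..}"

definition baire_dist :: "(nat \<Rightarrow> nat) \<Rightarrow> (nat \<Rightarrow> nat) \<Rightarrow> real" where
  "baire_dist x y = (if x = y then 0 else (1 / 2) ^ (LEAST m. 1 \<le> m \<and> x m \<noteq> y m))"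

definition boxtimes :: "(nat \<Rightarrow> nat) \<Rightarrow> nat \<Rightarrow> nat" where
  "boxtimes \<sigma> m = (\<Prod>j=1..m. \<sigma> j)"

definition vec_norm :: "complex Matrix.vec \<Rightarrow> real" where
  "vec_norm v = L2_set (\<lambda>i. cmod (vec_index v i)) {..<dim_vec v}"

definition op_norm :: "complex Matrix.mat \<Rightarrow> real" where
  "op_norm M = (SUP v \<in> {v \<in> carrier_vec (dim_col M). vec_norm v \<le> 1}. vec_norm (M *\<^sub>v v))"

definition mat_trace :: "complex Matrix.mat \<Rightarrow> complex" where
  "mat_trace M = (\<Sum>i<dim_row M. M $$ (i, i))"

definition block :: "nat \<Rightarrow> complex Matrix.mat \<Rightarrow> nat \<Rightarrow> nat \<Rightarrow> complex Matrix.mat" where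
  "block b M j k = Matrix.mat b b (\<lambda>(p, q). M $$ (j * b + p, k * b + q))"

definition lip :: "(real \<Rightarrow> complex Matrix.mat) \<Rightarrow> ereal" where
  "lip f = (SUP (x, y) \<in> {(x, y). x \<noteq> y}. ereal (op_norm (f x - f y) / \<bar>x - y\<bar>))"

text \<open>The indices \<open>j, k\<close> of \<open>z_entry\<close> run from \<open>1\<close>; matrix
  and block indices of \<^typ>\<open>complex Matrix.mat\<close> run from \<open>0\<close>, whence the \<^const>\<open>Suc\<close> in \<open>U\<close>.\<close>

definition z_entry :: "nat \<Rightarrow> nat \<Rightarrow> nat \<Rightarrow> real \<Rightarrow> complex" where
  "z_entry n j k t =
     1 / complex_of_real (sqrt (real n)) *
     exp (2 * complex_of_real pi * \<i> *
          complex_of_real ((real n - real j) * (t + real k - 1) / real n))"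

fun U :: "(nat \<Rightarrow> nat) \<Rightarrow> nat \<Rightarrow> real \<Rightarrow> complex Matrix.mat" where
  "U \<sigma> 0 t = 1\<^sub>m 1"
| "U \<sigma> (Suc m) t = Matrix.mat (boxtimes \<sigma> (Suc m)) (boxtimes \<sigma> (Suc m))
     (\<lambda>(p, q). let b = boxtimes \<sigma> m in
        z_entry (\<sigma> (Suc m)) (Suc (p div b)) (Suc (q div b)) t * (1\<^sub>m b $$ (p mod b, q mod b)))"

definition CP :: "(nat \<Rightarrow> nat) \<Rightarrow> nat \<Rightarrow> (real \<Rightarrow> complex Matrix.mat) star_alg" where
  "CP \<sigma> m = (let N = boxtimes \<sigma> m in
     \<lparr>carrier = {f. (\<forall>t. f t \<in> carrier_mat N N) \<and>
                    (\<forall>i<N. \<forall>j<N. continuous_on UNIV (\<lambda>t. f t $$ (i, j))) \<and>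
                    (\<forall>t. f (t + 1) = f t)},
      mult = (\<lambda>f g t. f t * g t),
      one = (\<lambda>t. 1\<^sub>m N),
      zero = (\<lambda>t. 0\<^sub>m N N),
      add = (\<lambda>f g t. f t + g t),
      smult = (\<lambda>c f t. c \<cdot>\<^sub>m f t),
      star = (\<lambda>f t. mat_adjoint (f t)),
      nrm = (\<lambda>f. SUP t. op_norm (f t))\<rparr>)"

definition alpha ::
  "(nat \<Rightarrow> nat) \<Rightarrow> nat \<Rightarrow> (real \<Rightarrow> complex Matrix.mat) \<Rightarrow> (real \<Rightarrow> complex Matrix.mat)" where
  "alpha \<sigma> m a = (\<lambda>t.
     U \<sigma> (Suc m) t *
     diag_block_mat (map (\<lambda>j. a ((t + real j) / real (\<sigma> (Suc m)))) [0..<\<sigma> (Suc m)]) *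
     mat_adjoint (U \<sigma> (Suc m) t))"

definition BD :: "(nat \<Rightarrow> nat) \<Rightarrow> (nat \<Rightarrow> real \<Rightarrow> complex Matrix.mat) set star_alg" where
  "BD \<sigma> = ind_lim (CP \<sigma>) (alpha \<sigma>)"

definition tau :: "(nat \<Rightarrow> nat) \<Rightarrow> nat \<Rightarrow> (real \<Rightarrow> complex Matrix.mat) \<Rightarrow> complex" where
  "tau \<sigma> m a = integral {0..1} (\<lambda>t. 1 / of_nat (boxtimes \<sigma> m) * mat_trace (a t))"

text \<open>\<open>block_diag\<close> and \<open>cond_exp\<close> are meaningful for \<open>m \<ge> 1\<close>.\<close>

definition block_diag :: "(nat \<Rightarrow> nat) \<Rightarrow> nat \<Rightarrow> complex Matrix.mat \<Rightarrow> complex Matrix.mat" where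
  "block_diag \<sigma> m M =
     diag_block_mat (map (\<lambda>j. block (boxtimes \<sigma> (m - 1)) M j j) [0..<\<sigma> m])"

definition cond_exp ::
  "(nat \<Rightarrow> nat) \<Rightarrow> nat \<Rightarrow> (real \<Rightarrow> complex Matrix.mat) \<Rightarrow> (real \<Rightarrow> complex Matrix.mat)" where
  "cond_exp \<sigma> m a = (\<lambda>t.
     U \<sigma> m t * block_diag \<sigma> m (mat_adjoint (U \<sigma> m t) * a t * U \<sigma> m t) * mat_adjoint (U \<sigma> m t))"

definition L_CP :: "(nat \<Rightarrow> nat) \<Rightarrow> nat \<Rightarrow> (real \<Rightarrow> complex Matrix.mat) \<Rightarrow> ereal" where
  "L_CP \<sigma> m a = max (lip (\<lambda>t. mat_adjoint (U \<sigma> m t) * a t * U \<sigma> m t))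
     (ereal (nrm (CP \<sigma> m) (\<lambda>t. a t - tau \<sigma> m a \<cdot>\<^sub>m 1\<^sub>m (boxtimes \<sigma> m))))"

definition k_fac :: "(nat \<Rightarrow> nat) \<Rightarrow> nat \<Rightarrow> ereal" where
  "k_fac \<sigma> m = max 1 ((1 + 2 * lip (U \<sigma> (m - 1))) / ereal (real (\<sigma> m)))"

fun kappa :: "(nat \<Rightarrow> nat) \<Rightarrow> nat \<Rightarrow> ereal" where
  "kappa \<sigma> 0 = 1"
| "kappa \<sigma> (Suc 0) = 1"
| "kappa \<sigma> (Suc (Suc n)) = kappa \<sigma> (Suc n) / k_fac \<sigma> (Suc (Suc n))"

primrec S_CP :: "(nat \<Rightarrow> nat) \<Rightarrow> nat \<Rightarrow> (real \<Rightarrow> complex Matrix.mat) \<Rightarrow> ereal" where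
  "S_CP \<sigma> 0 a = L_CP \<sigma> 0 a"
| "S_CP \<sigma> (Suc m) a =
     max (kappa \<sigma> (Suc m) * L_CP \<sigma> (Suc m) a)
       (max (S_CP \<sigma> m (the_inv_into (carrier (CP \<sigma> m)) (alpha \<sigma> m) (cond_exp \<sigma> (Suc m) a)))
            (ereal (2 ^ Suc m * nrm (CP \<sigma> (Suc m)) (\<lambda>t. a t - cond_exp \<sigma> (Suc m) a t))))"

definition bridge_bound :: "nat \<Rightarrow> real" where
  "bridge_bound n = (1 / 2) ^ (n + 1)"

definition approx_seqs ::
  "(nat \<Rightarrow> nat) \<Rightarrow> (nat \<Rightarrow> real \<Rightarrow> complex Matrix.mat) set
    \<Rightarrow> (nat \<Rightarrow> real \<Rightarrow> complex Matrix.mat) set" where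
  "approx_seqs \<sigma> a = {s. (\<forall>n. s n \<in> carrier (sa (CP \<sigma> n))) \<and>
     (\<lambda>n. nrm (BD \<sigma>) (to_lim (CP \<sigma>) (alpha \<sigma>) n (s n) \<ominus>\<^bsub>BD \<sigma>\<^esub> a)) \<longlonglongrightarrow> 0}"

definition L_BD :: "(nat \<Rightarrow> nat) \<Rightarrow> (nat \<Rightarrow> real \<Rightarrow> complex Matrix.mat) set \<Rightarrow> ereal" where
  "L_BD \<sigma> a = (INF s \<in> approx_seqs \<sigma> a. SUP n.
     max (S_CP \<sigma> n (s n))
       (ereal (nrm (CP \<sigma> (Suc n)) (\<lambda>t. s (Suc n) t - alpha \<sigma> n (s n) t)
               / (4 * bridge_bound n))))"

end

theory Submission imports Defs begin

text \<open>
  Each finite stage carries a seminorm under which the stage is a compact quantum metric space, and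
  the conditional expectations give retractions of every stage onto the previous one. Following an
  element of the limit down through these retractions yields a canonical approximating sequence,
  and it attains the infimum that defines the Lip-norm of the limit: that Lip-norm is the supremum
  of the seminorms of the stages along the canonical sequence. All axioms of a quantum metric order
  unit space then reduce to properties of the stages, namely density of Lipschitz functions,
  total boundedness of balls modulo scalars, and lower semicontinuity.

  The term of the seminorm that bounds the distance of an element from its conditional expectation
  makes the canonical sequence converge geometrically: an element of Lip-norm at most one is within
  \<open>(1 / 2) ^ n\<close> of its image in the \<open>n\<close>-th stage. If two sequences agree up to place \<open>n\<close>, their first
  \<open>n\<close> stages coincide, so the elements of both limits can be compared through the common stage; the
  comparison gives a bridge seminorm on the direct sum which is admissible and places the two state
  spaces within \<open>(1 / 2) ^ n\<close> of each other. When the first disagreement is at place \<open>m\<close>, this is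
  \<open>(1 / 2) ^ (m - 1)\<close>, twice the Baire distance.

  Order and norm are handled through sets of states that determine positivity: for matrix-valued
  functions these are the vector states at the points of the circle, and for the limit the states
  obtained from them by the retractions.
\<close>

section \<open>Order unit spaces given by a separating family of states\<close>

text \<open>
  All vector space axioms, the order, and the norm of an ordered space are determined as soon as
  the order is the pointwise one for a family of unital functionals that separates the points.
  This reduces every computation in such a space to one with real numbers.
\<close>

locale state_separated =
  fixes A :: "'a ous" and Om :: "('a \<Rightarrow> real) set"
  assumes one_mem: "\<one>\<^bsub>A\<^esub> \<in> carrier A"
    and zero_mem: "\<zero>\<^bsub>A\<^esub> \<in> carrier A"
    and add_mem: "a \<in> carrier A \<Longrightarrow> b \<in> carrier A \<Longrightarrow> a \<oplus>\<^bsub>A\<^esub> b \<in> carrier A"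
    and smult_mem: "a \<in> carrier A \<Longrightarrow> r \<odot>\<^bsub>A\<^esub> a \<in> carrier A"
    and state_add: "w \<in> Om \<Longrightarrow> a \<in> carrier A \<Longrightarrow> b \<in> carrier A \<Longrightarrow> w (a \<oplus>\<^bsub>A\<^esub> b) = w a + w b"
    and state_smult: "w \<in> Om \<Longrightarrow> a \<in> carrier A \<Longrightarrow> w (r \<odot>\<^bsub>A\<^esub> a) = r * w a"
    and state_zero: "w \<in> Om \<Longrightarrow> w \<zero>\<^bsub>A\<^esub> = 0"
    and state_one: "w \<in> Om \<Longrightarrow> w \<one>\<^bsub>A\<^esub> = 1"
    and state_bounded: "a \<in> carrier A \<Longrightarrow> \<exists>B. \<forall>w\<in>Om. \<bar>w a\<bar> \<le> B"
    and states_nonempty: "Om \<noteq> {}"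
    and state_le: "a \<in> carrier A \<Longrightarrow> b \<in> carrier A \<Longrightarrow> le A a b \<longleftrightarrow> (\<forall>w\<in>Om. w a \<le> w b)"
    and states_separate:
      "a \<in> carrier A \<Longrightarrow> b \<in> carrier A \<Longrightarrow> (\<And>w. w \<in> Om \<Longrightarrow> w a = w b) \<Longrightarrow> a = b"
begin

lemmas mems = one_mem zero_mem add_mem smult_mem
lemmas evals = state_add state_smult state_zero state_one

lemma abelian_group: "abelian_group A"
proof (rule abelian_groupI)
  fix x assume x: "x \<in> carrier A"
  show "\<exists>y\<in>carrier A. y \<oplus>\<^bsub>A\<^esub> x = \<zero>\<^bsub>A\<^esub>"
    using x by (intro bexI[of _ "(-1) \<odot>\<^bsub>A\<^esub> x"] states_separate) (auto simp: mems evals)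
qed (auto simp: mems evals intro!: states_separate)

lemma order_unit_space: "order_unit_space A"
proof -
  have "module (class_ring :: real ring) A"
    using abelian_group
    by (intro moduleI class_cring.is_cring)
      (auto simp: mems evals algebra_simps intro!: states_separate)
  then show ?thesis
  proof (rule order_unit_space.intro, unfold_locales)
    fix a assume a: "a \<in> carrier A"
    obtain B where B: "\<forall>w\<in>Om. \<bar>w a\<bar> \<le> B" using state_bounded[OF a] by blast
    then have "\<forall>w\<in>Om. - (\<bar>B\<bar> + 1) \<le> w a \<and> w a \<le> \<bar>B\<bar> + 1" by fastforce
    then show "\<exists>r>0. le A ((- r) \<odot>\<^bsub>A\<^esub> \<one>\<^bsub>A\<^esub>) a \<and> le A a (r \<odot>\<^bsub>A\<^esub> \<one>\<^bsub>A\<^esub>)"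
      using a by (intro exI[of _ "\<bar>B\<bar> + 1"]) (auto simp: mems evals state_le)
  next
    fix a assume a: "a \<in> carrier A" and *: "\<And>r. 0 < r \<Longrightarrow> le A a (r \<odot>\<^bsub>A\<^esub> \<one>\<^bsub>A\<^esub>)"
    then have "w a \<le> r" if "0 < r" "w \<in> Om" for w r
      using that by (auto simp: mems evals state_le)
    then show "le A a \<zero>\<^bsub>A\<^esub>"
      using a by (auto simp: mems evals state_le intro: field_le_epsilon)
  qed (auto simp: mems evals state_le intro!: mult_left_mono states_separate; fastforce)+
qed

lemma minus_mem: "a \<in> carrier A \<Longrightarrow> b \<in> carrier A \<Longrightarrow> a \<ominus>\<^bsub>A\<^esub> b \<in> carrier A"
  using abelian_group by (simp add: abelian_group.minus_closed)

lemma state_minus: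
  assumes "w \<in> Om" "a \<in> carrier A" "b \<in> carrier A"
  shows "w (a \<ominus>\<^bsub>A\<^esub> b) = w a - w b"
proof -
  interpret abelian_group A by (rule abelian_group)
  have "b \<oplus>\<^bsub>A\<^esub> (\<ominus>\<^bsub>A\<^esub> b) = \<zero>\<^bsub>A\<^esub>" using assms by (simp add: r_neg)
  then have "w b + w (\<ominus>\<^bsub>A\<^esub> b) = 0" using assms state_add[of w b "\<ominus>\<^bsub>A\<^esub> b"] by (simp add: state_zero)
  then show ?thesis using assms by (simp add: a_minus_def state_add)
qed

lemma ou_norm_eq: assumes a: "a \<in> carrier A" shows "ou_norm A a = (SUP w\<in>Om. \<bar>w a\<bar>)"
proof -
  define N where "N = (SUP w\<in>Om. \<bar>w a\<bar>)"
  have bdd: "bdd_above ((\<lambda>w. \<bar>w a\<bar>) ` Om)"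
    using state_bounded[OF a] by (auto simp: bdd_above_def)
  have N: "N \<le> r \<longleftrightarrow> (\<forall>w\<in>Om. \<bar>w a\<bar> \<le> r)" for r
    unfolding N_def using states_nonempty bdd by (simp add: cSUP_le_iff)
  have N0: "0 \<le> N"
  proof -
    obtain w where "w \<in> Om" using states_nonempty by blast
    then have "\<bar>w a\<bar> \<le> N" using N[of N] by blast
    then show ?thesis by linarith
  qed
  have "le A ((- r) \<odot>\<^bsub>A\<^esub> \<one>\<^bsub>A\<^esub>) a \<and> le A a (r \<odot>\<^bsub>A\<^esub> \<one>\<^bsub>A\<^esub>) \<longleftrightarrow> N \<le> r" for r
  proof -
    have "le A ((- r) \<odot>\<^bsub>A\<^esub> \<one>\<^bsub>A\<^esub>) a \<longleftrightarrow> (\<forall>w\<in>Om. - r \<le> w a)"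
      using a by (auto simp: mems evals state_le)
    moreover have "le A a (r \<odot>\<^bsub>A\<^esub> \<one>\<^bsub>A\<^esub>) \<longleftrightarrow> (\<forall>w\<in>Om. w a \<le> r)"
      using a by (auto simp: mems evals state_le)
    moreover have "N \<le> r \<longleftrightarrow> (\<forall>w\<in>Om. w a \<le> r) \<and> (\<forall>w\<in>Om. - r \<le> w a)"
      unfolding N abs_le_iff ball_conj_distrib by (simp only: minus_le_iff[of r])
    ultimately show ?thesis by (simp add: conj_commute)
  qed
  then have "ou_norm A a = Inf {r. 0 < r \<and> N \<le> r}" unfolding ou_norm_def by simp
  also have "\<dots> = N"
  proof (rule cInf_eq_non_empty)
    have "N + 1 \<in> {r. 0 < r \<and> N \<le> r}" using N0 by simp
    then show "{r. 0 < r \<and> N \<le> r} \<noteq> {}" by blast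
    show "N \<le> r" if "r \<in> {r. 0 < r \<and> N \<le> r}" for r using that by simp
  next
    fix y assume *: "\<And>x. x \<in> {r. 0 < r \<and> N \<le> r} \<Longrightarrow> y \<le> x"
    show "y \<le> N"
    proof (rule field_le_epsilon)
      fix e :: real assume "0 < e"
      then show "y \<le> N + e" using N0 by (intro *) auto
    qed
  qed
  finally show ?thesis unfolding N_def .
qed

lemma ou_norm_le_iff:
  assumes a: "a \<in> carrier A" shows "ou_norm A a \<le> r \<longleftrightarrow> (\<forall>w\<in>Om. \<bar>w a\<bar> \<le> r)"
  unfolding ou_norm_eq[OF a] using states_nonempty state_bounded[OF a]
  by (intro cSUP_le_iff) (auto simp: bdd_above_def)

lemma state_le_ou_norm: "a \<in> carrier A \<Longrightarrow> w \<in> Om \<Longrightarrow> \<bar>w a\<bar> \<le> ou_norm A a"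
  using ou_norm_le_iff[of a "ou_norm A a"] by auto

lemma ou_norm_nonneg: "a \<in> carrier A \<Longrightarrow> 0 \<le> ou_norm A a"
  using state_le_ou_norm[of a] states_nonempty by fastforce

lemma ou_dist_le_iff:
  assumes "a \<in> carrier A" "b \<in> carrier A"
  shows "ou_dist A a b \<le> r \<longleftrightarrow> (\<forall>w\<in>Om. \<bar>w a - w b\<bar> \<le> r)"
  using assms by (simp add: ou_dist_def ou_norm_le_iff minus_mem state_minus)

lemma state_diff_le_ou_dist:
  "a \<in> carrier A \<Longrightarrow> b \<in> carrier A \<Longrightarrow> w \<in> Om \<Longrightarrow> \<bar>w a - w b\<bar> \<le> ou_dist A a b"
  using ou_dist_le_iff[of a b "ou_dist A a b"] by auto

lemma Metric_space_ou_dist: "Metric_space (carrier A) (ou_dist A)"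
proof
  show "0 \<le> ou_dist A x y" for x y
    by (auto simp: ou_dist_def minus_mem ou_norm_nonneg)
  show "ou_dist A x y = ou_dist A y x" for x y
  proof (cases "x \<in> carrier A \<and> y \<in> carrier A")
    case True
    then show ?thesis
      by (auto simp: ou_dist_def ou_norm_eq minus_mem state_minus abs_minus_commute)
  qed (auto simp: ou_dist_def)
  show "ou_dist A x y = 0 \<longleftrightarrow> x = y" if "x \<in> carrier A" "y \<in> carrier A" for x y
  proof
    assume "ou_dist A x y = 0"
    then have "\<forall>w\<in>Om. \<bar>w x - w y\<bar> \<le> 0" using ou_dist_le_iff[OF that, of 0] by simp
    then show "x = y" using that by (intro states_separate) auto
  next
    assume "x = y"
    then have "ou_dist A x y \<le> 0" using that by (simp add: ou_dist_le_iff)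
    moreover have "0 \<le> ou_dist A x y" using that by (simp add: ou_dist_def minus_mem ou_norm_nonneg)
    ultimately show "ou_dist A x y = 0" by simp
  qed
  show "ou_dist A x z \<le> ou_dist A x y + ou_dist A y z"
    if "x \<in> carrier A" "y \<in> carrier A" "z \<in> carrier A" for x y z
  proof (subst ou_dist_le_iff[OF that(1,3)], intro ballI)
    fix w assume "w \<in> Om"
    then show "\<bar>w x - w z\<bar> \<le> ou_dist A x y + ou_dist A y z"
      using state_diff_le_ou_dist[of x y w] state_diff_le_ou_dist[of y z w] that by linarith
  qed
qed

sublocale M: Metric_space "carrier A" "ou_dist A"
  by (rule Metric_space_ou_dist)

lemma states_mono:
  assumes "\<phi> \<in> states A" "a \<in> carrier A" "b \<in> carrier A" "le A a b" shows "\<phi> a \<le> \<phi> b"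
proof -
  let ?c = "b \<oplus>\<^bsub>A\<^esub> ((-1) \<odot>\<^bsub>A\<^esub> a)"
  have c: "?c \<in> carrier A" "le A \<zero>\<^bsub>A\<^esub> ?c"
    using assms by (auto simp: mems evals state_le)
  then have "0 \<le> \<phi> ?c" using assms(1) by (auto simp: states_def)
  moreover have "\<phi> ?c = \<phi> b - \<phi> a" using assms by (auto simp: states_def mems)
  ultimately show ?thesis by simp
qed

lemma states_shift:
  assumes "\<phi> \<in> states A" "a \<in> carrier A" shows "\<phi> (a \<oplus>\<^bsub>A\<^esub> r \<odot>\<^bsub>A\<^esub> \<one>\<^bsub>A\<^esub>) = \<phi> a + r"
  using assms by (auto simp: states_def mems)

lemma states_le_ou_dist:
  assumes "\<phi> \<in> states A" "a \<in> carrier A" "b \<in> carrier A" shows "\<bar>\<phi> a - \<phi> b\<bar> \<le> ou_dist A a b"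
proof -
  let ?r = "ou_dist A a b"
  have *: "\<forall>w\<in>Om. \<bar>w a - w b\<bar> \<le> ?r" using state_diff_le_ou_dist assms by blast
  have "le A a (b \<oplus>\<^bsub>A\<^esub> ?r \<odot>\<^bsub>A\<^esub> \<one>\<^bsub>A\<^esub>)" "le A b (a \<oplus>\<^bsub>A\<^esub> ?r \<odot>\<^bsub>A\<^esub> \<one>\<^bsub>A\<^esub>)"
    using assms * by (auto simp: mems evals state_le abs_le_iff algebra_simps)
  then have "\<phi> a \<le> \<phi> (b \<oplus>\<^bsub>A\<^esub> ?r \<odot>\<^bsub>A\<^esub> \<one>\<^bsub>A\<^esub>)" "\<phi> b \<le> \<phi> (a \<oplus>\<^bsub>A\<^esub> ?r \<odot>\<^bsub>A\<^esub> \<one>\<^bsub>A\<^esub>)"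
    using assms by (auto intro!: states_mono simp: mems)
  then show ?thesis using assms by (simp add: states_shift)
qed

end

section \<open>A criterion for Lip-norms\<close>

text \<open>
  The last hypothesis below, total boundedness of the unit ball of the seminorm modulo scalars, is
  what makes the metric on the state space finite and weak* continuous.
\<close>

locale lip_space = state_separated A Om for A :: "'a ous" and Om +
  fixes L :: "'a \<Rightarrow> ereal"
  assumes cauchy_converges: "\<And>x. (\<And>n. x n \<in> carrier A) \<Longrightarrow>
      (\<forall>e>0. \<exists>N. \<forall>m\<ge>N. \<forall>n\<ge>N. ou_dist A (x m) (x n) < e) \<Longrightarrow>
      \<exists>l\<in>carrier A. (\<lambda>n. ou_dist A (x n) l) \<longlonglongrightarrow> 0"
    and L_nonneg: "a \<in> carrier A \<Longrightarrow> 0 \<le> L a"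
    and L_add: "a \<in> carrier A \<Longrightarrow> b \<in> carrier A \<Longrightarrow> L (a \<oplus>\<^bsub>A\<^esub> b) \<le> L a + L b"
    and L_smult_le: "a \<in> carrier A \<Longrightarrow> L (r \<odot>\<^bsub>A\<^esub> a) \<le> ereal \<bar>r\<bar> * L a"
    and L_finite_dense:
      "a \<in> carrier A \<Longrightarrow> 0 < e \<Longrightarrow> \<exists>b\<in>carrier A. L b < \<infinity> \<and> ou_dist A a b < e"
    and L_kernel: "a \<in> carrier A \<Longrightarrow> L a = 0 \<Longrightarrow> \<exists>r. a = r \<odot>\<^bsub>A\<^esub> \<one>\<^bsub>A\<^esub>"
    and L_one: "L \<one>\<^bsub>A\<^esub> = 0"
    and L_limit: "\<And>x l. (\<And>n. x n \<in> carrier A) \<Longrightarrow> (\<And>n. L (x n) \<le> 1) \<Longrightarrow> l \<in> carrier A \<Longrightarrow>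
      (\<lambda>n. ou_dist A (x n) l) \<longlonglongrightarrow> 0 \<Longrightarrow> L l \<le> 1"
    and L_precompact: "0 < e \<Longrightarrow> \<exists>F. finite F \<and> F \<subseteq> carrier A \<and>
      (\<forall>a\<in>carrier A. L a \<le> 1 \<longrightarrow> (\<exists>f\<in>F. \<exists>r. ou_dist A a (f \<oplus>\<^bsub>A\<^esub> r \<odot>\<^bsub>A\<^esub> \<one>\<^bsub>A\<^esub>) \<le> e))"
begin

lemma smult_cancel: "a \<in> carrier A \<Longrightarrow> r \<noteq> 0 \<Longrightarrow> inverse r \<odot>\<^bsub>A\<^esub> (r \<odot>\<^bsub>A\<^esub> a) = a"
  by (rule states_separate) (auto simp: mems evals)

lemma L_smult: assumes a: "a \<in> carrier A" shows "L (r \<odot>\<^bsub>A\<^esub> a) = ereal \<bar>r\<bar> * L a"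
proof (cases "r = 0")
  case True
  then show ?thesis using L_smult_le[OF a, of r] L_nonneg[OF smult_mem[OF a], of r]
    by (simp add: zero_ereal_def[symmetric])
next
  case False
  have "L a \<le> ereal \<bar>inverse r\<bar> * L (r \<odot>\<^bsub>A\<^esub> a)"
    using L_smult_le[of "r \<odot>\<^bsub>A\<^esub> a" "inverse r"] smult_cancel[OF a False] smult_mem[OF a] by simp
  then have "ereal \<bar>r\<bar> * L a \<le> ereal \<bar>r\<bar> * (ereal \<bar>inverse r\<bar> * L (r \<odot>\<^bsub>A\<^esub> a))"
    by (intro ereal_mult_left_mono) auto
  also have "\<dots> = L (r \<odot>\<^bsub>A\<^esub> a)"
    using False by (simp add: mult.assoc[symmetric] abs_mult[symmetric] one_ereal_def[symmetric])
  finally show ?thesis using L_smult_le[OF a, of r] by (intro antisym) auto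
qed

lemma ball_rescale:
  assumes a: "a \<in> carrier A" and "L a < \<infinity>"
  shows "\<exists>K>0. L ((1 / K) \<odot>\<^bsub>A\<^esub> a) \<le> 1"
proof -
  have "0 \<le> L a" by (rule L_nonneg[OF a])
  then obtain l where l: "L a = ereal l" "0 \<le> l" using assms(2) by (cases "L a") auto
  have "L ((1 / (l + 1)) \<odot>\<^bsub>A\<^esub> a) \<le> 1"
    using l by (simp add: L_smult[OF a] divide_simps one_ereal_def)
  then show ?thesis using l by (intro exI[of _ "l + 1"]) auto
qed

abbreviation "D \<phi> \<psi> \<equiv> real_of_ereal (mk A L \<phi> \<psi>)"

lemma zero_mem_ball: "\<zero>\<^bsub>A\<^esub> \<in> {a \<in> carrier A. L a \<le> 1}"
proof -
  have "\<zero>\<^bsub>A\<^esub> = 0 \<odot>\<^bsub>A\<^esub> \<one>\<^bsub>A\<^esub>" by (rule states_separate) (auto simp: mems evals)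
  then have "L \<zero>\<^bsub>A\<^esub> = 0" using L_smult[OF one_mem, of 0] by simp
  then show ?thesis by (simp add: zero_mem)
qed

lemma mk_nonneg: "0 \<le> mk A L \<phi> \<psi>"
  unfolding mk_def by (rule SUP_upper2[OF zero_mem_ball]) simp

lemma mk_less_infty:
  assumes "\<phi> \<in> states A" "\<psi> \<in> states A" shows "mk A L \<phi> \<psi> < \<infinity>"
proof -
  obtain F where F: "finite F" "F \<subseteq> carrier A"
    "\<And>a. a \<in> carrier A \<Longrightarrow> L a \<le> 1 \<Longrightarrow> \<exists>f\<in>F. \<exists>r. ou_dist A a (f \<oplus>\<^bsub>A\<^esub> r \<odot>\<^bsub>A\<^esub> \<one>\<^bsub>A\<^esub>) \<le> 1"
    using L_precompact[of 1] by auto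
  have "mk A L \<phi> \<psi> \<le> ereal (2 + (\<Sum>f\<in>F. \<bar>\<phi> f - \<psi> f\<bar>))"
    unfolding mk_def
  proof (rule SUP_least, clarsimp)
    fix a assume a: "a \<in> carrier A" "L a \<le> 1"
    then obtain f r where f: "f \<in> F" "ou_dist A a (f \<oplus>\<^bsub>A\<^esub> r \<odot>\<^bsub>A\<^esub> \<one>\<^bsub>A\<^esub>) \<le> 1" using F(3) by blast
    then have fA: "f \<in> carrier A" using F by auto
    have "\<bar>\<phi> a - \<phi> (f \<oplus>\<^bsub>A\<^esub> r \<odot>\<^bsub>A\<^esub> \<one>\<^bsub>A\<^esub>)\<bar> \<le> 1" "\<bar>\<psi> a - \<psi> (f \<oplus>\<^bsub>A\<^esub> r \<odot>\<^bsub>A\<^esub> \<one>\<^bsub>A\<^esub>)\<bar> \<le> 1"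
      using states_le_ou_dist[OF assms(1) a(1), of "f \<oplus>\<^bsub>A\<^esub> r \<odot>\<^bsub>A\<^esub> \<one>\<^bsub>A\<^esub>"]
        states_le_ou_dist[OF assms(2) a(1), of "f \<oplus>\<^bsub>A\<^esub> r \<odot>\<^bsub>A\<^esub> \<one>\<^bsub>A\<^esub>"] f fA by (auto simp: mems)
    moreover have "\<bar>\<phi> f - \<psi> f\<bar> \<le> (\<Sum>f\<in>F. \<bar>\<phi> f - \<psi> f\<bar>)"
      using F(1) f(1) by (intro member_le_sum) auto
    ultimately show "\<bar>\<phi> a - \<psi> a\<bar> \<le> 2 + (\<Sum>f\<in>F. \<bar>\<phi> f - \<psi> f\<bar>)"
      using fA assms by (simp add: states_shift)
  qed
  then show ?thesis by (cases "mk A L \<phi> \<psi>") auto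
qed

lemma mk_eq_D: "\<phi> \<in> states A \<Longrightarrow> \<psi> \<in> states A \<Longrightarrow> mk A L \<phi> \<psi> = ereal (D \<phi> \<psi>)"
  using mk_less_infty[of \<phi> \<psi>] mk_nonneg[of \<phi> \<psi>] by (cases "mk A L \<phi> \<psi>") auto

lemma D_upper:
  assumes "\<phi> \<in> states A" "\<psi> \<in> states A" "a \<in> carrier A" "L a \<le> 1"
  shows "\<bar>\<phi> a - \<psi> a\<bar> \<le> D \<phi> \<psi>"
proof -
  have "ereal \<bar>\<phi> a - \<psi> a\<bar> \<le> mk A L \<phi> \<psi>" unfolding mk_def using assms by (intro SUP_upper) auto
  then show ?thesis using mk_eq_D[OF assms(1,2)] by (metis ereal_less_eq(3))
qed

lemma D_least:
  assumes "\<phi> \<in> states A" "\<psi> \<in> states A" "\<And>a. a \<in> carrier A \<Longrightarrow> L a \<le> 1 \<Longrightarrow> \<bar>\<phi> a - \<psi> a\<bar> \<le> c"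
  shows "D \<phi> \<psi> \<le> c"
proof -
  have "mk A L \<phi> \<psi> \<le> ereal c" unfolding mk_def using assms by (intro SUP_least) auto
  then show ?thesis using mk_eq_D[OF assms(1,2)] by (metis ereal_less_eq(3))
qed

lemma D_control:
  assumes a: "a \<in> carrier A" and e: "0 < e"
  shows "\<exists>K>0. \<forall>\<phi>\<in>states A. \<forall>\<psi>\<in>states A. \<bar>\<phi> a - \<psi> a\<bar> \<le> e + K * D \<phi> \<psi>"
proof -
  obtain b where b: "b \<in> carrier A" "L b < \<infinity>" "ou_dist A a b < e / 2"
    using L_finite_dense[OF a, of "e/2"] e by auto
  obtain K where K: "K > 0" "L ((1 / K) \<odot>\<^bsub>A\<^esub> b) \<le> 1" using ball_rescale[OF b(1,2)] by auto
  have "\<bar>\<phi> a - \<psi> a\<bar> \<le> e + K * D \<phi> \<psi>" if \<phi>: "\<phi> \<in> states A" "\<psi> \<in> states A" for \<phi> \<psi>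
  proof -
    have "\<bar>\<phi> ((1 / K) \<odot>\<^bsub>A\<^esub> b) - \<psi> ((1 / K) \<odot>\<^bsub>A\<^esub> b)\<bar> \<le> D \<phi> \<psi>"
      using b K \<phi> by (intro D_upper) (auto simp: mems)
    moreover have "\<phi> ((1 / K) \<odot>\<^bsub>A\<^esub> b) - \<psi> ((1 / K) \<odot>\<^bsub>A\<^esub> b) = (\<phi> b - \<psi> b) / K"
      using \<phi> b by (simp add: states_def diff_divide_distrib)
    ultimately have "\<bar>\<phi> b - \<psi> b\<bar> \<le> K * D \<phi> \<psi>" using K by (simp add: field_simps abs_mult)
    moreover have "\<bar>\<phi> a - \<phi> b\<bar> \<le> e / 2" "\<bar>\<psi> a - \<psi> b\<bar> \<le> e / 2"
      using states_le_ou_dist[OF \<phi>(1) a b(1)] states_le_ou_dist[OF \<phi>(2) a b(1)] b by auto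
    ultimately show ?thesis by linarith
  qed
  then show ?thesis using K by blast
qed

lemma Metric_space_D: "Metric_space (states A) D"
proof
  show "0 \<le> D \<phi> \<psi>" for \<phi> \<psi> using mk_nonneg by (simp add: real_of_ereal_pos)
  show "D \<phi> \<psi> = D \<psi> \<phi>" for \<phi> \<psi> by (simp add: mk_def abs_minus_commute)
  show "D \<phi> \<psi> = 0 \<longleftrightarrow> \<phi> = \<psi>" if \<phi>: "\<phi> \<in> states A" "\<psi> \<in> states A" for \<phi> \<psi>
  proof
    assume D: "D \<phi> \<psi> = 0"
    show "\<phi> = \<psi>"
    proof (rule extensionalityI[of _ "carrier A"])
      show "\<phi> \<in> extensional (carrier A)" "\<psi> \<in> extensional (carrier A)"
        using \<phi> by (auto simp: states_def)
      fix a assume a: "a \<in> carrier A"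
      have "\<bar>\<phi> a - \<psi> a\<bar> \<le> 0 + e" if "0 < e" for e
        using D_control[OF a that] \<phi> D by (metis add.commute add_0 mult_zero_right)
      then show "\<phi> a = \<psi> a" using field_le_epsilon by (metis abs_le_zero_iff eq_iff_diff_eq_0)
    qed
  next
    assume "\<phi> = \<psi>"
    then have "D \<phi> \<psi> \<le> 0" using \<phi> by (intro D_least) auto
    moreover have "0 \<le> D \<phi> \<psi>" using mk_nonneg by (simp add: real_of_ereal_pos)
    ultimately show "D \<phi> \<psi> = 0" by (rule antisym)
  qed
  show "D \<phi> \<xi> \<le> D \<phi> \<psi> + D \<psi> \<xi>"
    if \<phi>: "\<phi> \<in> states A" "\<psi> \<in> states A" "\<xi> \<in> states A" for \<phi> \<psi> \<xi>
  proof (rule D_least[OF \<phi>(1,3)])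
    fix a assume "a \<in> carrier A" "L a \<le> 1"
    then show "\<bar>\<phi> a - \<xi> a\<bar> \<le> D \<phi> \<psi> + D \<psi> \<xi>"
      using D_upper[OF \<phi>(1,2), of a] D_upper[OF \<phi>(2,3), of a] by linarith
  qed
qed

lemma topspace_weak_star: "topspace (weak_star A) = states A"
  by (auto simp: weak_star_def states_def PiE_def)

lemma continuous_map_eval:
  "a \<in> carrier A \<Longrightarrow> continuous_map (weak_star A) euclideanreal (\<lambda>\<phi>. \<phi> a)"
  unfolding weak_star_def
  by (intro continuous_map_from_subtopology continuous_map_product_projection)

lemma mk_topology: "Metric_space.mtopology (states A) D = weak_star A"
proof -
  interpret S: Metric_space "states A" D by (rule Metric_space_D)
  show ?thesis
  proof (rule topology_eq[THEN iffD2], intro allI iffI)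
    fix U assume U: "openin S.mtopology U"
    then have US: "U \<subseteq> states A" by (simp add: S.openin_mtopology)
    show "openin (weak_star A) U"
    proof (rule openin_subopen[THEN iffD2], intro ballI)
      fix \<phi> assume \<phi>U: "\<phi> \<in> U"
      then have \<phi>: "\<phi> \<in> states A" using US by auto
      obtain e where e: "e > 0" "S.mball \<phi> e \<subseteq> U"
        using U \<phi>U by (auto simp: S.openin_mtopology)
      define d where "d = e / 4"
      have d: "0 < d" using e by (simp add: d_def)
      obtain F where F: "finite F" "F \<subseteq> carrier A"
        "\<And>a. a \<in> carrier A \<Longrightarrow> L a \<le> 1 \<Longrightarrow> \<exists>f\<in>F. \<exists>r. ou_dist A a (f \<oplus>\<^bsub>A\<^esub> r \<odot>\<^bsub>A\<^esub> \<one>\<^bsub>A\<^esub>) \<le> d"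
        using L_precompact[OF d] by blast
      let ?W = "(\<Inter>f\<in>F. {\<psi> \<in> topspace (weak_star A). \<psi> f \<in> ball (\<phi> f) d}) \<inter> topspace (weak_star A)"
      have "openin (weak_star A) ?W"
        using F
        by (intro openin_INT ballI openin_continuous_map_preimage[OF continuous_map_eval]) auto
      moreover have "\<phi> \<in> ?W" using \<phi> d by (auto simp: topspace_weak_star)
      moreover have "?W \<subseteq> U"
      proof
        fix \<psi> assume W: "\<psi> \<in> ?W"
        then have \<psi>: "\<psi> \<in> states A" by (simp add: topspace_weak_star)
        have near: "\<bar>\<phi> f - \<psi> f\<bar> < d" if "f \<in> F" for f
          using W that by (auto simp: dist_real_def)
        have "D \<phi> \<psi> \<le> 3 * d"
        proof (rule D_least[OF \<phi> \<psi>])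
          fix a assume a: "a \<in> carrier A" "L a \<le> 1"
          then obtain f r where f: "f \<in> F" "ou_dist A a (f \<oplus>\<^bsub>A\<^esub> r \<odot>\<^bsub>A\<^esub> \<one>\<^bsub>A\<^esub>) \<le> d"
            using F(3) by blast
          then have fA: "f \<in> carrier A" using F by auto
          have "\<bar>\<phi> a - (\<phi> f + r)\<bar> \<le> d" "\<bar>\<psi> a - (\<psi> f + r)\<bar> \<le> d"
            using states_le_ou_dist[OF \<phi> a(1), of "f \<oplus>\<^bsub>A\<^esub> r \<odot>\<^bsub>A\<^esub> \<one>\<^bsub>A\<^esub>"]
              states_le_ou_dist[OF \<psi> a(1), of "f \<oplus>\<^bsub>A\<^esub> r \<odot>\<^bsub>A\<^esub> \<one>\<^bsub>A\<^esub>"] f fA \<phi> \<psi>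
            by (auto simp: mems states_shift)
          then show "\<bar>\<phi> a - \<psi> a\<bar> \<le> 3 * d" using near[OF f(1)] by linarith
        qed
        then have "\<psi> \<in> S.mball \<phi> e" using \<phi> \<psi> e by (simp add: S.in_mball d_def)
        then show "\<psi> \<in> U" using e by auto
      qed
      ultimately show "\<exists>T. openin (weak_star A) T \<and> \<phi> \<in> T \<and> T \<subseteq> U" by blast
    qed
  next
    have cont: "continuous_map S.mtopology euclideanreal (\<lambda>\<phi>. \<phi> a)" if a: "a \<in> carrier A" for a
      unfolding continuous_map_def
    proof (intro conjI allI impI)
      fix V :: "real set" assume V: "openin euclideanreal V"
      show "openin S.mtopology {\<phi> \<in> topspace S.mtopology. \<phi> a \<in> V}"
        unfolding S.openin_mtopology
      proof (intro conjI allI impI)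
        fix \<phi> assume "\<phi> \<in> {\<phi> \<in> topspace S.mtopology. \<phi> a \<in> V}"
        then have \<phi>: "\<phi> \<in> states A" "\<phi> a \<in> V" by auto
        obtain e where e: "e > 0" "ball (\<phi> a) e \<subseteq> V" using V \<phi> by (auto simp: open_contains_ball)
        obtain K where K: "K > 0"
          "\<And>\<phi> \<psi>. \<phi> \<in> states A \<Longrightarrow> \<psi> \<in> states A \<Longrightarrow> \<bar>\<phi> a - \<psi> a\<bar> \<le> e / 2 + K * D \<phi> \<psi>"
          using D_control[OF a, of "e / 2"] e by auto
        have "S.mball \<phi> (e / (2 * K)) \<subseteq> {\<phi> \<in> topspace S.mtopology. \<phi> a \<in> V}"
        proof
          fix \<psi> assume "\<psi> \<in> S.mball \<phi> (e / (2 * K))"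
          then have \<psi>: "\<psi> \<in> states A" "D \<phi> \<psi> < e / (2 * K)" by auto
          then have "K * D \<phi> \<psi> < e / 2" using K(1) by (simp add: field_simps)
          then have "\<bar>\<phi> a - \<psi> a\<bar> < e" using K(2)[OF \<phi>(1) \<psi>(1)] by linarith
          then show "\<psi> \<in> {\<phi> \<in> topspace S.mtopology. \<phi> a \<in> V}"
            using e \<psi> by (auto simp: dist_real_def subset_iff)
        qed
        then show "\<exists>r>0. S.mball \<phi> r \<subseteq> {\<phi> \<in> topspace S.mtopology. \<phi> a \<in> V}"
          using e K by (intro exI[of _ "e / (2 * K)"]) auto
      qed auto
    qed auto
    have sub: "states A \<subseteq> extensional (carrier A)" by (auto simp: states_def)
    have "continuous_map S.mtopology (weak_star A) id"
      unfolding weak_star_def continuous_map_in_subtopology continuous_map_componentwise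
    proof (intro conjI ballI)
      show "id ` topspace S.mtopology \<subseteq> extensional (carrier A)"
        using sub by (simp only: S.topspace_mtopology image_id id_apply)
      show "continuous_map S.mtopology euclideanreal (\<lambda>\<phi>. id \<phi> a)" if "a \<in> carrier A" for a
        using cont[OF that] by simp
    qed simp
    moreover fix U assume U: "openin (weak_star A) U"
    ultimately have "openin S.mtopology {\<phi> \<in> topspace S.mtopology. id \<phi> \<in> U}"
      by (rule openin_continuous_map_preimage)
    moreover have "{\<phi> \<in> topspace S.mtopology. id \<phi> \<in> U} = U"
      using openin_subset[OF U] by (auto simp: topspace_weak_star)
    ultimately show "openin S.mtopology U" by simp
  qed
qed

lemma complete: "M.mcomplete"
  unfolding M.mcomplete_def
proof (intro allI impI)
  fix x assume x: "M.MCauchy x"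
  then have xA: "x n \<in> carrier A" for n by (auto simp: M.MCauchy_def)
  have "\<forall>e>0. \<exists>N. \<forall>m\<ge>N. \<forall>n\<ge>N. ou_dist A (x m) (x n) < e"
    using x by (auto simp: M.MCauchy_def)
  then obtain l where "l \<in> carrier A" "(\<lambda>n. ou_dist A (x n) l) \<longlonglongrightarrow> 0"
    using cauchy_converges[of x, OF xA] by auto
  then show "\<exists>l. limitin M.mtopology x l sequentially"
    using xA by (auto simp: M.limitin_metric_dist_null)
qed

theorem quantum_metric: "quantum_metric_ous A L"
proof (rule quantum_metric_ous.intro[OF order_unit_space], rule quantum_metric_ous_axioms.intro)
  show "M.mcomplete" by (rule complete)
  show "M.mtopology closure_of {a \<in> carrier A. L a < \<infinity>} = carrier A"
    unfolding M.metric_closure_of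
  proof (intro equalityI subsetI CollectI conjI allI impI)
    fix a r assume a: "a \<in> carrier A" and "0 < (r::real)"
    then obtain b where "b \<in> carrier A" "L b < \<infinity>" "ou_dist A a b < r"
      using L_finite_dense by blast
    then have "b \<in> M.mball a r" "b \<in> {a \<in> carrier A. L a < \<infinity>}"
      using a by (simp_all only: M.in_mball mem_Collect_eq simp_thms)
    then show "\<exists>b\<in>{a \<in> carrier A. L a < \<infinity>}. b \<in> M.mball a r" by blast
  qed simp
  show "{a \<in> carrier A. L a = 0} = range (\<lambda>r. r \<odot>\<^bsub>A\<^esub> \<one>\<^bsub>A\<^esub>)"
  proof (intro equalityI subsetI)
    fix a assume "a \<in> {a \<in> carrier A. L a = 0}"
    then show "a \<in> range (\<lambda>r. r \<odot>\<^bsub>A\<^esub> \<one>\<^bsub>A\<^esub>)" using L_kernel[of a] by blast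
  next
    fix a assume "a \<in> range (\<lambda>r. r \<odot>\<^bsub>A\<^esub> \<one>\<^bsub>A\<^esub>)"
    then obtain r where "a = r \<odot>\<^bsub>A\<^esub> \<one>\<^bsub>A\<^esub>" by blast
    then show "a \<in> {a \<in> carrier A. L a = 0}"
      using L_smult[OF one_mem, of r] L_one one_mem smult_mem by simp
  qed
  show "closedin M.mtopology {a \<in> carrier A. L a \<le> 1}"
    unfolding M.metric_closedin_iff_sequentially_closed
  proof (intro conjI allI impI)
    fix x l assume *: "range x \<subseteq> {a \<in> carrier A. L a \<le> 1} \<and> limitin M.mtopology x l sequentially"
    then have xA: "x n \<in> carrier A" "L (x n) \<le> 1" for n by auto
    have l: "l \<in> carrier A" "(\<lambda>n. ou_dist A (x n) l) \<longlonglongrightarrow> 0"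
      using * by (simp_all add: M.limitin_metric_dist_null)
    show "l \<in> {a \<in> carrier A. L a \<le> 1}" using L_limit[of x l, OF xA l] l(1) by simp
  qed auto
  show "Metric_space (states A) D" by (rule Metric_space_D)
  show "Metric_space.mtopology (states A) D = weak_star A" by (rule mk_topology)
qed (use L_nonneg L_add L_smult mk_less_infty in auto)

end

section \<open>Bounding Rieffel's distance by a pair of maps\<close>

definition sum_states :: "('a \<Rightarrow> real) set \<Rightarrow> ('b \<Rightarrow> real) set \<Rightarrow> ('a \<times> 'b \<Rightarrow> real) set" where
  "sum_states Oa Ob = (\<lambda>w x. w (fst x)) ` Oa \<union> (\<lambda>w x. w (snd x)) ` Ob"

lemma ous_sum_simps [simp]:
  "carrier (ous_sum A B) = carrier A \<times> carrier B"
  "\<one>\<^bsub>ous_sum A B\<^esub> = (\<one>\<^bsub>A\<^esub>, \<one>\<^bsub>B\<^esub>)"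
  "\<zero>\<^bsub>ous_sum A B\<^esub> = (\<zero>\<^bsub>A\<^esub>, \<zero>\<^bsub>B\<^esub>)"
  "x \<oplus>\<^bsub>ous_sum A B\<^esub> y = (fst x \<oplus>\<^bsub>A\<^esub> fst y, snd x \<oplus>\<^bsub>B\<^esub> snd y)"
  "r \<odot>\<^bsub>ous_sum A B\<^esub> x = (r \<odot>\<^bsub>A\<^esub> fst x, r \<odot>\<^bsub>B\<^esub> snd x)"
  "le (ous_sum A B) x y \<longleftrightarrow> le A (fst x) (fst y) \<and> le B (snd x) (snd y)"
  by (auto simp: ous_sum_def)

locale state_separated_pair =
  A: state_separated A Oa + B: state_separated B Ob
  for A :: "'a ous" and Oa and B :: "'b ous" and Ob
begin

abbreviation "S \<equiv> ous_sum A B"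

lemma state_separated_sum: "state_separated S (sum_states Oa Ob)"
proof
  fix x assume "x \<in> carrier S"
  then have x: "fst x \<in> carrier A" "snd x \<in> carrier B" by auto
  obtain B1 B2 where "\<forall>w\<in>Oa. \<bar>w (fst x)\<bar> \<le> B1" "\<forall>w\<in>Ob. \<bar>w (snd x)\<bar> \<le> B2"
    using A.state_bounded[OF x(1)] B.state_bounded[OF x(2)] by blast
  then show "\<exists>C. \<forall>w\<in>sum_states Oa Ob. \<bar>w x\<bar> \<le> C"
    by (intro exI[of _ "max B1 B2"]) (auto simp: sum_states_def max.coboundedI1 max.coboundedI2)
  fix y assume "y \<in> carrier S"
  then have y: "fst y \<in> carrier A" "snd y \<in> carrier B" by auto
  show "le S x y \<longleftrightarrow> (\<forall>w\<in>sum_states Oa Ob. w x \<le> w y)"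
    using x y by (simp add: sum_states_def A.state_le B.state_le ball_Un)
  assume "\<And>w. w \<in> sum_states Oa Ob \<Longrightarrow> w x = w y"
  then have *: "\<forall>w\<in>sum_states Oa Ob. w x = w y" by blast
  have "fst x = fst y"
    by (rule A.states_separate[OF x(1) y(1)]) (use * in \<open>auto simp: sum_states_def ball_Un\<close>)
  moreover have "snd x = snd y"
    by (rule B.states_separate[OF x(2) y(2)]) (use * in \<open>auto simp: sum_states_def ball_Un\<close>)
  ultimately show "x = y" by (simp add: prod_eq_iff)
next
  show "sum_states Oa Ob \<noteq> {}" using A.states_nonempty by (simp add: sum_states_def)
qed (auto simp: sum_states_def A.mems B.mems A.evals B.evals)

sublocale S: state_separated S "sum_states Oa Ob"
  by (rule state_separated_sum)

lemma ou_dist_sum: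
  assumes "a \<in> carrier A" "a' \<in> carrier A" "b \<in> carrier B" "b' \<in> carrier B"
  shows "ou_dist S (a, b) (a', b') = max (ou_dist A a a') (ou_dist B b b')"
proof -
  have "ou_dist S (a, b) (a', b') \<le> r \<longleftrightarrow> max (ou_dist A a a') (ou_dist B b b') \<le> r" for r
    using assms
    by (simp add: S.ou_dist_le_iff A.ou_dist_le_iff B.ou_dist_le_iff sum_states_def ball_Un)
  then show ?thesis by (metis antisym order_refl)
qed

end

locale unital_positive =
  A: state_separated A Oa + B: state_separated B Ob
  for A :: "'a ous" and Oa and B :: "'b ous" and Ob +
  fixes P :: "'a \<Rightarrow> 'b"
  assumes map_mem: "a \<in> carrier A \<Longrightarrow> P a \<in> carrier B"
    and map_add: "a \<in> carrier A \<Longrightarrow> a' \<in> carrier A \<Longrightarrow> P (a \<oplus>\<^bsub>A\<^esub> a') = P a \<oplus>\<^bsub>B\<^esub> P a'"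
    and map_smult: "a \<in> carrier A \<Longrightarrow> P (r \<odot>\<^bsub>A\<^esub> a) = r \<odot>\<^bsub>B\<^esub> P a"
    and map_one: "P \<one>\<^bsub>A\<^esub> = \<one>\<^bsub>B\<^esub>"
    and map_mono: "a \<in> carrier A \<Longrightarrow> a' \<in> carrier A \<Longrightarrow> le A a a' \<Longrightarrow> le B (P a) (P a')"
begin

lemma map_shift: "a \<in> carrier A \<Longrightarrow> P (a \<oplus>\<^bsub>A\<^esub> r \<odot>\<^bsub>A\<^esub> \<one>\<^bsub>A\<^esub>) = P a \<oplus>\<^bsub>B\<^esub> r \<odot>\<^bsub>B\<^esub> \<one>\<^bsub>B\<^esub>"
  by (simp add: map_add map_smult map_one A.mems)

lemma map_zero: "P \<zero>\<^bsub>A\<^esub> = \<zero>\<^bsub>B\<^esub>"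
proof -
  have "\<zero>\<^bsub>A\<^esub> = 0 \<odot>\<^bsub>A\<^esub> \<one>\<^bsub>A\<^esub>" by (rule A.states_separate) (auto simp: A.mems A.evals)
  moreover have "0 \<odot>\<^bsub>B\<^esub> \<one>\<^bsub>B\<^esub> = \<zero>\<^bsub>B\<^esub>" by (rule B.states_separate) (auto simp: B.mems B.evals)
  ultimately show ?thesis using map_smult[OF A.one_mem, of 0] map_one by simp
qed

lemma map_contractive:
  assumes a: "a \<in> carrier A" and a': "a' \<in> carrier A"
  shows "ou_dist B (P a) (P a') \<le> ou_dist A a a'"
proof -
  let ?r = "ou_dist A a a'"
  have mono: "w (P x) \<le> w (P y) + ?r"
    if "x \<in> carrier A" "y \<in> carrier A" "\<forall>v\<in>Oa. v x \<le> v y + ?r" "w \<in> Ob" for x y w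
  proof -
    have "le A x (y \<oplus>\<^bsub>A\<^esub> ?r \<odot>\<^bsub>A\<^esub> \<one>\<^bsub>A\<^esub>)"
      using that by (simp add: A.mems A.evals A.state_le)
    then have "le B (P x) (P y \<oplus>\<^bsub>B\<^esub> ?r \<odot>\<^bsub>B\<^esub> \<one>\<^bsub>B\<^esub>)"
      using map_mono[of x "y \<oplus>\<^bsub>A\<^esub> ?r \<odot>\<^bsub>A\<^esub> \<one>\<^bsub>A\<^esub>"] that by (simp add: map_shift A.mems)
    then show ?thesis using that by (auto simp: B.state_le map_mem B.mems B.evals)
  qed
  have near: "\<bar>v a - v a'\<bar> \<le> ?r" if "v \<in> Oa" for v
    using A.state_diff_le_ou_dist a a' that by blast
  then have "\<forall>v\<in>Oa. v a \<le> v a' + ?r" "\<forall>v\<in>Oa. v a' \<le> v a + ?r"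
    by (auto simp: abs_le_iff) (smt (verit) near)+
  then have "w (P a) \<le> w (P a') + ?r" "w (P a') \<le> w (P a) + ?r" if "w \<in> Ob" for w
    using mono a a' that by blast+
  then show ?thesis using a a'
    by (simp add: B.ou_dist_le_iff map_mem abs_le_iff algebra_simps)
qed

lemma pullback_state:
  assumes "\<phi> \<in> states B" shows "(\<lambda>a\<in>carrier A. \<phi> (P a)) \<in> states A"
proof -
  have "0 \<le> \<phi> (P a)" if "a \<in> carrier A" "le A \<zero>\<^bsub>A\<^esub> a" for a
    using assms map_mono[OF A.zero_mem that] map_mem[OF that(1)] by (simp add: map_zero states_def)
  then show ?thesis
    using assms by (auto simp: states_def A.mems map_mem map_add map_smult map_one)
qed

end

text \<open>
  Two maps that are mutually inverse on their ranges, decrease the Lip-norms, and move the Lipschitz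
  unit balls by at most \<open>g\<close> give the bound \<open>g\<close> for the distance. On the sum, the seminorm that
  compares \<open>P a\<close> with \<open>P (Q b)\<close> at a scale \<open>\<delta>\<close> is admissible: the pairs \<open>(a, P a)\<close> and \<open>(Q b, b)\<close>
  are not penalised, so the quotients are the given Lip-norms. Composition with the maps moves
  states of one summand to states of the other over a distance of at most \<open>g + \<delta>\<close>.
\<close>

locale lip_bridge =
  A: lip_space A Oa LA + B: lip_space B Ob LB +
  P: unital_positive A Oa B Ob P + Q: unital_positive B Ob A Oa Q
  for A :: "'a ous" and Oa LA and B :: "'b ous" and Ob LB and P Q +
  fixes g :: real
  assumes PQP: "a \<in> carrier A \<Longrightarrow> P (Q (P a)) = P a"
    and QPQ: "b \<in> carrier B \<Longrightarrow> Q (P (Q b)) = Q b"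
    and L_map: "a \<in> carrier A \<Longrightarrow> LB (P a) \<le> LA a" "b \<in> carrier B \<Longrightarrow> LA (Q b) \<le> LB b"
    and near: "a \<in> carrier A \<Longrightarrow> LA a \<le> 1 \<Longrightarrow> ou_dist A a (Q (P a)) \<le> g"
      "b \<in> carrier B \<Longrightarrow> LB b \<le> 1 \<Longrightarrow> ou_dist B b (P (Q b)) \<le> g"
begin

sublocale state_separated_pair A Oa B Ob ..

lemmas maps_mem = P.map_mem Q.map_mem

definition gap :: "'a \<Rightarrow> 'b \<Rightarrow> real" where
  "gap a b = ou_dist B (P a) (P (Q b))"

definition Lsum :: "real \<Rightarrow> 'a \<times> 'b \<Rightarrow> ereal" where
  "Lsum \<delta> x = max (LA (fst x)) (max (LB (snd x)) (ereal (gap (fst x) (snd x) / \<delta>)))"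

lemma gap_le_iff:
  "a \<in> carrier A \<Longrightarrow> b \<in> carrier B \<Longrightarrow> gap a b \<le> r \<longleftrightarrow> (\<forall>w\<in>Ob. \<bar>w (P a) - w (P (Q b))\<bar> \<le> r)"
  by (simp add: gap_def B.ou_dist_le_iff maps_mem)

lemma gap_upper:
  "a \<in> carrier A \<Longrightarrow> b \<in> carrier B \<Longrightarrow> w \<in> Ob \<Longrightarrow> \<bar>w (P a) - w (P (Q b))\<bar> \<le> gap a b"
  using gap_le_iff[of a b "gap a b"] by auto

lemma gap_nonneg: "0 \<le> gap a b"
  by (simp add: gap_def)

lemma gap_add:
  assumes "a \<in> carrier A" "b \<in> carrier B" "a' \<in> carrier A" "b' \<in> carrier B"
  shows "gap (a \<oplus>\<^bsub>A\<^esub> a') (b \<oplus>\<^bsub>B\<^esub> b') \<le> gap a b + gap a' b'"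
proof (subst gap_le_iff)
  show "\<forall>w\<in>Ob. \<bar>w (P (a \<oplus>\<^bsub>A\<^esub> a')) - w (P (Q (b \<oplus>\<^bsub>B\<^esub> b')))\<bar> \<le> gap a b + gap a' b'"
  proof
    fix w assume w: "w \<in> Ob"
    show "\<bar>w (P (a \<oplus>\<^bsub>A\<^esub> a')) - w (P (Q (b \<oplus>\<^bsub>B\<^esub> b')))\<bar> \<le> gap a b + gap a' b'"
      using gap_upper[OF assms(1,2) w] gap_upper[OF assms(3,4) w] assms w
      by (simp add: P.map_add Q.map_add maps_mem B.evals)
  qed
qed (use assms in \<open>auto simp: A.mems B.mems\<close>)

lemma gap_smult:
  assumes "a \<in> carrier A" "b \<in> carrier B"
  shows "gap (r \<odot>\<^bsub>A\<^esub> a) (r \<odot>\<^bsub>B\<^esub> b) \<le> \<bar>r\<bar> * gap a b"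
proof (subst gap_le_iff)
  show "\<forall>w\<in>Ob. \<bar>w (P (r \<odot>\<^bsub>A\<^esub> a)) - w (P (Q (r \<odot>\<^bsub>B\<^esub> b)))\<bar> \<le> \<bar>r\<bar> * gap a b"
  proof
    fix w assume w: "w \<in> Ob"
    have "\<bar>r\<bar> * \<bar>w (P a) - w (P (Q b))\<bar> \<le> \<bar>r\<bar> * gap a b"
      by (rule mult_left_mono[OF gap_upper[OF assms w]]) simp
    then show "\<bar>w (P (r \<odot>\<^bsub>A\<^esub> a)) - w (P (Q (r \<odot>\<^bsub>B\<^esub> b)))\<bar> \<le> \<bar>r\<bar> * gap a b"
      using assms w
      by (simp add: P.map_smult Q.map_smult maps_mem B.evals abs_mult[symmetric] algebra_simps)
  qed
qed (use assms in \<open>auto simp: A.mems B.mems\<close>)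

lemma gap_continuous:
  assumes "a \<in> carrier A" "b \<in> carrier B" "a' \<in> carrier A" "b' \<in> carrier B"
  shows "gap a b \<le> gap a' b' + ou_dist A a' a + ou_dist B b' b"
proof -
  have "gap a b \<le> ou_dist B (P a) (P a') + ou_dist B (P a') (P (Q b))"
    unfolding gap_def using assms by (intro B.M.triangle) (auto simp: maps_mem)
  also have "ou_dist B (P a') (P (Q b)) \<le> gap a' b' + ou_dist B (P (Q b')) (P (Q b))"
    unfolding gap_def using assms by (intro B.M.triangle) (auto simp: maps_mem)
  also have "ou_dist B (P (Q b')) (P (Q b)) \<le> ou_dist A (Q b') (Q b)"
    using assms by (intro P.map_contractive) (auto simp: maps_mem)
  also have "ou_dist A (Q b') (Q b) \<le> ou_dist B b' b" by (rule Q.map_contractive) fact+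
  also have "ou_dist B (P a) (P a') \<le> ou_dist A a a'" by (rule P.map_contractive) fact+
  finally show ?thesis by (simp add: A.M.commute)
qed

lemma Lsum_parts:
  "LA (fst x) \<le> Lsum \<delta> x" "LB (snd x) \<le> Lsum \<delta> x" "ereal (gap (fst x) (snd x) / \<delta>) \<le> Lsum \<delta> x"
  by (simp_all add: Lsum_def le_max_iff_disj)

lemma Lsum_leI:
  "LA (fst x) \<le> c \<Longrightarrow> LB (snd x) \<le> c \<Longrightarrow> ereal (gap (fst x) (snd x) / \<delta>) \<le> c \<Longrightarrow> Lsum \<delta> x \<le> c"
  by (simp add: Lsum_def)

lemma Lsum_le_iff:
  "0 < \<delta> \<Longrightarrow> Lsum \<delta> (a, b) \<le> ereal r \<longleftrightarrow> LA a \<le> ereal r \<and> LB b \<le> ereal r \<and> gap a b \<le> \<delta> * r"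
  by (simp add: Lsum_def pos_divide_le_eq mult.commute)

text \<open>
  The unit ball of \<open>Lsum \<delta>\<close> is totally bounded modulo the scalars of the sum, which are only the
  diagonal ones, because the gap bounds the difference between the scalars in the two summands.
\<close>

lemma Lsum_precompact:
  assumes "0 < \<delta>" "0 < e"
  shows "\<exists>F. finite F \<and> F \<subseteq> carrier S \<and>
    (\<forall>x\<in>carrier S. Lsum \<delta> x \<le> 1 \<longrightarrow> (\<exists>f\<in>F. \<exists>r. ou_dist S x (f \<oplus>\<^bsub>S\<^esub> r \<odot>\<^bsub>S\<^esub> \<one>\<^bsub>S\<^esub>) \<le> e))"
proof -
  define h where "h = e / 2"
  have h: "0 < h" using assms by (simp add: h_def)
  obtain FA where FA: "finite FA" "FA \<subseteq> carrier A"
    "\<And>a. a \<in> carrier A \<Longrightarrow> LA a \<le> 1 \<Longrightarrow> \<exists>f\<in>FA. \<exists>r. ou_dist A a (f \<oplus>\<^bsub>A\<^esub> r \<odot>\<^bsub>A\<^esub> \<one>\<^bsub>A\<^esub>) \<le> h"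
    using A.L_precompact[OF h] by blast
  obtain FB where FB: "finite FB" "FB \<subseteq> carrier B"
    "\<And>b. b \<in> carrier B \<Longrightarrow> LB b \<le> 1 \<Longrightarrow> \<exists>f\<in>FB. \<exists>r. ou_dist B b (f \<oplus>\<^bsub>B\<^esub> r \<odot>\<^bsub>B\<^esub> \<one>\<^bsub>B\<^esub>) \<le> h"
    using B.L_precompact[OF h] by blast
  obtain w where w: "w \<in> Ob" using B.states_nonempty by blast
  define C where "C = \<delta> + 2 * h + (\<Sum>p\<in>FA \<times> FB. \<bar>w (P (fst p)) - w (P (Q (snd p)))\<bar>)"
  define K where "K = \<lceil>C / h\<rceil> + 1"
  define F where "F = (\<lambda>(f, f', k). (f, f' \<oplus>\<^bsub>B\<^esub> (real_of_int k * h) \<odot>\<^bsub>B\<^esub> \<one>\<^bsub>B\<^esub>)) `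
    (FA \<times> FB \<times> {-K..K})"
  have "finite F" using FA FB by (simp add: F_def)
  moreover have "F \<subseteq> carrier S" using FA FB by (auto simp: F_def B.mems)
  moreover have "\<exists>f\<in>F. \<exists>r. ou_dist S x (f \<oplus>\<^bsub>S\<^esub> r \<odot>\<^bsub>S\<^esub> \<one>\<^bsub>S\<^esub>) \<le> e"
    if x: "x \<in> carrier S" "Lsum \<delta> x \<le> 1" for x
  proof -
    obtain a b where ab: "x = (a, b)" "a \<in> carrier A" "b \<in> carrier B" using x by auto
    have L: "LA a \<le> 1" "LB b \<le> 1" "gap a b \<le> \<delta>"
      using x(2) Lsum_le_iff[OF assms(1), of a b 1] by (auto simp: ab one_ereal_def)
    obtain f r where f: "f \<in> FA" "ou_dist A a (f \<oplus>\<^bsub>A\<^esub> r \<odot>\<^bsub>A\<^esub> \<one>\<^bsub>A\<^esub>) \<le> h" using FA(3) ab L by blast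
    obtain f' r' where f': "f' \<in> FB" "ou_dist B b (f' \<oplus>\<^bsub>B\<^esub> r' \<odot>\<^bsub>B\<^esub> \<one>\<^bsub>B\<^esub>) \<le> h" using FB(3) ab L by blast
    have fA: "f \<in> carrier A" "f' \<in> carrier B" using f f' FA FB by auto
    have "\<bar>w (P a) - (w (P f) + r)\<bar> \<le> h"
    proof -
      have "ou_dist B (P a) (P (f \<oplus>\<^bsub>A\<^esub> r \<odot>\<^bsub>A\<^esub> \<one>\<^bsub>A\<^esub>)) \<le> h"
        using P.map_contractive[of a "f \<oplus>\<^bsub>A\<^esub> r \<odot>\<^bsub>A\<^esub> \<one>\<^bsub>A\<^esub>"] f ab fA by (simp add: A.mems)
      then show ?thesis
        using w ab fA by (simp add: B.ou_dist_le_iff P.map_shift maps_mem A.mems B.mems B.evals)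
    qed
    moreover have "\<bar>w (P (Q b)) - (w (P (Q f')) + r')\<bar> \<le> h"
    proof -
      have "ou_dist B (P (Q b)) (P (Q (f' \<oplus>\<^bsub>B\<^esub> r' \<odot>\<^bsub>B\<^esub> \<one>\<^bsub>B\<^esub>))) \<le> h"
        using P.map_contractive[of "Q b" "Q (f' \<oplus>\<^bsub>B\<^esub> r' \<odot>\<^bsub>B\<^esub> \<one>\<^bsub>B\<^esub>)"]
          Q.map_contractive[of b "f' \<oplus>\<^bsub>B\<^esub> r' \<odot>\<^bsub>B\<^esub> \<one>\<^bsub>B\<^esub>"] f' ab fA by (simp add: B.mems maps_mem)
      then show ?thesis
        using w ab fA
        by (simp add: B.ou_dist_le_iff P.map_shift Q.map_shift maps_mem A.mems B.mems B.evals)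
    qed
    moreover have "\<bar>w (P a) - w (P (Q b))\<bar> \<le> \<delta>"
      using gap_upper[OF ab(2,3) w] L by linarith
    moreover have "\<bar>w (P f) - w (P (Q f'))\<bar> \<le> (\<Sum>p\<in>FA \<times> FB. \<bar>w (P (fst p)) - w (P (Q (snd p)))\<bar>)"
      using member_le_sum[of "(f, f')" "FA \<times> FB" "\<lambda>p. \<bar>w (P (fst p)) - w (P (Q (snd p)))\<bar>"]
        f f' FA FB by auto
    ultimately have C: "\<bar>r' - r\<bar> \<le> C" unfolding C_def by linarith
    define k where "k = \<lfloor>(r' - r) / h\<rfloor>"
    have fl: "real_of_int k \<le> (r' - r) / h" "(r' - r) / h \<le> real_of_int k + 1"
      unfolding k_def by linarith+
    then have k: "real_of_int k * h \<le> r' - r" "r' - r \<le> real_of_int k * h + h"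
      using h by (simp_all add: pos_le_divide_eq pos_divide_le_eq distrib_right)
    have "\<bar>(r' - r) / h\<bar> \<le> C / h" using C h by (simp add: abs_divide divide_right_mono)
    then have "- (C / h) \<le> (r' - r) / h" "(r' - r) / h \<le> C / h" by linarith+
    then have "k \<in> {-K..K}" using fl unfolding K_def atLeastAtMost_iff by linarith
    then have "(f, f' \<oplus>\<^bsub>B\<^esub> (real_of_int k * h) \<odot>\<^bsub>B\<^esub> \<one>\<^bsub>B\<^esub>) \<in> F"
      unfolding F_def using f f' by (intro image_eqI[of _ _ "(f, f', k)"]) auto
    moreover have "ou_dist B b (f' \<oplus>\<^bsub>B\<^esub> (real_of_int k * h) \<odot>\<^bsub>B\<^esub> \<one>\<^bsub>B\<^esub> \<oplus>\<^bsub>B\<^esub> r \<odot>\<^bsub>B\<^esub> \<one>\<^bsub>B\<^esub>) \<le> e"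
    proof (subst B.ou_dist_le_iff)
      show "\<forall>w\<in>Ob. \<bar>w b - w (f' \<oplus>\<^bsub>B\<^esub> (real_of_int k * h) \<odot>\<^bsub>B\<^esub> \<one>\<^bsub>B\<^esub> \<oplus>\<^bsub>B\<^esub> r \<odot>\<^bsub>B\<^esub> \<one>\<^bsub>B\<^esub>)\<bar> \<le> e"
      proof
        fix v assume v: "v \<in> Ob"
        have "\<bar>v b - (v f' + r')\<bar> \<le> h"
          using f'(2) ab fA v by (simp add: B.ou_dist_le_iff B.mems B.evals)
        moreover have "v (f' \<oplus>\<^bsub>B\<^esub> (real_of_int k * h) \<odot>\<^bsub>B\<^esub> \<one>\<^bsub>B\<^esub> \<oplus>\<^bsub>B\<^esub> r \<odot>\<^bsub>B\<^esub> \<one>\<^bsub>B\<^esub>)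
            = v f' + real_of_int k * h + r"
          using v fA by (simp add: B.mems B.evals)
        moreover have "e = h + h" by (simp add: h_def)
        ultimately show "\<bar>v b - v (f' \<oplus>\<^bsub>B\<^esub> (real_of_int k * h) \<odot>\<^bsub>B\<^esub> \<one>\<^bsub>B\<^esub> \<oplus>\<^bsub>B\<^esub> r \<odot>\<^bsub>B\<^esub> \<one>\<^bsub>B\<^esub>)\<bar> \<le> e"
          using k by linarith
      qed
    qed (use ab fA in \<open>auto simp: B.mems\<close>)
    moreover have "ou_dist A a (f \<oplus>\<^bsub>A\<^esub> r \<odot>\<^bsub>A\<^esub> \<one>\<^bsub>A\<^esub>) \<le> e" using f h_def h by simp
    ultimately show ?thesis
      using ab fA
      by (intro bexI[of _ "(f, f' \<oplus>\<^bsub>B\<^esub> (real_of_int k * h) \<odot>\<^bsub>B\<^esub> \<one>\<^bsub>B\<^esub>)"] exI[of _ r])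
        (simp_all add: ou_dist_sum A.mems B.mems)
  qed
  ultimately show ?thesis by blast
qed

lemma lip_space_sum: assumes \<delta>: "0 < \<delta>" shows "lip_space S (sum_states Oa Ob) (Lsum \<delta>)"
proof
  fix x :: "nat \<Rightarrow> 'a \<times> 'b"
  assume x: "\<And>n. x n \<in> carrier S" and cauchy: "\<forall>e>0. \<exists>N. \<forall>m\<ge>N. \<forall>n\<ge>N. ou_dist S (x m) (x n) < e"
  have xA: "fst (x n) \<in> carrier A" and xB: "snd (x n) \<in> carrier B" for n using x[of n] by auto
  have d: "ou_dist S (x n) (l, l') = max (ou_dist A (fst (x n)) l) (ou_dist B (snd (x n)) l')"
    if "l \<in> carrier A" "l' \<in> carrier B" for n l l'
    using ou_dist_sum[of "fst (x n)" l "snd (x n)" l'] xA xB that by simp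
  have d': "ou_dist S (x m) (x n) =
      max (ou_dist A (fst (x m)) (fst (x n))) (ou_dist B (snd (x m)) (snd (x n)))" for m n
    using d[of "fst (x n)" "snd (x n)" m] xA xB by simp
  have "\<forall>e>0. \<exists>N. \<forall>m\<ge>N. \<forall>n\<ge>N. ou_dist A (fst (x m)) (fst (x n)) < e"
    "\<forall>e>0. \<exists>N. \<forall>m\<ge>N. \<forall>n\<ge>N. ou_dist B (snd (x m)) (snd (x n)) < e"
    using cauchy unfolding d' max_less_iff_conj by meson+
  then obtain l l' where l: "l \<in> carrier A" "(\<lambda>n. ou_dist A (fst (x n)) l) \<longlonglongrightarrow> 0"
    "l' \<in> carrier B" "(\<lambda>n. ou_dist B (snd (x n)) l') \<longlonglongrightarrow> 0"
    using A.cauchy_converges[of "fst \<circ> x"] B.cauchy_converges[of "snd \<circ> x"] xA xB by auto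
  have "(\<lambda>n. ou_dist S (x n) (l, l')) \<longlonglongrightarrow> 0"
    unfolding d[OF l(1,3)] using tendsto_max[OF l(2,4)] by simp
  then show "\<exists>l\<in>carrier S. (\<lambda>n. ou_dist S (x n) l) \<longlonglongrightarrow> 0"
    using l by (intro bexI[of _ "(l, l')"]) auto
next
  fix x assume "x \<in> carrier S"
  then have x: "fst x \<in> carrier A" "snd x \<in> carrier B" by auto
  show "0 \<le> Lsum \<delta> x" using A.L_nonneg[OF x(1)] by (simp add: Lsum_def max.coboundedI1)
  show "Lsum \<delta> (r \<odot>\<^bsub>S\<^esub> x) \<le> ereal \<bar>r\<bar> * Lsum \<delta> x" for r
  proof -
    have "ereal (gap (r \<odot>\<^bsub>A\<^esub> fst x) (r \<odot>\<^bsub>B\<^esub> snd x) / \<delta>) \<le> ereal \<bar>r\<bar> * ereal (gap (fst x) (snd x) / \<delta>)"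
      using gap_smult[OF x, of r] \<delta> by (simp add: divide_right_mono)
    also have "\<dots> \<le> ereal \<bar>r\<bar> * Lsum \<delta> x"
      by (rule ereal_mult_left_mono[OF Lsum_parts(3)]) simp
    finally have 1: "ereal (gap (r \<odot>\<^bsub>A\<^esub> fst x) (r \<odot>\<^bsub>B\<^esub> snd x) / \<delta>) \<le> ereal \<bar>r\<bar> * Lsum \<delta> x" .
    have "LA (r \<odot>\<^bsub>A\<^esub> fst x) \<le> ereal \<bar>r\<bar> * Lsum \<delta> x"
      by (rule order.trans[OF A.L_smult_le[OF x(1)]], rule ereal_mult_left_mono[OF Lsum_parts(1)])
        simp
    moreover have "LB (r \<odot>\<^bsub>B\<^esub> snd x) \<le> ereal \<bar>r\<bar> * Lsum \<delta> x"
      by (rule order.trans[OF B.L_smult_le[OF x(2)]], rule ereal_mult_left_mono[OF Lsum_parts(2)])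
        simp
    ultimately show ?thesis using 1 by (intro Lsum_leI) simp_all
  qed
  show "\<exists>r. x = r \<odot>\<^bsub>S\<^esub> \<one>\<^bsub>S\<^esub>" if "Lsum \<delta> x = 0"
  proof -
    have "LA (fst x) \<le> 0" "LB (snd x) \<le> 0" "ereal (gap (fst x) (snd x) / \<delta>) \<le> 0"
      using Lsum_parts[of x \<delta>] that by simp_all
    then have "LA (fst x) = 0" "LB (snd x) = 0" and g: "gap (fst x) (snd x) \<le> 0"
      using A.L_nonneg[OF x(1)] B.L_nonneg[OF x(2)] \<delta> by (auto simp: divide_le_0_iff)
    then obtain r s where rs: "fst x = r \<odot>\<^bsub>A\<^esub> \<one>\<^bsub>A\<^esub>" "snd x = s \<odot>\<^bsub>B\<^esub> \<one>\<^bsub>B\<^esub>"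
      using A.L_kernel[OF x(1)] B.L_kernel[OF x(2)] by blast
    obtain w where w: "w \<in> Ob" using B.states_nonempty by blast
    have "r = s"
      using gap_upper[OF x w] g w rs
      by (simp add: P.map_smult Q.map_smult P.map_one Q.map_one A.mems B.mems maps_mem B.evals)
    then show ?thesis using rs by (intro exI[of _ r]) (simp add: prod_eq_iff)
  qed
  show "\<exists>y\<in>carrier S. Lsum \<delta> y < \<infinity> \<and> ou_dist S x y < e" if e: "0 < e" for e
  proof -
    obtain a b where "a \<in> carrier A" "LA a < \<infinity>" "ou_dist A (fst x) a < e"
      "b \<in> carrier B" "LB b < \<infinity>" "ou_dist B (snd x) b < e"
      using A.L_finite_dense[OF x(1) e] B.L_finite_dense[OF x(2) e] by blast
    moreover from this have "Lsum \<delta> (a, b) < \<infinity>"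
      unfolding Lsum_def max_less_iff_conj by simp
    ultimately show ?thesis
      using ou_dist_sum[of "fst x" a "snd x" b] x by (intro bexI[of _ "(a, b)"]) auto
  qed
  fix y assume "y \<in> carrier S"
  then have y: "fst y \<in> carrier A" "snd y \<in> carrier B" by auto
  show "Lsum \<delta> (x \<oplus>\<^bsub>S\<^esub> y) \<le> Lsum \<delta> x + Lsum \<delta> y"
  proof -
    note le = Lsum_parts[where \<delta> = \<delta>]
    have "ereal (gap (fst x \<oplus>\<^bsub>A\<^esub> fst y) (snd x \<oplus>\<^bsub>B\<^esub> snd y) / \<delta>)
        \<le> ereal (gap (fst x) (snd x) / \<delta>) + ereal (gap (fst y) (snd y) / \<delta>)"
      using gap_add[OF x y] \<delta> by (simp add: add_divide_distrib[symmetric] divide_right_mono)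
    then have "ereal (gap (fst x \<oplus>\<^bsub>A\<^esub> fst y) (snd x \<oplus>\<^bsub>B\<^esub> snd y) / \<delta>) \<le> Lsum \<delta> x + Lsum \<delta> y"
      using add_mono[OF le(3)[of x] le(3)[of y]] by (rule order.trans)
    moreover have "LA (fst x \<oplus>\<^bsub>A\<^esub> fst y) \<le> Lsum \<delta> x + Lsum \<delta> y"
      using A.L_add[OF x(1) y(1)] add_mono[OF le(1)[of x] le(1)[of y]] by (rule order.trans)
    moreover have "LB (snd x \<oplus>\<^bsub>B\<^esub> snd y) \<le> Lsum \<delta> x + Lsum \<delta> y"
      using B.L_add[OF x(2) y(2)] add_mono[OF le(2)[of x] le(2)[of y]] by (rule order.trans)
    ultimately show ?thesis by (intro Lsum_leI) simp_all
  qed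
next
  have "P (Q \<one>\<^bsub>B\<^esub>) = P \<one>\<^bsub>A\<^esub>" by (simp add: Q.map_one)
  then show "Lsum \<delta> \<one>\<^bsub>S\<^esub> = 0"
    by (simp add: Lsum_def A.L_one B.L_one gap_def maps_mem A.mems zero_ereal_def)
next
  fix x :: "nat \<Rightarrow> 'a \<times> 'b" and l
  assume x: "\<And>n. x n \<in> carrier S" "\<And>n. Lsum \<delta> (x n) \<le> 1"
    and "l \<in> carrier S" and lim: "(\<lambda>n. ou_dist S (x n) l) \<longlonglongrightarrow> 0"
  then have l: "fst l \<in> carrier A" "snd l \<in> carrier B" by auto
  have xA: "fst (x n) \<in> carrier A" and xB: "snd (x n) \<in> carrier B" for n using x(1)[of n] by auto
  have "Lsum \<delta> (fst (x n), snd (x n)) \<le> ereal 1" for n using x(2)[of n] by (simp add: one_ereal_def)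
  then have L: "LA (fst (x n)) \<le> 1" "LB (snd (x n)) \<le> 1" "gap (fst (x n)) (snd (x n)) \<le> \<delta>" for n
    unfolding Lsum_le_iff[OF \<delta>] by (auto simp: one_ereal_def)
  have d: "ou_dist S (x n) l = max (ou_dist A (fst (x n)) (fst l)) (ou_dist B (snd (x n)) (snd l))"
    for n
    using ou_dist_sum[of "fst (x n)" "fst l" "snd (x n)" "snd l"] xA xB l by simp
  have limA: "(\<lambda>n. ou_dist A (fst (x n)) (fst l)) \<longlonglongrightarrow> 0"
    by (rule tendsto_sandwich[OF _ _ tendsto_const lim]) (auto simp: d)
  have limB: "(\<lambda>n. ou_dist B (snd (x n)) (snd l)) \<longlonglongrightarrow> 0"
    by (rule tendsto_sandwich[OF _ _ tendsto_const lim]) (auto simp: d)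
  have "gap (fst l) (snd l) \<le> \<delta> + ou_dist A (fst (x n)) (fst l) + ou_dist B (snd (x n)) (snd l)" for n
    using gap_continuous[OF l xA[of n] xB[of n]] L(3)[of n] by linarith
  moreover have "(\<lambda>n. \<delta> + ou_dist A (fst (x n)) (fst l) + ou_dist B (snd (x n)) (snd l)) \<longlonglongrightarrow> \<delta> + 0 + 0"
    by (intro tendsto_intros limA limB)
  ultimately have "gap (fst l) (snd l) \<le> \<delta>" by (intro LIMSEQ_le_const[where a = "gap (fst l) (snd l)"]) auto
  moreover have "LA (fst l) \<le> 1"
    by (rule A.L_limit[of "\<lambda>n. fst (x n)"]) (use xA L l limA in auto)
  moreover have "LB (snd l) \<le> 1"
    by (rule B.L_limit[of "\<lambda>n. snd (x n)"]) (use xB L l limB in auto)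
  ultimately show "Lsum \<delta> l \<le> 1"
    using Lsum_le_iff[OF \<delta>, of "fst l" "snd l" 1] by (simp add: one_ereal_def)
next
  fix e :: real assume "0 < e"
  then show "\<exists>F. finite F \<and> F \<subseteq> carrier S \<and>
    (\<forall>x\<in>carrier S. Lsum \<delta> x \<le> 1 \<longrightarrow> (\<exists>f\<in>F. \<exists>r. ou_dist S x (f \<oplus>\<^bsub>S\<^esub> r \<odot>\<^bsub>S\<^esub> \<one>\<^bsub>S\<^esub>) \<le> e))"
    by (rule Lsum_precompact[OF \<delta>])
qed

lemma admissible_Lsum: assumes \<delta>: "0 < \<delta>" shows "admissible A LA B LB (Lsum \<delta>)"
  unfolding admissible_def
proof (intro conjI ballI)
  show "quantum_metric_ous S (Lsum \<delta>)"
    using lip_space.quantum_metric[OF lip_space_sum[OF \<delta>]] .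
  fix a assume a: "a \<in> carrier A"
  have "gap a (P a) = 0" using a by (simp add: gap_def PQP maps_mem)
  then have "Lsum \<delta> (a, P a) = LA a"
    using L_map(1)[OF a] A.L_nonneg[OF a] by (simp add: Lsum_def max_absorb1 zero_ereal_def[symmetric])
  then show "(INF b\<in>carrier B. Lsum \<delta> (a, b)) = LA a"
    using a Lsum_parts(1)[where x = "(a, b)" and \<delta> = \<delta> for b]
    by (intro antisym INF_greatest INF_lower2[of "P a"]) (auto simp: maps_mem)
next
  fix b assume b: "b \<in> carrier B"
  have "gap (Q b) b = 0" using b by (simp add: gap_def maps_mem)
  then have "Lsum \<delta> (Q b, b) = LB b"
    using L_map(2)[OF b] B.L_nonneg[OF b]
    by (simp add: Lsum_def max_absorb1 max_absorb2 zero_ereal_def[symmetric])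
  then show "(INF a\<in>carrier A. Lsum \<delta> (a, b)) = LB b"
    using b Lsum_parts(2)[where x = "(a, b)" and \<delta> = \<delta> for a]
    by (intro antisym INF_greatest INF_lower2[of "Q b"]) (auto simp: maps_mem)
qed

lemma hausdorff_le:
  assumes \<delta>: "0 < \<delta>"
  shows "hausdorff_dist (mk S (Lsum \<delta>)) (fst_states A B) (snd_states A B) \<le> ereal (g + \<delta>)"
proof -
  have mk_le: "mk S (Lsum \<delta>) (\<lambda>x\<in>carrier S. \<phi> (fst x)) (\<lambda>x\<in>carrier S. \<psi> (snd x)) \<le> ereal (g + \<delta>)"
    if "\<And>a b. a \<in> carrier A \<Longrightarrow> b \<in> carrier B \<Longrightarrow> LA a \<le> 1 \<Longrightarrow> LB b \<le> 1 \<Longrightarrow> gap a b \<le> \<delta> \<Longrightarrow>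
      \<bar>\<phi> a - \<psi> b\<bar> \<le> g + \<delta>" for \<phi> \<psi>
    unfolding mk_def
  proof (rule SUP_least, clarify)
    fix a b assume ab: "(a, b) \<in> carrier S" "Lsum \<delta> (a, b) \<le> 1"
    then have "\<bar>\<phi> a - \<psi> b\<bar> \<le> g + \<delta>"
      using Lsum_le_iff[OF \<delta>, of a b 1] by (intro that) (auto simp: one_ereal_def)
    then show "ereal \<bar>(\<lambda>x\<in>carrier S. \<phi> (fst x)) (a, b) - (\<lambda>x\<in>carrier S. \<psi> (snd x)) (a, b)\<bar>
        \<le> ereal (g + \<delta>)"
      using ab by simp
  qed
  have 1: "\<exists>Y\<in>snd_states A B. mk S (Lsum \<delta>) X Y \<le> ereal (g + \<delta>)" if X: "X \<in> fst_states A B" for X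
  proof -
    obtain \<phi> where \<phi>: "\<phi> \<in> states A" "X = (\<lambda>x\<in>carrier S. \<phi> (fst x))"
      using X unfolding fst_states_def by blast
    let ?\<psi> = "\<lambda>b\<in>carrier B. \<phi> (Q b)"
    have "mk S (Lsum \<delta>) X (\<lambda>x\<in>carrier S. ?\<psi> (snd x)) \<le> ereal (g + \<delta>)"
      unfolding \<phi>(2)
    proof (rule mk_le)
      fix a b assume *: "a \<in> carrier A" "b \<in> carrier B" "LA a \<le> 1" "gap a b \<le> \<delta>"
      have "\<bar>\<phi> a - \<phi> (Q (P a))\<bar> \<le> g"
        using A.states_le_ou_dist[OF \<phi>(1), of a "Q (P a)"] near(1)[of a] * by (simp add: maps_mem)
      moreover have "\<bar>\<phi> (Q (P a)) - \<phi> (Q (P (Q b)))\<bar> \<le> \<delta>"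
        using A.states_le_ou_dist[OF \<phi>(1), of "Q (P a)" "Q (P (Q b))"]
          Q.map_contractive[of "P a" "P (Q b)"] * by (simp add: maps_mem gap_def)
      ultimately show "\<bar>\<phi> a - ?\<psi> b\<bar> \<le> g + \<delta>" using * by (simp add: QPQ)
    qed
    then show ?thesis
      using Q.pullback_state[OF \<phi>(1)] unfolding snd_states_def by blast
  qed
  have 2: "\<exists>X\<in>fst_states A B. mk S (Lsum \<delta>) X Y \<le> ereal (g + \<delta>)" if Y: "Y \<in> snd_states A B" for Y
  proof -
    obtain \<psi> where \<psi>: "\<psi> \<in> states B" "Y = (\<lambda>x\<in>carrier S. \<psi> (snd x))"
      using Y unfolding snd_states_def by blast
    let ?\<phi> = "\<lambda>a\<in>carrier A. \<psi> (P a)"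
    have "mk S (Lsum \<delta>) (\<lambda>x\<in>carrier S. ?\<phi> (fst x)) Y \<le> ereal (g + \<delta>)"
      unfolding \<psi>(2)
    proof (rule mk_le)
      fix a b assume *: "a \<in> carrier A" "b \<in> carrier B" "LB b \<le> 1" "gap a b \<le> \<delta>"
      have "\<bar>\<psi> b - \<psi> (P (Q b))\<bar> \<le> g"
        using B.states_le_ou_dist[OF \<psi>(1), of b "P (Q b)"] near(2)[of b] * by (simp add: maps_mem)
      moreover have "\<bar>\<psi> (P a) - \<psi> (P (Q b))\<bar> \<le> \<delta>"
        using B.states_le_ou_dist[OF \<psi>(1), of "P a" "P (Q b)"] * by (simp add: maps_mem gap_def)
      ultimately show "\<bar>?\<phi> a - \<psi> b\<bar> \<le> g + \<delta>" using * by simp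
    qed
    then show ?thesis
      using P.pullback_state[OF \<psi>(1)] unfolding fst_states_def by blast
  qed
  show ?thesis
    unfolding hausdorff_dist_def
    using 1 2 by (auto intro!: SUP_least) (meson INF_lower2)+
qed

theorem dist_q_le: "dist_q A LA B LB \<le> ereal g"
proof (rule ereal_le_epsilon2)
  fix \<delta> :: real assume \<delta>: "0 < \<delta>"
  have "dist_q A LA B LB \<le> hausdorff_dist (mk S (Lsum \<delta>)) (fst_states A B) (snd_states A B)"
    unfolding dist_q_def using admissible_Lsum[OF \<delta>] by (intro INF_lower) simp
  also have "\<dots> \<le> ereal g + ereal \<delta>" using hausdorff_le[OF \<delta>] by simp
  finally show "dist_q A LA B LB \<le> ereal g + ereal \<delta>" .
qed

end

section \<open>Normed star algebras with a norming family of states\<close>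

locale state_star_algebra = ring A for A :: "'a star_alg" +
  fixes Om :: "('a \<Rightarrow> real) set"
  assumes smult_mem [simp]: "a \<in> carrier A \<Longrightarrow> c \<odot>\<^bsub>A\<^esub> a \<in> carrier A"
    and smult_add: "a \<in> carrier A \<Longrightarrow> b \<in> carrier A \<Longrightarrow> c \<odot>\<^bsub>A\<^esub> (a \<oplus>\<^bsub>A\<^esub> b) = c \<odot>\<^bsub>A\<^esub> a \<oplus>\<^bsub>A\<^esub> c \<odot>\<^bsub>A\<^esub> b"
    and smult_add_left: "a \<in> carrier A \<Longrightarrow> (c + d) \<odot>\<^bsub>A\<^esub> a = c \<odot>\<^bsub>A\<^esub> a \<oplus>\<^bsub>A\<^esub> d \<odot>\<^bsub>A\<^esub> a"
    and smult_smult: "a \<in> carrier A \<Longrightarrow> c \<odot>\<^bsub>A\<^esub> (d \<odot>\<^bsub>A\<^esub> a) = (c * d) \<odot>\<^bsub>A\<^esub> a"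
    and smult_one: "a \<in> carrier A \<Longrightarrow> 1 \<odot>\<^bsub>A\<^esub> a = a"
    and smult_mult: "a \<in> carrier A \<Longrightarrow> b \<in> carrier A \<Longrightarrow> (c \<odot>\<^bsub>A\<^esub> a) \<otimes>\<^bsub>A\<^esub> b = c \<odot>\<^bsub>A\<^esub> (a \<otimes>\<^bsub>A\<^esub> b)"
      "a \<in> carrier A \<Longrightarrow> b \<in> carrier A \<Longrightarrow> a \<otimes>\<^bsub>A\<^esub> (c \<odot>\<^bsub>A\<^esub> b) = c \<odot>\<^bsub>A\<^esub> (a \<otimes>\<^bsub>A\<^esub> b)"
    and star_mem [simp]: "a \<in> carrier A \<Longrightarrow> star A a \<in> carrier A"
    and star_add: "a \<in> carrier A \<Longrightarrow> b \<in> carrier A \<Longrightarrow> star A (a \<oplus>\<^bsub>A\<^esub> b) = star A a \<oplus>\<^bsub>A\<^esub> star A b"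
    and star_smult: "a \<in> carrier A \<Longrightarrow> star A (c \<odot>\<^bsub>A\<^esub> a) = cnj c \<odot>\<^bsub>A\<^esub> star A a"
    and star_mult: "a \<in> carrier A \<Longrightarrow> b \<in> carrier A \<Longrightarrow> star A (a \<otimes>\<^bsub>A\<^esub> b) = star A b \<otimes>\<^bsub>A\<^esub> star A a"
    and star_one: "star A \<one>\<^bsub>A\<^esub> = \<one>\<^bsub>A\<^esub>"
    and nrm_zero_imp: "a \<in> carrier A \<Longrightarrow> nrm A a = 0 \<Longrightarrow> a = \<zero>\<^bsub>A\<^esub>"
    and nrm_add: "a \<in> carrier A \<Longrightarrow> b \<in> carrier A \<Longrightarrow> nrm A (a \<oplus>\<^bsub>A\<^esub> b) \<le> nrm A a + nrm A b"
    and nrm_smult: "a \<in> carrier A \<Longrightarrow> nrm A (c \<odot>\<^bsub>A\<^esub> a) = cmod c * nrm A a"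
    and nrm_mult: "a \<in> carrier A \<Longrightarrow> b \<in> carrier A \<Longrightarrow> nrm A (a \<otimes>\<^bsub>A\<^esub> b) \<le> nrm A a * nrm A b"
    and nrm_star: "a \<in> carrier A \<Longrightarrow> nrm A (star A a) = nrm A a"
    and nrm_one: "nrm A \<one>\<^bsub>A\<^esub> = 1"
    and cauchy_converges: "\<And>x. (\<And>n. x n \<in> carrier A) \<Longrightarrow>
      (\<forall>e>0. \<exists>N. \<forall>m\<ge>N. \<forall>n\<ge>N. nrm A (x m \<ominus>\<^bsub>A\<^esub> x n) < e) \<Longrightarrow>
      \<exists>l\<in>carrier A. (\<lambda>n. nrm A (x n \<ominus>\<^bsub>A\<^esub> l)) \<longlonglongrightarrow> 0"
    and om_nonempty: "Om \<noteq> {}"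
    and om_add: "w \<in> Om \<Longrightarrow> a \<in> carrier A \<Longrightarrow> b \<in> carrier A \<Longrightarrow> w (a \<oplus>\<^bsub>A\<^esub> b) = w a + w b"
    and om_smult: "w \<in> Om \<Longrightarrow> a \<in> carrier A \<Longrightarrow> w (complex_of_real r \<odot>\<^bsub>A\<^esub> a) = r * w a"
    and om_pos: "w \<in> Om \<Longrightarrow> a \<in> carrier A \<Longrightarrow> 0 \<le> w (star A a \<otimes>\<^bsub>A\<^esub> a)"
    and om_one: "w \<in> Om \<Longrightarrow> w \<one>\<^bsub>A\<^esub> = 1"
    and om_le_nrm: "w \<in> Om \<Longrightarrow> a \<in> carrier A \<Longrightarrow> \<bar>w a\<bar> \<le> nrm A a"
    and om_norming: "a \<in> carrier A \<Longrightarrow> star A a = a \<Longrightarrow> 0 \<le> r \<Longrightarrow> (\<And>w. w \<in> Om \<Longrightarrow> \<bar>w a\<bar> \<le> r)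
      \<Longrightarrow> nrm A a \<le> r"
begin

lemma smult_zero: "a \<in> carrier A \<Longrightarrow> 0 \<odot>\<^bsub>A\<^esub> a = \<zero>\<^bsub>A\<^esub>"
  by (rule nrm_zero_imp) (simp_all add: nrm_smult)

lemma neg_eq: assumes a: "a \<in> carrier A" shows "\<ominus>\<^bsub>A\<^esub> a = (-1) \<odot>\<^bsub>A\<^esub> a"
proof -
  have "(-1) \<odot>\<^bsub>A\<^esub> a \<oplus>\<^bsub>A\<^esub> a = ((-1) + 1) \<odot>\<^bsub>A\<^esub> a"
    using a by (simp only: smult_add_left smult_one)
  then have "(-1) \<odot>\<^bsub>A\<^esub> a \<oplus>\<^bsub>A\<^esub> a = \<zero>\<^bsub>A\<^esub>" using a by (simp add: smult_zero)
  then show ?thesis using a by (intro minus_equality) auto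
qed

lemma minus_eq: "a \<in> carrier A \<Longrightarrow> b \<in> carrier A \<Longrightarrow> a \<ominus>\<^bsub>A\<^esub> b = a \<oplus>\<^bsub>A\<^esub> (-1) \<odot>\<^bsub>A\<^esub> b"
  by (simp add: a_minus_def neg_eq)

lemma nrm_zero [simp]: "nrm A \<zero>\<^bsub>A\<^esub> = 0"
  using nrm_smult[of "\<one>\<^bsub>A\<^esub>" 0] by (simp add: smult_zero)

lemma star_minus:
  "a \<in> carrier A \<Longrightarrow> b \<in> carrier A \<Longrightarrow> star A (a \<ominus>\<^bsub>A\<^esub> b) = star A a \<ominus>\<^bsub>A\<^esub> star A b"
  by (simp add: minus_eq star_add star_smult)

lemma star_zero: "star A \<zero>\<^bsub>A\<^esub> = \<zero>\<^bsub>A\<^esub>"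
  using star_smult[of "\<one>\<^bsub>A\<^esub>" 0] by (simp add: smult_zero)

lemma nrm_neg: "a \<in> carrier A \<Longrightarrow> nrm A (\<ominus>\<^bsub>A\<^esub> a) = nrm A a"
  by (simp add: neg_eq nrm_smult)

lemma nrm_nonneg: assumes a: "a \<in> carrier A" shows "0 \<le> nrm A a"
  using nrm_add[of a "\<ominus>\<^bsub>A\<^esub> a"] a by (simp add: nrm_neg r_neg)

lemma dist_self [simp]: "a \<in> carrier A \<Longrightarrow> nrm A (a \<ominus>\<^bsub>A\<^esub> a) = 0"
  by (simp add: a_minus_def r_neg)

lemma minus_mem [simp]: "a \<in> carrier A \<Longrightarrow> b \<in> carrier A \<Longrightarrow> a \<ominus>\<^bsub>A\<^esub> b \<in> carrier A"
  by (rule minus_closed)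

lemma minus_swap:
  assumes "a \<in> carrier A" "b \<in> carrier A" shows "a \<ominus>\<^bsub>A\<^esub> b = \<ominus>\<^bsub>A\<^esub> (b \<ominus>\<^bsub>A\<^esub> a)"
  using assms by (simp add: a_minus_def minus_add a_comm)

lemma dist_commute:
  "a \<in> carrier A \<Longrightarrow> b \<in> carrier A \<Longrightarrow> nrm A (a \<ominus>\<^bsub>A\<^esub> b) = nrm A (b \<ominus>\<^bsub>A\<^esub> a)"
  using minus_swap[of a b] nrm_neg[of "b \<ominus>\<^bsub>A\<^esub> a"] by simp

lemma minus_split:
  assumes "a \<in> carrier A" "b \<in> carrier A" "c \<in> carrier A"
  shows "a \<ominus>\<^bsub>A\<^esub> c = (a \<ominus>\<^bsub>A\<^esub> b) \<oplus>\<^bsub>A\<^esub> (b \<ominus>\<^bsub>A\<^esub> c)"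
proof -
  have "(a \<ominus>\<^bsub>A\<^esub> b) \<oplus>\<^bsub>A\<^esub> (b \<ominus>\<^bsub>A\<^esub> c) = a \<oplus>\<^bsub>A\<^esub> ((\<ominus>\<^bsub>A\<^esub> b \<oplus>\<^bsub>A\<^esub> b) \<oplus>\<^bsub>A\<^esub> \<ominus>\<^bsub>A\<^esub> c)"
    using assms by (simp add: a_minus_def a_assoc)
  then show ?thesis using assms by (simp add: l_neg a_minus_def)
qed

lemma dist_triangle:
  assumes "a \<in> carrier A" "b \<in> carrier A" "c \<in> carrier A"
  shows "nrm A (a \<ominus>\<^bsub>A\<^esub> c) \<le> nrm A (a \<ominus>\<^bsub>A\<^esub> b) + nrm A (b \<ominus>\<^bsub>A\<^esub> c)"
  using nrm_add[of "a \<ominus>\<^bsub>A\<^esub> b" "b \<ominus>\<^bsub>A\<^esub> c"] assms by (simp add: minus_split[OF assms, symmetric])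

lemma dist_zero_imp: "a \<in> carrier A \<Longrightarrow> b \<in> carrier A \<Longrightarrow> nrm A (a \<ominus>\<^bsub>A\<^esub> b) = 0 \<Longrightarrow> a = b"
  using nrm_zero_imp[of "a \<ominus>\<^bsub>A\<^esub> b"] by (metis a_minus_def a_inv_closed minus_equality minus_minus minus_mem)

lemma minus_zero: "a \<in> carrier A \<Longrightarrow> a \<ominus>\<^bsub>A\<^esub> \<zero>\<^bsub>A\<^esub> = a"
  by (simp add: a_minus_def)

lemma nrm_le_dist:
  assumes "a \<in> carrier A" "b \<in> carrier A" shows "nrm A a \<le> nrm A b + nrm A (a \<ominus>\<^bsub>A\<^esub> b)"
  using dist_triangle[of a b "\<zero>\<^bsub>A\<^esub>"] assms by (simp add: minus_zero)

lemma add_minus_add: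
  assumes "a \<in> carrier A" "b \<in> carrier A" "c \<in> carrier A" "d \<in> carrier A"
  shows "(a \<oplus>\<^bsub>A\<^esub> b) \<ominus>\<^bsub>A\<^esub> (c \<oplus>\<^bsub>A\<^esub> d) = (a \<ominus>\<^bsub>A\<^esub> c) \<oplus>\<^bsub>A\<^esub> (b \<ominus>\<^bsub>A\<^esub> d)"
proof -
  have "(a \<oplus>\<^bsub>A\<^esub> b) \<ominus>\<^bsub>A\<^esub> (c \<oplus>\<^bsub>A\<^esub> d) = a \<oplus>\<^bsub>A\<^esub> (b \<oplus>\<^bsub>A\<^esub> (\<ominus>\<^bsub>A\<^esub> c \<oplus>\<^bsub>A\<^esub> \<ominus>\<^bsub>A\<^esub> d))"
    using assms by (simp add: a_minus_def minus_add a_assoc)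
  also have "b \<oplus>\<^bsub>A\<^esub> (\<ominus>\<^bsub>A\<^esub> c \<oplus>\<^bsub>A\<^esub> \<ominus>\<^bsub>A\<^esub> d) = \<ominus>\<^bsub>A\<^esub> c \<oplus>\<^bsub>A\<^esub> (b \<oplus>\<^bsub>A\<^esub> \<ominus>\<^bsub>A\<^esub> d)"
    using assms by (simp add: a_lcomm)
  finally show ?thesis using assms by (simp add: a_minus_def a_assoc)
qed

lemma dist_add:
  assumes "a \<in> carrier A" "b \<in> carrier A" "c \<in> carrier A" "d \<in> carrier A"
  shows "nrm A ((a \<oplus>\<^bsub>A\<^esub> b) \<ominus>\<^bsub>A\<^esub> (c \<oplus>\<^bsub>A\<^esub> d)) \<le> nrm A (a \<ominus>\<^bsub>A\<^esub> c) + nrm A (b \<ominus>\<^bsub>A\<^esub> d)"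
  using nrm_add[of "a \<ominus>\<^bsub>A\<^esub> c" "b \<ominus>\<^bsub>A\<^esub> d"] assms by (simp add: add_minus_add)

lemma smult_minus:
  "a \<in> carrier A \<Longrightarrow> b \<in> carrier A \<Longrightarrow> c \<odot>\<^bsub>A\<^esub> (a \<ominus>\<^bsub>A\<^esub> b) = c \<odot>\<^bsub>A\<^esub> a \<ominus>\<^bsub>A\<^esub> c \<odot>\<^bsub>A\<^esub> b"
  by (simp add: minus_eq smult_add smult_smult mult.commute)

lemma dist_smult:
  assumes "a \<in> carrier A" "b \<in> carrier A"
  shows "nrm A (c \<odot>\<^bsub>A\<^esub> a \<ominus>\<^bsub>A\<^esub> c \<odot>\<^bsub>A\<^esub> b) = cmod c * nrm A (a \<ominus>\<^bsub>A\<^esub> b)"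
  using assms by (simp add: smult_minus[symmetric] nrm_smult)

lemma dist_star:
  "a \<in> carrier A \<Longrightarrow> b \<in> carrier A \<Longrightarrow> nrm A (star A a \<ominus>\<^bsub>A\<^esub> star A b) = nrm A (a \<ominus>\<^bsub>A\<^esub> b)"
  by (simp add: star_minus[symmetric] nrm_star)

lemma dist_mult:
  assumes "a \<in> carrier A" "b \<in> carrier A" "c \<in> carrier A" "d \<in> carrier A"
  shows "nrm A ((a \<otimes>\<^bsub>A\<^esub> b) \<ominus>\<^bsub>A\<^esub> (c \<otimes>\<^bsub>A\<^esub> d))
    \<le> nrm A a * nrm A (b \<ominus>\<^bsub>A\<^esub> d) + nrm A (a \<ominus>\<^bsub>A\<^esub> c) * nrm A d"
proof -
  have "nrm A ((a \<otimes>\<^bsub>A\<^esub> b) \<ominus>\<^bsub>A\<^esub> (c \<otimes>\<^bsub>A\<^esub> d)) \<le>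
      nrm A ((a \<otimes>\<^bsub>A\<^esub> b) \<ominus>\<^bsub>A\<^esub> (a \<otimes>\<^bsub>A\<^esub> d)) + nrm A ((a \<otimes>\<^bsub>A\<^esub> d) \<ominus>\<^bsub>A\<^esub> (c \<otimes>\<^bsub>A\<^esub> d))"
    using assms by (intro dist_triangle) auto
  moreover have "(a \<otimes>\<^bsub>A\<^esub> b) \<ominus>\<^bsub>A\<^esub> (a \<otimes>\<^bsub>A\<^esub> d) = a \<otimes>\<^bsub>A\<^esub> (b \<ominus>\<^bsub>A\<^esub> d)"
    using assms by (simp add: minus_eq r_distr smult_mult)
  moreover have "(a \<otimes>\<^bsub>A\<^esub> d) \<ominus>\<^bsub>A\<^esub> (c \<otimes>\<^bsub>A\<^esub> d) = (a \<ominus>\<^bsub>A\<^esub> c) \<otimes>\<^bsub>A\<^esub> d"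
    using assms by (simp add: minus_eq l_distr smult_mult)
  moreover have "nrm A (a \<otimes>\<^bsub>A\<^esub> (b \<ominus>\<^bsub>A\<^esub> d)) \<le> nrm A a * nrm A (b \<ominus>\<^bsub>A\<^esub> d)"
    "nrm A ((a \<ominus>\<^bsub>A\<^esub> c) \<otimes>\<^bsub>A\<^esub> d) \<le> nrm A (a \<ominus>\<^bsub>A\<^esub> c) * nrm A d"
    using assms by (auto intro: nrm_mult)
  ultimately show ?thesis by simp
qed

lemma om_minus: "w \<in> Om \<Longrightarrow> a \<in> carrier A \<Longrightarrow> b \<in> carrier A \<Longrightarrow> w (a \<ominus>\<^bsub>A\<^esub> b) = w a - w b"
  using om_smult[of w b "-1"] by (simp add: minus_eq om_add)

lemma om_zero: "w \<in> Om \<Longrightarrow> w \<zero>\<^bsub>A\<^esub> = 0"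
  using om_smult[of w "\<one>\<^bsub>A\<^esub>" 0] by (simp add: smult_zero)

lemma limit_unique:
  assumes "\<And>n. x n \<in> carrier A" "l \<in> carrier A" "l' \<in> carrier A"
    "(\<lambda>n. nrm A (x n \<ominus>\<^bsub>A\<^esub> l)) \<longlonglongrightarrow> 0" "(\<lambda>n. nrm A (x n \<ominus>\<^bsub>A\<^esub> l')) \<longlonglongrightarrow> 0"
  shows "l = l'"
proof -
  have "nrm A (l \<ominus>\<^bsub>A\<^esub> l') \<le> nrm A (x n \<ominus>\<^bsub>A\<^esub> l) + nrm A (x n \<ominus>\<^bsub>A\<^esub> l')" for n
    using dist_triangle[of l "x n" l'] dist_commute[of l "x n"] assms by simp
  moreover have "(\<lambda>n. nrm A (x n \<ominus>\<^bsub>A\<^esub> l) + nrm A (x n \<ominus>\<^bsub>A\<^esub> l')) \<longlonglongrightarrow> 0 + 0"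
    by (intro tendsto_intros assms)
  ultimately have "nrm A (l \<ominus>\<^bsub>A\<^esub> l') \<le> 0"
    by (intro LIMSEQ_le_const[of _ 0 "nrm A (l \<ominus>\<^bsub>A\<^esub> l')"]) auto
  then have "nrm A (l \<ominus>\<^bsub>A\<^esub> l') = 0" using assms nrm_nonneg[of "l \<ominus>\<^bsub>A\<^esub> l'"] by simp
  then show ?thesis using assms by (intro dist_zero_imp) auto
qed

end

subsection \<open>Square roots of positive contractions\<close>

text \<open>
  The iteration \<open>q \<mapsto> (y + q\<^sup>2) / 2\<close> started at \<open>0\<close> is dominated, for \<open>\<parallel>y\<parallel> \<le> 1\<close>, by the same
  iteration for the number \<open>1\<close>, which increases to \<open>1\<close>. Its limit \<open>q\<close> satisfies \<open>(1 - q)\<^sup>2 = 1 - y\<close>.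
\<close>

primrec sqrt_iter :: "'a star_alg \<Rightarrow> 'a \<Rightarrow> nat \<Rightarrow> 'a" where
  "sqrt_iter A y 0 = \<zero>\<^bsub>A\<^esub>"
| "sqrt_iter A y (Suc k) = (1 / 2) \<odot>\<^bsub>A\<^esub> (y \<oplus>\<^bsub>A\<^esub> (sqrt_iter A y k \<otimes>\<^bsub>A\<^esub> sqrt_iter A y k))"

primrec sqrt_bound :: "nat \<Rightarrow> real" where
  "sqrt_bound 0 = 0"
| "sqrt_bound (Suc k) = (1 + sqrt_bound k * sqrt_bound k) / 2"

lemma sqrt_bound_range: "0 \<le> sqrt_bound k \<and> sqrt_bound k \<le> 1"
proof (induction k)
  case (Suc k)
  then have "sqrt_bound k * sqrt_bound k \<le> 1 * 1" by (intro mult_mono) auto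
  then show ?case by simp
qed simp

lemma sqrt_bound_Suc_mono: "sqrt_bound k \<le> sqrt_bound (Suc k)"
proof -
  have "0 \<le> (1 - sqrt_bound k) * (1 - sqrt_bound k)" by simp
  then show ?thesis by (simp add: algebra_simps)
qed

lemma sqrt_bound_Cauchy: assumes "0 < e" shows "\<exists>N. \<forall>k\<ge>N. \<forall>j. sqrt_bound (k + j) - sqrt_bound k < e"
proof -
  have "incseq sqrt_bound" by (rule incseq_SucI) (rule sqrt_bound_Suc_mono)
  moreover have "Bseq sqrt_bound" using sqrt_bound_range by (intro BseqI'[where K = 1]) auto
  ultimately have "convergent sqrt_bound" by (auto intro: Bseq_mono_convergent simp: incseq_def)
  then have "Cauchy sqrt_bound" by (rule convergent_Cauchy)
  then obtain N where "\<forall>m\<ge>N. \<forall>n\<ge>N. dist (sqrt_bound m) (sqrt_bound n) < e"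
    using assms unfolding Cauchy_def by blast
  then show ?thesis
    by (intro exI[of _ N]) (fastforce simp: dist_real_def abs_less_iff)
qed

context state_star_algebra
begin

lemma sqrt_iter_mem [simp]: "y \<in> carrier A \<Longrightarrow> sqrt_iter A y k \<in> carrier A"
  by (induction k) auto

lemma sqrt_iter_star: "y \<in> carrier A \<Longrightarrow> star A y = y \<Longrightarrow> star A (sqrt_iter A y k) = sqrt_iter A y k"
  by (induction k) (auto simp: star_zero star_smult star_add star_mult)

lemma nrm_sqrt_iter:
  assumes y: "y \<in> carrier A" "nrm A y \<le> 1" shows "nrm A (sqrt_iter A y k) \<le> sqrt_bound k"
proof (induction k)
  case (Suc k)
  let ?q = "sqrt_iter A y k"
  have "nrm A (y \<oplus>\<^bsub>A\<^esub> (?q \<otimes>\<^bsub>A\<^esub> ?q)) \<le> nrm A y + nrm A ?q * nrm A ?q"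
    using nrm_add[of y "?q \<otimes>\<^bsub>A\<^esub> ?q"] nrm_mult[of ?q ?q] y by simp
  also have "\<dots> \<le> 1 + sqrt_bound k * sqrt_bound k"
    using Suc y sqrt_bound_range[of k] by (intro add_mono mult_mono) (auto simp: nrm_nonneg)
  finally show ?case using y by (simp add: nrm_smult)
qed (simp add: sqrt_bound_range)

lemma dist_sqrt_iter_Suc:
  assumes y: "y \<in> carrier A" "nrm A y \<le> 1"
  shows "nrm A (sqrt_iter A y (Suc k) \<ominus>\<^bsub>A\<^esub> sqrt_iter A y k) \<le> sqrt_bound (Suc k) - sqrt_bound k"
proof (induction k)
  case 0
  show ?case using y by (simp add: nrm_smult minus_zero)
next
  case (Suc k)
  let ?p = "sqrt_iter A y (Suc k)" and ?q = "sqrt_iter A y k"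
  let ?s = "sqrt_bound (Suc k)" and ?r = "sqrt_bound k"
  have mem: "?p \<in> carrier A" "?q \<in> carrier A" using y(1) by (simp_all del: sqrt_iter.simps)
  have "nrm A (sqrt_iter A y (Suc (Suc k)) \<ominus>\<^bsub>A\<^esub> ?p)
      = nrm A ((1/2) \<odot>\<^bsub>A\<^esub> (y \<oplus>\<^bsub>A\<^esub> (?p \<otimes>\<^bsub>A\<^esub> ?p)) \<ominus>\<^bsub>A\<^esub> (1/2) \<odot>\<^bsub>A\<^esub> (y \<oplus>\<^bsub>A\<^esub> (?q \<otimes>\<^bsub>A\<^esub> ?q)))"
    by (simp only: sqrt_iter.simps)
  also have "\<dots> = 1 / 2 * nrm A ((y \<oplus>\<^bsub>A\<^esub> (?p \<otimes>\<^bsub>A\<^esub> ?p)) \<ominus>\<^bsub>A\<^esub> (y \<oplus>\<^bsub>A\<^esub> (?q \<otimes>\<^bsub>A\<^esub> ?q)))"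
    using mem y(1) by (subst dist_smult) (simp_all del: sqrt_iter.simps add: norm_divide)
  also have "\<dots> \<le> 1 / 2 * (nrm A (y \<ominus>\<^bsub>A\<^esub> y) + nrm A ((?p \<otimes>\<^bsub>A\<^esub> ?p) \<ominus>\<^bsub>A\<^esub> (?q \<otimes>\<^bsub>A\<^esub> ?q)))"
    using dist_add[of y "?p \<otimes>\<^bsub>A\<^esub> ?p" y "?q \<otimes>\<^bsub>A\<^esub> ?q"] mem y(1) by (simp del: sqrt_iter.simps)
  also have "\<dots> = 1 / 2 * nrm A ((?p \<otimes>\<^bsub>A\<^esub> ?p) \<ominus>\<^bsub>A\<^esub> (?q \<otimes>\<^bsub>A\<^esub> ?q))" using y(1) by simp
  also have "\<dots> \<le> 1 / 2 * (nrm A ?p * nrm A (?p \<ominus>\<^bsub>A\<^esub> ?q) + nrm A (?p \<ominus>\<^bsub>A\<^esub> ?q) * nrm A ?q)"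
    using dist_mult[OF mem(1) mem(1) mem(2) mem(2)] by simp
  also have "\<dots> \<le> 1 / 2 * (?s * (?s - ?r) + (?s - ?r) * ?r)"
    using nrm_sqrt_iter[OF y, of "Suc k"] nrm_sqrt_iter[OF y, of k] Suc mem
      sqrt_bound_range[of "Suc k"] sqrt_bound_range[of k] sqrt_bound_Suc_mono[of k]
    by (intro mult_left_mono add_mono mult_mono) (auto simp: nrm_nonneg simp del: sqrt_iter.simps sqrt_bound.simps)
  also have "\<dots> = sqrt_bound (Suc (Suc k)) - ?s" by (simp add: field_simps)
  finally show ?case .
qed

lemma dist_sqrt_iter:
  assumes y: "y \<in> carrier A" "nrm A y \<le> 1"
  shows "nrm A (sqrt_iter A y (k + j) \<ominus>\<^bsub>A\<^esub> sqrt_iter A y k) \<le> sqrt_bound (k + j) - sqrt_bound k"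
proof (induction j)
  case (Suc j)
  have "nrm A (sqrt_iter A y (k + Suc j) \<ominus>\<^bsub>A\<^esub> sqrt_iter A y k) \<le>
    nrm A (sqrt_iter A y (Suc (k + j)) \<ominus>\<^bsub>A\<^esub> sqrt_iter A y (k + j)) +
    nrm A (sqrt_iter A y (k + j) \<ominus>\<^bsub>A\<^esub> sqrt_iter A y k)"
    using dist_triangle[of "sqrt_iter A y (Suc (k + j))" "sqrt_iter A y (k + j)" "sqrt_iter A y k"] y(1)
    by (simp del: sqrt_iter.simps)
  then show ?case
    using Suc dist_sqrt_iter_Suc[OF y, of "k + j"] by (simp del: sqrt_iter.simps sqrt_bound.simps)
qed (use y in simp)

lemma dist_sqrt_iter_arg:
  assumes y: "y \<in> carrier A" "nrm A y \<le> 1" "z \<in> carrier A" "nrm A z \<le> 1"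
  shows "nrm A (sqrt_iter A y k \<ominus>\<^bsub>A\<^esub> sqrt_iter A z k) \<le> real k * nrm A (y \<ominus>\<^bsub>A\<^esub> z)"
proof (induction k)
  case (Suc k)
  let ?p = "sqrt_iter A y k" and ?q = "sqrt_iter A z k"
  have mem: "?p \<in> carrier A" "?q \<in> carrier A" using y by simp_all
  have le1: "nrm A ?p \<le> 1" "nrm A ?q \<le> 1"
    using nrm_sqrt_iter[OF y(1,2), of k] nrm_sqrt_iter[OF y(3,4), of k] sqrt_bound_range[of k] by auto
  have "nrm A (sqrt_iter A y (Suc k) \<ominus>\<^bsub>A\<^esub> sqrt_iter A z (Suc k))
      = 1 / 2 * nrm A ((y \<oplus>\<^bsub>A\<^esub> (?p \<otimes>\<^bsub>A\<^esub> ?p)) \<ominus>\<^bsub>A\<^esub> (z \<oplus>\<^bsub>A\<^esub> (?q \<otimes>\<^bsub>A\<^esub> ?q)))"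
    using mem y by (simp add: dist_smult norm_divide)
  also have "\<dots> \<le> 1 / 2 * (nrm A (y \<ominus>\<^bsub>A\<^esub> z) +
      (nrm A ?p * nrm A (?p \<ominus>\<^bsub>A\<^esub> ?q) + nrm A (?p \<ominus>\<^bsub>A\<^esub> ?q) * nrm A ?q))"
    using dist_add[of y "?p \<otimes>\<^bsub>A\<^esub> ?p" z "?q \<otimes>\<^bsub>A\<^esub> ?q"] dist_mult[OF mem(1) mem(1) mem(2) mem(2)] mem y
    by simp
  also have "\<dots> \<le> 1 / 2 * (nrm A (y \<ominus>\<^bsub>A\<^esub> z) + (1 * nrm A (?p \<ominus>\<^bsub>A\<^esub> ?q) + nrm A (?p \<ominus>\<^bsub>A\<^esub> ?q) * 1))"
    using le1 mem by (intro mult_left_mono add_mono mult_mono) (auto simp: nrm_nonneg)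
  also have "\<dots> \<le> real (Suc k) * nrm A (y \<ominus>\<^bsub>A\<^esub> z)"
    using Suc nrm_nonneg[of "y \<ominus>\<^bsub>A\<^esub> z"] y by (simp add: algebra_simps)
  finally show ?case .
qed (use y in \<open>simp add: nrm_nonneg minus_zero\<close>)

lemma one_minus_sqrt_iter_square:
  assumes y: "y \<in> carrier A" "nrm A y \<le> 1"
  shows "nrm A (((\<one>\<^bsub>A\<^esub> \<ominus>\<^bsub>A\<^esub> sqrt_iter A y k) \<otimes>\<^bsub>A\<^esub> (\<one>\<^bsub>A\<^esub> \<ominus>\<^bsub>A\<^esub> sqrt_iter A y k)) \<ominus>\<^bsub>A\<^esub> (\<one>\<^bsub>A\<^esub> \<ominus>\<^bsub>A\<^esub> y))
    \<le> 2 * (sqrt_bound (Suc k) - sqrt_bound k)"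
proof -
  let ?q = "sqrt_iter A y k" and ?p = "sqrt_iter A y (Suc k)"
  have q: "?q \<in> carrier A" using y by simp
  have p: "?p \<in> carrier A" using y by (simp del: sqrt_iter.simps)
  have two: "2 \<odot>\<^bsub>A\<^esub> ?p = y \<oplus>\<^bsub>A\<^esub> (?q \<otimes>\<^bsub>A\<^esub> ?q)" "2 \<odot>\<^bsub>A\<^esub> ?q = ?q \<oplus>\<^bsub>A\<^esub> ?q"
    using y q smult_add_left[of ?q 1 1] by (simp_all add: smult_smult smult_one)
  have "((\<one>\<^bsub>A\<^esub> \<ominus>\<^bsub>A\<^esub> ?q) \<otimes>\<^bsub>A\<^esub> (\<one>\<^bsub>A\<^esub> \<ominus>\<^bsub>A\<^esub> ?q)) \<ominus>\<^bsub>A\<^esub> (\<one>\<^bsub>A\<^esub> \<ominus>\<^bsub>A\<^esub> y) = (y \<oplus>\<^bsub>A\<^esub> (?q \<otimes>\<^bsub>A\<^esub> ?q)) \<ominus>\<^bsub>A\<^esub> (?q \<oplus>\<^bsub>A\<^esub> ?q)"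
    using y(1) q by algebra simp
  also have "\<dots> = 2 \<odot>\<^bsub>A\<^esub> (?p \<ominus>\<^bsub>A\<^esub> ?q)"
    using p q y by (simp only: smult_minus two)
  finally show ?thesis
    using dist_sqrt_iter_Suc[OF y, of k] p q by (simp only: nrm_smult minus_mem norm_numeral) (simp del: sqrt_iter.simps sqrt_bound.simps)
qed

end

section \<open>Inductive limits with retractions\<close>

locale retract_system =
  fixes A :: "nat \<Rightarrow> 'a star_alg" and Om :: "nat \<Rightarrow> ('a \<Rightarrow> real) set"
    and \<alpha> R :: "nat \<Rightarrow> 'a \<Rightarrow> 'a"
  assumes state_star_algebra: "state_star_algebra (A n) (Om n)"
    and incl_mem: "a \<in> carrier (A n) \<Longrightarrow> \<alpha> n a \<in> carrier (A (Suc n))"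
    and incl_add: "a \<in> carrier (A n) \<Longrightarrow> b \<in> carrier (A n) \<Longrightarrow>
      \<alpha> n (a \<oplus>\<^bsub>A n\<^esub> b) = \<alpha> n a \<oplus>\<^bsub>A (Suc n)\<^esub> \<alpha> n b"
    and incl_smult: "a \<in> carrier (A n) \<Longrightarrow> \<alpha> n (c \<odot>\<^bsub>A n\<^esub> a) = c \<odot>\<^bsub>A (Suc n)\<^esub> \<alpha> n a"
    and incl_mult: "a \<in> carrier (A n) \<Longrightarrow> b \<in> carrier (A n) \<Longrightarrow>
      \<alpha> n (a \<otimes>\<^bsub>A n\<^esub> b) = \<alpha> n a \<otimes>\<^bsub>A (Suc n)\<^esub> \<alpha> n b"
    and incl_star: "a \<in> carrier (A n) \<Longrightarrow> \<alpha> n (star (A n) a) = star (A (Suc n)) (\<alpha> n a)"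
    and incl_one: "\<alpha> n \<one>\<^bsub>A n\<^esub> = \<one>\<^bsub>A (Suc n)\<^esub>"
    and incl_nrm: "a \<in> carrier (A n) \<Longrightarrow> nrm (A (Suc n)) (\<alpha> n a) = nrm (A n) a"
    and retr_mem: "a \<in> carrier (A (Suc n)) \<Longrightarrow> R n a \<in> carrier (A n)"
    and retr_add: "a \<in> carrier (A (Suc n)) \<Longrightarrow> b \<in> carrier (A (Suc n)) \<Longrightarrow>
      R n (a \<oplus>\<^bsub>A (Suc n)\<^esub> b) = R n a \<oplus>\<^bsub>A n\<^esub> R n b"
    and retr_smult: "a \<in> carrier (A (Suc n)) \<Longrightarrow> R n (c \<odot>\<^bsub>A (Suc n)\<^esub> a) = c \<odot>\<^bsub>A n\<^esub> R n a"
    and retr_star: "a \<in> carrier (A (Suc n)) \<Longrightarrow> R n (star (A (Suc n)) a) = star (A n) (R n a)"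
    and retr_nrm: "a \<in> carrier (A (Suc n)) \<Longrightarrow> nrm (A n) (R n a) \<le> nrm (A (Suc n)) a"
    and retr_incl: "a \<in> carrier (A n) \<Longrightarrow> R n (\<alpha> n a) = a"
    and retr_state: "w \<in> Om n \<Longrightarrow> \<exists>v\<in>Om (Suc n). \<forall>a\<in>carrier (A (Suc n)). w (R n a) = v a"
begin

sublocale A: state_star_algebra "A n" "Om n" for n
  by (rule state_star_algebra)

abbreviation dst :: "nat \<Rightarrow> 'a \<Rightarrow> 'a \<Rightarrow> real" where
  "dst n a b \<equiv> nrm (A n) (a \<ominus>\<^bsub>A n\<^esub> b)"

abbreviation conn :: "nat \<Rightarrow> nat \<Rightarrow> 'a \<Rightarrow> 'a" where
  "conn \<equiv> connecting \<alpha>"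

subsection \<open>Iterated inclusions and retractions\<close>

lemma incl_minus: "a \<in> carrier (A n) \<Longrightarrow> b \<in> carrier (A n) \<Longrightarrow>
    \<alpha> n (a \<ominus>\<^bsub>A n\<^esub> b) = \<alpha> n a \<ominus>\<^bsub>A (Suc n)\<^esub> \<alpha> n b"
  by (simp add: A.minus_eq incl_add incl_smult incl_mem)

lemma retr_minus: "a \<in> carrier (A (Suc n)) \<Longrightarrow> b \<in> carrier (A (Suc n)) \<Longrightarrow>
    R n (a \<ominus>\<^bsub>A (Suc n)\<^esub> b) = R n a \<ominus>\<^bsub>A n\<^esub> R n b"
  by (simp add: A.minus_eq retr_add retr_smult retr_mem)

lemma retr_dist: "a \<in> carrier (A (Suc n)) \<Longrightarrow> b \<in> carrier (A (Suc n)) \<Longrightarrow>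
    dst n (R n a) (R n b) \<le> dst (Suc n) a b"
  using retr_nrm[of "a \<ominus>\<^bsub>A (Suc n)\<^esub> b" n] by (simp add: retr_minus)

lemma conn_mem: "a \<in> carrier (A n) \<Longrightarrow> conn n k a \<in> carrier (A (n + k))"
  by (induction k) (auto intro: incl_mem)

lemma conn_add: "a \<in> carrier (A n) \<Longrightarrow> b \<in> carrier (A n) \<Longrightarrow>
    conn n k (a \<oplus>\<^bsub>A n\<^esub> b) = conn n k a \<oplus>\<^bsub>A (n + k)\<^esub> conn n k b"
  by (induction k) (auto simp: incl_add conn_mem)

lemma conn_smult: "a \<in> carrier (A n) \<Longrightarrow> conn n k (c \<odot>\<^bsub>A n\<^esub> a) = c \<odot>\<^bsub>A (n + k)\<^esub> conn n k a"
  by (induction k) (auto simp: incl_smult conn_mem)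

lemma conn_mult: "a \<in> carrier (A n) \<Longrightarrow> b \<in> carrier (A n) \<Longrightarrow>
    conn n k (a \<otimes>\<^bsub>A n\<^esub> b) = conn n k a \<otimes>\<^bsub>A (n + k)\<^esub> conn n k b"
  by (induction k) (auto simp: incl_mult conn_mem)

lemma conn_star: "a \<in> carrier (A n) \<Longrightarrow> conn n k (star (A n) a) = star (A (n + k)) (conn n k a)"
  by (induction k) (auto simp: incl_star conn_mem)

lemma conn_one: "conn n k \<one>\<^bsub>A n\<^esub> = \<one>\<^bsub>A (n + k)\<^esub>"
  by (induction k) (auto simp: incl_one)

lemma conn_zero: "conn n k \<zero>\<^bsub>A n\<^esub> = \<zero>\<^bsub>A (n + k)\<^esub>"
  using conn_smult[of "\<one>\<^bsub>A n\<^esub>" n k 0] by (simp add: A.smult_zero conn_mem)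

lemma conn_nrm: "a \<in> carrier (A n) \<Longrightarrow> nrm (A (n + k)) (conn n k a) = nrm (A n) a"
  by (induction k) (auto simp: incl_nrm conn_mem)

lemma conn_minus: "a \<in> carrier (A n) \<Longrightarrow> b \<in> carrier (A n) \<Longrightarrow>
    conn n k (a \<ominus>\<^bsub>A n\<^esub> b) = conn n k a \<ominus>\<^bsub>A (n + k)\<^esub> conn n k b"
  by (simp add: A.minus_eq conn_add conn_smult conn_mem)

lemma conn_dist: "a \<in> carrier (A n) \<Longrightarrow> b \<in> carrier (A n) \<Longrightarrow>
    dst (n + k) (conn n k a) (conn n k b) = dst n a b"
  by (simp add: conn_minus[symmetric] conn_nrm)

lemma conn_conn: "conn n (j + k) a = conn (n + j) k (conn n j a)"
  by (induction k) (auto simp: add.assoc)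

primrec down :: "nat \<Rightarrow> nat \<Rightarrow> 'a \<Rightarrow> 'a" where
  "down n 0 a = a"
| "down n (Suc k) a = down n k (R (n + k) a)"

lemma down_mem: "a \<in> carrier (A (n + k)) \<Longrightarrow> down n k a \<in> carrier (A n)"
  by (induction k arbitrary: a) (auto intro: retr_mem)

lemma down_minus: "a \<in> carrier (A (n + k)) \<Longrightarrow> b \<in> carrier (A (n + k)) \<Longrightarrow>
    down n k (a \<ominus>\<^bsub>A (n + k)\<^esub> b) = down n k a \<ominus>\<^bsub>A n\<^esub> down n k b"
  by (induction k arbitrary: a b) (auto simp: retr_minus retr_mem)

lemma down_star: "a \<in> carrier (A (n + k)) \<Longrightarrow>
    down n k (star (A (n + k)) a) = star (A n) (down n k a)"
  by (induction k arbitrary: a) (auto simp: retr_star retr_mem)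

lemma down_nrm: "a \<in> carrier (A (n + k)) \<Longrightarrow> nrm (A n) (down n k a) \<le> nrm (A (n + k)) a"
proof (induction k arbitrary: a)
  case (Suc k)
  then have "nrm (A n) (down n k (R (n + k) a)) \<le> nrm (A (n + k)) (R (n + k) a)"
    by (auto intro: retr_mem)
  also have "\<dots> \<le> nrm (A (n + Suc k)) a" using Suc.prems retr_nrm by simp
  finally show ?case by simp
qed simp

lemma down_dist: "a \<in> carrier (A (n + k)) \<Longrightarrow> b \<in> carrier (A (n + k)) \<Longrightarrow>
    dst n (down n k a) (down n k b) \<le> dst (n + k) a b"
  using down_nrm[of "a \<ominus>\<^bsub>A (n + k)\<^esub> b" n k] by (simp add: down_minus)

lemma down_conn: "a \<in> carrier (A n) \<Longrightarrow> down n k (conn n k a) = a"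
  by (induction k) (auto simp: retr_incl conn_mem)

lemma down_down: "down n (j + k) a = down n j (down (n + j) k a)"
  by (induction k arbitrary: a) (auto simp: add.assoc)

lemma down_state:
  "w \<in> Om n \<Longrightarrow> \<exists>v\<in>Om (n + k). \<forall>a\<in>carrier (A (n + k)). w (down n k a) = v a"
proof (induction k)
  case (Suc k)
  then obtain v where v: "v \<in> Om (n + k)" "\<forall>a\<in>carrier (A (n + k)). w (down n k a) = v a" by blast
  obtain u where "u \<in> Om (Suc (n + k))" "\<forall>a\<in>carrier (A (Suc (n + k))). v (R (n + k) a) = u a"
    using retr_state[OF v(1)] by blast
  then show ?case using v by (intro bexI[of _ u]) (auto simp: retr_mem)
qed auto

subsection \<open>Coherent sequences\<close>

abbreviation "Coh \<equiv> coherent A \<alpha>"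
abbreviation "rel \<equiv> lim_rel A \<alpha>"
abbreviation "lim_alg \<equiv> ind_lim A \<alpha>"

definition cls :: "(nat \<Rightarrow> 'a) \<Rightarrow> (nat \<Rightarrow> 'a) set" where
  "cls x = rel `` {x}"

lemma coh_mem: "x \<in> Coh \<Longrightarrow> x n \<in> carrier (A n)"
  by (simp add: coherent_def)

lemma cohD: "x \<in> Coh \<Longrightarrow> 0 < e \<Longrightarrow> \<exists>N. \<forall>n\<ge>N. \<forall>k. dst (n + k) (x (n + k)) (conn n k (x n)) < e"
  by (simp add: coherent_def)

lemma cohI:
  assumes "\<And>n. x n \<in> carrier (A n)"
    "\<And>e. 0 < e \<Longrightarrow> \<exists>N. \<forall>n\<ge>N. \<forall>k. dst (n + k) (x (n + k)) (conn n k (x n)) < e"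
  shows "x \<in> Coh"
  using assms by (simp add: coherent_def)

lemma coh_dominated:
  assumes x: "x \<in> Coh" and y: "y \<in> Coh" and z: "\<And>n. z n \<in> carrier (A n)" and C: "0 < C"
    and le: "\<And>n k. dst (n + k) (z (n + k)) (conn n k (z n)) \<le>
      C * (dst (n + k) (x (n + k)) (conn n k (x n)) + dst (n + k) (y (n + k)) (conn n k (y n)))"
  shows "z \<in> Coh"
proof (rule cohI)
  fix e :: real assume e: "0 < e"
  obtain N1 N2 where N:
    "\<forall>n\<ge>N1. \<forall>k. dst (n + k) (x (n + k)) (conn n k (x n)) < e / (2 * C)"
    "\<forall>n\<ge>N2. \<forall>k. dst (n + k) (y (n + k)) (conn n k (y n)) < e / (2 * C)"
    using cohD[OF x, of "e / (2 * C)"] cohD[OF y, of "e / (2 * C)"] e C by auto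
  have "dst (n + k) (z (n + k)) (conn n k (z n)) < e" if n: "n \<ge> max N1 N2" for n k
  proof -
    have "dst (n + k) (x (n + k)) (conn n k (x n)) + dst (n + k) (y (n + k)) (conn n k (y n))
        < e / (2 * C) + e / (2 * C)"
      using N n by (intro add_strict_mono) auto
    also have "\<dots> = e / C" using C by (simp add: field_simps)
    finally have "C * (dst (n + k) (x (n + k)) (conn n k (x n)) +
        dst (n + k) (y (n + k)) (conn n k (y n))) < C * (e / C)"
      using C by (rule mult_strict_left_mono)
    then show ?thesis using le[of n k] C by simp
  qed
  then show "\<exists>N. \<forall>n\<ge>N. \<forall>k. dst (n + k) (z (n + k)) (conn n k (z n)) < e" by blast
qed (rule z)

lemma dst_nonneg: "a \<in> carrier (A n) \<Longrightarrow> b \<in> carrier (A n) \<Longrightarrow> 0 \<le> dst n a b"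
  by (simp add: A.nrm_nonneg)

lemma coh_dst_nonneg: "x \<in> Coh \<Longrightarrow> 0 \<le> dst (n + k) (x (n + k)) (conn n k (x n))"
  by (simp add: dst_nonneg coh_mem conn_mem)

lemma coh_add: "x \<in> Coh \<Longrightarrow> y \<in> Coh \<Longrightarrow> (\<lambda>n. x n \<oplus>\<^bsub>A n\<^esub> y n) \<in> Coh"
  by (rule coh_dominated[of x y _ 1]) (auto simp: coh_mem conn_add conn_mem intro!: A.dist_add)

lemma coh_smult: "x \<in> Coh \<Longrightarrow> (\<lambda>n. c \<odot>\<^bsub>A n\<^esub> x n) \<in> Coh"
proof (rule coh_dominated[of x x _ "cmod c + 1"])
  fix n k assume x: "x \<in> Coh"
  have "cmod c * dst (n + k) (x (n + k)) (conn n k (x n)) \<le>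
      (cmod c + 1) * (dst (n + k) (x (n + k)) (conn n k (x n)) + dst (n + k) (x (n + k)) (conn n k (x n)))"
    using coh_dst_nonneg[OF x, of n k] by (intro mult_mono) auto
  then show "dst (n + k) (c \<odot>\<^bsub>A (n + k)\<^esub> x (n + k)) (conn n k (c \<odot>\<^bsub>A n\<^esub> x n)) \<le>
      (cmod c + 1) * (dst (n + k) (x (n + k)) (conn n k (x n)) + dst (n + k) (x (n + k)) (conn n k (x n)))"
    using x by (simp add: conn_smult coh_mem conn_mem A.dist_smult)
qed (auto simp: coh_mem add_nonneg_pos)

lemma coh_star: "x \<in> Coh \<Longrightarrow> (\<lambda>n. star (A n) (x n)) \<in> Coh"
  by (rule coh_dominated[of x x _ 1])
    (auto simp: coh_mem conn_mem A.dist_star conn_star coh_dst_nonneg)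

lemma coh_one: "(\<lambda>n. \<one>\<^bsub>A n\<^esub>) \<in> Coh"
  by (rule cohI) (auto simp: conn_one)

lemma coh_bounded: assumes x: "x \<in> Coh" shows "\<exists>B>0. \<forall>n. nrm (A n) (x n) \<le> B"
proof -
  obtain N where N: "\<forall>n\<ge>N. \<forall>k. dst (n + k) (x (n + k)) (conn n k (x n)) < 1"
    using cohD[OF x, of 1] by auto
  define B where "B = nrm (A N) (x N) + 1 + (\<Sum>n<N. nrm (A n) (x n))"
  have s: "0 \<le> (\<Sum>n<N. nrm (A n) (x n))" by (intro sum_nonneg) (simp add: A.nrm_nonneg coh_mem x)
  have pos: "0 \<le> nrm (A n) (x n)" for n by (simp add: A.nrm_nonneg coh_mem x)
  have "nrm (A n) (x n) \<le> B" for n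
  proof (cases "n < N")
    case True
    then have "nrm (A n) (x n) \<le> (\<Sum>n<N. nrm (A n) (x n))"
      by (intro member_le_sum) (auto simp: pos)
    then show ?thesis using pos[of N] by (simp add: B_def)
  next
    case False
    then obtain k where k: "n = N + k" using le_Suc_ex not_less by blast
    have "nrm (A (N + k)) (x (N + k)) \<le> nrm (A (N + k)) (conn N k (x N)) +
        dst (N + k) (x (N + k)) (conn N k (x N))"
      by (rule A.nrm_le_dist) (auto simp: coh_mem x conn_mem)
    also have "\<dots> < nrm (A N) (x N) + 1" using N by (simp add: conn_nrm coh_mem x)
    finally show ?thesis using s by (simp add: B_def k)
  qed
  moreover have "B > 0" using s pos[of N] by (simp add: B_def)
  ultimately show ?thesis by blast
qed

lemma dist_mult_le:
  assumes "a \<in> carrier (A n)" "b \<in> carrier (A n)" "c \<in> carrier (A n)" "d \<in> carrier (A n)"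
    and "nrm (A n) a \<le> B" "nrm (A n) d \<le> C"
  shows "dst n (a \<otimes>\<^bsub>A n\<^esub> b) (c \<otimes>\<^bsub>A n\<^esub> d) \<le> (B + C) * (dst n a c + dst n b d)"
proof -
  have *: "0 \<le> B" "0 \<le> C" using A.nrm_nonneg assms by (meson order.trans)+
  have "dst n (a \<otimes>\<^bsub>A n\<^esub> b) (c \<otimes>\<^bsub>A n\<^esub> d) \<le> nrm (A n) a * dst n b d + dst n a c * nrm (A n) d"
    using assms by (intro A.dist_mult) auto
  also have "\<dots> \<le> B * dst n b d + dst n a c * C"
    using assms by (intro add_mono mult_mono) (auto simp: dst_nonneg A.nrm_nonneg *)
  also have "\<dots> \<le> (B + C) * dst n b d + dst n a c * (B + C)"
    using assms * by (intro add_mono mult_mono) (auto simp: dst_nonneg)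
  finally show ?thesis by (simp add: algebra_simps)
qed

lemma coh_mult: assumes x: "x \<in> Coh" and y: "y \<in> Coh" shows "(\<lambda>n. x n \<otimes>\<^bsub>A n\<^esub> y n) \<in> Coh"
proof -
  obtain B C where B: "B > 0" "\<forall>n. nrm (A n) (x n) \<le> B" and C: "C > 0" "\<forall>n. nrm (A n) (y n) \<le> C"
    using coh_bounded[OF x] coh_bounded[OF y] by blast
  show ?thesis
    by (rule coh_dominated[OF x y, of _ "B + C"])
      (use B C x y in \<open>auto simp: coh_mem conn_mult conn_mem conn_nrm intro!: dist_mult_le\<close>)
qed

lemma relD: assumes "(x, y) \<in> rel" shows "x \<in> Coh" "y \<in> Coh" "(\<lambda>n. dst n (x n) (y n)) \<longlonglongrightarrow> 0"
  using assms by (auto simp: lim_rel_def)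

lemma relI: "x \<in> Coh \<Longrightarrow> y \<in> Coh \<Longrightarrow> (\<lambda>n. dst n (x n) (y n)) \<longlonglongrightarrow> 0 \<Longrightarrow> (x, y) \<in> rel"
  by (simp add: lim_rel_def)

lemma rel_dominated:
  assumes z: "z \<in> Coh" "z' \<in> Coh" and x: "(x, x') \<in> rel" and y: "(y, y') \<in> rel"
    and le: "\<And>n. dst n (z n) (z' n) \<le> C * (dst n (x n) (x' n) + dst n (y n) (y' n))"
  shows "(z, z') \<in> rel"
proof (rule relI[OF z])
  have lim: "(\<lambda>n. C * (dst n (x n) (x' n) + dst n (y n) (y' n))) \<longlonglongrightarrow> C * (0 + 0)"
    by (intro tendsto_intros relD(3)[OF x] relD(3)[OF y])
  show "(\<lambda>n. dst n (z n) (z' n)) \<longlonglongrightarrow> 0"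
    by (rule tendsto_sandwich[OF _ _ tendsto_const lim[simplified]])
      (use z le in \<open>auto simp: dst_nonneg coh_mem\<close>)
qed

lemma equiv_rel: "equiv Coh rel"
proof (rule equivI)
  show "rel \<subseteq> Coh \<times> Coh" by (auto simp: lim_rel_def)
  show "refl_on Coh rel" by (auto simp: refl_on_def lim_rel_def coh_mem)
  show "sym rel"
  proof (rule symI)
    fix x y assume r: "(x, y) \<in> rel"
    have "(\<lambda>n. dst n (y n) (x n)) = (\<lambda>n. dst n (x n) (y n))"
      using relD(1,2)[OF r] by (intro ext A.dist_commute) (auto simp: coh_mem)
    then show "(y, x) \<in> rel" using relD[OF r] by (auto intro: relI)
  qed
  show "trans rel"
  proof (rule transI)
    fix x y z assume r: "(x, y) \<in> rel" "(y, z) \<in> rel"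
    show "(x, z) \<in> rel"
      by (rule rel_dominated[OF _ _ r, of x z 1])
        (use relD[OF r(1)] relD[OF r(2)] in \<open>auto intro!: A.dist_triangle coh_mem\<close>)
  qed
qed

lemma cls_eq_iff: "x \<in> Coh \<Longrightarrow> y \<in> Coh \<Longrightarrow> cls x = cls y \<longleftrightarrow> (x, y) \<in> rel"
  unfolding cls_def using eq_equiv_class_iff[OF equiv_rel] by blast

lemma cls_self: "x \<in> Coh \<Longrightarrow> x \<in> cls x"
  unfolding cls_def using equiv_class_self[OF equiv_rel] by blast

lemma cls_mem: "y \<in> cls x \<Longrightarrow> (x, y) \<in> rel"
  by (simp add: cls_def)

lemma carrier_lim: "carrier lim_alg = Coh // rel"
  by (simp add: ind_lim_def)

lemma cls_carrier: "x \<in> Coh \<Longrightarrow> cls x \<in> carrier lim_alg"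
  by (simp add: carrier_lim cls_def quotientI)

lemma carrierE: "X \<in> carrier lim_alg \<Longrightarrow> (\<And>x. x \<in> Coh \<Longrightarrow> X = cls x \<Longrightarrow> thesis) \<Longrightarrow> thesis"
  by (auto simp: carrier_lim cls_def elim: quotientE)

lemma UN_constant_value: "C \<noteq> {} \<Longrightarrow> (\<And>x. x \<in> C \<Longrightarrow> F x = c) \<Longrightarrow> (\<Union>x\<in>C. F x) = c"
  by auto

lemma cls_binary:
  assumes x: "x \<in> Coh" and y: "y \<in> Coh"
    and "\<And>x' y'. (x, x') \<in> rel \<Longrightarrow> (y, y') \<in> rel \<Longrightarrow> (f x y, f x' y') \<in> rel"
  shows "(\<Union>x'\<in>cls x. \<Union>y'\<in>cls y. cls (f x' y')) = cls (f x y)"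
proof (intro UN_constant_value)
  show "cls x \<noteq> {}" "cls y \<noteq> {}" using cls_self x y by blast+
  fix x' y' assume "x' \<in> cls x" "y' \<in> cls y"
  then have "(f x y, f x' y') \<in> rel" by (intro assms cls_mem)
  then show "cls (f x' y') = cls (f x y)"
    using cls_eq_iff relD by metis
qed

lemma cls_add:
  assumes x: "x \<in> Coh" and y: "y \<in> Coh"
  shows "cls x \<oplus>\<^bsub>lim_alg\<^esub> cls y = cls (\<lambda>n. x n \<oplus>\<^bsub>A n\<^esub> y n)"
proof -
  have "cls x \<oplus>\<^bsub>lim_alg\<^esub> cls y = (\<Union>x'\<in>cls x. \<Union>y'\<in>cls y. cls (\<lambda>n. x' n \<oplus>\<^bsub>A n\<^esub> y' n))"
    by (simp add: ind_lim_def cls_def)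
  also have "\<dots> = cls (\<lambda>n. x n \<oplus>\<^bsub>A n\<^esub> y n)"
  proof (rule cls_binary[OF x y])
    fix x' y' assume r: "(x, x') \<in> rel" "(y, y') \<in> rel"
    show "((\<lambda>n. x n \<oplus>\<^bsub>A n\<^esub> y n), (\<lambda>n. x' n \<oplus>\<^bsub>A n\<^esub> y' n)) \<in> rel"
      by (rule rel_dominated[OF _ _ r, of _ _ 1])
        (use relD[OF r(1)] relD[OF r(2)] in \<open>auto intro!: coh_add A.dist_add simp: coh_mem\<close>)
  qed
  finally show ?thesis .
qed

lemma cls_mult:
  assumes x: "x \<in> Coh" and y: "y \<in> Coh"
  shows "cls x \<otimes>\<^bsub>lim_alg\<^esub> cls y = cls (\<lambda>n. x n \<otimes>\<^bsub>A n\<^esub> y n)"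
proof -
  have "cls x \<otimes>\<^bsub>lim_alg\<^esub> cls y = (\<Union>x'\<in>cls x. \<Union>y'\<in>cls y. cls (\<lambda>n. x' n \<otimes>\<^bsub>A n\<^esub> y' n))"
    by (simp add: ind_lim_def cls_def)
  also have "\<dots> = cls (\<lambda>n. x n \<otimes>\<^bsub>A n\<^esub> y n)"
  proof (rule cls_binary[OF x y])
    fix x' y' assume r: "(x, x') \<in> rel" "(y, y') \<in> rel"
    obtain B C where B: "\<forall>n. nrm (A n) (x n) \<le> B" and C: "\<forall>n. nrm (A n) (y' n) \<le> C"
      using coh_bounded[OF x] coh_bounded[OF relD(2)[OF r(2)]] by blast
    show "((\<lambda>n. x n \<otimes>\<^bsub>A n\<^esub> y n), (\<lambda>n. x' n \<otimes>\<^bsub>A n\<^esub> y' n)) \<in> rel"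
      by (rule rel_dominated[OF _ _ r, of _ _ "B + C"])
        (use relD[OF r(1)] relD[OF r(2)] B C in \<open>auto intro!: coh_mult dist_mult_le simp: coh_mem\<close>)
  qed
  finally show ?thesis .
qed

lemma cls_unary:
  assumes x: "x \<in> Coh" and "\<And>x'. (x, x') \<in> rel \<Longrightarrow> (f x, f x') \<in> rel"
  shows "(\<Union>x'\<in>cls x. cls (f x')) = cls (f x)"
proof (intro UN_constant_value)
  show "cls x \<noteq> {}" using cls_self x by blast
  fix x' assume "x' \<in> cls x"
  then have "(f x, f x') \<in> rel" by (intro assms cls_mem)
  then show "cls (f x') = cls (f x)" using cls_eq_iff relD by metis
qed

lemma cls_smult:
  assumes x: "x \<in> Coh" shows "c \<odot>\<^bsub>lim_alg\<^esub> cls x = cls (\<lambda>n. c \<odot>\<^bsub>A n\<^esub> x n)"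
proof -
  have "c \<odot>\<^bsub>lim_alg\<^esub> cls x = (\<Union>x'\<in>cls x. cls (\<lambda>n. c \<odot>\<^bsub>A n\<^esub> x' n))"
    by (simp add: ind_lim_def cls_def)
  also have "\<dots> = cls (\<lambda>n. c \<odot>\<^bsub>A n\<^esub> x n)"
  proof (rule cls_unary[OF x])
    fix x' assume r: "(x, x') \<in> rel"
    have "0 \<le> dst n (x n) (x' n)" for n using relD(1,2)[OF r] by (simp add: dst_nonneg coh_mem)
    then show "((\<lambda>n. c \<odot>\<^bsub>A n\<^esub> x n), (\<lambda>n. c \<odot>\<^bsub>A n\<^esub> x' n)) \<in> rel"
      by (intro rel_dominated[OF _ _ r r, of _ _ "cmod c"])
        (use relD[OF r] in \<open>auto intro!: coh_smult mult_left_mono simp: coh_mem A.dist_smult\<close>)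
  qed
  finally show ?thesis .
qed

lemma cls_star:
  assumes x: "x \<in> Coh" shows "star lim_alg (cls x) = cls (\<lambda>n. star (A n) (x n))"
proof -
  have "star lim_alg (cls x) = (\<Union>x'\<in>cls x. cls (\<lambda>n. star (A n) (x' n)))"
    by (simp add: ind_lim_def cls_def)
  also have "\<dots> = cls (\<lambda>n. star (A n) (x n))"
  proof (rule cls_unary[OF x])
    fix x' assume r: "(x, x') \<in> rel"
    have "0 \<le> dst n (x n) (x' n)" for n using relD(1,2)[OF r] by (simp add: dst_nonneg coh_mem)
    then show "((\<lambda>n. star (A n) (x n)), (\<lambda>n. star (A n) (x' n))) \<in> rel"
      by (intro rel_dominated[OF _ _ r r, of _ _ 1])
        (use relD[OF r] in \<open>auto intro!: coh_star simp: coh_mem A.dist_star\<close>)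
  qed
  finally show ?thesis .
qed

lemma cls_one: "\<one>\<^bsub>lim_alg\<^esub> = cls (\<lambda>n. \<one>\<^bsub>A n\<^esub>)"
  by (simp add: ind_lim_def cls_def)

lemma cls_zero: "\<zero>\<^bsub>lim_alg\<^esub> = cls (\<lambda>n. \<zero>\<^bsub>A n\<^esub>)"
  by (simp add: ind_lim_def cls_def)

lemma coh_zero: "(\<lambda>n. \<zero>\<^bsub>A n\<^esub>) \<in> Coh"
  by (rule cohI) (auto simp: conn_zero)

subsection \<open>The representative fixed by the retractions\<close>

text \<open>
  Every class contains exactly one sequence \<open>y\<close> with \<open>R n (y (n + 1)) = y n\<close>: its entries are the
  limits of the retractions of the later and later entries of any representative. All operations
  except the multiplication act entrywise on these representatives.
\<close>

definition fixed :: "(nat \<Rightarrow> 'a) \<Rightarrow> bool" where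
  "fixed y \<longleftrightarrow> (\<forall>n. R n (y (Suc n)) = y n)"

lemma fixed_down: "fixed y \<Longrightarrow> down n k (y (n + k)) = y n"
  by (induction k) (auto simp: fixed_def)

lemma down_Suc_left: "down n (Suc k) a = R n (down (Suc n) k a)"
  using down_down[of n 1 k a] by simp

lemma fixed_exists: assumes x: "x \<in> Coh" shows "\<exists>y. fixed y \<and> (x, y) \<in> rel"
proof -
  have d_mem: "down n k (x (n + k)) \<in> carrier (A n)" for n k by (simp add: down_mem coh_mem x)
  have step: "dst n (down n (k + j) (x (n + (k + j)))) (down n k (x (n + k))) \<le>
      dst (n + k + j) (x (n + k + j)) (conn (n + k) j (x (n + k)))" for n k j
  proof -
    have c: "conn (n + k) j (x (n + k)) \<in> carrier (A (n + k + j))" by (simp add: conn_mem coh_mem x)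
    have "down n k (x (n + k)) = down n (k + j) (conn (n + k) j (x (n + k)))"
      by (simp add: down_down down_conn coh_mem x)
    then show ?thesis
      using down_dist[of "x (n + (k + j))" n "k + j" "conn (n + k) j (x (n + k))"] c
      by (simp add: coh_mem x add.assoc)
  qed
  have "\<exists>l\<in>carrier (A n). (\<lambda>k. dst n (down n k (x (n + k))) l) \<longlonglongrightarrow> 0" for n
  proof (rule A.cauchy_converges[OF d_mem], intro allI impI)
    fix e :: real assume e: "0 < e"
    obtain N where N: "\<forall>n\<ge>N. \<forall>k. dst (n + k) (x (n + k)) (conn n k (x n)) < e / 2"
      using cohD[OF x, of "e / 2"] e by auto
    have near: "dst n (down n k (x (n + k))) (down n N (x (n + N))) < e / 2" if k: "k \<ge> N" for k
    proof -
      obtain j where "k = N + j" using k le_Suc_ex by blast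
      moreover have "dst (n + N + j) (x (n + N + j)) (conn (n + N) j (x (n + N))) < e / 2"
        using N[rule_format, of "n + N" j] by simp
      ultimately show ?thesis using step[of n N j] by simp
    qed
    have "dst n (down n k (x (n + k))) (down n m (x (n + m))) < e"
      if "k \<ge> N" "m \<ge> N" for k m
      using A.dist_triangle[OF d_mem d_mem d_mem, of n k m N]
        A.dist_commute[OF d_mem d_mem, of n N m] near[OF that(1)] near[OF that(2)] by linarith
    then show "\<exists>N. \<forall>k\<ge>N. \<forall>m\<ge>N. dst n (down n k (x (n + k))) (down n m (x (n + m))) < e" by blast
  qed
  then obtain y where y: "\<And>n. y n \<in> carrier (A n)"
    "\<And>n. (\<lambda>k. dst n (down n k (x (n + k))) (y n)) \<longlonglongrightarrow> 0"
    by metis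
  have "fixed y" unfolding fixed_def
  proof
    fix n
    have mem': "down (Suc n) k (x (Suc n + k)) \<in> carrier (A (Suc n))" for k
      by (rule d_mem)
    have "(\<lambda>k. dst n (R n (down (Suc n) k (x (Suc n + k)))) (R n (y (Suc n)))) \<longlonglongrightarrow> 0"
    proof (rule tendsto_sandwich[OF _ _ tendsto_const y(2)[of "Suc n"]])
      show "\<forall>\<^sub>F k in sequentially. dst n (R n (down (Suc n) k (x (Suc n + k)))) (R n (y (Suc n))) \<le>
          dst (Suc n) (down (Suc n) k (x (Suc n + k))) (y (Suc n))"
        by (intro always_eventually allI retr_dist mem' y(1))
    qed (intro always_eventually allI dst_nonneg retr_mem mem' y(1))
    then have 1: "(\<lambda>k. dst n (down n (Suc k) (x (n + Suc k))) (R n (y (Suc n)))) \<longlonglongrightarrow> 0"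
      by (simp only: down_Suc_left add_Suc_right add_Suc)
    have 2: "(\<lambda>k. dst n (down n (Suc k) (x (n + Suc k))) (y n)) \<longlonglongrightarrow> 0"
      using y(2)[of n] by (rule LIMSEQ_Suc)
    show "R n (y (Suc n)) = y n"
      by (rule A.limit_unique[where x = "\<lambda>k. down n (Suc k) (x (n + Suc k))",
            OF d_mem retr_mem[OF y(1)] y(1) 1 2])
  qed
  have close: "dst n (x n) (y n) \<le> e"
    if N: "\<forall>k. dst (n + k) (x (n + k)) (conn n k (x n)) < e" for n e
  proof -
    have "dst n (x n) (y n) \<le> e + dst n (down n k (x (n + k))) (y n)" for k
    proof -
      have "dst n (down n k (x (n + k))) (x n) \<le> e"
        using step[of n 0 k] N by (simp add: less_imp_le order.trans)
      then show ?thesis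
        using A.dist_triangle[of "x n" n "down n k (x (n + k))" "y n"] d_mem[of n k] y(1)[of n]
          A.dist_commute[of "x n" n "down n k (x (n + k))"] coh_mem[OF x, of n] by linarith
    qed
    moreover have "(\<lambda>k. e + dst n (down n k (x (n + k))) (y n)) \<longlonglongrightarrow> e + 0"
      by (intro tendsto_intros y)
    ultimately show ?thesis by (intro LIMSEQ_le_const[of _ e]) auto
  qed
  have lim: "(\<lambda>n. dst n (x n) (y n)) \<longlonglongrightarrow> 0"
  proof (rule LIMSEQ_I)
    fix e :: real assume e: "0 < e"
    obtain N where N: "\<forall>n\<ge>N. \<forall>k. dst (n + k) (x (n + k)) (conn n k (x n)) < e / 2"
      using cohD[OF x, of "e / 2"] e by auto
    have "norm (dst n (x n) (y n) - 0) < e" if "n \<ge> N" for n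
    proof -
      have "dst n (x n) (y n) \<le> e / 2" by (rule close) (use N that in blast)
      then show ?thesis using e dst_nonneg[OF coh_mem[OF x] y(1), of n] by simp
    qed
    then show "\<exists>N. \<forall>n\<ge>N. norm (dst n (x n) (y n) - 0) < e" by blast
  qed
  have "y \<in> Coh"
  proof (rule cohI[OF y(1)])
    fix e :: real assume e: "0 < e"
    obtain N where N: "\<forall>n\<ge>N. \<forall>k. dst (n + k) (x (n + k)) (conn n k (x n)) < e / 4"
      using cohD[OF x, of "e / 4"] e by auto
    have "dst (n + k) (y (n + k)) (conn n k (y n)) < e" if n: "n \<ge> N" for n k
    proof -
      have a: "dst n (x n) (y n) \<le> e / 4" "dst (n + k) (x (n + k)) (y (n + k)) \<le> e / 4"
        by (rule close, use N n in simp)+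
      have "dst (n + k) (y (n + k)) (conn n k (y n)) \<le> dst (n + k) (y (n + k)) (x (n + k)) +
          (dst (n + k) (x (n + k)) (conn n k (x n)) + dst (n + k) (conn n k (x n)) (conn n k (y n)))"
        using A.dist_triangle[of "y (n + k)" "n + k" "x (n + k)" "conn n k (y n)"]
          A.dist_triangle[of "x (n + k)" "n + k" "conn n k (x n)" "conn n k (y n)"]
          coh_mem[OF x, of n] coh_mem[OF x, of "n + k"] y(1)[of n] y(1)[of "n + k"]
          conn_mem[of "x n" n k] conn_mem[of "y n" n k] by linarith
      also have "\<dots> < e"
        using a N[rule_format, OF n, of k] e
          A.dist_commute[of "y (n + k)" "n + k" "x (n + k)", OF y(1) coh_mem[OF x]]
          conn_dist[of "x n" n "y n" k, OF coh_mem[OF x] y(1)] by linarith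
      finally show ?thesis .
    qed
    then show "\<exists>N. \<forall>n\<ge>N. \<forall>k. dst (n + k) (y (n + k)) (conn n k (y n)) < e" by blast
  qed
  then show ?thesis using \<open>fixed y\<close> lim x by (blast intro: relI)
qed

lemma fixed_unique: assumes "fixed y" "fixed y'" "(y, y') \<in> rel" shows "y = y'"
proof
  fix n
  have mem: "y m \<in> carrier (A m)" "y' m \<in> carrier (A m)" for m using relD[OF assms(3)] coh_mem by auto
  have "dst n (y n) (y' n) \<le> dst (k + n) (y (k + n)) (y' (k + n))" for k
    using down_dist[of "y (n + k)" n k "y' (n + k)"] mem fixed_down[OF assms(1), of n k]
      fixed_down[OF assms(2), of n k] by (simp add: add.commute)
  moreover have "(\<lambda>k. dst (k + n) (y (k + n)) (y' (k + n))) \<longlonglongrightarrow> 0"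
    by (rule LIMSEQ_ignore_initial_segment[OF relD(3)[OF assms(3)]])
  ultimately have "dst n (y n) (y' n) \<le> 0" by (intro LIMSEQ_le_const[of _ 0]) auto
  then show "y n = y' n" using mem dst_nonneg[of "y n" n "y' n"] by (intro A.dist_zero_imp) auto
qed

end

lemma (in state_star_algebra) dist_one_minus:
  assumes "p \<in> carrier A" "q \<in> carrier A"
  shows "nrm A ((\<one>\<^bsub>A\<^esub> \<ominus>\<^bsub>A\<^esub> p) \<ominus>\<^bsub>A\<^esub> (\<one>\<^bsub>A\<^esub> \<ominus>\<^bsub>A\<^esub> q)) = nrm A (p \<ominus>\<^bsub>A\<^esub> q)"
proof -
  have "(\<one>\<^bsub>A\<^esub> \<ominus>\<^bsub>A\<^esub> p) \<ominus>\<^bsub>A\<^esub> (\<one>\<^bsub>A\<^esub> \<ominus>\<^bsub>A\<^esub> q) = q \<ominus>\<^bsub>A\<^esub> p" using assms by algebra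
  then show ?thesis using dist_commute[OF assms] by simp
qed

context retract_system
begin

definition rep :: "(nat \<Rightarrow> 'a) set \<Rightarrow> nat \<Rightarrow> 'a" where
  "rep X = (THE y. fixed y \<and> y \<in> X)"

lemma rep_cls: assumes y: "fixed y" "y \<in> Coh" shows "rep (cls y) = y"
  unfolding rep_def
proof (rule the_equality)
  show "fixed y \<and> y \<in> cls y" using y cls_self by blast
  fix z assume "fixed z \<and> z \<in> cls y"
  then show "z = y" using fixed_unique[OF y(1), of z] cls_mem by blast
qed

lemma rep_props:
  assumes "X \<in> carrier lim_alg" shows "fixed (rep X)" "rep X \<in> Coh" "cls (rep X) = X"
proof -
  obtain x where x: "x \<in> Coh" "X = cls x" using carrierE[OF assms] by blast
  obtain y where y: "fixed y" "(x, y) \<in> rel" using fixed_exists[OF x(1)] by blast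
  have yC: "y \<in> Coh" using relD(2)[OF y(2)] .
  have "X = cls y" using x y yC by (simp add: cls_eq_iff)
  then show "fixed (rep X)" "rep X \<in> Coh" "cls (rep X) = X" using rep_cls[OF y(1) yC] y yC by auto
qed

lemma rep_mem: "X \<in> carrier lim_alg \<Longrightarrow> rep X n \<in> carrier (A n)"
  by (simp add: coh_mem rep_props)

lemma rep_retr: "X \<in> carrier lim_alg \<Longrightarrow> R n (rep X (Suc n)) = rep X n"
  using rep_props(1) by (simp add: fixed_def)

lemma rep_ext:
  assumes "X \<in> carrier lim_alg" "Y \<in> carrier lim_alg" "\<And>n. rep X n = rep Y n" shows "X = Y"
proof -
  have "rep X = rep Y" using assms(3) by blast
  then show ?thesis using rep_props(3)[OF assms(1)] rep_props(3)[OF assms(2)] by metis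
qed

lemma lim_add:
  assumes X: "X \<in> carrier lim_alg" and Y: "Y \<in> carrier lim_alg"
  shows "X \<oplus>\<^bsub>lim_alg\<^esub> Y \<in> carrier lim_alg" "rep (X \<oplus>\<^bsub>lim_alg\<^esub> Y) n = rep X n \<oplus>\<^bsub>A n\<^esub> rep Y n"
proof -
  have eq: "X \<oplus>\<^bsub>lim_alg\<^esub> Y = cls (\<lambda>n. rep X n \<oplus>\<^bsub>A n\<^esub> rep Y n)"
    using cls_add[OF rep_props(2)[OF X] rep_props(2)[OF Y]] by (simp add: rep_props X Y)
  have C: "(\<lambda>n. rep X n \<oplus>\<^bsub>A n\<^esub> rep Y n) \<in> Coh" by (intro coh_add rep_props X Y)
  have "fixed (\<lambda>n. rep X n \<oplus>\<^bsub>A n\<^esub> rep Y n)"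
    by (simp add: fixed_def retr_add rep_mem X Y rep_retr)
  then show "X \<oplus>\<^bsub>lim_alg\<^esub> Y \<in> carrier lim_alg" "rep (X \<oplus>\<^bsub>lim_alg\<^esub> Y) n = rep X n \<oplus>\<^bsub>A n\<^esub> rep Y n"
    using C by (simp_all add: eq cls_carrier rep_cls)
qed

lemma lim_smult:
  assumes X: "X \<in> carrier lim_alg"
  shows "c \<odot>\<^bsub>lim_alg\<^esub> X \<in> carrier lim_alg" "rep (c \<odot>\<^bsub>lim_alg\<^esub> X) n = c \<odot>\<^bsub>A n\<^esub> rep X n"
proof -
  have eq: "c \<odot>\<^bsub>lim_alg\<^esub> X = cls (\<lambda>n. c \<odot>\<^bsub>A n\<^esub> rep X n)"
    using cls_smult[OF rep_props(2)[OF X]] by (simp add: rep_props X)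
  have C: "(\<lambda>n. c \<odot>\<^bsub>A n\<^esub> rep X n) \<in> Coh" by (intro coh_smult rep_props X)
  have "fixed (\<lambda>n. c \<odot>\<^bsub>A n\<^esub> rep X n)" by (simp add: fixed_def retr_smult rep_mem X rep_retr)
  then show "c \<odot>\<^bsub>lim_alg\<^esub> X \<in> carrier lim_alg" "rep (c \<odot>\<^bsub>lim_alg\<^esub> X) n = c \<odot>\<^bsub>A n\<^esub> rep X n"
    using C by (simp_all add: eq cls_carrier rep_cls)
qed

lemma lim_star:
  assumes X: "X \<in> carrier lim_alg"
  shows "star lim_alg X \<in> carrier lim_alg" "rep (star lim_alg X) n = star (A n) (rep X n)"
proof -
  have eq: "star lim_alg X = cls (\<lambda>n. star (A n) (rep X n))"
    using cls_star[OF rep_props(2)[OF X]] by (simp add: rep_props X)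
  have C: "(\<lambda>n. star (A n) (rep X n)) \<in> Coh" by (intro coh_star rep_props X)
  have "fixed (\<lambda>n. star (A n) (rep X n))" by (simp add: fixed_def retr_star rep_mem X rep_retr)
  then show "star lim_alg X \<in> carrier lim_alg" "rep (star lim_alg X) n = star (A n) (rep X n)"
    using C by (simp_all add: eq cls_carrier rep_cls)
qed

lemma lim_one: "\<one>\<^bsub>lim_alg\<^esub> \<in> carrier lim_alg" "rep \<one>\<^bsub>lim_alg\<^esub> n = \<one>\<^bsub>A n\<^esub>"
proof -
  have "R n \<one>\<^bsub>A (Suc n)\<^esub> = \<one>\<^bsub>A n\<^esub>" for n using retr_incl[of "\<one>\<^bsub>A n\<^esub>" n] by (simp add: incl_one)
  then have "fixed (\<lambda>n. \<one>\<^bsub>A n\<^esub>)" by (simp add: fixed_def)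
  then show "\<one>\<^bsub>lim_alg\<^esub> \<in> carrier lim_alg" "rep \<one>\<^bsub>lim_alg\<^esub> n = \<one>\<^bsub>A n\<^esub>"
    by (simp_all add: cls_one cls_carrier rep_cls coh_one)
qed

lemma lim_zero: "\<zero>\<^bsub>lim_alg\<^esub> \<in> carrier lim_alg" "rep \<zero>\<^bsub>lim_alg\<^esub> n = \<zero>\<^bsub>A n\<^esub>"
proof -
  have "R n \<zero>\<^bsub>A (Suc n)\<^esub> = \<zero>\<^bsub>A n\<^esub>" for n
    using retr_smult[of "\<one>\<^bsub>A (Suc n)\<^esub>" n 0] by (simp add: A.smult_zero retr_mem)
  then have "fixed (\<lambda>n. \<zero>\<^bsub>A n\<^esub>)" by (simp add: fixed_def)
  then show "\<zero>\<^bsub>lim_alg\<^esub> \<in> carrier lim_alg" "rep \<zero>\<^bsub>lim_alg\<^esub> n = \<zero>\<^bsub>A n\<^esub>"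
    by (simp_all add: cls_zero cls_carrier rep_cls coh_zero)
qed

lemma lim_abelian_group: "abelian_group lim_alg"
proof (rule abelian_groupI)
  fix X assume X: "X \<in> carrier lim_alg"
  have "(-1) \<odot>\<^bsub>A n\<^esub> rep X n \<oplus>\<^bsub>A n\<^esub> rep X n = \<zero>\<^bsub>A n\<^esub>" for n
    using rep_mem[OF X, of n] by (simp add: A.neg_eq[symmetric] A.l_neg)
  then show "\<exists>Y\<in>carrier lim_alg. Y \<oplus>\<^bsub>lim_alg\<^esub> X = \<zero>\<^bsub>lim_alg\<^esub>"
    using X by (intro bexI[of _ "(-1) \<odot>\<^bsub>lim_alg\<^esub> X"] rep_ext) (auto simp: lim_add lim_smult lim_zero)
next
  fix X Y assume X: "X \<in> carrier lim_alg" "Y \<in> carrier lim_alg"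
  then show "X \<oplus>\<^bsub>lim_alg\<^esub> Y = Y \<oplus>\<^bsub>lim_alg\<^esub> X"
    by (intro rep_ext) (auto simp: lim_add rep_mem intro!: A.a_comm)
next
  fix X Y Z assume X: "X \<in> carrier lim_alg" "Y \<in> carrier lim_alg" "Z \<in> carrier lim_alg"
  then show "X \<oplus>\<^bsub>lim_alg\<^esub> Y \<oplus>\<^bsub>lim_alg\<^esub> Z = X \<oplus>\<^bsub>lim_alg\<^esub> (Y \<oplus>\<^bsub>lim_alg\<^esub> Z)"
    by (intro rep_ext) (auto simp: lim_add rep_mem intro!: A.a_assoc)
next
  fix X assume X: "X \<in> carrier lim_alg"
  then show "\<zero>\<^bsub>lim_alg\<^esub> \<oplus>\<^bsub>lim_alg\<^esub> X = X"
    by (intro rep_ext) (auto simp: lim_add lim_zero rep_mem)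
qed (auto simp: lim_add lim_zero)

lemma lim_minus:
  assumes X: "X \<in> carrier lim_alg" and Y: "Y \<in> carrier lim_alg"
  shows "X \<ominus>\<^bsub>lim_alg\<^esub> Y \<in> carrier lim_alg" "rep (X \<ominus>\<^bsub>lim_alg\<^esub> Y) n = rep X n \<ominus>\<^bsub>A n\<^esub> rep Y n"
proof -
  interpret B: abelian_group lim_alg by (rule lim_abelian_group)
  have nY: "\<ominus>\<^bsub>lim_alg\<^esub> Y \<in> carrier lim_alg" using Y by simp
  have "rep (\<ominus>\<^bsub>lim_alg\<^esub> Y \<oplus>\<^bsub>lim_alg\<^esub> Y) n = \<zero>\<^bsub>A n\<^esub>" using Y by (simp add: B.l_neg lim_zero)
  then have "rep (\<ominus>\<^bsub>lim_alg\<^esub> Y) n \<oplus>\<^bsub>A n\<^esub> rep Y n = \<zero>\<^bsub>A n\<^esub>" using lim_add[OF nY Y] by simp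
  then have "\<ominus>\<^bsub>A n\<^esub> rep Y n = rep (\<ominus>\<^bsub>lim_alg\<^esub> Y) n"
    by (intro A.minus_equality) (auto simp: rep_mem Y nY)
  then show "rep (X \<ominus>\<^bsub>lim_alg\<^esub> Y) n = rep X n \<ominus>\<^bsub>A n\<^esub> rep Y n"
    using lim_add[OF X nY] by (simp add: a_minus_def)
  show "X \<ominus>\<^bsub>lim_alg\<^esub> Y \<in> carrier lim_alg" using X Y by simp
qed

subsection \<open>The norm of the limit\<close>

lemma nrm_rep_mono:
  "X \<in> carrier lim_alg \<Longrightarrow> nrm (A n) (rep X n) \<le> nrm (A (Suc n)) (rep X (Suc n))"
  using retr_nrm[of "rep X (Suc n)" n] by (simp add: rep_mem rep_retr)

lemma nrm_cls_tendsto: assumes x: "x \<in> Coh" shows "(\<lambda>n. nrm (A n) (x n)) \<longlonglongrightarrow> nrm lim_alg (cls x)"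
proof -
  let ?y = "rep (cls x)"
  have X: "cls x \<in> carrier lim_alg" by (rule cls_carrier[OF x])
  obtain B where B: "\<forall>n. nrm (A n) (?y n) \<le> B" using coh_bounded[OF rep_props(2)[OF X]] by blast
  have "incseq (\<lambda>n. nrm (A n) (?y n))" by (intro incseq_SucI nrm_rep_mono X)
  then obtain L where L: "(\<lambda>n. nrm (A n) (?y n)) \<longlonglongrightarrow> L" using incseq_convergent[of _ B] B by blast
  have lim: "(\<lambda>n. nrm (A n) (z n)) \<longlonglongrightarrow> L" if z: "z \<in> cls x" for z
  proof -
    have r: "(x, z) \<in> rel" by (rule cls_mem[OF z])
    have "cls z = cls ?y" using r relD[OF r] rep_props[OF X] by (metis cls_eq_iff)
    then have r': "(z, ?y) \<in> rel"
      by (rule cls_eq_iff[THEN iffD1, OF relD(2)[OF r] rep_props(2)[OF X]])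
    have m: "z n \<in> carrier (A n)" "?y n \<in> carrier (A n)" for n using relD[OF r'] coh_mem by auto
    have "norm (nrm (A n) (z n) - nrm (A n) (?y n)) \<le> dst n (z n) (?y n)" for n
      using A.nrm_le_dist[OF m, of n] A.nrm_le_dist[OF m(2) m(1), of n]
        A.dist_commute[OF m, of n] by simp
    then have "(\<lambda>n. nrm (A n) (z n) - nrm (A n) (?y n)) \<longlonglongrightarrow> 0"
      by (intro Lim_null_comparison[OF _ relD(3)[OF r']]) auto
    from tendsto_add[OF this L] show ?thesis by simp
  qed
  have "(\<lambda>z. lim (\<lambda>n. nrm (A n) (z n))) ` cls x = {L}"
  proof -
    have "lim (\<lambda>n. nrm (A n) (z n)) = L" if "z \<in> cls x" for z by (rule limI[OF lim[OF that]])
    then show ?thesis using cls_self[OF x] by auto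
  qed
  then have "nrm lim_alg (cls x) = L" by (simp add: ind_lim_def)
  then show ?thesis using lim[OF cls_self[OF x]] by simp
qed

lemma nrm_rep_tendsto: "X \<in> carrier lim_alg \<Longrightarrow> (\<lambda>n. nrm (A n) (rep X n)) \<longlonglongrightarrow> nrm lim_alg X"
  using nrm_cls_tendsto[of "rep X"] by (simp add: rep_props)

lemma nrm_rep_le: assumes X: "X \<in> carrier lim_alg" shows "nrm (A n) (rep X n) \<le> nrm lim_alg X"
  by (rule incseq_le[OF incseq_SucI nrm_rep_tendsto[OF X]]) (rule nrm_rep_mono[OF X])

lemma lim_nrm_le_iff:
  assumes X: "X \<in> carrier lim_alg"
  shows "nrm lim_alg X \<le> r \<longleftrightarrow> (\<forall>n. nrm (A n) (rep X n) \<le> r)"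
proof
  show "\<forall>n. nrm (A n) (rep X n) \<le> r" if "nrm lim_alg X \<le> r"
    using nrm_rep_le[OF X] that order.trans by blast
  show "nrm lim_alg X \<le> r" if "\<forall>n. nrm (A n) (rep X n) \<le> r"
    by (rule LIMSEQ_le_const2[OF nrm_rep_tendsto[OF X]]) (use that in blast)
qed

subsection \<open>The images of the algebras in the limit\<close>

abbreviation "emb \<equiv> to_lim A \<alpha>"

lemma emb_coherent:
  assumes a: "a \<in> carrier (A n)"
  shows "(\<lambda>k. if k < n then \<zero>\<^bsub>A k\<^esub> else conn n (k - n) a) \<in> Coh" (is "?s \<in> Coh")
proof (rule cohI)
  show "?s k \<in> carrier (A k)" for k using conn_mem[OF a, of "k - n"] by auto
  fix e :: real assume e: "0 < e"
  have "dst (m + k) (?s (m + k)) (conn m k (?s m)) < e" if m: "n \<le> m" for m k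
  proof -
    obtain j where j: "m = n + j" using m le_Suc_ex by blast
    have "conn n (j + k) a \<in> carrier (A (n + j + k))" using conn_mem[OF a, of "j + k"] by (simp add: add.assoc)
    then show ?thesis using e by (simp add: j conn_conn)
  qed
  then show "\<exists>N. \<forall>m\<ge>N. \<forall>k. dst (m + k) (?s (m + k)) (conn m k (?s m)) < e" by blast
qed

lemma emb_eq_cls: "emb n a = cls (\<lambda>k. if k < n then \<zero>\<^bsub>A k\<^esub> else conn n (k - n) a)"
  by (simp add: to_lim_def cls_def)

lemma emb_mem: "a \<in> carrier (A n) \<Longrightarrow> emb n a \<in> carrier lim_alg"
  by (simp add: emb_eq_cls cls_carrier emb_coherent)

lemma rep_emb_ge:
  assumes a: "a \<in> carrier (A n)" shows "rep (emb n a) (n + k) = conn n k a"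
proof -
  define s where "s = (\<lambda>k. if k < n then \<zero>\<^bsub>A k\<^esub> else conn n (k - n) a)"
  let ?y = "rep (emb n a)"
  have s: "s \<in> Coh" "emb n a = cls s" by (simp_all add: s_def emb_coherent[OF a] emb_eq_cls)
  have r: "(s, ?y) \<in> rel"
    using cls_eq_iff[OF s(1), of ?y] rep_props[OF emb_mem[OF a]] s(2) by metis
  have m: "s j \<in> carrier (A j)" "?y j \<in> carrier (A j)" for j
    using coh_mem[OF relD(1)[OF r]] coh_mem[OF relD(2)[OF r]] by auto
  have "dst (n + k) (conn n k a) (?y (n + k)) \<le> dst (j + (n + k)) (s (j + (n + k))) (?y (j + (n + k)))" for j
  proof -
    have "s (n + k + j) = conn (n + k) j (conn n k a)"
      by (simp add: s_def conn_conn[symmetric] add.assoc)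
    then have "down (n + k) j (s (n + k + j)) = conn n k a"
      using down_conn[OF conn_mem[OF a]] by simp
    moreover have "down (n + k) j (?y (n + k + j)) = ?y (n + k)"
      by (rule fixed_down[OF rep_props(1)[OF emb_mem[OF a]]])
    ultimately show ?thesis
      using down_dist[OF m(1) m(2), of "n + k" j] by (simp add: add.commute[of j])
  qed
  moreover have "(\<lambda>j. dst (j + (n + k)) (s (j + (n + k))) (?y (j + (n + k)))) \<longlonglongrightarrow> 0"
    by (rule LIMSEQ_ignore_initial_segment[OF relD(3)[OF r]])
  ultimately have "dst (n + k) (conn n k a) (?y (n + k)) \<le> 0"
    by (intro LIMSEQ_le_const[of _ 0]) auto
  then have "dst (n + k) (conn n k a) (?y (n + k)) = 0"
    using dst_nonneg[of "conn n k a" "n + k" "?y (n + k)"] m(2) conn_mem[OF a] by simp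
  then show ?thesis using A.dist_zero_imp[OF conn_mem[OF a] m(2), of k] by simp
qed

lemma rep_emb: "a \<in> carrier (A n) \<Longrightarrow> rep (emb n a) n = a"
  using rep_emb_ge[of a n 0] by simp

lemma rep_ext_from:
  assumes X: "X \<in> carrier lim_alg" and Y: "Y \<in> carrier lim_alg"
    and eq: "\<And>k. rep X (n + k) = rep Y (n + k)"
  shows "X = Y"
proof (rule rep_ext[OF X Y])
  fix m
  have "rep X m = down m n (rep X (m + n))" "rep Y m = down m n (rep Y (m + n))"
    using fixed_down rep_props(1) X Y by metis+
  then show "rep X m = rep Y m" using eq[of m] by (simp add: add.commute)
qed

lemma emb_add:
  assumes "a \<in> carrier (A n)" "b \<in> carrier (A n)"
  shows "emb n (a \<oplus>\<^bsub>A n\<^esub> b) = emb n a \<oplus>\<^bsub>lim_alg\<^esub> emb n b"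
  by (rule rep_ext_from[where n = n]) (use assms in \<open>simp_all add: emb_mem lim_add rep_emb_ge conn_add\<close>)

lemma emb_smult:
  assumes "a \<in> carrier (A n)" shows "emb n (c \<odot>\<^bsub>A n\<^esub> a) = c \<odot>\<^bsub>lim_alg\<^esub> emb n a"
  by (rule rep_ext_from[where n = n]) (use assms in \<open>simp_all add: emb_mem lim_smult rep_emb_ge conn_smult\<close>)

lemma emb_star:
  assumes "a \<in> carrier (A n)" shows "emb n (star (A n) a) = star lim_alg (emb n a)"
  by (rule rep_ext_from[where n = n]) (use assms in \<open>simp_all add: emb_mem lim_star rep_emb_ge conn_star\<close>)

lemma emb_one: "emb n \<one>\<^bsub>A n\<^esub> = \<one>\<^bsub>lim_alg\<^esub>"
  by (rule rep_ext_from[where n = n]) (simp_all add: emb_mem lim_one rep_emb_ge conn_one)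

lemma dist_emb_tendsto:
  assumes X: "X \<in> carrier lim_alg"
  shows "(\<lambda>n. nrm lim_alg (emb n (rep X n) \<ominus>\<^bsub>lim_alg\<^esub> X)) \<longlonglongrightarrow> 0"
proof (rule LIMSEQ_I)
  fix e :: real assume e: "0 < e"
  obtain N where N: "\<forall>n\<ge>N. \<forall>k. dst (n + k) (rep X (n + k)) (conn n k (rep X n)) < e / 2"
    using cohD[OF rep_props(2)[OF X], of "e / 2"] e by auto
  have "norm (nrm lim_alg (emb n (rep X n) \<ominus>\<^bsub>lim_alg\<^esub> X) - 0) < e" if n: "n \<ge> N" for n
  proof -
    let ?Z = "emb n (rep X n) \<ominus>\<^bsub>lim_alg\<^esub> X"
    have Z: "?Z \<in> carrier lim_alg" by (intro lim_minus emb_mem rep_mem X)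
    have "nrm (A (k + n)) (rep ?Z (k + n)) \<le> e / 2" for k
    proof -
      have "rep ?Z (n + k) = conn n k (rep X n) \<ominus>\<^bsub>A (n + k)\<^esub> rep X (n + k)"
        by (simp add: lim_minus emb_mem rep_mem X rep_emb_ge)
      then have "nrm (A (n + k)) (rep ?Z (n + k)) \<le> e / 2"
        using N[rule_format, OF n, of k]
          A.dist_commute[OF conn_mem[OF rep_mem[OF X]] rep_mem[OF X], of n k] by simp
      then show ?thesis by (simp add: add.commute)
    qed
    then have "nrm lim_alg ?Z \<le> e / 2"
      by (intro LIMSEQ_le_const2[OF LIMSEQ_ignore_initial_segment[OF nrm_rep_tendsto[OF Z], of n]]) auto
    moreover have "0 \<le> nrm lim_alg ?Z"
      using nrm_rep_le[OF Z, of 0] A.nrm_nonneg[OF rep_mem[OF Z, of 0]] by linarith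
    ultimately show ?thesis using e by simp
  qed
  then show "\<exists>N. \<forall>n\<ge>N. norm (nrm lim_alg (emb n (rep X n) \<ominus>\<^bsub>lim_alg\<^esub> X) - 0) < e" by blast
qed

subsection \<open>Positivity in the limit\<close>

lemma sqrt_iter_conn:
  assumes "y \<in> carrier (A n)"
  shows "conn n j (sqrt_iter (A n) y k) = sqrt_iter (A (n + j)) (conn n j y) k"
  by (induction k) (use assms in \<open>auto simp: conn_zero conn_smult conn_add conn_mult\<close>)

text \<open>
  The square roots of the entries of a coherent sequence of positive contractions are approximated
  by the iterates of increasing order. They form a coherent sequence again since the iteration
  converges uniformly and each iterate depends continuously on its argument.
\<close>

lemma sqrt_coherent:
  assumes y: "y \<in> Coh" and le1: "\<And>n. nrm (A n) (y n) \<le> 1"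
  shows "(\<lambda>n. \<one>\<^bsub>A n\<^esub> \<ominus>\<^bsub>A n\<^esub> sqrt_iter (A n) (y n) n) \<in> Coh" (is "?c \<in> Coh")
proof (rule cohI)
  have ym: "y n \<in> carrier (A n)" for n by (rule coh_mem[OF y])
  show "?c n \<in> carrier (A n)" for n by (simp add: ym)
  fix e :: real assume e: "0 < e"
  obtain M where M: "\<forall>k\<ge>M. \<forall>j. sqrt_bound (k + j) - sqrt_bound k < e / 4"
    using sqrt_bound_Cauchy[of "e / 4"] e by auto
  obtain N where N: "\<forall>n\<ge>N. \<forall>k. dst (n + k) (y (n + k)) (conn n k (y n)) < e / (4 * (real M + 1))"
    using cohD[OF y, of "e / (4 * (real M + 1))"] e by auto
  have "dst (n + k) (?c (n + k)) (conn n k (?c n)) < e" if n: "n \<ge> max M N" for n k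
  proof -
    let ?B = "A (n + k)" and ?y = "y (n + k)" and ?z = "conn n k (y n)"
    have z: "?z \<in> carrier ?B" "nrm ?B ?z \<le> 1" by (auto simp: conn_mem ym conn_nrm le1)
    have to_M: "nrm ?B (sqrt_iter ?B u m \<ominus>\<^bsub>?B\<^esub> sqrt_iter ?B u M) \<le> e / 4"
      if u: "u \<in> carrier ?B" "nrm ?B u \<le> 1" and m: "m \<ge> M" for u m
    proof -
      obtain j where "m = M + j" using m le_Suc_ex by blast
      then show ?thesis using A.dist_sqrt_iter[OF u, of M j] M[rule_format, of M j] by simp
    qed
    have mem: "sqrt_iter ?B ?y m \<in> carrier ?B" "sqrt_iter ?B ?z m \<in> carrier ?B" for m
      using z ym by auto
    have "nrm ?B (sqrt_iter ?B ?y M \<ominus>\<^bsub>?B\<^esub> sqrt_iter ?B ?z M) \<le> real M * nrm ?B (?y \<ominus>\<^bsub>?B\<^esub> ?z)"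
      by (rule A.dist_sqrt_iter_arg[OF ym le1 z])
    also have "\<dots> \<le> (real M + 1) * (e / (4 * (real M + 1)))"
      using N[rule_format, of n k] n dst_nonneg[OF ym z(1)] by (intro mult_mono) auto
    also have "\<dots> = e / 4" by (simp add: field_simps)
    finally have mid: "nrm ?B (sqrt_iter ?B ?y M \<ominus>\<^bsub>?B\<^esub> sqrt_iter ?B ?z M) \<le> e / 4" .
    have "nrm ?B (sqrt_iter ?B ?y (n + k) \<ominus>\<^bsub>?B\<^esub> sqrt_iter ?B ?z n) \<le>
        nrm ?B (sqrt_iter ?B ?y (n + k) \<ominus>\<^bsub>?B\<^esub> sqrt_iter ?B ?y M) +
        nrm ?B (sqrt_iter ?B ?y M \<ominus>\<^bsub>?B\<^esub> sqrt_iter ?B ?z n)"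
      by (intro A.dist_triangle mem)
    also have "nrm ?B (sqrt_iter ?B ?y M \<ominus>\<^bsub>?B\<^esub> sqrt_iter ?B ?z n) \<le>
        nrm ?B (sqrt_iter ?B ?y M \<ominus>\<^bsub>?B\<^esub> sqrt_iter ?B ?z M) +
        nrm ?B (sqrt_iter ?B ?z M \<ominus>\<^bsub>?B\<^esub> sqrt_iter ?B ?z n)"
      by (intro A.dist_triangle mem)
    also have "nrm ?B (sqrt_iter ?B ?z M \<ominus>\<^bsub>?B\<^esub> sqrt_iter ?B ?z n) \<le> e / 4"
      using to_M[OF z, of n] n A.dist_commute[OF mem(2) mem(2), of M n] by simp
    finally have "nrm ?B (sqrt_iter ?B ?y (n + k) \<ominus>\<^bsub>?B\<^esub> sqrt_iter ?B ?z n) \<le> 3 * (e / 4)"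
      using to_M[OF ym le1, of "n + k"] mid n by linarith
    moreover have "conn n k (?c n) = \<one>\<^bsub>?B\<^esub> \<ominus>\<^bsub>?B\<^esub> sqrt_iter ?B ?z n"
      by (simp add: conn_minus conn_one ym sqrt_iter_conn)
    ultimately show ?thesis using e mem by (simp add: A.dist_one_minus)
  qed
  then show "\<exists>N. \<forall>n\<ge>N. \<forall>k. dst (n + k) (?c (n + k)) (conn n k (?c n)) < e" by blast
qed

end

lemma sa_simps [simp]:
  "carrier (sa B) = {a \<in> carrier B. star B a = a}"
  "\<one>\<^bsub>sa B\<^esub> = \<one>\<^bsub>B\<^esub>" "\<zero>\<^bsub>sa B\<^esub> = \<zero>\<^bsub>B\<^esub>"
  "a \<oplus>\<^bsub>sa B\<^esub> b = a \<oplus>\<^bsub>B\<^esub> b"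
  "r \<odot>\<^bsub>sa B\<^esub> a = complex_of_real r \<odot>\<^bsub>B\<^esub> a"
  "le (sa B) a b \<longleftrightarrow> (\<exists>c\<in>carrier B. b \<ominus>\<^bsub>B\<^esub> a = star B c \<otimes>\<^bsub>B\<^esub> c)"
  by (simp_all add: sa_def)

context retract_system
begin

lemma om_dist: "w \<in> Om n \<Longrightarrow> a \<in> carrier (A n) \<Longrightarrow> b \<in> carrier (A n) \<Longrightarrow> \<bar>w a - w b\<bar> \<le> dst n a b"
  using A.om_le_nrm[of w n "a \<ominus>\<^bsub>A n\<^esub> b"] by (simp add: A.om_minus)

lemma state_rep_from:
  assumes X: "X \<in> carrier lim_alg" and w: "w \<in> Om n"
  shows "\<exists>v\<in>Om (n + k). w (rep X n) = v (rep X (n + k)) \<and>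
    (\<forall>a\<in>carrier (A (n + k)). w (down n k a) = v a)"
  using down_state[OF w, of k] fixed_down[OF rep_props(1)[OF X], of n k] rep_mem[OF X, of "n + k"]
  by metis

lemma square_pos:
  assumes D: "D \<in> carrier lim_alg" and C: "C \<in> carrier lim_alg"
    and eq: "D = star lim_alg C \<otimes>\<^bsub>lim_alg\<^esub> C" and w: "w \<in> Om n"
  shows "0 \<le> w (rep D n)"
proof -
  let ?x = "rep C"
  let ?z = "\<lambda>n. star (A n) (?x n) \<otimes>\<^bsub>A n\<^esub> ?x n"
  have x: "?x \<in> Coh" by (rule rep_props(2)[OF C])
  have z: "?z \<in> Coh" by (intro coh_mult coh_star x)
  have "D = cls ?z"
    using cls_star[OF x] cls_mult[OF coh_star[OF x] x] rep_props(3)[OF C] eq by simp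
  then have r: "(?z, rep D) \<in> rel"
    using cls_eq_iff[OF z rep_props(2)[OF D]] rep_props(3)[OF D] by simp
  have "- w (rep D n) \<le> dst (k + n) (?z (k + n)) (rep D (k + n))" for k
  proof -
    obtain v where v: "v \<in> Om (n + k)" "w (rep D n) = v (rep D (n + k))"
      using state_rep_from[OF D w] by blast
    have "0 \<le> v (?z (n + k))" using v(1) by (intro A.om_pos) (auto simp: rep_mem C)
    then show ?thesis
      using om_dist[OF v(1) coh_mem[OF z] rep_mem[OF D]] v(2) by (simp add: add.commute)
  qed
  moreover have "(\<lambda>k. dst (k + n) (?z (k + n)) (rep D (k + n))) \<longlonglongrightarrow> 0"
    by (rule LIMSEQ_ignore_initial_segment[OF relD(3)[OF r]])
  ultimately have "- w (rep D n) \<le> 0" by (intro LIMSEQ_le_const[of _ 0]) auto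
  then show ?thesis by simp
qed

lemma pos_square:
  assumes D: "D \<in> carrier lim_alg" "star lim_alg D = D"
    and pos: "\<And>n w. w \<in> Om n \<Longrightarrow> 0 \<le> w (rep D n)"
  shows "\<exists>C\<in>carrier lim_alg. D = star lim_alg C \<otimes>\<^bsub>lim_alg\<^esub> C"
proof -
  let ?d = "rep D"
  define r where "r = nrm lim_alg D + 1"
  have d: "?d n \<in> carrier (A n)" for n by (rule rep_mem[OF D(1)])
  have ds: "star (A n) (?d n) = ?d n" for n using lim_star(2)[OF D(1), of n] D(2) by simp
  have nd: "nrm (A n) (?d n) \<le> r" for n using nrm_rep_le[OF D(1), of n] by (simp add: r_def)
  have r: "0 < r" using nrm_rep_le[OF D(1), of 0] A.nrm_nonneg[OF d[of 0]] by (simp add: r_def)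
  define y where "y n = \<one>\<^bsub>A n\<^esub> \<ominus>\<^bsub>A n\<^esub> complex_of_real (1 / r) \<odot>\<^bsub>A n\<^esub> ?d n" for n
  have "y = rep (\<one>\<^bsub>lim_alg\<^esub> \<ominus>\<^bsub>lim_alg\<^esub> complex_of_real (1 / r) \<odot>\<^bsub>lim_alg\<^esub> D)"
    by (rule ext) (simp add: y_def lim_minus lim_one lim_smult D)
  then have yC: "y \<in> Coh" by (simp add: rep_props lim_minus lim_one lim_smult D)
  have ym: "y n \<in> carrier (A n)" for n by (rule coh_mem[OF yC])
  have ys: "star (A n) (y n) = y n" for n
    by (simp add: y_def A.star_minus A.star_one A.star_smult d ds)
  have y1: "nrm (A n) (y n) \<le> 1" for n
  proof (rule A.om_norming[OF ym ys])
    fix w assume w: "w \<in> Om n"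
    have "w (y n) = 1 - (1 / r) * w (?d n)"
      using w d by (simp add: y_def A.om_minus A.om_one A.om_smult del: of_real_divide of_real_1)
    moreover have "0 \<le> w (?d n)" "w (?d n) \<le> r"
      using pos[OF w] A.om_le_nrm[OF w d] nd[of n] by auto
    moreover from this have "0 \<le> (1 / r) * w (?d n)" "(1 / r) * w (?d n) \<le> 1"
      using r by (simp_all add: pos_divide_le_eq)
    ultimately show "\<bar>w (y n)\<bar> \<le> 1" by linarith
  qed simp
  define c where "c n = \<one>\<^bsub>A n\<^esub> \<ominus>\<^bsub>A n\<^esub> sqrt_iter (A n) (y n) n" for n
  have cC: "c \<in> Coh" unfolding c_def by (rule sqrt_coherent[OF yC y1])
  have cm: "c n \<in> carrier (A n)" for n by (rule coh_mem[OF cC])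
  have cs: "star (A n) (c n) = c n" for n
    by (simp add: c_def A.star_minus A.star_one A.sqrt_iter_star ym ys)
  let ?s = "complex_of_real (sqrt r)"
  let ?e = "\<lambda>n. ?s \<odot>\<^bsub>A n\<^esub> c n"
  have eC: "?e \<in> Coh" by (rule coh_smult[OF cC])
  have "star lim_alg (cls ?e) \<otimes>\<^bsub>lim_alg\<^esub> cls ?e = cls (\<lambda>n. star (A n) (?e n) \<otimes>\<^bsub>A n\<^esub> ?e n)"
    by (simp only: cls_star[OF eC] cls_mult[OF coh_star[OF eC] eC])
  also have "(\<lambda>n. star (A n) (?e n) \<otimes>\<^bsub>A n\<^esub> ?e n) = (\<lambda>n. complex_of_real r \<odot>\<^bsub>A n\<^esub> (c n \<otimes>\<^bsub>A n\<^esub> c n))"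
  proof
    fix n
    have "?s * ?s = complex_of_real r" using r by (simp flip: of_real_mult)
    then show "star (A n) (?e n) \<otimes>\<^bsub>A n\<^esub> ?e n = complex_of_real r \<odot>\<^bsub>A n\<^esub> (c n \<otimes>\<^bsub>A n\<^esub> c n)"
      using cm by (simp add: A.star_smult cs A.smult_mult A.smult_smult)
  qed
  also have "cls \<dots> = cls ?d"
  proof (subst cls_eq_iff)
    let ?f = "\<lambda>n. complex_of_real r \<odot>\<^bsub>A n\<^esub> (c n \<otimes>\<^bsub>A n\<^esub> c n)"
    show "?f \<in> Coh" by (intro coh_smult coh_mult cC)
    show "?d \<in> Coh" by (rule rep_props[OF D(1)])
    have bound: "dst n (?f n) (?d n) \<le> r * (2 * (sqrt_bound (Suc n) - sqrt_bound n))" for n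
    proof -
      let ?t = "complex_of_real (1 / r) \<odot>\<^bsub>A n\<^esub> ?d n"
      have t: "?t \<in> carrier (A n)" using d by (rule A.smult_mem)
      have one_y: "\<one>\<^bsub>A n\<^esub> \<ominus>\<^bsub>A n\<^esub> y n = ?t"
      proof -
        have "\<one>\<^bsub>A n\<^esub> \<ominus>\<^bsub>A n\<^esub> (\<one>\<^bsub>A n\<^esub> \<ominus>\<^bsub>A n\<^esub> ?t) = ?t"
        proof -
          interpret R: ring "A n" ..
          show ?thesis using t by algebra
        qed
        then show ?thesis by (simp add: y_def)
      qed
      have rt: "complex_of_real r \<odot>\<^bsub>A n\<^esub> ?t = ?d n"
        using r d by (simp add: A.smult_smult A.smult_one flip: of_real_mult)
      have "dst n (?f n) (?d n) = r * dst n (c n \<otimes>\<^bsub>A n\<^esub> c n) ?t"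
        using r A.dist_smult[OF A.m_closed[OF cm cm] t, of "complex_of_real r"] unfolding rt by simp
      then have "dst n (?f n) (?d n) = r * dst n (c n \<otimes>\<^bsub>A n\<^esub> c n) (\<one>\<^bsub>A n\<^esub> \<ominus>\<^bsub>A n\<^esub> y n)"
        unfolding one_y .
      also have "\<dots> \<le> r * (2 * (sqrt_bound (Suc n) - sqrt_bound n))"
        using A.one_minus_sqrt_iter_square[OF ym y1, of n n] r
        unfolding c_def by (intro mult_left_mono) auto
      finally show ?thesis .
    qed
    have "(\<lambda>n. sqrt_bound (Suc n) - sqrt_bound n) \<longlonglongrightarrow> 0"
    proof (rule LIMSEQ_I)
      fix e :: real assume e: "0 < e"
      obtain N where N: "\<forall>k\<ge>N. \<forall>j. sqrt_bound (k + j) - sqrt_bound k < e"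
        using sqrt_bound_Cauchy[OF e] by blast
      have "norm (sqrt_bound (Suc n) - sqrt_bound n - 0) < e" if "n \<ge> N" for n
        using N[rule_format, OF that, of 1] sqrt_bound_Suc_mono[of n] by simp
      then show "\<exists>N. \<forall>n\<ge>N. norm (sqrt_bound (Suc n) - sqrt_bound n - 0) < e" by blast
    qed
    then have "(\<lambda>n. r * (2 * (sqrt_bound (Suc n) - sqrt_bound n))) \<longlonglongrightarrow> r * (2 * 0)"
      by (intro tendsto_intros)
    then have lim: "(\<lambda>n. r * (2 * (sqrt_bound (Suc n) - sqrt_bound n))) \<longlonglongrightarrow> 0" by simp
    have "(\<lambda>n. dst n (?f n) (?d n)) \<longlonglongrightarrow> 0"
      by (rule tendsto_sandwich[OF _ _ tendsto_const lim])
        (use bound cm d in \<open>auto simp: dst_nonneg simp del: sqrt_bound.simps\<close>)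
    then show "(?f, ?d) \<in> rel" using \<open>?f \<in> Coh\<close> \<open>?d \<in> Coh\<close> by (rule relI[rotated 2])
  qed
  also have "cls ?d = D" by (rule rep_props[OF D(1)])
  finally show ?thesis by (intro bexI[of _ "cls ?e"]) (auto intro: cls_carrier[OF eC])
qed

subsection \<open>The limit as an order unit space\<close>

abbreviation "sac n \<equiv> carrier (sa (A n))"
abbreviation "sa_lim \<equiv> sa lim_alg"

definition lim_states :: "((nat \<Rightarrow> 'a) set \<Rightarrow> real) set" where
  "lim_states = (\<Union>n. (\<lambda>w X. w (rep X n)) ` Om n)"

lemma rep_sa: "X \<in> carrier sa_lim \<Longrightarrow> rep X n \<in> sac n"
  using lim_star(2)[of X n] by (simp add: rep_mem)

lemma sa_limI:
  assumes "X \<in> carrier lim_alg" "\<And>n. star (A n) (rep X n) = rep X n" shows "X \<in> carrier sa_lim"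
proof -
  have "star lim_alg X = X" by (rule rep_ext) (use assms in \<open>simp_all add: lim_star\<close>)
  then show ?thesis using assms by simp
qed

lemma lim_minus_sa:
  assumes "X \<in> carrier sa_lim" "Y \<in> carrier sa_lim" shows "X \<ominus>\<^bsub>lim_alg\<^esub> Y \<in> carrier sa_lim"
  using assms rep_sa[OF assms(1)] rep_sa[OF assms(2)]
  by (intro sa_limI) (simp_all add: lim_minus A.star_minus)

lemma state_separated_lim: "state_separated sa_lim lim_states"
proof
  show "\<one>\<^bsub>sa_lim\<^esub> \<in> carrier sa_lim"
    unfolding sa_simps(2) by (rule sa_limI) (simp_all add: lim_one A.star_one)
  show "\<zero>\<^bsub>sa_lim\<^esub> \<in> carrier sa_lim"
    unfolding sa_simps(3) by (rule sa_limI) (simp_all add: lim_zero A.star_zero)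
  show "lim_states \<noteq> {}" using A.om_nonempty by (auto simp: lim_states_def)
next
  fix X assume X: "X \<in> carrier sa_lim"
  have Xc: "X \<in> carrier lim_alg" using X by simp
  show "r \<odot>\<^bsub>sa_lim\<^esub> X \<in> carrier sa_lim" for r
    unfolding sa_simps(5) by (rule sa_limI) (use rep_sa[OF X] Xc in \<open>simp_all add: lim_smult A.star_smult\<close>)
  show "\<exists>B. \<forall>w\<in>lim_states. \<bar>w X\<bar> \<le> B"
  proof (intro exI ballI)
    fix w assume "w \<in> lim_states"
    then obtain n v where v: "v \<in> Om n" "w = (\<lambda>X. v (rep X n))" by (auto simp: lim_states_def)
    then show "\<bar>w X\<bar> \<le> nrm lim_alg X"
      using A.om_le_nrm[OF v(1) rep_mem[OF Xc]] nrm_rep_le[OF Xc, of n] by simp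
  qed
  fix Y assume Y: "Y \<in> carrier sa_lim"
  have Yc: "Y \<in> carrier lim_alg" using Y by simp
  show "X \<oplus>\<^bsub>sa_lim\<^esub> Y \<in> carrier sa_lim"
    unfolding sa_simps(4)
    by (rule sa_limI) (use rep_sa[OF X] rep_sa[OF Y] Xc Yc in \<open>simp_all add: lim_add A.star_add\<close>)
  show "le sa_lim X Y \<longleftrightarrow> (\<forall>w\<in>lim_states. w X \<le> w Y)"
  proof -
    have D: "Y \<ominus>\<^bsub>lim_alg\<^esub> X \<in> carrier lim_alg" "star lim_alg (Y \<ominus>\<^bsub>lim_alg\<^esub> X) = Y \<ominus>\<^bsub>lim_alg\<^esub> X"
      using lim_minus_sa[OF Y X] by auto
    have "le sa_lim X Y \<longleftrightarrow> (\<forall>n. \<forall>w\<in>Om n. 0 \<le> w (rep (Y \<ominus>\<^bsub>lim_alg\<^esub> X) n))"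
      unfolding sa_simps
    proof (intro iffI allI ballI)
      fix n w assume "\<exists>c\<in>carrier lim_alg. Y \<ominus>\<^bsub>lim_alg\<^esub> X = star lim_alg c \<otimes>\<^bsub>lim_alg\<^esub> c" and w: "w \<in> Om n"
      then obtain C where "C \<in> carrier lim_alg" "Y \<ominus>\<^bsub>lim_alg\<^esub> X = star lim_alg C \<otimes>\<^bsub>lim_alg\<^esub> C" by blast
      then show "0 \<le> w (rep (Y \<ominus>\<^bsub>lim_alg\<^esub> X) n)" using w by (rule square_pos[OF D(1)])
    next
      assume "\<forall>n. \<forall>w\<in>Om n. 0 \<le> w (rep (Y \<ominus>\<^bsub>lim_alg\<^esub> X) n)"
      then show "\<exists>c\<in>carrier lim_alg. Y \<ominus>\<^bsub>lim_alg\<^esub> X = star lim_alg c \<otimes>\<^bsub>lim_alg\<^esub> c"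
        by (intro pos_square[OF D]) blast
    qed
    also have "\<dots> \<longleftrightarrow> (\<forall>n. \<forall>w\<in>Om n. w (rep X n) \<le> w (rep Y n))"
      by (simp add: lim_minus Xc Yc rep_mem A.om_minus)
    also have "\<dots> \<longleftrightarrow> (\<forall>w\<in>lim_states. w X \<le> w Y)" by (auto simp: lim_states_def)
    finally show ?thesis .
  qed
  assume eq: "\<And>w. w \<in> lim_states \<Longrightarrow> w X = w Y"
  show "X = Y"
  proof (rule rep_ext[OF Xc Yc])
    fix n
    have "nrm (A n) (rep X n \<ominus>\<^bsub>A n\<^esub> rep Y n) \<le> 0"
    proof (rule A.om_norming)
      fix w assume w: "w \<in> Om n"
      then have "(\<lambda>X. w (rep X n)) \<in> lim_states" by (auto simp: lim_states_def)
      from eq[OF this] show "\<bar>w (rep X n \<ominus>\<^bsub>A n\<^esub> rep Y n)\<bar> \<le> 0"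
        using w by (simp add: A.om_minus rep_mem Xc Yc)
    qed (use rep_sa[OF X, of n] rep_sa[OF Y, of n] in \<open>auto simp: A.star_minus\<close>)
    then show "rep X n = rep Y n"
      using dst_nonneg[OF rep_mem[OF Xc] rep_mem[OF Yc], of n]
      by (intro A.dist_zero_imp) (auto simp: rep_mem Xc Yc)
  qed
qed (auto simp: lim_states_def lim_add lim_smult lim_zero lim_one rep_mem A.om_add A.om_smult
    A.om_zero A.om_one)

sublocale E: state_separated sa_lim lim_states
  by (rule state_separated_lim)

lemma lim_dist_le_iff:
  assumes X: "X \<in> carrier sa_lim" and Y: "Y \<in> carrier sa_lim"
  shows "ou_dist sa_lim X Y \<le> r \<longleftrightarrow> (\<forall>n. dst n (rep X n) (rep Y n) \<le> r)"
proof
  have c: "X \<in> carrier lim_alg" "Y \<in> carrier lim_alg" using X Y by auto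
  have near: "\<bar>w (rep X n) - w (rep Y n)\<bar> \<le> ou_dist sa_lim X Y" if "w \<in> Om n" for w n
    using E.state_diff_le_ou_dist[OF X Y, of "\<lambda>X. w (rep X n)"] that by (auto simp: lim_states_def)
  show "\<forall>n. dst n (rep X n) (rep Y n) \<le> r" if "ou_dist sa_lim X Y \<le> r"
  proof
    fix n
    have "dst n (rep X n) (rep Y n) \<le> ou_dist sa_lim X Y"
    proof (rule A.om_norming)
      fix w assume "w \<in> Om n"
      then show "\<bar>w (rep X n \<ominus>\<^bsub>A n\<^esub> rep Y n)\<bar> \<le> ou_dist sa_lim X Y"
        using near[of w n] by (simp add: A.om_minus rep_mem c)
    qed (use rep_sa[OF X, of n] rep_sa[OF Y, of n] in \<open>auto simp: A.star_minus\<close>)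
    then show "dst n (rep X n) (rep Y n) \<le> r" using that by simp
  qed
  assume le: "\<forall>n. dst n (rep X n) (rep Y n) \<le> r"
  show "ou_dist sa_lim X Y \<le> r"
    unfolding E.ou_dist_le_iff[OF X Y]
  proof
    fix w assume "w \<in> lim_states"
    then obtain n v where v: "v \<in> Om n" "w = (\<lambda>X. v (rep X n))" by (auto simp: lim_states_def)
    then show "\<bar>w X - w Y\<bar> \<le> r"
      using om_dist[OF v(1) rep_mem[OF c(1)] rep_mem[OF c(2)]] le[rule_format, of n] by simp
  qed
qed

lemma rep_dist_le:
  "X \<in> carrier sa_lim \<Longrightarrow> Y \<in> carrier sa_lim \<Longrightarrow> dst n (rep X n) (rep Y n) \<le> ou_dist sa_lim X Y"
  using lim_dist_le_iff[of X Y "ou_dist sa_lim X Y"] by blast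

lemma lim_dist_eq_nrm:
  assumes X: "X \<in> carrier sa_lim" and Y: "Y \<in> carrier sa_lim"
  shows "ou_dist sa_lim X Y = nrm lim_alg (X \<ominus>\<^bsub>lim_alg\<^esub> Y)"
proof -
  have "ou_dist sa_lim X Y \<le> r \<longleftrightarrow> nrm lim_alg (X \<ominus>\<^bsub>lim_alg\<^esub> Y) \<le> r" for r
    using X Y by (simp add: lim_dist_le_iff[OF X Y] lim_nrm_le_iff lim_minus)
  then show ?thesis by (metis antisym order_refl)
qed

lemma lim_dist_le_from:
  assumes X: "X \<in> carrier sa_lim" and Y: "Y \<in> carrier sa_lim"
    and le: "\<And>k. dst (n + k) (rep X (n + k)) (rep Y (n + k)) \<le> r"
  shows "ou_dist sa_lim X Y \<le> r"
proof (subst lim_dist_le_iff[OF X Y], rule)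
  fix m
  have c: "X \<in> carrier lim_alg" "Y \<in> carrier lim_alg" using X Y by auto
  have "dst m (rep X m) (rep Y m) \<le> dst (m + n) (rep X (m + n)) (rep Y (m + n))"
    using down_dist[OF rep_mem[OF c(1)] rep_mem[OF c(2)], of m n]
    by (simp add: fixed_down[OF rep_props(1)[OF c(1)]] fixed_down[OF rep_props(1)[OF c(2)]])
  then show "dst m (rep X m) (rep Y m) \<le> r" using le[of m] by (simp add: add.commute)
qed

lemma lim_cauchy_converges:
  assumes X: "\<And>j. X j \<in> carrier sa_lim"
    and cauchy: "\<forall>e>0. \<exists>N. \<forall>i\<ge>N. \<forall>j\<ge>N. ou_dist sa_lim (X i) (X j) < e"
  shows "\<exists>Y\<in>carrier sa_lim. (\<lambda>j. ou_dist sa_lim (X j) Y) \<longlonglongrightarrow> 0"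
proof -
  have c: "X j \<in> carrier lim_alg" for j using X by simp
  have "\<exists>l\<in>carrier (A n). (\<lambda>j. dst n (rep (X j) n) l) \<longlonglongrightarrow> 0" for n
  proof (rule A.cauchy_converges)
    show "\<forall>e>0. \<exists>N. \<forall>i\<ge>N. \<forall>j\<ge>N. dst n (rep (X i) n) (rep (X j) n) < e"
      using cauchy rep_dist_le[OF X X] by (meson order_le_less_trans)
  qed (rule rep_mem[OF c])
  then obtain y where y: "\<And>n. y n \<in> carrier (A n)" "\<And>n. (\<lambda>j. dst n (rep (X j) n) (y n)) \<longlonglongrightarrow> 0"
    by metis
  have uniform: "\<exists>N. \<forall>j\<ge>N. \<forall>n. dst n (rep (X j) n) (y n) \<le> e" if e: "0 < e" for e
  proof -
    obtain N where N: "\<forall>i\<ge>N. \<forall>j\<ge>N. ou_dist sa_lim (X i) (X j) < e" using cauchy e by blast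
    have "dst n (rep (X j) n) (y n) \<le> e" if j: "j \<ge> N" for j n
    proof -
      have "dst n (rep (X j) n) (y n) \<le> e + dst n (rep (X (i + N)) n) (y n)" for i
        using A.dist_triangle[OF rep_mem[OF c] rep_mem[OF c] y(1), of n j "i + N"]
          rep_dist_le[OF X X, of n j "i + N"] N[rule_format, OF j, of "i + N"] by simp
      moreover have "(\<lambda>i. e + dst n (rep (X (i + N)) n) (y n)) \<longlonglongrightarrow> e + 0"
        by (intro tendsto_intros LIMSEQ_ignore_initial_segment[OF y(2)])
      ultimately show ?thesis by (intro LIMSEQ_le_const[of _ e]) auto
    qed
    then show ?thesis by blast
  qed
  have "R n (y (Suc n)) = y n" for n
  proof (rule A.limit_unique[OF rep_mem[OF c] retr_mem[OF y(1)] y(1) _ y(2)])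
    show "(\<lambda>j. dst n (rep (X j) n) (R n (y (Suc n)))) \<longlonglongrightarrow> 0"
    proof (rule tendsto_sandwich[OF _ _ tendsto_const y(2)[of "Suc n"]])
      have "dst n (rep (X j) n) (R n (y (Suc n))) \<le> dst (Suc n) (rep (X j) (Suc n)) (y (Suc n))" for j
        using retr_dist[OF rep_mem[OF c] y(1), of n j] by (simp add: rep_retr c)
      then show "\<forall>\<^sub>F j in sequentially. dst n (rep (X j) n) (R n (y (Suc n))) \<le>
          dst (Suc n) (rep (X j) (Suc n)) (y (Suc n))" by simp
    qed (intro always_eventually allI dst_nonneg retr_mem rep_mem c y(1))
  qed
  then have fy: "fixed y" by (simp add: fixed_def)
  have yC: "y \<in> Coh"
  proof (rule cohI[OF y(1)])
    fix e :: real assume e: "0 < e"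
    obtain j where j: "\<forall>n. dst n (rep (X j) n) (y n) \<le> e / 4" using uniform[of "e / 4"] e by auto
    let ?x = "rep (X j)"
    have x: "?x n \<in> carrier (A n)" for n by (rule rep_mem[OF c])
    obtain N where N: "\<forall>n\<ge>N. \<forall>k. dst (n + k) (?x (n + k)) (conn n k (?x n)) < e / 4"
      using cohD[OF rep_props(2)[OF c], of "e / 4"] e by auto
    have "dst (n + k) (y (n + k)) (conn n k (y n)) < e" if n: "n \<ge> N" for n k
    proof -
      have "dst (n + k) (y (n + k)) (conn n k (y n)) \<le>
          dst (n + k) (y (n + k)) (?x (n + k)) + dst (n + k) (?x (n + k)) (conn n k (y n))"
        by (intro A.dist_triangle y(1) x conn_mem)
      moreover have "dst (n + k) (?x (n + k)) (conn n k (y n)) \<le>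
          dst (n + k) (?x (n + k)) (conn n k (?x n)) + dst (n + k) (conn n k (?x n)) (conn n k (y n))"
        by (intro A.dist_triangle y(1) x conn_mem)
      ultimately show ?thesis
        using A.dist_commute[OF y(1) x, of "n + k"] conn_dist[OF x y(1), of n k]
          j[rule_format, of n] j[rule_format, of "n + k"] N[rule_format, OF n, of k] e by linarith
    qed
    then show "\<exists>N. \<forall>n\<ge>N. \<forall>k. dst (n + k) (y (n + k)) (conn n k (y n)) < e" by blast
  qed
  have repY: "rep (cls y) = y" by (rule rep_cls[OF fy yC])
  have Yc: "cls y \<in> carrier lim_alg" by (rule cls_carrier[OF yC])
  have "star (A n) (y n) = y n" for n
  proof (rule A.limit_unique[OF rep_mem[OF c] _ y(1) _ y(2)])
    have "dst n (rep (X j) n) (star (A n) (y n)) = dst n (rep (X j) n) (y n)" for j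
      using A.dist_star[OF rep_mem[OF c] y(1), of n j] rep_sa[OF X, of j n] by simp
    then show "(\<lambda>j. dst n (rep (X j) n) (star (A n) (y n))) \<longlonglongrightarrow> 0" using y(2) by simp
  qed (simp add: y)
  then have Y: "cls y \<in> carrier sa_lim"
    using Yc by (intro sa_limI) (simp_all add: repY)
  have "(\<lambda>j. ou_dist sa_lim (X j) (cls y)) \<longlonglongrightarrow> 0"
  proof (rule LIMSEQ_I)
    fix e :: real assume e: "0 < e"
    obtain N where N: "\<forall>j\<ge>N. \<forall>n. dst n (rep (X j) n) (y n) \<le> e / 2"
      using uniform[of "e / 2"] e by auto
    have "norm (ou_dist sa_lim (X j) (cls y) - 0) < e" if "j \<ge> N" for j
    proof -
      have "\<forall>n. dst n (rep (X j) n) (y n) \<le> e / 2" using N that by blast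
      then have "ou_dist sa_lim (X j) (cls y) \<le> e / 2"
        by (subst lim_dist_le_iff[OF X Y]) (simp add: repY)
      then show ?thesis using e by simp
    qed
    then show "\<exists>N. \<forall>j\<ge>N. norm (ou_dist sa_lim (X j) (cls y) - 0) < e" by blast
  qed
  then show ?thesis using Y by (rule bexI)
qed

lemma emb_sa: "a \<in> sac n \<Longrightarrow> emb n a \<in> carrier sa_lim"
  using emb_star[of a n] by (simp add: emb_mem)

lemma emb_dist:
  assumes a: "a \<in> sac n" and b: "b \<in> sac n" shows "ou_dist sa_lim (emb n a) (emb n b) \<le> dst n a b"
  by (rule lim_dist_le_from[where n = n, OF emb_sa[OF a] emb_sa[OF b]])
    (use a b in \<open>simp add: rep_emb_ge conn_dist\<close>)

lemma emb_pos:
  assumes a: "a \<in> sac n" and pos: "\<And>w. w \<in> Om n \<Longrightarrow> 0 \<le> w a" and v: "v \<in> Om m"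
  shows "0 \<le> v (rep (emb n a) m)"
proof -
  have am: "a \<in> carrier (A n)" using a by simp
  let ?r = "nrm (A n) a" and ?c = "conn n m a"
  obtain u where u: "u \<in> Om (m + n)" "v (rep (emb n a) m) = u (rep (emb n a) (m + n))"
    using state_rep_from[OF emb_mem[OF am] v] by blast
  then have u': "u \<in> Om (n + m)" "v (rep (emb n a) m) = u ?c"
    by (simp_all add: rep_emb_ge[OF am, symmetric] add.commute)
  have r0: "0 \<le> ?r" by (rule A.nrm_nonneg[OF am])
  have "nrm (A n) (complex_of_real ?r \<odot>\<^bsub>A n\<^esub> \<one>\<^bsub>A n\<^esub> \<ominus>\<^bsub>A n\<^esub> a) \<le> ?r"
  proof (rule A.om_norming)
    fix w assume w: "w \<in> Om n"
    then show "\<bar>w (complex_of_real ?r \<odot>\<^bsub>A n\<^esub> \<one>\<^bsub>A n\<^esub> \<ominus>\<^bsub>A n\<^esub> a)\<bar> \<le> ?r"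
      using pos[OF w] A.om_le_nrm[OF w am] am
      by (simp add: A.om_minus A.om_smult A.om_one abs_le_iff)
  qed (use a r0 in \<open>auto simp: A.star_minus A.star_smult A.star_one\<close>)
  then have "nrm (A (n + m)) (conn n m (complex_of_real ?r \<odot>\<^bsub>A n\<^esub> \<one>\<^bsub>A n\<^esub> \<ominus>\<^bsub>A n\<^esub> a)) \<le> ?r"
    using am by (simp add: conn_nrm)
  then have "nrm (A (n + m)) (complex_of_real ?r \<odot>\<^bsub>A (n + m)\<^esub> \<one>\<^bsub>A (n + m)\<^esub> \<ominus>\<^bsub>A (n + m)\<^esub> ?c) \<le> ?r"
    using am by (simp add: conn_minus conn_smult conn_one)
  then have "\<bar>u (complex_of_real ?r \<odot>\<^bsub>A (n + m)\<^esub> \<one>\<^bsub>A (n + m)\<^esub> \<ominus>\<^bsub>A (n + m)\<^esub> ?c)\<bar> \<le> ?r"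
    using A.om_le_nrm[OF u'(1), of "complex_of_real ?r \<odot>\<^bsub>A (n + m)\<^esub> \<one>\<^bsub>A (n + m)\<^esub> \<ominus>\<^bsub>A (n + m)\<^esub> ?c"]
      conn_mem[OF am, of m] by simp
  then show ?thesis
    using u' conn_mem[OF am, of m] by (simp add: A.om_minus A.om_smult A.om_one)
qed

end

section \<open>Lip-norms on inductive limits\<close>

lemma (in state_star_algebra) minus_add_cancel:
  "a \<in> carrier A \<Longrightarrow> b \<in> carrier A \<Longrightarrow> (a \<ominus>\<^bsub>A\<^esub> b) \<oplus>\<^bsub>A\<^esub> b = a"
  by (simp add: a_minus_def a_assoc l_neg)

text \<open>
  The seminorms \<open>l n\<close> below do not increase under the inclusions. The seminorm \<open>S n\<close>, built from
  them as in the definition of the Lip-norm on the limit, then increases along the canonical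
  representative of an element of the limit, and its supremum is the Lip-norm.
\<close>

locale lip_system = retract_system A Om \<alpha> R
  for A :: "nat \<Rightarrow> 'a star_alg" and Om \<alpha> R +
  fixes l :: "nat \<Rightarrow> 'a \<Rightarrow> ereal"
  assumes l_nonneg: "a \<in> carrier (sa (A n)) \<Longrightarrow> 0 \<le> l n a"
    and l_add: "a \<in> carrier (sa (A n)) \<Longrightarrow> b \<in> carrier (sa (A n)) \<Longrightarrow> l n (a \<oplus>\<^bsub>A n\<^esub> b) \<le> l n a + l n b"
    and l_smult_le: "a \<in> carrier (sa (A n)) \<Longrightarrow> l n (complex_of_real r \<odot>\<^bsub>A n\<^esub> a) \<le> ereal \<bar>r\<bar> * l n a"
    and l_one: "l n \<one>\<^bsub>A n\<^esub> = 0"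
    and l_kernel: "a \<in> carrier (sa (A n)) \<Longrightarrow> l n a = 0 \<Longrightarrow> \<exists>r. a = complex_of_real r \<odot>\<^bsub>A n\<^esub> \<one>\<^bsub>A n\<^esub>"
    and l_incl: "a \<in> carrier (sa (A n)) \<Longrightarrow> l (Suc n) (\<alpha> n a) \<le> l n a"
    and l_retr_finite: "a \<in> carrier (sa (A (Suc n))) \<Longrightarrow> l (Suc n) a < \<infinity> \<Longrightarrow> l n (R n a) < \<infinity>"
    and l_dense: "a \<in> carrier (sa (A n)) \<Longrightarrow> 0 < e \<Longrightarrow>
      \<exists>b\<in>carrier (sa (A n)). l n b < \<infinity> \<and> nrm (A n) (a \<ominus>\<^bsub>A n\<^esub> b) < e"
    and l_limit: "\<And>x. (\<And>k. x k \<in> carrier (sa (A n))) \<Longrightarrow> (\<And>k. l n (x k) \<le> M) \<Longrightarrow>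
      a \<in> carrier (sa (A n)) \<Longrightarrow> (\<lambda>k. nrm (A n) (x k \<ominus>\<^bsub>A n\<^esub> a)) \<longlonglongrightarrow> 0 \<Longrightarrow> l n a \<le> M"
    and l_precompact: "0 < e \<Longrightarrow> \<exists>F. finite F \<and> F \<subseteq> carrier (sa (A n)) \<and>
      (\<forall>a\<in>carrier (sa (A n)). l n a \<le> 1 \<longrightarrow>
        (\<exists>f\<in>F. \<exists>r. nrm (A n) (a \<ominus>\<^bsub>A n\<^esub> (f \<oplus>\<^bsub>A n\<^esub> complex_of_real r \<odot>\<^bsub>A n\<^esub> \<one>\<^bsub>A n\<^esub>)) \<le> e))"
begin

primrec S :: "nat \<Rightarrow> 'a \<Rightarrow> ereal" where
  "S 0 a = l 0 a"
| "S (Suc n) a = max (l (Suc n) a)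
    (max (S n (R n a)) (ereal (2 ^ Suc n * dst (Suc n) a (\<alpha> n (R n a)))))"

definition Llim :: "(nat \<Rightarrow> 'a) set \<Rightarrow> ereal" where
  "Llim X = (SUP n. S n (rep X n))"

lemma retr_sa: "a \<in> sac (Suc n) \<Longrightarrow> R n a \<in> sac n"
  using retr_star[of a n] by (simp add: retr_mem)

lemma incl_sa: "a \<in> sac n \<Longrightarrow> \<alpha> n a \<in> sac (Suc n)"
  using incl_star[of a n] by (simp add: incl_mem)

lemma conn_sa: "a \<in> sac n \<Longrightarrow> conn n k a \<in> sac (n + k)"
  using conn_star[of a n k] by (simp add: conn_mem)

lemma add_sa: "a \<in> sac n \<Longrightarrow> b \<in> sac n \<Longrightarrow> a \<oplus>\<^bsub>A n\<^esub> b \<in> sac n"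
  by (simp add: A.star_add)

lemma smult_sa: "a \<in> sac n \<Longrightarrow> complex_of_real r \<odot>\<^bsub>A n\<^esub> a \<in> sac n"
  by (simp add: A.star_smult)

lemma one_sa: "\<one>\<^bsub>A n\<^esub> \<in> sac n"
  by (simp add: A.star_one)

lemma gap_mem: "a \<in> sac (Suc n) \<Longrightarrow> a \<in> carrier (A (Suc n)) \<and> \<alpha> n (R n a) \<in> carrier (A (Suc n))"
  by (simp add: incl_mem retr_mem)

lemma S_parts:
  "l (Suc n) a \<le> S (Suc n) a" "S n (R n a) \<le> S (Suc n) a"
  "ereal (2 ^ Suc n * dst (Suc n) a (\<alpha> n (R n a))) \<le> S (Suc n) a"
  by (simp_all add: le_max_iff_disj)

lemma S_leI:
  "l (Suc n) a \<le> c \<Longrightarrow> S n (R n a) \<le> c \<Longrightarrow> ereal (2 ^ Suc n * dst (Suc n) a (\<alpha> n (R n a))) \<le> c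
    \<Longrightarrow> S (Suc n) a \<le> c"
  by simp

lemma l_le_S: "l n a \<le> S n a"
  by (cases n) (auto simp: le_max_iff_disj)

lemma S_nonneg: "a \<in> sac n \<Longrightarrow> 0 \<le> S n a"
  using l_nonneg l_le_S order.trans by blast

lemma S_add: "a \<in> sac n \<Longrightarrow> b \<in> sac n \<Longrightarrow> S n (a \<oplus>\<^bsub>A n\<^esub> b) \<le> S n a + S n b"
proof (induction n arbitrary: a b)
  case 0
  then show ?case by (simp only: S.simps(1) l_add)
next
  case (Suc n)
  have m: "a \<in> carrier (A (Suc n))" "b \<in> carrier (A (Suc n))" using Suc.prems by auto
  show ?case
  proof (rule S_leI)
    show "l (Suc n) (a \<oplus>\<^bsub>A (Suc n)\<^esub> b) \<le> S (Suc n) a + S (Suc n) b"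
      using l_add[OF Suc.prems] add_mono[OF S_parts(1) S_parts(1)] by (rule order.trans)
    have "S n (R n a \<oplus>\<^bsub>A n\<^esub> R n b) \<le> S n (R n a) + S n (R n b)"
      by (intro Suc.IH retr_sa Suc.prems)
    then show "S n (R n (a \<oplus>\<^bsub>A (Suc n)\<^esub> b)) \<le> S (Suc n) a + S (Suc n) b"
      using add_mono[OF S_parts(2)[of n a] S_parts(2)[of n b]] m
      by (simp only: retr_add)
    have "dst (Suc n) (a \<oplus>\<^bsub>A (Suc n)\<^esub> b) (\<alpha> n (R n (a \<oplus>\<^bsub>A (Suc n)\<^esub> b))) \<le>
        dst (Suc n) a (\<alpha> n (R n a)) + dst (Suc n) b (\<alpha> n (R n b))"
      using A.dist_add[OF m(1) m(2), of "\<alpha> n (R n a)" "\<alpha> n (R n b)"] m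
      by (simp add: retr_add incl_add retr_mem incl_mem)
    then have "2 ^ Suc n * dst (Suc n) (a \<oplus>\<^bsub>A (Suc n)\<^esub> b) (\<alpha> n (R n (a \<oplus>\<^bsub>A (Suc n)\<^esub> b))) \<le>
        2 ^ Suc n * (dst (Suc n) a (\<alpha> n (R n a)) + dst (Suc n) b (\<alpha> n (R n b)))"
      by (rule mult_left_mono) simp
    then have "ereal (2 ^ Suc n * dst (Suc n) (a \<oplus>\<^bsub>A (Suc n)\<^esub> b) (\<alpha> n (R n (a \<oplus>\<^bsub>A (Suc n)\<^esub> b)))) \<le>
        ereal (2 ^ Suc n * dst (Suc n) a (\<alpha> n (R n a))) +
        ereal (2 ^ Suc n * dst (Suc n) b (\<alpha> n (R n b)))"
      by (simp add: distrib_left)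
    then show "ereal (2 ^ Suc n * dst (Suc n) (a \<oplus>\<^bsub>A (Suc n)\<^esub> b) (\<alpha> n (R n (a \<oplus>\<^bsub>A (Suc n)\<^esub> b))))
        \<le> S (Suc n) a + S (Suc n) b"
      using add_mono[OF S_parts(3)[of n a] S_parts(3)[of n b]] by (rule order.trans)
  qed
qed

lemma S_smult_le: "a \<in> sac n \<Longrightarrow> S n (complex_of_real r \<odot>\<^bsub>A n\<^esub> a) \<le> ereal \<bar>r\<bar> * S n a"
proof (induction n arbitrary: a)
  case 0
  then show ?case by (simp only: S.simps(1) l_smult_le)
next
  case (Suc n)
  have m: "a \<in> carrier (A (Suc n))" using Suc.prems by auto
  have mono: "x \<le> S (Suc n) a \<Longrightarrow> ereal \<bar>r\<bar> * x \<le> ereal \<bar>r\<bar> * S (Suc n) a" for x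
    by (rule ereal_mult_left_mono) auto
  show ?case
  proof (rule S_leI)
    show "l (Suc n) (complex_of_real r \<odot>\<^bsub>A (Suc n)\<^esub> a) \<le> ereal \<bar>r\<bar> * S (Suc n) a"
      using l_smult_le[OF Suc.prems] mono[OF S_parts(1)] by (rule order.trans)
    have "S n (complex_of_real r \<odot>\<^bsub>A n\<^esub> R n a) \<le> ereal \<bar>r\<bar> * S n (R n a)"
      by (intro Suc.IH retr_sa Suc.prems)
    then show "S n (R n (complex_of_real r \<odot>\<^bsub>A (Suc n)\<^esub> a)) \<le> ereal \<bar>r\<bar> * S (Suc n) a"
      using mono[OF S_parts(2)] m by (simp only: retr_smult)
    have "dst (Suc n) (complex_of_real r \<odot>\<^bsub>A (Suc n)\<^esub> a)
        (\<alpha> n (R n (complex_of_real r \<odot>\<^bsub>A (Suc n)\<^esub> a))) = \<bar>r\<bar> * dst (Suc n) a (\<alpha> n (R n a))"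
      using A.dist_smult[OF m, of "\<alpha> n (R n a)" "complex_of_real r"] m
      by (simp add: retr_smult incl_smult retr_mem incl_mem)
    then have "ereal (2 ^ Suc n * dst (Suc n) (complex_of_real r \<odot>\<^bsub>A (Suc n)\<^esub> a)
        (\<alpha> n (R n (complex_of_real r \<odot>\<^bsub>A (Suc n)\<^esub> a)))) =
        ereal \<bar>r\<bar> * ereal (2 ^ Suc n * dst (Suc n) a (\<alpha> n (R n a)))" by simp
    then show "ereal (2 ^ Suc n * dst (Suc n) (complex_of_real r \<odot>\<^bsub>A (Suc n)\<^esub> a)
        (\<alpha> n (R n (complex_of_real r \<odot>\<^bsub>A (Suc n)\<^esub> a)))) \<le> ereal \<bar>r\<bar> * S (Suc n) a"
      using mono[OF S_parts(3)[of n a]] by (simp only:)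
  qed
qed

lemma retr_one: "R n \<one>\<^bsub>A (Suc n)\<^esub> = \<one>\<^bsub>A n\<^esub>"
  using retr_incl[of "\<one>\<^bsub>A n\<^esub>" n] by (simp add: incl_one)

lemma S_one: "S n \<one>\<^bsub>A n\<^esub> = 0"
  by (induction n) (simp_all add: l_one retr_one incl_one zero_ereal_def[symmetric])

lemma S_incl: assumes a: "a \<in> sac n" shows "S (Suc n) (\<alpha> n a) \<le> S n a"
proof (rule S_leI)
  have am: "a \<in> carrier (A n)" using a by simp
  show "l (Suc n) (\<alpha> n a) \<le> S n a" using l_incl[OF a] l_le_S by (rule order.trans)
  show "S n (R n (\<alpha> n a)) \<le> S n a" using am by (simp add: retr_incl)
  show "ereal (2 ^ Suc n * dst (Suc n) (\<alpha> n a) (\<alpha> n (R n (\<alpha> n a)))) \<le> S n a"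
    using am S_nonneg[OF a] by (simp add: retr_incl incl_mem zero_ereal_def[symmetric])
qed

lemma S_conn: "a \<in> sac n \<Longrightarrow> S (n + k) (conn n k a) \<le> S n a"
proof (induction k)
  case (Suc k)
  have "S (Suc (n + k)) (\<alpha> (n + k) (conn n k a)) \<le> S (n + k) (conn n k a)"
    by (rule S_incl[OF conn_sa[OF Suc.prems]])
  then show ?case using Suc by (simp del: S.simps)
qed simp

lemma S_down: "a \<in> sac (n + k) \<Longrightarrow> S n (down n k a) \<le> S (n + k) a"
proof (induction k arbitrary: a)
  case (Suc k)
  then have "S n (down n k (R (n + k) a)) \<le> S (n + k) (R (n + k) a)"
    by (intro Suc.IH retr_sa) (simp del: sa_simps)
  also have "\<dots> \<le> S (Suc (n + k)) a" by (rule S_parts(2))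
  finally show ?case by (simp del: S.simps)
qed simp

lemma S_finite: "a \<in> sac n \<Longrightarrow> l n a < \<infinity> \<Longrightarrow> S n a < \<infinity>"
proof (induction n arbitrary: a)
  case (Suc n)
  then have "S n (R n a) < \<infinity>" by (intro Suc.IH retr_sa l_retr_finite)
  then show ?case using Suc.prems unfolding S.simps max_less_iff_conj by simp
qed simp

lemma S_limit:
  assumes "\<And>k. x k \<in> sac n" "\<And>k. S n (x k) \<le> M" "a \<in> sac n" "(\<lambda>k. dst n (x k) a) \<longlonglongrightarrow> 0"
  shows "S n a \<le> M"
  using assms
proof (induction n arbitrary: x a)
  case 0
  show ?case
    using l_limit[of x 0 M a] 0 by (simp only: S.simps)
next
  case (Suc n)
  have xm: "x k \<in> carrier (A (Suc n))" and am: "a \<in> carrier (A (Suc n))" for k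
    using Suc.prems(1)[of k] Suc.prems(3) by auto
  have R: "(\<lambda>k. dst n (R n (x k)) (R n a)) \<longlonglongrightarrow> 0"
    by (rule tendsto_sandwich[OF _ _ tendsto_const Suc.prems(4)])
      (intro always_eventually allI dst_nonneg retr_mem xm am retr_dist)+
  show ?case
  proof (rule S_leI)
    show "l (Suc n) a \<le> M"
      using Suc.prems S_parts(1) by (intro l_limit[of x "Suc n" M a]) (blast intro: order.trans)+
    show "S n (R n a) \<le> M"
    proof (rule Suc.IH[of "\<lambda>k. R n (x k)"])
      show "S n (R n (x k)) \<le> M" for k using S_parts(2) Suc.prems(2)[of k] by (rule order.trans)
    qed (intro retr_sa Suc.prems R)+
    let ?g = "\<lambda>b. dst (Suc n) b (\<alpha> n (R n b))"
    have gm: "\<alpha> n (R n b) \<in> carrier (A (Suc n))" if "b \<in> carrier (A (Suc n))" for b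
      using that by (simp add: retr_mem incl_mem)
    have g: "?g a \<le> ?g (x k) + 2 * dst (Suc n) (x k) a" for k
    proof -
      have "dst (Suc n) (\<alpha> n (R n (x k))) (\<alpha> n (R n a)) = dst n (R n (x k)) (R n a)"
        using incl_nrm[of "R n (x k) \<ominus>\<^bsub>A n\<^esub> R n a" n] by (simp add: incl_minus retr_mem xm am)
      then have "dst (Suc n) (\<alpha> n (R n (x k))) (\<alpha> n (R n a)) \<le> dst (Suc n) (x k) a"
        using retr_dist[OF xm am, of k] by simp
      then show ?thesis
        using A.dist_triangle[OF am xm gm[OF am], of k]
          A.dist_triangle[OF xm gm[OF xm] gm[OF am], of k k] A.dist_commute[OF am xm, of k]
        by linarith
    qed
    show "ereal (2 ^ Suc n * ?g a) \<le> M"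
    proof (cases M)
      case (real m)
      have "2 ^ Suc n * ?g (x k) \<le> m" for k
        using order.trans[OF S_parts(3) Suc.prems(2), of k] real by simp
      moreover have "2 ^ Suc n * ?g a \<le> 2 ^ Suc n * ?g (x k) + 2 ^ Suc n * (2 * dst (Suc n) (x k) a)" for k
        unfolding distrib_left[symmetric] by (rule mult_left_mono[OF g]) simp
      ultimately have "2 ^ Suc n * ?g a \<le> m + 2 ^ Suc n * (2 * dst (Suc n) (x k) a)" for k
        by (meson add_right_mono order.trans)
      moreover have "(\<lambda>k. m + 2 ^ Suc n * (2 * dst (Suc n) (x k) a)) \<longlonglongrightarrow> m + 2 ^ Suc n * (2 * 0)"
        by (intro tendsto_intros Suc.prems(4))
      ultimately have "2 ^ Suc n * ?g a \<le> m + 2 ^ Suc n * (2 * 0)"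
        by (intro LIMSEQ_le_const) auto
      then show ?thesis using real by simp
    next
      case MInf
      then show ?thesis using Suc.prems(2)[of 0] S_nonneg[OF Suc.prems(1), of 0] by simp
    qed simp
  qed
qed

lemma S_rep_mono: "X \<in> carrier sa_lim \<Longrightarrow> S n (rep X n) \<le> S (n + k) (rep X (n + k))"
  using S_down[OF rep_sa, of X n k] fixed_down[OF rep_props(1), of X n k] by simp

lemma S_rep_le: "S n (rep X n) \<le> Llim X"
  unfolding Llim_def by (rule SUP_upper) simp

lemma Llim_leI: "(\<And>n. S n (rep X n) \<le> c) \<Longrightarrow> Llim X \<le> c"
  unfolding Llim_def by (rule SUP_least) simp

lemma Llim_le_from:
  assumes X: "X \<in> carrier sa_lim" and le: "\<And>k. S (n + k) (rep X (n + k)) \<le> c"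
  shows "Llim X \<le> c"
proof (rule Llim_leI)
  fix m
  show "S m (rep X m) \<le> c" using S_rep_mono[OF X, of m n] le[of m] by (simp add: add.commute)
qed

lemma Llim_emb: assumes a: "a \<in> sac n" shows "Llim (emb n a) \<le> S n a"
  by (rule Llim_le_from[OF emb_sa[OF a], of n]) (use a S_conn[OF a] in \<open>simp add: rep_emb_ge\<close>)

text \<open>
  The canonical approximants of an element of the unit ball converge geometrically, since the last
  term in the definition of \<open>S\<close> bounds the distance of consecutive ones.
\<close>

lemma dist_emb_rep:
  assumes X: "X \<in> carrier sa_lim" "Llim X \<le> 1"
  shows "ou_dist sa_lim X (emb n (rep X n)) \<le> (1 / 2) ^ n"
proof (rule lim_dist_le_from[where n = n])
  have Xc: "X \<in> carrier lim_alg" using X by simp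
  have m: "rep X n \<in> carrier (A n)" for n by (rule rep_mem[OF Xc])
  have step: "dst (Suc j) (rep X (Suc j)) (\<alpha> j (rep X j)) \<le> (1 / 2) ^ Suc j" for j
  proof -
    have "ereal (2 ^ Suc j * dst (Suc j) (rep X (Suc j)) (\<alpha> j (rep X j))) \<le> 1"
      using S_parts(3)[of j "rep X (Suc j)"] S_rep_le[of "Suc j" X] X(2) by (simp only: rep_retr[OF Xc])
    then have "2 ^ Suc j * dst (Suc j) (rep X (Suc j)) (\<alpha> j (rep X j)) \<le> 1"
      by (simp only: ereal_less_eq one_ereal_def)
    then have "dst (Suc j) (rep X (Suc j)) (\<alpha> j (rep X j)) \<le> 1 / 2 ^ Suc j"
      by (simp only: pos_le_divide_eq zero_less_power zero_less_numeral mult.commute)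
    then show ?thesis by (simp add: power_one_over)
  qed
  show "dst (n + k) (rep X (n + k)) (rep (emb n (rep X n)) (n + k)) \<le> (1 / 2) ^ n" for k
  proof -
    have "dst (n + k) (rep X (n + k)) (conn n k (rep X n)) \<le> (1 / 2) ^ n - (1 / 2) ^ (n + k)"
    proof (induction k)
      case (Suc k)
      let ?j = "n + k"
      have c: "conn n k (rep X n) \<in> carrier (A ?j)" by (rule conn_mem[OF m])
      have eq: "dst (Suc ?j) (\<alpha> ?j (rep X ?j)) (\<alpha> ?j (conn n k (rep X n))) =
          dst ?j (rep X ?j) (conn n k (rep X n))"
        using incl_nrm[of "rep X ?j \<ominus>\<^bsub>A ?j\<^esub> conn n k (rep X n)" ?j] by (simp add: incl_minus m c)
      have "dst (Suc ?j) (rep X (Suc ?j)) (\<alpha> ?j (conn n k (rep X n))) \<le>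
          (1 / 2) ^ Suc ?j + ((1 / 2) ^ n - (1 / 2) ^ ?j)"
      proof -
        have "dst (Suc ?j) (rep X (Suc ?j)) (\<alpha> ?j (conn n k (rep X n))) \<le>
            dst (Suc ?j) (rep X (Suc ?j)) (\<alpha> ?j (rep X ?j)) +
            dst (Suc ?j) (\<alpha> ?j (rep X ?j)) (\<alpha> ?j (conn n k (rep X n)))"
          by (intro A.dist_triangle m incl_mem c)
        then show ?thesis using step[of ?j] Suc eq by linarith
      qed
      also have "\<dots> = (1 / 2) ^ n - (1 / 2) ^ (n + Suc k)" by simp
      finally show ?case by simp
    qed (simp add: m)
    moreover have "0 \<le> (1 / 2 :: real) ^ (n + k)" by simp
    ultimately have "dst (n + k) (rep X (n + k)) (conn n k (rep X n)) \<le> (1 / 2) ^ n" by linarith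
    then show ?thesis by (simp only: rep_emb_ge[OF m])
  qed
qed (intro X emb_sa rep_sa)+

lemma lip_space_lim: "lip_space sa_lim lim_states Llim"
proof
  show "\<exists>Y\<in>carrier sa_lim. (\<lambda>j. ou_dist sa_lim (X j) Y) \<longlonglongrightarrow> 0"
    if "\<And>n. X n \<in> carrier sa_lim" "\<forall>e>0. \<exists>N. \<forall>m\<ge>N. \<forall>n\<ge>N. ou_dist sa_lim (X m) (X n) < e" for X
    using that by (rule lim_cauchy_converges)
next
  fix X assume X: "X \<in> carrier sa_lim"
  have Xc: "X \<in> carrier lim_alg" using X by simp
  show "0 \<le> Llim X" using S_nonneg[OF rep_sa[OF X]] S_rep_le by (rule order.trans)
  show "Llim (r \<odot>\<^bsub>sa_lim\<^esub> X) \<le> ereal \<bar>r\<bar> * Llim X" for r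
  proof (rule Llim_leI)
    fix n
    have "S n (rep (r \<odot>\<^bsub>sa_lim\<^esub> X) n) \<le> ereal \<bar>r\<bar> * S n (rep X n)"
      using S_smult_le[OF rep_sa[OF X]] by (simp add: lim_smult Xc)
    also have "\<dots> \<le> ereal \<bar>r\<bar> * Llim X" by (rule ereal_mult_left_mono[OF S_rep_le]) simp
    finally show "S n (rep (r \<odot>\<^bsub>sa_lim\<^esub> X) n) \<le> ereal \<bar>r\<bar> * Llim X" .
  qed
  show "\<exists>Y\<in>carrier sa_lim. Llim Y < \<infinity> \<and> ou_dist sa_lim X Y < e" if e: "0 < e" for e
  proof -
    obtain n where "norm (nrm lim_alg (emb n (rep X n) \<ominus>\<^bsub>lim_alg\<^esub> X) - 0) < e / 2"
      using LIMSEQ_D[OF dist_emb_tendsto[OF Xc], of "e / 2"] e by auto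
    then have near: "ou_dist sa_lim (emb n (rep X n)) X < e / 2"
      using lim_dist_eq_nrm[OF emb_sa[OF rep_sa[OF X]] X, of n] by simp
    obtain b where b: "b \<in> sac n" "l n b < \<infinity>" "dst n (rep X n) b < e / 2"
      using l_dense[OF rep_sa[OF X], of "e / 2" n] e by (metis half_gt_zero)
    have "ou_dist sa_lim X (emb n b) \<le>
        ou_dist sa_lim X (emb n (rep X n)) + ou_dist sa_lim (emb n (rep X n)) (emb n b)"
      by (intro E.M.triangle X emb_sa rep_sa b)
    then have "ou_dist sa_lim X (emb n b) < e"
      using emb_dist[OF rep_sa[OF X] b(1)] near b(3) E.M.commute[of X] by simp
    moreover have "Llim (emb n b) < \<infinity>" using Llim_emb[OF b(1)] S_finite[OF b(1,2)] by (rule order.strict_trans1)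
    ultimately show ?thesis using emb_sa[OF b(1)] by blast
  qed
  show "\<exists>r. X = r \<odot>\<^bsub>sa_lim\<^esub> \<one>\<^bsub>sa_lim\<^esub>" if L0: "Llim X = 0"
  proof -
    have S0: "S n (rep X n) \<le> 0" for n using S_rep_le[of n X] L0 by simp
    have "l 0 (rep X 0) = 0"
      using S0[of 0] l_nonneg[OF rep_sa[OF X], of 0] by (simp add: antisym)
    then obtain r where r: "rep X 0 = complex_of_real r \<odot>\<^bsub>A 0\<^esub> \<one>\<^bsub>A 0\<^esub>"
      using l_kernel[OF rep_sa[OF X]] by blast
    have "rep X n = complex_of_real r \<odot>\<^bsub>A n\<^esub> \<one>\<^bsub>A n\<^esub>" for n
    proof (induction n)
      case (Suc n)
      have m: "rep X (Suc n) \<in> carrier (A (Suc n))" "\<alpha> n (rep X n) \<in> carrier (A (Suc n))"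
        by (simp_all add: rep_mem Xc incl_mem)
      have "ereal (2 ^ Suc n * dst (Suc n) (rep X (Suc n)) (\<alpha> n (rep X n))) \<le> 0"
        using order.trans[OF S_parts(3) S0] by (simp only: rep_retr[OF Xc])
      then have "2 ^ Suc n * dst (Suc n) (rep X (Suc n)) (\<alpha> n (rep X n)) \<le> 0"
        by (simp only: zero_ereal_def ereal_less_eq)
      moreover have "0 < (2 :: real) ^ Suc n" by simp
      ultimately have "dst (Suc n) (rep X (Suc n)) (\<alpha> n (rep X n)) \<le> 0"
        by (meson mult_pos_pos not_le)
      then have "dst (Suc n) (rep X (Suc n)) (\<alpha> n (rep X n)) = 0"
        using dst_nonneg[OF m] by (rule antisym)
      then have "rep X (Suc n) = \<alpha> n (rep X n)" by (rule A.dist_zero_imp[OF m])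
      then show ?case using Suc by (simp add: incl_smult incl_one)
    qed (rule r)
    then have "X = complex_of_real r \<odot>\<^bsub>lim_alg\<^esub> \<one>\<^bsub>lim_alg\<^esub>"
      by (intro rep_ext) (simp_all add: Xc lim_smult lim_one)
    then show ?thesis by (intro exI[of _ r]) simp
  qed
  fix Y assume Y: "Y \<in> carrier sa_lim"
  have Yc: "Y \<in> carrier lim_alg" using Y by simp
  show "Llim (X \<oplus>\<^bsub>sa_lim\<^esub> Y) \<le> Llim X + Llim Y"
  proof (rule Llim_leI)
    fix n
    have "S n (rep (X \<oplus>\<^bsub>sa_lim\<^esub> Y) n) \<le> S n (rep X n) + S n (rep Y n)"
      using S_add[OF rep_sa[OF X] rep_sa[OF Y]] by (simp add: lim_add Xc Yc)
    also have "\<dots> \<le> Llim X + Llim Y" by (intro add_mono S_rep_le)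
    finally show "S n (rep (X \<oplus>\<^bsub>sa_lim\<^esub> Y) n) \<le> Llim X + Llim Y" .
  qed
next
  show "Llim \<one>\<^bsub>sa_lim\<^esub> = 0" unfolding Llim_def by (simp add: lim_one S_one)
next
  fix X Y assume X: "\<And>j. X j \<in> carrier sa_lim" "\<And>j. Llim (X j) \<le> 1" and Y: "Y \<in> carrier sa_lim"
    and lim: "(\<lambda>j. ou_dist sa_lim (X j) Y) \<longlonglongrightarrow> 0"
  show "Llim Y \<le> 1"
  proof (rule Llim_leI)
    fix n
    show "S n (rep Y n) \<le> 1"
    proof (rule S_limit[of "\<lambda>j. rep (X j) n"])
      show "S n (rep (X j) n) \<le> 1" for j using S_rep_le X(2) by (rule order.trans)
      have Xc: "X j \<in> carrier lim_alg" "Y \<in> carrier lim_alg" for j using X(1)[of j] Y by auto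
      show "(\<lambda>j. dst n (rep (X j) n) (rep Y n)) \<longlonglongrightarrow> 0"
        by (rule tendsto_sandwich[OF _ _ tendsto_const lim])
          (intro always_eventually allI dst_nonneg rep_mem Xc rep_dist_le X(1) Y)+
    qed (intro rep_sa X Y)+
  qed
next
  fix e :: real assume e: "0 < e"
  obtain n where n: "(1 / 2 :: real) ^ n < e / 2"
    using real_arch_pow_inv[of "e / 2" "1 / 2"] e by auto
  obtain F where F: "finite F" "F \<subseteq> sac n" "\<And>a. a \<in> sac n \<Longrightarrow> l n a \<le> 1 \<Longrightarrow>
      \<exists>f\<in>F. \<exists>r. dst n a (f \<oplus>\<^bsub>A n\<^esub> complex_of_real r \<odot>\<^bsub>A n\<^esub> \<one>\<^bsub>A n\<^esub>) \<le> e / 2"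
    using l_precompact[of "e / 2" n] e by (metis half_gt_zero)
  have "\<exists>f\<in>emb n ` F. \<exists>r. ou_dist sa_lim X (f \<oplus>\<^bsub>sa_lim\<^esub> r \<odot>\<^bsub>sa_lim\<^esub> \<one>\<^bsub>sa_lim\<^esub>) \<le> e"
    if X: "X \<in> carrier sa_lim" "Llim X \<le> 1" for X
  proof -
    have "l n (rep X n) \<le> 1" using order.trans[OF l_le_S order.trans[OF S_rep_le X(2)]] .
    then obtain f r where f: "f \<in> F" "dst n (rep X n) (f \<oplus>\<^bsub>A n\<^esub> complex_of_real r \<odot>\<^bsub>A n\<^esub> \<one>\<^bsub>A n\<^esub>) \<le> e / 2"
      using F(3)[OF rep_sa[OF X(1)]] by blast
    let ?g = "f \<oplus>\<^bsub>A n\<^esub> complex_of_real r \<odot>\<^bsub>A n\<^esub> \<one>\<^bsub>A n\<^esub>"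
    have fs: "f \<in> sac n" using F f by blast
    then have fm: "f \<in> carrier (A n)" by simp
    have g: "?g \<in> sac n" by (intro add_sa smult_sa one_sa fs)
    have eq: "emb n ?g = emb n f \<oplus>\<^bsub>sa_lim\<^esub> r \<odot>\<^bsub>sa_lim\<^esub> \<one>\<^bsub>sa_lim\<^esub>"
      using fm by (simp add: emb_add emb_smult emb_one)
    have "ou_dist sa_lim X (emb n ?g) \<le>
        ou_dist sa_lim X (emb n (rep X n)) + ou_dist sa_lim (emb n (rep X n)) (emb n ?g)"
      by (intro E.M.triangle X emb_sa rep_sa g)
    also have "\<dots> \<le> e / 2 + e / 2"
      using dist_emb_rep[OF X, of n] n emb_dist[OF rep_sa[OF X(1)] g] f(2) by linarith
    finally show ?thesis using f(1) eq by (intro bexI[of _ "emb n f"] exI[of _ r]) simp_all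
  qed
  then show "\<exists>F. finite F \<and> F \<subseteq> carrier sa_lim \<and> (\<forall>X\<in>carrier sa_lim. Llim X \<le> 1 \<longrightarrow>
      (\<exists>f\<in>F. \<exists>r. ou_dist sa_lim X (f \<oplus>\<^bsub>sa_lim\<^esub> r \<odot>\<^bsub>sa_lim\<^esub> \<one>\<^bsub>sa_lim\<^esub>) \<le> e))"
    using F emb_sa by (intro exI[of _ "emb n ` F"]) blast
qed

text \<open>
  The infimum over approximating sequences in the definition of the Lip-norm of the limit is
  attained at the canonical representative.
\<close>

lemma Llim_eq_INF:
  assumes X: "X \<in> carrier sa_lim"
  shows "(INF s \<in> {s. (\<forall>n. s n \<in> sac n) \<and>
      (\<lambda>n. nrm lim_alg (emb n (s n) \<ominus>\<^bsub>lim_alg\<^esub> X)) \<longlonglongrightarrow> 0}.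
    SUP n. max (S n (s n)) (ereal (dst (Suc n) (s (Suc n)) (\<alpha> n (s n)) / (4 * bridge_bound n)))) = Llim X"
    (is "(INF s \<in> ?seqs. SUP n. ?f s n) = _")
proof (rule antisym)
  have Xc: "X \<in> carrier lim_alg" using X by simp
  have "?f (rep X) n \<le> Llim X" for n
  proof -
    let ?d = "dst (Suc n) (rep X (Suc n)) (\<alpha> n (rep X n))"
    have "0 \<le> ?d" by (intro dst_nonneg incl_mem rep_mem Xc)
    then have "?d / (4 * bridge_bound n) \<le> 2 ^ Suc n * ?d"
      by (simp add: bridge_bound_def power_one_over field_simps)
    then have "ereal (?d / (4 * bridge_bound n)) \<le> ereal (2 ^ Suc n * ?d)" by simp
    also have "\<dots> \<le> S (Suc n) (rep X (Suc n))"
      using S_parts(3)[of n "rep X (Suc n)"] by (simp only: rep_retr[OF Xc])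
    also have "\<dots> \<le> Llim X" by (rule S_rep_le)
    finally show ?thesis using S_rep_le[of n X] by simp
  qed
  then show "(INF s \<in> ?seqs. SUP n. ?f s n) \<le> Llim X"
    using rep_sa[OF X] dist_emb_tendsto[OF Xc]
    by (intro INF_lower2[of "rep X"] SUP_least) (auto simp del: sa_simps)
  show "Llim X \<le> (INF s \<in> ?seqs. SUP n. ?f s n)"
  proof (rule INF_greatest)
    fix s assume "s \<in> ?seqs"
    then have s: "\<And>n. s n \<in> sac n" and lim: "(\<lambda>n. nrm lim_alg (emb n (s n) \<ominus>\<^bsub>lim_alg\<^esub> X)) \<longlonglongrightarrow> 0"
      by auto
    let ?M = "SUP n. ?f s n"
    have sm: "s n \<in> carrier (A n)" for n using s[of n] by simp
    have SM: "S n (s n) \<le> ?M" for n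
      by (rule SUP_upper2[of n]) (simp_all add: le_max_iff_disj)
    show "Llim X \<le> ?M"
    proof (rule Llim_leI, rule S_limit)
      fix n
      show "down n k (s (n + k)) \<in> sac n" for k
        using s[of "n + k"] down_star[OF sm, of n k] by (simp add: down_mem)
      show "S n (down n k (s (n + k))) \<le> ?M" for k
        using S_down[OF s, of n k] SM by (rule order.trans)
      show "rep X n \<in> sac n" by (rule rep_sa[OF X])
      have "dst n (down n k (s (n + k))) (rep X n) \<le> nrm lim_alg (emb (k + n) (s (k + n)) \<ominus>\<^bsub>lim_alg\<^esub> X)" for k
      proof -
        let ?Z = "emb (n + k) (s (n + k)) \<ominus>\<^bsub>lim_alg\<^esub> X"
        have "dst n (down n k (s (n + k))) (rep X n) \<le> dst (n + k) (s (n + k)) (rep X (n + k))"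
          using down_dist[OF sm rep_mem[OF Xc], of n k] by (simp add: fixed_down rep_props(1)[OF Xc])
        also have "\<dots> = nrm (A (n + k)) (rep ?Z (n + k))"
          by (simp add: lim_minus emb_mem sm Xc rep_emb)
        also have "\<dots> \<le> nrm lim_alg ?Z" by (intro nrm_rep_le lim_minus emb_mem sm Xc)
        finally show ?thesis by (simp add: add.commute)
      qed
      then show "(\<lambda>k. dst n (down n k (s (n + k))) (rep X n)) \<longlonglongrightarrow> 0"
        by (intro tendsto_sandwich[OF _ _ tendsto_const LIMSEQ_ignore_initial_segment[OF lim, of n]])
          (auto intro!: always_eventually dst_nonneg down_mem rep_mem sm Xc)
    qed
  qed
qed

end

section \<open>Limits of systems that agree on an initial segment\<close>

locale lip_systems_agree =
  L1: lip_system A1 Om1 \<alpha>1 R1 l1 + L2: lip_system A2 Om2 \<alpha>2 R2 l2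
  for A1 :: "nat \<Rightarrow> 'a star_alg" and Om1 \<alpha>1 R1 l1
    and A2 :: "nat \<Rightarrow> 'a star_alg" and Om2 \<alpha>2 R2 l2 +
  fixes n :: nat
  assumes A_eq: "A1 n = A2 n" and Om_eq: "Om1 n = Om2 n"
    and S_eq: "a \<in> carrier (sa (A1 n)) \<Longrightarrow> L1.S n a = L2.S n a"
begin

abbreviation "P \<equiv> \<lambda>X. L2.emb n (L1.rep X n)"
abbreviation "Q \<equiv> \<lambda>X. L1.emb n (L2.rep X n)"

lemma unital_positive_P: "unital_positive L1.sa_lim L1.lim_states L2.sa_lim L2.lim_states P"
proof (rule unital_positive.intro[OF L1.state_separated_lim L2.state_separated_lim
      unital_positive_axioms.intro])
  have m: "L1.rep X n \<in> carrier (sa (A2 n))" if "X \<in> carrier L1.sa_lim" for X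
    using L1.rep_sa[OF that, of n] unfolding A_eq .
  then have m': "L1.rep X n \<in> carrier (A2 n)" if "X \<in> carrier L1.sa_lim" for X
    using that by simp
  show mem: "P X \<in> carrier L2.sa_lim" if "X \<in> carrier L1.sa_lim" for X
    by (rule L2.emb_sa[OF m[OF that]])
  show "P (X \<oplus>\<^bsub>L1.sa_lim\<^esub> Y) = P X \<oplus>\<^bsub>L2.sa_lim\<^esub> P Y"
    if "X \<in> carrier L1.sa_lim" "Y \<in> carrier L1.sa_lim" for X Y
    using that m'[OF that(1)] m'[OF that(2)] by (simp add: L1.lim_add A_eq L2.emb_add)
  show "P (r \<odot>\<^bsub>L1.sa_lim\<^esub> X) = r \<odot>\<^bsub>L2.sa_lim\<^esub> P X" if "X \<in> carrier L1.sa_lim" for r X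
    using that m'[OF that] by (simp add: L1.lim_smult A_eq L2.emb_smult)
  show "P \<one>\<^bsub>L1.sa_lim\<^esub> = \<one>\<^bsub>L2.sa_lim\<^esub>" by (simp add: L1.lim_one A_eq L2.emb_one)
  show "le L2.sa_lim (P X) (P Y)"
    if X: "X \<in> carrier L1.sa_lim" and Y: "Y \<in> carrier L1.sa_lim" and le: "le L1.sa_lim X Y" for X Y
  proof -
    have Xc: "X \<in> carrier L1.lim_alg" "Y \<in> carrier L1.lim_alg" using X Y by auto
    let ?d = "L1.rep Y n \<ominus>\<^bsub>A2 n\<^esub> L1.rep X n"
    have ds: "?d \<in> carrier (sa (A2 n))" using m[OF X] m[OF Y] by (simp add: L2.A.star_minus)
    then have dm: "?d \<in> carrier (A2 n)" by simp
    have nonneg: "0 \<le> w ?d" if w: "w \<in> Om2 n" for w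
    proof -
      have "(\<lambda>X. w (L1.rep X n)) \<in> L1.lim_states" using w Om_eq by (auto simp: L1.lim_states_def)
      moreover have "\<forall>w\<in>L1.lim_states. w X \<le> w Y" using le L1.E.state_le[OF X Y] by simp
      ultimately have "w (L1.rep X n) \<le> w (L1.rep Y n)" by (rule bspec[rotated])
      then show ?thesis using w m'[OF X] m'[OF Y] by (simp add: L2.A.om_minus)
    qed
    have pos: "0 \<le> v (L2.rep (L2.emb n ?d) k)" if "v \<in> Om2 k" for v k
    proof (rule L2.emb_pos[OF ds])
      show "0 \<le> w ?d" if "w \<in> Om2 n" for w by (rule nonneg[OF that])
    qed (rule that)
    have "L2.emb n ?d \<oplus>\<^bsub>L2.lim_alg\<^esub> P X = P Y"
    proof -
      have "?d \<oplus>\<^bsub>A2 n\<^esub> L1.rep X n = L1.rep Y n"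
        by (rule L2.A.minus_add_cancel[OF m'[OF Y] m'[OF X]])
      then show ?thesis using L2.emb_add[OF dm m'[OF X]] by simp
    qed
    then have "L2.rep (P Y) k = L2.rep (L2.emb n ?d) k \<oplus>\<^bsub>A2 k\<^esub> L2.rep (P X) k" for k
      using L2.lim_add(2)[OF L2.emb_mem[OF dm] L2.emb_mem[OF m'[OF X]], of k] by simp
    then have "v (L2.rep (P X) k) \<le> v (L2.rep (P Y) k)" if v: "v \<in> Om2 k" for v k
      using pos[OF v]
        L2.A.om_add[OF v L2.rep_mem[OF L2.emb_mem[OF dm]] L2.rep_mem[OF L2.emb_mem[OF m'[OF X]]]]
      by simp
    then show ?thesis
      unfolding L2.E.state_le[OF mem[OF X] mem[OF Y]] by (auto simp: L2.lim_states_def)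
  qed
qed

lemma PQ: assumes "X \<in> carrier L1.sa_lim" shows "L2.rep (P X) n = L1.rep X n"
  using L1.rep_sa[OF assms, of n] unfolding A_eq by (simp add: L2.rep_emb)

lemma L_P: assumes X: "X \<in> carrier L1.sa_lim" shows "L2.Llim (P X) \<le> L1.Llim X"
proof -
  have "L2.Llim (P X) \<le> L2.S n (L1.rep X n)"
    using L1.rep_sa[OF X, of n] unfolding A_eq by (rule L2.Llim_emb)
  also have "\<dots> = L1.S n (L1.rep X n)" using S_eq[OF L1.rep_sa[OF X]] by simp
  also have "\<dots> \<le> L1.Llim X" by (rule L1.S_rep_le)
  finally show ?thesis .
qed

end

lemma lip_systems_agree_sym:
  assumes "lip_systems_agree A1 Om1 \<alpha>1 R1 l1 A2 Om2 \<alpha>2 R2 l2 n"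
  shows "lip_systems_agree A2 Om2 \<alpha>2 R2 l2 A1 Om1 \<alpha>1 R1 l1 n"
  using assms unfolding lip_systems_agree_def lip_systems_agree_axioms_def by simp

theorem (in lip_systems_agree) dist_q_lim_le:
  "dist_q L1.sa_lim L1.Llim L2.sa_lim L2.Llim \<le> ereal ((1 / 2) ^ n)"
proof -
  interpret op: lip_systems_agree A2 Om2 \<alpha>2 R2 l2 A1 Om1 \<alpha>1 R1 l1 n
    by (rule lip_systems_agree_sym) (rule lip_systems_agree_axioms)
  interpret P: unital_positive L1.sa_lim L1.lim_states L2.sa_lim L2.lim_states P
    by (rule unital_positive_P)
  interpret Q: unital_positive L2.sa_lim L2.lim_states L1.sa_lim L1.lim_states Q
    using op.unital_positive_P .
  have "lip_bridge L1.sa_lim L1.lim_states L1.Llim L2.sa_lim L2.lim_states L2.Llim P Q ((1 / 2) ^ n)"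
  proof (intro lip_bridge.intro L1.lip_space_lim L2.lip_space_lim unital_positive_P
      op.unital_positive_P lip_bridge_axioms.intro)
    fix X assume X: "X \<in> carrier L1.sa_lim"
    show "P (Q (P X)) = P X" using op.PQ[OF P.map_mem[OF X]] PQ[OF X] by simp
    show "L2.Llim (P X) \<le> L1.Llim X" by (rule L_P[OF X])
    show "ou_dist L1.sa_lim X (Q (P X)) \<le> (1 / 2) ^ n" if "L1.Llim X \<le> 1"
      using L1.dist_emb_rep[OF X that, of n] PQ[OF X] by simp
  next
    fix Y assume Y: "Y \<in> carrier L2.sa_lim"
    show "Q (P (Q Y)) = Q Y" using PQ[OF Q.map_mem[OF Y]] op.PQ[OF Y] by simp
    show "L1.Llim (Q Y) \<le> L2.Llim Y" by (rule op.L_P[OF Y])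
    show "ou_dist L2.sa_lim Y (P (Q Y)) \<le> (1 / 2) ^ n" if "L2.Llim Y \<le> 1"
      using L2.dist_emb_rep[OF Y that, of n] op.PQ[OF Y] by simp
  qed
  then show ?thesis by (rule lip_bridge.dist_q_le)
qed

section \<open>The operator norm of complex matrices\<close>

definition ip :: "complex Matrix.vec \<Rightarrow> complex Matrix.vec \<Rightarrow> complex" where
  "ip v w = (\<Sum>i<dim_vec v. vec_index v i * cnj (vec_index w i))"

lemma vec_norm_nonneg: "0 \<le> vec_norm v"
  by (simp add: vec_norm_def)

lemma vec_norm_square: "(vec_norm v)\<^sup>2 = (\<Sum>i<dim_vec v. (cmod (vec_index v i))\<^sup>2)"
  by (simp add: vec_norm_def L2_set_def sum_nonneg)

lemma vec_norm_triangle: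
  assumes "dim_vec v = dim_vec w" shows "vec_norm (v + w) \<le> vec_norm v + vec_norm w"
proof -
  have "vec_norm (v + w) \<le> L2_set (\<lambda>i. cmod (vec_index v i) + cmod (vec_index w i)) {..<dim_vec v}"
    unfolding vec_norm_def using assms by (simp, intro L2_set_mono) (auto intro: norm_triangle_ineq)
  also have "\<dots> \<le> vec_norm v + vec_norm w"
    unfolding vec_norm_def using assms L2_set_triangle_ineq by metis
  finally show ?thesis .
qed

lemma vec_norm_smult: "vec_norm (c \<cdot>\<^sub>v v) = cmod c * vec_norm v"
proof -
  have "vec_norm (c \<cdot>\<^sub>v v) = L2_set (\<lambda>i. cmod c * cmod (vec_index v i)) {..<dim_vec v}"
    unfolding vec_norm_def by (simp, intro L2_set_cong) (auto simp: norm_mult)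
  then show ?thesis by (simp add: vec_norm_def L2_set_right_distrib)
qed

lemma vec_norm_zero_imp:
  assumes "v \<in> carrier_vec n" "vec_norm v = 0" shows "v = 0\<^sub>v n"
  using assms by (intro eq_vecI) (auto simp: vec_norm_def L2_set_eq_0_iff)

lemma vec_norm_zero [simp]: "vec_norm (0\<^sub>v n) = 0"
  by (simp add: vec_norm_def L2_set_eq_0_iff)

lemma entry_le_vec_norm: "i < dim_vec v \<Longrightarrow> cmod (vec_index v i) \<le> vec_norm v"
  unfolding vec_norm_def by (intro member_le_L2_set) auto

lemma vec_norm_unit: "j < n \<Longrightarrow> vec_norm (unit_vec n j) = 1"
proof -
  assume j: "j < n"
  have "(\<Sum>i<n. (cmod (vec_index (unit_vec n j) i))\<^sup>2) = (\<Sum>i<n. if i = j then 1 else 0)"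
    by (intro sum.cong) (auto simp: unit_vec_def)
  then have "(vec_norm (unit_vec n j))\<^sup>2 = 1" using j by (simp add: vec_norm_square)
  then show ?thesis using vec_norm_nonneg[of "unit_vec n j"] by (simp add: power2_eq_1_iff)
qed

lemma ip_self: "ip v v = complex_of_real ((vec_norm v)\<^sup>2)"
  unfolding vec_norm_square ip_def of_real_sum by (intro sum.cong refl) (rule complex_norm_square[symmetric])

lemma ip_add_left: "dim_vec u = dim_vec v \<Longrightarrow> ip (u + v) w = ip u w + ip v w"
  by (simp add: ip_def sum.distrib distrib_right)

lemma ip_add_right: "dim_vec w = dim_vec u \<Longrightarrow> dim_vec w = dim_vec v \<Longrightarrow> ip w (u + v) = ip w u + ip w v"
  by (simp add: ip_def sum.distrib distrib_left)

lemma ip_smult_left: "ip (c \<cdot>\<^sub>v v) w = c * ip v w"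
  by (simp add: ip_def sum_distrib_left mult.assoc)

lemma ip_smult_right: "dim_vec v = dim_vec w \<Longrightarrow> ip v (c \<cdot>\<^sub>v w) = cnj c * ip v w"
  by (simp add: ip_def sum_distrib_left algebra_simps)

lemma ip_commute: "dim_vec v = dim_vec w \<Longrightarrow> ip w v = cnj (ip v w)"
  by (simp add: ip_def mult.commute)

lemma Cauchy_Schwarz_ip:
  assumes "dim_vec v = dim_vec w" shows "cmod (ip v w) \<le> vec_norm v * vec_norm w"
proof -
  have "cmod (ip v w) \<le> (\<Sum>i<dim_vec v. \<bar>cmod (vec_index v i)\<bar> * \<bar>cmod (vec_index w i)\<bar>)"
    unfolding ip_def by (rule order.trans[OF norm_sum]) (simp add: norm_mult)
  also have "\<dots> \<le> vec_norm v * vec_norm w"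
    unfolding vec_norm_def using L2_set_mult_ineq assms by metis
  finally show ?thesis .
qed

lemma mult_mat_vec_index:
  "M \<in> carrier_mat n m \<Longrightarrow> v \<in> carrier_vec m \<Longrightarrow> i < n \<Longrightarrow>
    vec_index (M *\<^sub>v v) i = (\<Sum>j<m. M $$ (i, j) * vec_index v j)"
  by (auto simp: scalar_prod_def intro!: sum.cong)

lemma mult_mat_index:
  "M \<in> carrier_mat n m \<Longrightarrow> N \<in> carrier_mat m k \<Longrightarrow> i < n \<Longrightarrow> j < k \<Longrightarrow>
    (M * N) $$ (i, j) = (\<Sum>l<m. M $$ (i, l) * N $$ (l, j))"
  by (auto simp: scalar_prod_def intro!: sum.cong)

lemma adjoint_eq:
  fixes M :: "complex Matrix.mat"
  shows "mat_adjoint M = Matrix.mat (dim_col M) (dim_row M) (\<lambda>(i, j). cnj (M $$ (j, i)))"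
  by (intro eq_matI) (auto simp: mat_adjoint_def mat_of_rows_index)

lemma adjoint_mem [simp]:
  fixes M :: "complex Matrix.mat"
  shows "M \<in> carrier_mat n m \<Longrightarrow> mat_adjoint M \<in> carrier_mat m n"
  by (auto simp: adjoint_eq)

lemma adjoint_index:
  fixes M :: "complex Matrix.mat"
  shows "M \<in> carrier_mat n m \<Longrightarrow> i < m \<Longrightarrow> j < n \<Longrightarrow> mat_adjoint M $$ (i, j) = cnj (M $$ (j, i))"
  by (auto simp: adjoint_eq)

lemma adjoint_adjoint: "mat_adjoint (mat_adjoint M) = (M :: complex Matrix.mat)"
  by (intro eq_matI) (auto simp: adjoint_eq)

lemma adjoint_add:
  fixes M :: "complex Matrix.mat"
  shows "M \<in> carrier_mat n m \<Longrightarrow> N \<in> carrier_mat n m \<Longrightarrow> mat_adjoint (M + N) = mat_adjoint M + mat_adjoint N"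
  by (intro eq_matI) (auto simp: adjoint_eq)

lemma adjoint_smult: "mat_adjoint (c \<cdot>\<^sub>m M) = cnj c \<cdot>\<^sub>m mat_adjoint M"
  by (intro eq_matI) (auto simp: adjoint_eq)

lemma adjoint_mult:
  fixes M :: "complex Matrix.mat"
  assumes "M \<in> carrier_mat n m" "N \<in> carrier_mat m k"
  shows "mat_adjoint (M * N) = mat_adjoint N * mat_adjoint M"
proof (rule eq_matI)
  fix i j assume "i < dim_row (mat_adjoint N * mat_adjoint M)" "j < dim_col (mat_adjoint N * mat_adjoint M)"
  then have ij: "i < k" "j < n" using assms adjoint_mem[OF assms(1)] adjoint_mem[OF assms(2)] by auto
  have "mat_adjoint (M * N) $$ (i, j) = cnj ((M * N) $$ (j, i))"
    using assms ij by (intro adjoint_index[of _ n k]) auto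
  also have "\<dots> = (\<Sum>l<m. mat_adjoint N $$ (i, l) * mat_adjoint M $$ (l, j))"
    using assms ij by (simp add: mult_mat_index adjoint_index[of _ n m] adjoint_index[of _ m k] mult.commute
      del: index_mult_mat)
  also have "\<dots> = (mat_adjoint N * mat_adjoint M) $$ (i, j)"
    using assms ij by (subst mult_mat_index[of _ k m _ n]) auto
  finally show "mat_adjoint (M * N) $$ (i, j) = (mat_adjoint N * mat_adjoint M) $$ (i, j)" .
qed (use assms in \<open>auto simp: adjoint_eq\<close>)

lemma adjoint_one: "mat_adjoint (1\<^sub>m n :: complex Matrix.mat) = 1\<^sub>m n"
  by (intro eq_matI) (auto simp: adjoint_eq)

lemma ip_adjoint:
  assumes M: "M \<in> carrier_mat n m" and v: "v \<in> carrier_vec m" and w: "w \<in> carrier_vec n"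
  shows "ip (M *\<^sub>v v) w = ip v (mat_adjoint M *\<^sub>v w)"
proof -
  have "ip (M *\<^sub>v v) w = (\<Sum>i<n. \<Sum>j<m. M $$ (i, j) * vec_index v j * cnj (vec_index w i))"
    unfolding ip_def using assms by (simp add: mult_mat_vec_index sum_distrib_right del: index_mult_mat_vec)
  also have "\<dots> = (\<Sum>j<m. \<Sum>i<n. M $$ (i, j) * vec_index v j * cnj (vec_index w i))"
    by (rule sum.swap)
  also have "\<dots> = ip v (mat_adjoint M *\<^sub>v w)"
    unfolding ip_def using assms
    by (simp add: mult_mat_vec_index[of _ m n] adjoint_index[of _ n m] sum_distrib_left mult_ac
      del: index_mult_mat_vec)
  finally show ?thesis .
qed

lemma vec_norm_mult_mat_vec_le_sum:
  assumes M: "M \<in> carrier_mat n m" and v: "v \<in> carrier_vec m"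
  shows "vec_norm (M *\<^sub>v v) \<le> (\<Sum>i<n. \<Sum>j<m. cmod (M $$ (i, j))) * vec_norm v"
proof -
  have "vec_norm (M *\<^sub>v v) \<le> (\<Sum>i<n. cmod (vec_index (M *\<^sub>v v) i))"
  proof -
    have "dim_vec (M *\<^sub>v v) = n" using M by simp
    then show ?thesis unfolding vec_norm_def by (simp only:) (rule L2_set_le_sum, simp)
  qed
  also have "\<dots> \<le> (\<Sum>i<n. (\<Sum>j<m. cmod (M $$ (i, j))) * vec_norm v)"
  proof (rule sum_mono)
    fix i assume i: "i \<in> {..<n}"
    have "cmod (vec_index (M *\<^sub>v v) i) \<le> (\<Sum>j<m. cmod (M $$ (i, j)) * cmod (vec_index v j))"
      using i M v by (simp add: mult_mat_vec_index norm_mult[symmetric] norm_sum del: index_mult_mat_vec)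
    also have "\<dots> \<le> (\<Sum>j<m. cmod (M $$ (i, j)) * vec_norm v)"
      using v by (intro sum_mono mult_left_mono entry_le_vec_norm) auto
    finally show "cmod (vec_index (M *\<^sub>v v) i) \<le> (\<Sum>j<m. cmod (M $$ (i, j))) * vec_norm v"
      by (simp add: sum_distrib_right)
  qed
  finally show ?thesis by (simp add: sum_distrib_right)
qed

lemma op_norm_bdd:
  assumes M: "M \<in> carrier_mat n m"
  shows "bdd_above ((\<lambda>v. vec_norm (M *\<^sub>v v)) ` {v \<in> carrier_vec (dim_col M). vec_norm v \<le> 1})"
proof (rule bdd_aboveI2)
  fix v assume "v \<in> {v \<in> carrier_vec (dim_col M). vec_norm v \<le> 1}"
  then have v: "v \<in> carrier_vec m" "vec_norm v \<le> 1" using M by auto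
  have "(\<Sum>i<n. \<Sum>j<m. cmod (M $$ (i, j))) * vec_norm v \<le> (\<Sum>i<n. \<Sum>j<m. cmod (M $$ (i, j))) * 1"
    using v(2) by (intro mult_left_mono sum_nonneg) auto
  then show "vec_norm (M *\<^sub>v v) \<le> (\<Sum>i<n. \<Sum>j<m. cmod (M $$ (i, j)))"
    using vec_norm_mult_mat_vec_le_sum[OF M v(1)] by simp
qed

lemma op_norm_upper1:
  assumes M: "M \<in> carrier_mat n m" and v: "v \<in> carrier_vec m" "vec_norm v \<le> 1"
  shows "vec_norm (M *\<^sub>v v) \<le> op_norm M"
  unfolding op_norm_def using assms by (intro cSUP_upper[OF _ op_norm_bdd[OF M]]) auto

lemma op_norm_nonneg: "M \<in> carrier_mat n m \<Longrightarrow> 0 \<le> op_norm M"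
  using op_norm_upper1[of M n m "0\<^sub>v m"] vec_norm_nonneg[of "M *\<^sub>v 0\<^sub>v m"] by simp

lemma op_norm_upper:
  assumes M: "M \<in> carrier_mat n m" and v: "v \<in> carrier_vec m"
  shows "vec_norm (M *\<^sub>v v) \<le> op_norm M * vec_norm v"
proof (cases "vec_norm v = 0")
  case True
  then show ?thesis using vec_norm_mult_mat_vec_le_sum[OF M v] by simp
next
  case False
  let ?c = "complex_of_real (1 / vec_norm v)"
  have pos: "0 < vec_norm v" using False vec_norm_nonneg[of v] by simp
  have "vec_norm (M *\<^sub>v (?c \<cdot>\<^sub>v v)) \<le> op_norm M"
    using pos v by (intro op_norm_upper1[OF M]) (auto simp: vec_norm_smult norm_divide)
  moreover have "M *\<^sub>v (?c \<cdot>\<^sub>v v) = ?c \<cdot>\<^sub>v (M *\<^sub>v v)" using M v by (simp add: mult_mat_vec)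
  ultimately show ?thesis using pos by (simp add: vec_norm_smult norm_divide field_simps)
qed

lemma op_norm_leI:
  assumes M: "M \<in> carrier_mat n m" and r: "0 \<le> r"
    and le: "\<And>v. v \<in> carrier_vec m \<Longrightarrow> vec_norm (M *\<^sub>v v) \<le> r * vec_norm v"
  shows "op_norm M \<le> r"
  unfolding op_norm_def
proof (rule cSUP_least)
  show "{v \<in> carrier_vec (dim_col M). vec_norm v \<le> 1} \<noteq> {}"
    by (auto intro!: exI[of _ "0\<^sub>v (dim_col M)"])
  fix v assume "v \<in> {v \<in> carrier_vec (dim_col M). vec_norm v \<le> 1}"
  then have v: "v \<in> carrier_vec m" "vec_norm v \<le> 1" using M by auto
  have "r * vec_norm v \<le> r * 1" using r v by (intro mult_left_mono) auto
  then show "vec_norm (M *\<^sub>v v) \<le> r" using le[OF v(1)] by simp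
qed

lemma op_norm_le_sum:
  assumes M: "M \<in> carrier_mat n m" shows "op_norm M \<le> (\<Sum>i<n. \<Sum>j<m. cmod (M $$ (i, j)))"
  by (rule op_norm_leI[OF M]) (auto intro!: sum_nonneg vec_norm_mult_mat_vec_le_sum[OF M])

lemma entry_le_op_norm:
  assumes M: "M \<in> carrier_mat n m" and ij: "i < n" "j < m"
  shows "cmod (M $$ (i, j)) \<le> op_norm M"
proof -
  have "vec_index (M *\<^sub>v unit_vec m j) i = (\<Sum>l<m. M $$ (i, l) * vec_index (unit_vec m j) l)"
    using M ij by (intro mult_mat_vec_index) auto
  also have "\<dots> = (\<Sum>l<m. if l = j then M $$ (i, l) else 0)"
    using ij by (intro sum.cong) (auto simp: unit_vec_def)
  also have "\<dots> = M $$ (i, j)" using ij by simp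
  finally have "cmod (M $$ (i, j)) \<le> vec_norm (M *\<^sub>v unit_vec m j)"
    using entry_le_vec_norm[of i "M *\<^sub>v unit_vec m j"] M ij by simp
  also have "\<dots> \<le> op_norm M" using ij by (intro op_norm_upper1[OF M]) (auto simp: vec_norm_unit)
  finally show ?thesis .
qed

lemma op_norm_zero_imp:
  assumes M: "M \<in> carrier_mat n m" and "op_norm M = 0" shows "M = 0\<^sub>m n m"
  using entry_le_op_norm[OF M] assms by (intro eq_matI) auto

lemma op_norm_add:
  assumes M: "M \<in> carrier_mat n m" and N: "N \<in> carrier_mat n m"
  shows "op_norm (M + N) \<le> op_norm M + op_norm N"
proof (rule op_norm_leI)
  fix v :: "complex Matrix.vec" assume v: "v \<in> carrier_vec m"
  have "(M + N) *\<^sub>v v = M *\<^sub>v v + N *\<^sub>v v" using M N v by (rule add_mult_distrib_mat_vec)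
  then have "vec_norm ((M + N) *\<^sub>v v) \<le> vec_norm (M *\<^sub>v v) + vec_norm (N *\<^sub>v v)"
    using vec_norm_triangle[of "M *\<^sub>v v" "N *\<^sub>v v"] M N by simp
  then show "vec_norm ((M + N) *\<^sub>v v) \<le> (op_norm M + op_norm N) * vec_norm v"
    using op_norm_upper[OF M v] op_norm_upper[OF N v] by (simp add: distrib_right)
qed (use M N op_norm_nonneg in auto)

lemma op_norm_smult_le:
  assumes M: "M \<in> carrier_mat n m" shows "op_norm (c \<cdot>\<^sub>m M) \<le> cmod c * op_norm M"
proof (rule op_norm_leI)
  fix v :: "complex Matrix.vec" assume v: "v \<in> carrier_vec m"
  have "(c \<cdot>\<^sub>m M) *\<^sub>v v = c \<cdot>\<^sub>v (M *\<^sub>v v)" using M v by (intro eq_vecI) (auto simp: scalar_prod_def sum_distrib_left mult.assoc)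
  then show "vec_norm ((c \<cdot>\<^sub>m M) *\<^sub>v v) \<le> cmod c * op_norm M * vec_norm v"
    using mult_left_mono[OF op_norm_upper[OF M v], of "cmod c"] by (simp add: vec_norm_smult mult.assoc)
qed (use M op_norm_nonneg in auto)

lemma op_norm_smult:
  assumes M: "M \<in> carrier_mat n m" shows "op_norm (c \<cdot>\<^sub>m M) = cmod c * op_norm M"
proof (cases "c = 0")
  case True
  then show ?thesis using op_norm_smult_le[OF M, of c] op_norm_nonneg[of "c \<cdot>\<^sub>m M" n m] M by simp
next
  case False
  have "inverse c \<cdot>\<^sub>m (c \<cdot>\<^sub>m M) = M" using False M by (intro eq_matI) auto
  then have "op_norm M \<le> cmod (inverse c) * op_norm (c \<cdot>\<^sub>m M)"
    using op_norm_smult_le[of "c \<cdot>\<^sub>m M" n m "inverse c"] M by simp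
  then have "cmod c * op_norm M \<le> cmod c * (cmod (inverse c) * op_norm (c \<cdot>\<^sub>m M))"
    by (rule mult_left_mono) simp
  then have "cmod c * op_norm M \<le> op_norm (c \<cdot>\<^sub>m M)"
    using False by (simp add: norm_inverse mult.assoc[symmetric])
  then show ?thesis using op_norm_smult_le[OF M, of c] by simp
qed

lemma op_norm_mult:
  assumes M: "M \<in> carrier_mat n m" and N: "N \<in> carrier_mat m k"
  shows "op_norm (M * N) \<le> op_norm M * op_norm N"
proof (rule op_norm_leI)
  fix v :: "complex Matrix.vec" assume v: "v \<in> carrier_vec k"
  have Nv: "N *\<^sub>v v \<in> carrier_vec m" using N v by simp
  have "vec_norm ((M * N) *\<^sub>v v) \<le> op_norm M * vec_norm (N *\<^sub>v v)"
    using op_norm_upper[OF M Nv] assoc_mult_mat_vec[OF M N v] by simp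
  also have "\<dots> \<le> op_norm M * (op_norm N * vec_norm v)"
    by (intro mult_left_mono op_norm_upper[OF N v] op_norm_nonneg[OF M])
  finally show "vec_norm ((M * N) *\<^sub>v v) \<le> op_norm M * op_norm N * vec_norm v" by (simp add: mult.assoc)
qed (use M N op_norm_nonneg in auto)

lemma op_norm_adjoint_le:
  assumes M: "M \<in> carrier_mat n m" shows "op_norm (mat_adjoint M) \<le> op_norm M"
proof (rule op_norm_leI[OF adjoint_mem[OF M] op_norm_nonneg[OF M]])
  fix v :: "complex Matrix.vec" assume v: "v \<in> carrier_vec n"
  let ?w = "mat_adjoint M *\<^sub>v v"
  have w: "?w \<in> carrier_vec m" using adjoint_mem[OF M] v by simp
  have Mw: "M *\<^sub>v ?w \<in> carrier_vec n" using M w by simp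
  have "(vec_norm ?w)\<^sup>2 = cmod (complex_of_real ((vec_norm ?w)\<^sup>2))"
    by (simp only: norm_of_real abs_power2)
  also have "\<dots> = cmod (ip (M *\<^sub>v ?w) v)"
    using ip_adjoint[OF M w v] by (simp only: ip_self)
  also have "\<dots> \<le> vec_norm (M *\<^sub>v ?w) * vec_norm v" using M Mw v by (intro Cauchy_Schwarz_ip) auto
  also have "\<dots> \<le> (op_norm M * vec_norm ?w) * vec_norm v"
    by (intro mult_right_mono op_norm_upper[OF M w] vec_norm_nonneg)
  finally have "vec_norm ?w * vec_norm ?w \<le> vec_norm ?w * (op_norm M * vec_norm v)"
    by (simp add: power2_eq_square mult_ac)
  then show "vec_norm ?w \<le> op_norm M * vec_norm v"
    using op_norm_nonneg[OF M] vec_norm_nonneg[of v] vec_norm_nonneg[of ?w]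
    by (cases "vec_norm ?w = 0") (auto simp: mult_le_cancel_left)
qed

lemma op_norm_adjoint:
  assumes M: "M \<in> carrier_mat n m" shows "op_norm (mat_adjoint M) = op_norm M"
  using op_norm_adjoint_le[OF M] op_norm_adjoint_le[OF adjoint_mem[OF M]] adjoint_adjoint[of M] by simp

lemma op_norm_one: assumes "0 < n" shows "op_norm (1\<^sub>m n) = 1"
proof (rule antisym)
  show "op_norm (1\<^sub>m n) \<le> 1" by (rule op_norm_leI[of _ n n]) auto
  show "1 \<le> op_norm (1\<^sub>m n)" using entry_le_op_norm[of "1\<^sub>m n" n n 0 0] assms by simp
qed

lemma op_norm_isometry:
  assumes V: "V \<in> carrier_mat n m" "mat_adjoint V * V = 1\<^sub>m m" and v: "v \<in> carrier_vec m"
  shows "vec_norm (V *\<^sub>v v) = vec_norm v"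
proof -
  have Vv: "V *\<^sub>v v \<in> carrier_vec n" using V v by simp
  have "ip (V *\<^sub>v v) (V *\<^sub>v v) = ip v (mat_adjoint V *\<^sub>v (V *\<^sub>v v))" by (rule ip_adjoint[OF V(1) v Vv])
  also have "mat_adjoint V *\<^sub>v (V *\<^sub>v v) = v"
    using assoc_mult_mat_vec[OF adjoint_mem[OF V(1)] V(1) v] V(2) v by simp
  finally have "(vec_norm (V *\<^sub>v v))\<^sup>2 = (vec_norm v)\<^sup>2" unfolding ip_self of_real_eq_iff .
  then show ?thesis using vec_norm_nonneg by (simp add: power2_eq_iff_nonneg)
qed

lemma op_norm_isometry_le_1:
  assumes V: "V \<in> carrier_mat n m" "mat_adjoint V * V = 1\<^sub>m m" shows "op_norm V \<le> 1"
  using op_norm_isometry[OF V] by (intro op_norm_leI[OF V(1)]) auto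

definition numr :: "complex Matrix.mat \<Rightarrow> complex Matrix.vec \<Rightarrow> real" where
  "numr M v = Re (ip (M *\<^sub>v v) v)"

lemma numr_le_op_norm:
  assumes M: "M \<in> carrier_mat n n" and v: "v \<in> carrier_vec n" shows "\<bar>numr M v\<bar> \<le> op_norm M * (vec_norm v)\<^sup>2"
proof -
  have "\<bar>numr M v\<bar> \<le> cmod (ip (M *\<^sub>v v) v)" unfolding numr_def by (rule abs_Re_le_cmod)
  also have "\<dots> \<le> vec_norm (M *\<^sub>v v) * vec_norm v" using M v by (intro Cauchy_Schwarz_ip) auto
  also have "\<dots> \<le> (op_norm M * vec_norm v) * vec_norm v"
    by (intro mult_right_mono op_norm_upper[OF M v] vec_norm_nonneg)
  finally show ?thesis by (simp add: power2_eq_square mult.assoc)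
qed

lemma numr_square:
  assumes M: "M \<in> carrier_mat n m" and v: "v \<in> carrier_vec m"
  shows "numr (mat_adjoint M * M) v = (vec_norm (M *\<^sub>v v))\<^sup>2"
proof -
  have Mv: "M *\<^sub>v v \<in> carrier_vec n" using M v by simp
  have "numr (mat_adjoint M * M) v = Re (ip (mat_adjoint M *\<^sub>v (M *\<^sub>v v)) v)"
    using assoc_mult_mat_vec[OF adjoint_mem[OF M] M v] by (simp add: numr_def)
  also have "\<dots> = Re (ip (M *\<^sub>v v) (M *\<^sub>v v))"
    using ip_adjoint[OF adjoint_mem[OF M] Mv v] adjoint_adjoint[of M] by simp
  finally show ?thesis by (simp add: ip_self)
qed

lemma numr_smult:
  assumes "M \<in> carrier_mat n n" "u \<in> carrier_vec n"
  shows "numr M (complex_of_real d \<cdot>\<^sub>v u) = d\<^sup>2 * numr M u"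
  using assms by (simp add: numr_def mult_mat_vec[OF assms] ip_smult_left ip_smult_right power2_eq_square)

text \<open>
  The norm of a self-adjoint matrix is its numerical radius: polarise \<open>\<langle>Mu, w\<rangle>\<close> with \<open>w\<close> the multiple
  of \<open>Mu\<close> that has the length of \<open>u\<close>.
\<close>

lemma op_norm_le_numr:
  assumes M: "M \<in> carrier_mat n n" "mat_adjoint M = M" and r: "0 \<le> r"
    and le: "\<And>v. v \<in> carrier_vec n \<Longrightarrow> vec_norm v = 1 \<Longrightarrow> \<bar>numr M v\<bar> \<le> r"
  shows "op_norm M \<le> r"
proof (rule op_norm_leI[OF M(1) r])
  have q: "\<bar>numr M v\<bar> \<le> r * (vec_norm v)\<^sup>2" if v: "v \<in> carrier_vec n" for v
  proof (cases "vec_norm v = 0")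
    case True
    then show ?thesis using numr_le_op_norm[OF M(1) v] by simp
  next
    case False
    let ?c = "complex_of_real (1 / vec_norm v)" and ?d = "complex_of_real (vec_norm v)"
    let ?u = "?c \<cdot>\<^sub>v v"
    have u: "?u \<in> carrier_vec n" "vec_norm ?u = 1"
      using v False vec_norm_nonneg[of v] by (auto simp: vec_norm_smult norm_divide)
    have "v = ?d \<cdot>\<^sub>v ?u" using False v by (intro eq_vecI) auto
    then have "numr M v = numr M (?d \<cdot>\<^sub>v ?u)" by simp
    also have "\<dots> = (vec_norm v)\<^sup>2 * numr M ?u" by (rule numr_smult[OF M(1) u(1)])
    finally show ?thesis
      using mult_left_mono[OF le[OF u], of "(vec_norm v)\<^sup>2"] by (simp add: abs_mult mult.commute)
  qed
  fix u :: "complex Matrix.vec" assume u: "u \<in> carrier_vec n"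
  let ?Mu = "M *\<^sub>v u"
  have Mu: "?Mu \<in> carrier_vec n" using M u by simp
  show "vec_norm ?Mu \<le> r * vec_norm u"
  proof (cases "vec_norm ?Mu = 0")
    case True
    then show ?thesis using r vec_norm_nonneg[of u] by simp
  next
    case False
    define c where "c = vec_norm u / vec_norm ?Mu"
    define w where "w = complex_of_real c \<cdot>\<^sub>v ?Mu"
    have w: "w \<in> carrier_vec n" using Mu by (simp add: w_def)
    have Mw: "M *\<^sub>v w \<in> carrier_vec n" using M w by simp
    have pos: "0 < vec_norm ?Mu" using False vec_norm_nonneg[of ?Mu] by simp
    have c0: "0 \<le> c" using pos vec_norm_nonneg[of u] by (simp add: c_def)
    have cM: "c * vec_norm ?Mu = vec_norm u" using pos by (simp add: c_def)
    have nw: "vec_norm w = vec_norm u"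
      by (simp only: w_def vec_norm_smult norm_of_real abs_of_nonneg[OF c0] cM)
    have "ip ?Mu w = complex_of_real (c * (vec_norm ?Mu)\<^sup>2)" by (simp add: w_def ip_smult_right ip_self)
    then have Muw: "Re (ip ?Mu w) = vec_norm u * vec_norm ?Mu"
      by (simp only: Re_complex_of_real power2_eq_square mult.assoc[symmetric] cM)
    have sym: "Re (ip (M *\<^sub>v w) u) = Re (ip ?Mu w)"
      using ip_adjoint[OF M(1) w u] M ip_commute[of ?Mu w] Mu w by simp
    define m :: complex where "m = -1"
    have mw: "m \<cdot>\<^sub>v w \<in> carrier_vec n" using w by simp
    have Mm: "M *\<^sub>v (u + m \<cdot>\<^sub>v w) = ?Mu + m \<cdot>\<^sub>v (M *\<^sub>v w)"
      using mult_add_distrib_mat_vec[OF M(1) u mw] mult_mat_vec[OF M(1) w] by simp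
    have plus: "numr M (u + w) = numr M u + numr M w + 2 * Re (ip ?Mu w)"
      using M u w Mu Mw sym
      by (simp add: numr_def mult_add_distrib_mat_vec[OF M(1) u w] ip_add_left ip_add_right)
    have "numr M (u + m \<cdot>\<^sub>v w) = numr M u + numr M w - 2 * Re (ip ?Mu w)"
      unfolding numr_def Mm using M u w Mu Mw mw sym
      by (simp add: ip_add_left ip_add_right ip_smult_left ip_smult_right) (simp add: m_def)
    with plus have "4 * Re (ip ?Mu w) = numr M (u + w) - numr M (u + m \<cdot>\<^sub>v w)" by simp
    also have "\<dots> \<le> r * (vec_norm (u + w))\<^sup>2 + r * (vec_norm (u + m \<cdot>\<^sub>v w))\<^sup>2"
      using q[of "u + w"] q[of "u + m \<cdot>\<^sub>v w"] u w mw by (simp add: abs_le_iff)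
    also have "\<dots> = r * (2 * (vec_norm u)\<^sup>2 + 2 * (vec_norm w)\<^sup>2)"
    proof -
      have sq: "(vec_norm x)\<^sup>2 = Re (ip x x)" for x by (simp add: ip_self)
      have "(vec_norm (u + w))\<^sup>2 + (vec_norm (u + m \<cdot>\<^sub>v w))\<^sup>2 = 2 * (vec_norm u)\<^sup>2 + 2 * (vec_norm w)\<^sup>2"
        unfolding sq using u w mw
        by (simp add: ip_add_left ip_add_right ip_smult_left ip_smult_right) (simp add: m_def)
      then show ?thesis by (simp only: distrib_left[of r, symmetric])
    qed
    finally have "vec_norm u * vec_norm ?Mu \<le> vec_norm u * (r * vec_norm u)"
      unfolding Muw nw by (simp add: power2_eq_square algebra_simps)
    then show ?thesis
    proof (cases "vec_norm u = 0")
      case True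
      then show ?thesis using op_norm_upper[OF M(1) u] by simp
    qed (use vec_norm_nonneg[of u] in \<open>simp add: mult_le_cancel_left\<close>)
  qed
qed

section \<open>Block matrices\<close>

lemma sum_blocks: "(\<Sum>p<k * b. g p) = (\<Sum>j<k. \<Sum>s<b. g (j * b + s))" for g :: "nat \<Rightarrow> 'a :: comm_monoid_add"
proof (induction k)
  case (Suc k)
  have split: "(\<Sum>p<m + n. g p) = (\<Sum>p<m. g p) + (\<Sum>s<n. g (m + s))" for m n
    by (induction n) (auto simp: add.assoc)
  show ?case using Suc split[of "k * b" b] by (simp add: add.commute[of b])
qed simp

definition blocks :: "nat \<Rightarrow> nat \<Rightarrow> (nat \<Rightarrow> complex Matrix.mat) \<Rightarrow> complex Matrix.mat" where
  "blocks k b f = Matrix.mat (k * b) (k * b)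
    (\<lambda>(p, q). if p div b = q div b then f (p div b) $$ (p mod b, q mod b) else 0)"

lemma blocks_mem [simp]: "blocks k b f \<in> carrier_mat (k * b) (k * b)"
  by (simp add: blocks_def)

lemma block_index_bounds:
  "(p :: nat) < k * b \<Longrightarrow> p div b < k \<and> p mod b < b"
  by (metis less_mult_imp_div_less mod_less_divisor mult_0_right not_gr_zero not_less_zero)

lemma diag_block_mat_eq_blocks:
  assumes b: "0 < b" and f: "\<And>j. j < k \<Longrightarrow> f j \<in> carrier_mat b b"
  shows "diag_block_mat (map f [0..<k]) = blocks k b f"
  using f
proof (induction k)
  case 0
  show ?case by (intro eq_matI) (auto simp: blocks_def)
next
  case (Suc k)
  have IH: "diag_block_mat (map f [0..<k]) = blocks k b f" using Suc by simp
  have fk: "f k \<in> carrier_mat b b" using Suc by simp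
  have "diag_block_mat (map f [0..<Suc k]) =
      four_block_mat (blocks k b f) (0\<^sub>m (k * b) b) (0\<^sub>m b (k * b)) (f k)"
    using fk by (simp add: diag_block_mat_last IH blocks_def Let_def)
  also have "\<dots> = blocks (Suc k) b f"
  proof (rule eq_matI)
    fix p q assume "p < dim_row (blocks (Suc k) b f)" "q < dim_col (blocks (Suc k) b f)"
    then have pq: "p < k * b + b" "q < k * b + b" by (auto simp: blocks_def add.commute)
    have div: "x div b = (if x < k * b then x div b else k)" "x < k * b \<Longrightarrow> x div b < k"
      "\<not> x < k * b \<Longrightarrow> x mod b = x - k * b" if "x < k * b + b" for x
    proof -
      show "x < k * b \<Longrightarrow> x div b < k" using block_index_bounds by blast
      have *: "x div b = k \<and> x mod b = x - k * b" if ge: "\<not> x < k * b"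
      proof -
        obtain s where s: "x = k * b + s" using ge le_Suc_ex not_less by metis
        then have "s < b" using \<open>x < k * b + b\<close> by simp
        then show ?thesis using s b by simp
      qed
      then show "x div b = (if x < k * b then x div b else k)" "\<not> x < k * b \<Longrightarrow> x mod b = x - k * b"
        by auto
    qed
    show "four_block_mat (blocks k b f) (0\<^sub>m (k * b) b) (0\<^sub>m b (k * b)) (f k) $$ (p, q) =
        blocks (Suc k) b f $$ (p, q)"
      using pq fk div[OF pq(1)] div[OF pq(2)]
      by (cases "p < k * b"; cases "q < k * b") (auto simp: blocks_def)
  qed (use fk in \<open>auto simp: blocks_def\<close>)
  finally show ?case .
qed

lemma blocks_index:
  "p < k * b \<Longrightarrow> q < k * b \<Longrightarrow> blocks k b f $$ (p, q) =
    (if p div b = q div b then f (p div b) $$ (p mod b, q mod b) else 0)"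
  by (simp add: blocks_def)

lemma blocks_cong: "(\<And>j. j < k \<Longrightarrow> f j = g j) \<Longrightarrow> blocks k b f = blocks k b g"
  by (intro eq_matI) (auto simp: blocks_def dest: block_index_bounds)

lemma blocks_add:
  assumes "\<And>j. j < k \<Longrightarrow> f j \<in> carrier_mat b b" "\<And>j. j < k \<Longrightarrow> g j \<in> carrier_mat b b"
  shows "blocks k b (\<lambda>j. f j + g j) = blocks k b f + blocks k b g"
proof (rule eq_matI)
  fix p q assume "p < dim_row (blocks k b f + blocks k b g)" "q < dim_col (blocks k b f + blocks k b g)"
  then have pq: "p < k * b" "q < k * b" by (auto simp: blocks_def)
  have d: "q div b < k" "p mod b < b" "q mod b < b" using block_index_bounds pq by auto
  show "blocks k b (\<lambda>j. f j + g j) $$ (p, q) = (blocks k b f + blocks k b g) $$ (p, q)"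
    using pq d assms(1)[OF d(1)] assms(2)[OF d(1)] by (simp add: blocks_def)
qed (auto simp: blocks_def)

lemma blocks_smult:
  assumes "\<And>j. j < k \<Longrightarrow> f j \<in> carrier_mat b b"
  shows "blocks k b (\<lambda>j. c \<cdot>\<^sub>m f j) = c \<cdot>\<^sub>m blocks k b f"
proof (rule eq_matI)
  fix p q assume "p < dim_row (c \<cdot>\<^sub>m blocks k b f)" "q < dim_col (c \<cdot>\<^sub>m blocks k b f)"
  then have pq: "p < k * b" "q < k * b" by (auto simp: blocks_def)
  have d: "q div b < k" "p mod b < b" "q mod b < b" using block_index_bounds pq by auto
  show "blocks k b (\<lambda>j. c \<cdot>\<^sub>m f j) $$ (p, q) = (c \<cdot>\<^sub>m blocks k b f) $$ (p, q)"
    using pq d assms(1)[OF d(1)] by (simp add: blocks_def)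
qed (auto simp: blocks_def)

lemma blocks_adjoint:
  assumes "\<And>j. j < k \<Longrightarrow> f j \<in> carrier_mat b b"
  shows "blocks k b (\<lambda>j. mat_adjoint (f j)) = mat_adjoint (blocks k b f)"
proof (rule eq_matI)
  have m: "mat_adjoint (blocks k b f) \<in> carrier_mat (k * b) (k * b)" by simp
  fix p q assume "p < dim_row (mat_adjoint (blocks k b f))" "q < dim_col (mat_adjoint (blocks k b f))"
  then have pq: "p < k * b" "q < k * b" using m by auto
  have d: "p div b < k" "p mod b < b" "q mod b < b" using block_index_bounds pq by auto
  show "blocks k b (\<lambda>j. mat_adjoint (f j)) $$ (p, q) = mat_adjoint (blocks k b f) $$ (p, q)"
    using pq d assms(1)[OF d(1)]
    by (auto simp: blocks_index adjoint_index[OF blocks_mem] adjoint_index[of "f _" b b])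
qed (auto simp: adjoint_eq blocks_def)

lemma blocks_one: "0 < b \<Longrightarrow> blocks k b (\<lambda>j. 1\<^sub>m b) = 1\<^sub>m (k * b)"
proof (intro eq_matI)
  fix p q assume "0 < b" "p < dim_row (1\<^sub>m (k * b))" "q < dim_col (1\<^sub>m (k * b))"
  then show "blocks k b (\<lambda>j. 1\<^sub>m b) $$ (p, q) = 1\<^sub>m (k * b) $$ (p, q)"
    by (auto simp: blocks_index) (metis div_mult_mod_eq)
qed (auto simp: blocks_def)

lemma block_pos: "j < k \<Longrightarrow> s < b \<Longrightarrow> j * b + s < k * (b :: nat)"
  using mult_le_mono1[of "Suc j" k b] by simp

lemma blocks_mult_vec:
  assumes f: "\<And>j. j < k \<Longrightarrow> f j \<in> carrier_mat b b" and v: "v \<in> carrier_vec (k * b)"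
    and j: "j < k" "s < b"
  shows "vec_index (blocks k b f *\<^sub>v v) (j * b + s) =
    vec_index (f j *\<^sub>v Matrix.vec b (\<lambda>i. vec_index v (j * b + i))) s"
proof -
  have p: "j * b + s < k * b" by (rule block_pos[OF j])
  have "vec_index (blocks k b f *\<^sub>v v) (j * b + s) =
      (\<Sum>i<k. \<Sum>t<b. blocks k b f $$ (j * b + s, i * b + t) * vec_index v (i * b + t))"
    using mult_mat_vec_index[OF blocks_mem v p] by (simp only: sum_blocks)
  also have "\<dots> = (\<Sum>i<k. if i = j then (\<Sum>t<b. f j $$ (s, t) * vec_index v (j * b + t)) else 0)"
    using j p by (intro sum.cong refl) (auto simp: blocks_index block_pos intro!: sum.cong sum.neutral)
  also have "\<dots> = (\<Sum>t<b. f j $$ (s, t) * vec_index v (j * b + t))" using j by simp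
  also have "\<dots> = vec_index (f j *\<^sub>v Matrix.vec b (\<lambda>i. vec_index v (j * b + i))) s"
    using mult_mat_vec_index[OF f[OF j(1)], of "Matrix.vec b (\<lambda>i. vec_index v (j * b + i))" s] j
    by simp
  finally show ?thesis .
qed

lemma op_norm_blocks_le:
  assumes f: "\<And>j. j < k \<Longrightarrow> f j \<in> carrier_mat b b" and r: "0 \<le> r" "\<And>j. j < k \<Longrightarrow> op_norm (f j) \<le> r"
  shows "op_norm (blocks k b f) \<le> r"
proof (rule op_norm_leI[OF blocks_mem r(1)])
  fix v :: "complex Matrix.vec" assume v: "v \<in> carrier_vec (k * b)"
  let ?v = "\<lambda>j. Matrix.vec b (\<lambda>i. vec_index v (j * b + i))"
  have "(vec_norm (blocks k b f *\<^sub>v v))\<^sup>2 =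
      (\<Sum>j<k. \<Sum>s<b. (cmod (vec_index (blocks k b f *\<^sub>v v) (j * b + s)))\<^sup>2)"
  proof -
    have "dim_vec (blocks k b f *\<^sub>v v) = k * b" by (simp add: blocks_def)
    then show ?thesis unfolding vec_norm_square by (simp only: sum_blocks)
  qed
  also have "\<dots> = (\<Sum>j<k. (vec_norm (f j *\<^sub>v ?v j))\<^sup>2)"
  proof (intro sum.cong refl)
    fix j assume "j \<in> {..<k}"
    then have j: "j < k" by simp
    show "(\<Sum>s<b. (cmod (vec_index (blocks k b f *\<^sub>v v) (j * b + s)))\<^sup>2) = (vec_norm (f j *\<^sub>v ?v j))\<^sup>2"
      unfolding vec_norm_square using f[OF j] blocks_mult_vec[OF f v j] by simp
  qed
  also have "\<dots> \<le> (\<Sum>j<k. (r * vec_norm (?v j))\<^sup>2)"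
  proof (intro sum_mono power_mono vec_norm_nonneg)
    fix j assume "j \<in> {..<k}"
    then have j: "j < k" by simp
    show "vec_norm (f j *\<^sub>v ?v j) \<le> r * vec_norm (?v j)"
      using op_norm_upper[OF f[OF j], of "?v j"] mult_right_mono[OF r(2)[OF j] vec_norm_nonneg[of "?v j"]] by simp
  qed
  also have "\<dots> = r\<^sup>2 * (vec_norm v)\<^sup>2"
    unfolding power_mult_distrib sum_distrib_left[symmetric] vec_norm_square
    using v by (simp add: sum_blocks)
  finally have "(vec_norm (blocks k b f *\<^sub>v v))\<^sup>2 \<le> (r * vec_norm v)\<^sup>2" by (simp add: power_mult_distrib)
  then show "vec_norm (blocks k b f *\<^sub>v v) \<le> r * vec_norm v"
    by (rule power2_le_imp_le) (intro mult_nonneg_nonneg r vec_norm_nonneg)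
qed

lemma blocks_mult:
  assumes f: "\<And>j. j < k \<Longrightarrow> f j \<in> carrier_mat b b" and g: "\<And>j. j < k \<Longrightarrow> g j \<in> carrier_mat b b"
  shows "blocks k b f * blocks k b g = blocks k b (\<lambda>j. f j * g j)"
proof (rule eq_matI)
  fix p q assume "p < dim_row (blocks k b (\<lambda>j. f j * g j))" "q < dim_col (blocks k b (\<lambda>j. f j * g j))"
  then have pq: "p < k * b" "q < k * b" by (auto simp: blocks_def)
  let ?j = "p div b" and ?s = "p mod b" and ?i = "q div b" and ?t = "q mod b"
  have d: "?j < k" "?s < b" "?i < k" "?t < b" using block_index_bounds pq by auto
  have "(blocks k b f * blocks k b g) $$ (p, q) =
      (\<Sum>l<k. \<Sum>u<b. blocks k b f $$ (p, l * b + u) * blocks k b g $$ (l * b + u, q))"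
    using mult_mat_index[OF blocks_mem blocks_mem pq, of f g] by (simp only: sum_blocks)
  also have "\<dots> = (\<Sum>l<k. if l = ?j then (if ?j = ?i then (\<Sum>u<b. f ?j $$ (?s, u) * g ?j $$ (u, ?t)) else 0) else 0)"
    using d pq by (intro sum.cong refl) (auto simp: blocks_index block_pos intro!: sum.cong sum.neutral)
  also have "\<dots> = (if ?j = ?i then (\<Sum>u<b. f ?j $$ (?s, u) * g ?j $$ (u, ?t)) else 0)" using d by simp
  also have "\<dots> = blocks k b (\<lambda>j. f j * g j) $$ (p, q)"
    using pq d mult_mat_index[OF f[OF d(3)] g[OF d(3)] d(2) d(4)] by (simp add: blocks_index del: index_mult_mat)
  finally show "(blocks k b f * blocks k b g) $$ (p, q) = blocks k b (\<lambda>j. f j * g j) $$ (p, q)" .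
qed (auto simp: blocks_def)

lemma block_mem [simp]: "block b M j i \<in> carrier_mat b b"
  by (simp add: block_def)

lemma block_dim [simp]: "dim_row (block b M j i) = b" "dim_col (block b M j i) = b"
  by (simp_all add: block_def)

definition pad :: "nat \<Rightarrow> nat \<Rightarrow> complex Matrix.vec \<Rightarrow> complex Matrix.vec" where
  "pad k b v = Matrix.vec (k * b) (\<lambda>p. if p < b then vec_index v p else 0)"

lemma pad_mem [simp]: "pad k b v \<in> carrier_vec (k * b)"
  by (simp add: pad_def)

lemma sum_first_block: "0 < (k :: nat) \<Longrightarrow> (\<Sum>p<k * b. if p < b then g p else (0 :: 'a :: comm_monoid_add)) = (\<Sum>p<b. g p)"
proof -
  assume "0 < k"
  then have "{..<k * b} \<inter> {p. p < b} = {..<b}" by (cases k) auto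
  then show ?thesis by (simp add: sum.If_cases)
qed

lemma vec_norm_pad: assumes "0 < k" "v \<in> carrier_vec b" shows "vec_norm (pad k b v) = vec_norm v"
proof -
  have "(\<Sum>p<k * b. (cmod (vec_index (pad k b v) p))\<^sup>2) = (\<Sum>p<k * b. if p < b then (cmod (vec_index v p))\<^sup>2 else 0)"
    by (intro sum.cong) (auto simp: pad_def)
  then have "(vec_norm (pad k b v))\<^sup>2 = (vec_norm v)\<^sup>2"
    using assms by (simp add: vec_norm_square sum_first_block) (simp add: pad_def)
  then show ?thesis using vec_norm_nonneg by (simp add: power2_eq_iff_nonneg)
qed

lemma block_mult_pad:
  assumes k: "0 < k" and M: "M \<in> carrier_mat (k * b) (k * b)" and v: "v \<in> carrier_vec b" and i: "i < b"
  shows "vec_index (block b M 0 0 *\<^sub>v v) i = vec_index (M *\<^sub>v pad k b v) i"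
proof -
  have ik: "i < k * b" using k i by (cases k) auto
  have "vec_index (M *\<^sub>v pad k b v) i = (\<Sum>p<k * b. if p < b then M $$ (i, p) * vec_index v p else 0)"
    unfolding mult_mat_vec_index[OF M pad_mem ik] by (intro sum.cong) (auto simp: pad_def)
  also have "\<dots> = (\<Sum>p<b. M $$ (i, p) * vec_index v p)" by (rule sum_first_block[OF k])
  also have "\<dots> = vec_index (block b M 0 0 *\<^sub>v v) i"
    using mult_mat_vec_index[OF block_mem v i, of M 0 0] i
    by (simp add: block_def del: index_mult_mat_vec)
  finally show ?thesis by simp
qed

lemma numr_block:
  assumes k: "0 < k" and M: "M \<in> carrier_mat (k * b) (k * b)" and v: "v \<in> carrier_vec b"
  shows "numr (block b M 0 0) v = numr M (pad k b v)"
proof -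
  have "ip (M *\<^sub>v pad k b v) (pad k b v) =
      (\<Sum>p<k * b. if p < b then vec_index (M *\<^sub>v pad k b v) p * cnj (vec_index v p) else 0)"
    unfolding ip_def using M by (intro sum.cong) (auto simp: pad_def)
  also have "\<dots> = (\<Sum>p<b. vec_index (M *\<^sub>v pad k b v) p * cnj (vec_index v p))"
    by (rule sum_first_block[OF k])
  also have "\<dots> = ip (block b M 0 0 *\<^sub>v v) v"
    unfolding ip_def using block_mult_pad[OF k M v] by (simp del: index_mult_mat_vec)
  finally show ?thesis by (simp add: numr_def)
qed

lemma op_norm_block_le:
  assumes k: "0 < k" and M: "M \<in> carrier_mat (k * b) (k * b)"
  shows "op_norm (block b M 0 0) \<le> op_norm M"
proof (rule op_norm_leI[OF block_mem op_norm_nonneg[OF M]])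
  fix v :: "complex Matrix.vec" assume v: "v \<in> carrier_vec b"
  have "(vec_norm (block b M 0 0 *\<^sub>v v))\<^sup>2 = (\<Sum>p<b. (cmod (vec_index (M *\<^sub>v pad k b v) p))\<^sup>2)"
    unfolding vec_norm_square using block_mult_pad[OF k M v] by (simp del: index_mult_mat_vec)
  also have "\<dots> \<le> (\<Sum>p<k * b. (cmod (vec_index (M *\<^sub>v pad k b v) p))\<^sup>2)"
    using k by (intro sum_mono2) (cases k, auto)
  also have "\<dots> = (vec_norm (M *\<^sub>v pad k b v))\<^sup>2" using M by (simp add: vec_norm_square)
  finally have "vec_norm (block b M 0 0 *\<^sub>v v) \<le> vec_norm (M *\<^sub>v pad k b v)"
    by (rule power2_le_imp_le) (rule vec_norm_nonneg)
  also have "\<dots> \<le> op_norm M * vec_norm (pad k b v)" by (rule op_norm_upper[OF M pad_mem])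
  finally show "vec_norm (block b M 0 0 *\<^sub>v v) \<le> op_norm M * vec_norm v"
    by (simp add: vec_norm_pad[OF k v])
qed

lemma block_blocks: "j < k \<Longrightarrow> f j \<in> carrier_mat b b \<Longrightarrow> block b (blocks k b f) j j = f j"
  by (intro eq_matI) (auto simp: block_def blocks_index block_pos)

lemma block_add:
  "M \<in> carrier_mat (k * b) (k * b) \<Longrightarrow> N \<in> carrier_mat (k * b) (k * b) \<Longrightarrow> j < k \<Longrightarrow>
    block b (M + N) j j = block b M j j + block b N j j"
  by (intro eq_matI) (auto simp: block_def block_pos)

lemma block_smult:
  "M \<in> carrier_mat (k * b) (k * b) \<Longrightarrow> j < k \<Longrightarrow> block b (c \<cdot>\<^sub>m M) j j = c \<cdot>\<^sub>m block b M j j"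
  by (intro eq_matI) (auto simp: block_def block_pos)

lemma block_adjoint:
  assumes "M \<in> carrier_mat (k * b) (k * b)" "j < k"
  shows "block b (mat_adjoint M) j j = mat_adjoint (block b M j j)"
  using assms by (intro eq_matI) (auto simp: adjoint_eq block_def block_pos)

section \<open>Conjugation by unitary matrices\<close>

definition unitary_mat :: "nat \<Rightarrow> complex Matrix.mat \<Rightarrow> bool" where
  "unitary_mat N V \<longleftrightarrow> V \<in> carrier_mat N N \<and> mat_adjoint V * V = 1\<^sub>m N \<and> V * mat_adjoint V = 1\<^sub>m N"

definition conjug :: "complex Matrix.mat \<Rightarrow> complex Matrix.mat \<Rightarrow> complex Matrix.mat" where
  "conjug V X = V * X * mat_adjoint V"

lemma unitary_adjoint: "unitary_mat N V \<Longrightarrow> unitary_mat N (mat_adjoint V)"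
  by (auto simp: unitary_mat_def adjoint_adjoint)

lemma unitary_mem: "unitary_mat N V \<Longrightarrow> V \<in> carrier_mat N N"
  by (simp add: unitary_mat_def)

lemma op_norm_unitary_le: "unitary_mat N V \<Longrightarrow> op_norm V \<le> 1"
  by (auto simp: unitary_mat_def intro: op_norm_isometry_le_1)

lemma conjug_mem:
  assumes "unitary_mat N V" "X \<in> carrier_mat N N" shows "conjug V X \<in> carrier_mat N N"
  unfolding conjug_def
  using mult_carrier_mat[OF mult_carrier_mat[OF unitary_mem[OF assms(1)] assms(2)]
      adjoint_mem[OF unitary_mem[OF assms(1)]]] .

lemma conjug_add:
  assumes "unitary_mat N V" "X \<in> carrier_mat N N" "Y \<in> carrier_mat N N"
  shows "conjug V (X + Y) = conjug V X + conjug V Y"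
proof -
  note V = unitary_mem[OF assms(1)] adjoint_mem[OF unitary_mem[OF assms(1)]]
  show ?thesis
    unfolding conjug_def mult_add_distrib_mat[OF V(1) assms(2,3)]
    by (rule add_mult_distrib_mat[OF mult_carrier_mat[OF V(1) assms(2)] mult_carrier_mat[OF V(1) assms(3)] V(2)])
qed

lemma conjug_smult:
  assumes "unitary_mat N V" "X \<in> carrier_mat N N"
  shows "conjug V (c \<cdot>\<^sub>m X) = c \<cdot>\<^sub>m conjug V X"
proof -
  note V = unitary_mem[OF assms(1)] adjoint_mem[OF unitary_mem[OF assms(1)]]
  show ?thesis
    unfolding conjug_def mult_smult_distrib[OF V(1) assms(2)]
    by (rule mult_smult_assoc_mat[OF mult_carrier_mat[OF V(1) assms(2)] V(2)])
qed

lemma conjug_inverse: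
  assumes V: "unitary_mat N V" and X: "X \<in> carrier_mat N N"
  shows "conjug (mat_adjoint V) (conjug V X) = X"
proof -
  note Vm = unitary_mem[OF V]
  note Va = adjoint_mem[OF Vm]
  have e: "mat_adjoint V * V = 1\<^sub>m N" using V by (simp add: unitary_mat_def)
  have "conjug (mat_adjoint V) (conjug V X) = mat_adjoint V * (V * X * mat_adjoint V) * V"
    by (simp add: conjug_def adjoint_adjoint)
  also have "\<dots> = (mat_adjoint V * V) * X * (mat_adjoint V * V)"
    using Vm Va X by (simp add: assoc_mult_mat[of _ N N _ N _ N] mult_carrier_mat[of _ N N _ N])
  also have "\<dots> = X" using X by (simp add: e)
  finally show ?thesis .
qed

lemma conjug_inverse':
  assumes V: "unitary_mat N V" and X: "X \<in> carrier_mat N N"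
  shows "conjug V (conjug (mat_adjoint V) X) = X"
  using conjug_inverse[OF unitary_adjoint[OF V] X] by (simp add: adjoint_adjoint)

lemma conjug_mult:
  assumes V: "unitary_mat N V" and X: "X \<in> carrier_mat N N" and Y: "Y \<in> carrier_mat N N"
  shows "conjug V (X * Y) = conjug V X * conjug V Y"
proof -
  note Vm = unitary_mem[OF V]
  note Va = adjoint_mem[OF Vm]
  have e: "mat_adjoint V * V = 1\<^sub>m N" using V by (simp add: unitary_mat_def)
  have "conjug V X * conjug V Y = V * X * (mat_adjoint V * V) * (Y * mat_adjoint V)"
    unfolding conjug_def using Vm Va X Y by (simp add: assoc_mult_mat[of _ N N _ N _ N] mult_carrier_mat[of _ N N _ N])
  also have "\<dots> = conjug V (X * Y)"
    unfolding e conjug_def using Vm Va X Y by (simp add: assoc_mult_mat[of _ N N _ N _ N] mult_carrier_mat[of _ N N _ N])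
  finally show ?thesis by simp
qed

lemma conjug_adjoint:
  assumes V: "unitary_mat N V" and X: "X \<in> carrier_mat N N"
  shows "conjug V (mat_adjoint X) = mat_adjoint (conjug V X)"
proof -
  note Vm = unitary_mem[OF V]
  note Va = adjoint_mem[OF Vm]
  show ?thesis
    unfolding conjug_def adjoint_mult[OF mult_carrier_mat[OF Vm X] Va] adjoint_mult[OF Vm X] adjoint_adjoint
    using Vm Va X adjoint_mem[OF X] by (simp add: assoc_mult_mat[of _ N N _ N _ N] mult_carrier_mat[of _ N N _ N])
qed

lemma conjug_one: "unitary_mat N V \<Longrightarrow> conjug V (1\<^sub>m N) = 1\<^sub>m N"
  using right_mult_one_mat[OF unitary_mem, of N V] by (simp add: conjug_def unitary_mat_def)

lemma op_norm_conjug_le: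
  assumes V: "unitary_mat N V" and X: "X \<in> carrier_mat N N"
  shows "op_norm (conjug V X) \<le> op_norm X"
proof -
  note Vm = unitary_mem[OF V]
  have "op_norm (conjug V X) \<le> op_norm (V * X) * op_norm (mat_adjoint V)"
    unfolding conjug_def by (rule op_norm_mult[OF mult_carrier_mat[OF Vm X] adjoint_mem[OF Vm]])
  also have "\<dots> \<le> op_norm (V * X) * 1"
    by (intro mult_left_mono op_norm_unitary_le[OF unitary_adjoint[OF V]]
        op_norm_nonneg[OF mult_carrier_mat[OF Vm X]])
  also have "\<dots> \<le> op_norm V * op_norm X" using op_norm_mult[OF Vm X] by simp
  also have "\<dots> \<le> 1 * op_norm X"
    by (intro mult_right_mono op_norm_unitary_le[OF V] op_norm_nonneg[OF X])
  finally show ?thesis by simp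
qed

lemma conjug_adjoint_index:
  assumes V: "V \<in> carrier_mat N N" and X: "X \<in> carrier_mat N N" and pq: "p < N" "q < N"
  shows "conjug (mat_adjoint V) X $$ (p, q) =
    (\<Sum>l<N. (\<Sum>u<N. cnj (V $$ (u, p)) * X $$ (u, l)) * V $$ (l, q))"
proof -
  note Va = adjoint_mem[OF V]
  have "conjug (mat_adjoint V) X $$ (p, q) = (\<Sum>l<N. (mat_adjoint V * X) $$ (p, l) * V $$ (l, q))"
    unfolding conjug_def adjoint_adjoint by (rule mult_mat_index[OF mult_carrier_mat[OF Va X] V pq])
  also have "\<dots> = (\<Sum>l<N. (\<Sum>u<N. cnj (V $$ (u, p)) * X $$ (u, l)) * V $$ (l, q))"
    by (intro sum.cong refl arg_cong2[where f = "(*)"], subst mult_mat_index[OF Va X pq(1)])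
      (auto intro!: sum.cong simp: adjoint_index[OF V] pq)
  finally show ?thesis .
qed

section \<open>Block Fourier matrices\<close>

definition fourier :: "nat \<Rightarrow> nat \<Rightarrow> real \<Rightarrow> complex Matrix.mat" where
  "fourier k b t = Matrix.mat (k * b) (k * b) (\<lambda>(p, q).
     z_entry k (Suc (p div b)) (Suc (q div b)) t * (1\<^sub>m b $$ (p mod b, q mod b)))"

lemma z_entry_eq_cis:
  "z_entry k (Suc j) (Suc i) t =
    complex_of_real (1 / sqrt (real k)) * cis (2 * pi * ((real k - 1 - real j) * (t + real i) / real k))"
proof -
  have "exp (2 * complex_of_real pi * \<i> * complex_of_real x) = cis (2 * pi * x)" for x
    by (simp add: cis_conv_exp mult_ac)
  moreover have "real k - real (Suc j) = real k - 1 - real j" "t + real (Suc i) - 1 = t + real i" by auto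
  ultimately show ?thesis by (simp only: z_entry_def) simp
qed

lemma fourier_mem [simp]: "fourier k b t \<in> carrier_mat (k * b) (k * b)"
  by (simp add: fourier_def)

lemma fourier_index:
  assumes "p < k * b" "q < k * b"
  shows "fourier k b t $$ (p, q) =
    (if p mod b = q mod b then z_entry k (Suc (p div b)) (Suc (q div b)) t else 0)"
  using assms block_index_bounds[OF assms(1)] block_index_bounds[OF assms(2)] by (simp add: fourier_def)

lemma sum_root_of_unity:
  fixes d :: int
  assumes k: "0 < k" and d: "\<bar>d\<bar> < int k"
  shows "(\<Sum>l<k. cis (2 * pi * ((real k - 1 - real l) * real_of_int d / real k))) =
    (if d = 0 then of_nat k else 0)"
proof -
  define w where "w = cis (2 * pi * (real_of_int d / real k))"
  have "(\<Sum>l<k. cis (2 * pi * ((real k - 1 - real l) * real_of_int d / real k))) = (\<Sum>l<k. w ^ (k - Suc l))"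
  proof (intro sum.cong refl)
    fix l assume "l \<in> {..<k}"
    then have "real (k - Suc l) = real k - 1 - real l" by (simp add: of_nat_diff)
    then show "cis (2 * pi * ((real k - 1 - real l) * real_of_int d / real k)) = w ^ (k - Suc l)"
      unfolding w_def Complex.DeMoivre by (simp add: mult_ac)
  qed
  also have "\<dots> = (\<Sum>l<k. w ^ l)" by (rule sum.nat_diff_reindex)
  also have "\<dots> = (if d = 0 then of_nat k else 0)"
  proof (cases "d = 0")
    case True
    then show ?thesis by (simp add: w_def)
  next
    case False
    have "w \<noteq> 1"
    proof
      assume "w = 1"
      then have "cos (2 * pi * (real_of_int d / real k)) = 1" by (simp add: w_def complex_eq_iff)
      then obtain n :: int where "2 * pi * (real_of_int d / real k) = of_int n * 2 * pi"
        using cos_one_2pi_int by blast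
      then have "(2 * pi) * (real_of_int d / real k) = (2 * pi) * of_int n" by (simp only: mult_ac)
      then have "real_of_int d / real k = of_int n" using pi_neq_zero by (metis mult_left_cancel mult_eq_0_iff zero_neq_numeral)
      then have "real_of_int d = real_of_int n * real k" using k by (simp add: field_simps)
      then have "d = n * int k" by (metis of_int_eq_iff of_int_mult of_int_of_nat_eq)
      then show False using d False
        by (metis dvd_imp_le_int dvd_triv_right abs_of_nat linorder_not_less)
    qed
    moreover have "w ^ k = 1"
    proof -
      have "w ^ k = cis (2 * pi * of_int d)" unfolding w_def Complex.DeMoivre using k by simp
      then show ?thesis by (simp add: cis_multiple_2pi)
    qed
    ultimately show ?thesis using False by (simp add: sum_gp_strict)
  qed
  finally show ?thesis .
qed

lemma unitary_fourier: assumes k: "0 < k" and b: "0 < b" shows "unitary_mat (k * b) (fourier k b t)"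
proof -
  let ?V = "fourier k b t"
  have "mat_adjoint ?V * ?V = 1\<^sub>m (k * b)"
  proof (rule eq_matI)
    fix p q assume "p < dim_row (1\<^sub>m (k * b))" "q < dim_col (1\<^sub>m (k * b))"
    then have pq: "p < k * b" "q < k * b" by auto
    have d: "p div b < k" "p mod b < b" "q div b < k" "q mod b < b" using block_index_bounds pq by auto
    have "(mat_adjoint ?V * ?V) $$ (p, q) = (\<Sum>l<k * b. cnj (?V $$ (l, p)) * ?V $$ (l, q))"
      by (subst mult_mat_index[OF adjoint_mem[OF fourier_mem] fourier_mem pq])
        (auto intro!: sum.cong simp: adjoint_index[OF fourier_mem] pq)
    also have "\<dots> = (\<Sum>j<k. \<Sum>s<b. if s = p mod b then (if p mod b = q mod b then
        cnj (z_entry k (Suc j) (Suc (p div b)) t) * z_entry k (Suc j) (Suc (q div b)) t else 0) else 0)"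
      unfolding sum_blocks using pq by (intro sum.cong refl) (auto simp: fourier_index block_pos)
    also have "\<dots> = (if p mod b = q mod b then (\<Sum>j<k.
        cnj (z_entry k (Suc j) (Suc (p div b)) t) * z_entry k (Suc j) (Suc (q div b)) t) else 0)"
      using d by simp
    also have "(\<Sum>j<k. cnj (z_entry k (Suc j) (Suc (p div b)) t) * z_entry k (Suc j) (Suc (q div b)) t) =
        (\<Sum>j<k. complex_of_real (1 / real k) *
          cis (2 * pi * ((real k - 1 - real j) * real_of_int (int (q div b) - int (p div b)) / real k)))"
    proof (intro sum.cong refl)
      fix j
      have r: "complex_of_real (1 / sqrt (real k)) * complex_of_real (1 / sqrt (real k)) = complex_of_real (1 / real k)"
        unfolding of_real_mult[symmetric] by simp
      let ?x = "2 * pi * ((real k - 1 - real j) * (t + real (p div b)) / real k)"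
      let ?y = "2 * pi * ((real k - 1 - real j) * (t + real (q div b)) / real k)"
      have "?y - ?x = 2 * pi * ((real k - 1 - real j) * real_of_int (int (q div b) - int (p div b)) / real k)"
        by (simp add: algebra_simps diff_divide_distrib add_divide_distrib)
      moreover have "cnj (z_entry k (Suc j) (Suc (p div b)) t) * z_entry k (Suc j) (Suc (q div b)) t =
          complex_of_real (1 / real k) * cis (?y - ?x)"
      proof -
        have "cnj (z_entry k (Suc j) (Suc (p div b)) t) * z_entry k (Suc j) (Suc (q div b)) t =
          (complex_of_real (1 / sqrt (real k)) * complex_of_real (1 / sqrt (real k))) * (cis (- ?x) * cis ?y)"
          unfolding z_entry_eq_cis complex_cnj_mult complex_cnj_complex_of_real cis_cnj by (simp only: mult_ac)
        then show ?thesis unfolding r cis_mult by simp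
      qed
      ultimately show "cnj (z_entry k (Suc j) (Suc (p div b)) t) * z_entry k (Suc j) (Suc (q div b)) t =
          complex_of_real (1 / real k) *
          cis (2 * pi * ((real k - 1 - real j) * real_of_int (int (q div b) - int (p div b)) / real k))"
        by (simp only:)
    qed
    also have "\<dots> = (if p div b = q div b then 1 else 0)"
    proof -
      have bd: "\<bar>int (q div b) - int (p div b)\<bar> < int k" using d(1,3) by linarith
      show ?thesis by (subst sum_distrib_left[symmetric], subst sum_root_of_unity[OF k bd]) (use k in auto)
    qed
    also have "(if p mod b = q mod b then (if p div b = q div b then 1 else 0) else 0) =
        (1\<^sub>m (k * b) :: complex Matrix.mat) $$ (p, q)"
    proof -
      have "p div b = q div b \<Longrightarrow> p mod b = q mod b \<Longrightarrow> p = q" by (metis div_mult_mod_eq)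
      then show ?thesis using pq by auto
    qed
    finally show "(mat_adjoint ?V * ?V) $$ (p, q) = 1\<^sub>m (k * b) $$ (p, q)" .
  qed (use carrier_matD[OF adjoint_mem[OF fourier_mem[of k b t]]] carrier_matD[OF fourier_mem[of k b t]] in auto)
  moreover from this have "?V * mat_adjoint ?V = 1\<^sub>m (k * b)"
    by (rule mat_mult_left_right_inverse[OF adjoint_mem[OF fourier_mem] fourier_mem])
  ultimately show ?thesis by (simp add: unitary_mat_def)
qed

text \<open>Advancing the variable by a period permutes the block columns of the Fourier matrix cyclically.\<close>

definition shift :: "nat \<Rightarrow> nat \<Rightarrow> nat \<Rightarrow> nat" where
  "shift k b q = (if Suc (q div b) = k then 0 else Suc (q div b)) * b + q mod b"

lemma shift_bound: "q < k * b \<Longrightarrow> shift k b q < k * b"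
  using block_index_bounds[of q k b] block_pos[of "if Suc (q div b) = k then 0 else Suc (q div b)" k "q mod b" b]
  by (auto simp: shift_def)

lemma shift_div_mod:
  assumes "q < k * b"
  shows "shift k b q div b = (if Suc (q div b) = k then 0 else Suc (q div b))" "shift k b q mod b = q mod b"
  using block_index_bounds[OF assms] by (auto simp: shift_def)

lemma fourier_shift:
  assumes pq: "p < k * b" "q < k * b"
  shows "fourier k b (t + 1) $$ (p, q) = fourier k b t $$ (p, shift k b q)"
proof -
  have d: "p div b < k" "q div b < k" using block_index_bounds pq by auto
  have "z_entry k (Suc (p div b)) (Suc (q div b)) (t + 1) =
      z_entry k (Suc (p div b)) (Suc (shift k b q div b)) t"
  proof (cases "Suc (q div b) = k")
    case False
    then show ?thesis by (simp add: shift_div_mod[OF pq(2)] z_entry_eq_cis add_ac)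
  next
    case True
    then have k: "real (q div b) = real k - 1" "0 < k" by auto
    let ?c = "real k - 1 - real (p div b)"
    have "2 * pi * (?c * (t + 1 + real (q div b)) / real k) = 2 * pi * (?c * t / real k) + 2 * pi * ?c"
      unfolding k(1) using k(2) by (simp add: field_simps)
    moreover have "?c = of_int (int k - 1 - int (p div b))" by simp
    then have "cis (2 * pi * ?c) = 1" by (simp only: cis_multiple_2pi Ints_of_int)
    ultimately have e: "cis (2 * pi * (?c * (t + 1 + real (q div b)) / real k)) = cis (2 * pi * (?c * t / real k))"
      by (simp only: cis_mult[symmetric] mult_1_right)
    have s: "shift k b q div b = 0" using True by (simp add: shift_div_mod[OF pq(2)])
    show ?thesis unfolding z_entry_eq_cis s e by simp
  qed
  then show ?thesis
    using pq shift_bound[OF pq(2)] by (simp add: fourier_index shift_div_mod(2)[OF pq(2)])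
qed

lemma conjug_fourier_shift:
  assumes X: "X \<in> carrier_mat (k * b) (k * b)" and pq: "p < k * b" "q < k * b"
  shows "conjug (mat_adjoint (fourier k b (t + 1))) X $$ (p, q) =
    conjug (mat_adjoint (fourier k b t)) X $$ (shift k b p, shift k b q)"
  using pq by (simp add: conjug_adjoint_index[OF fourier_mem X] shift_bound fourier_shift)

section \<open>Periodic continuous matrix functions\<close>

definition mat_fun :: "nat \<Rightarrow> (real \<Rightarrow> complex Matrix.mat) \<Rightarrow> bool" where
  "mat_fun N f \<longleftrightarrow> (\<forall>t. f t \<in> carrier_mat N N) \<and>
     (\<forall>i<N. \<forall>j<N. continuous_on UNIV (\<lambda>t. f t $$ (i, j)))"

lemma mat_funD: "mat_fun N f \<Longrightarrow> f t \<in> carrier_mat N N"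
  "mat_fun N f \<Longrightarrow> i < N \<Longrightarrow> j < N \<Longrightarrow> continuous_on UNIV (\<lambda>t. f t $$ (i, j))"
  by (auto simp: mat_fun_def)

lemma mat_fun_add: assumes "mat_fun N f" "mat_fun N g" shows "mat_fun N (\<lambda>t. f t + g t)"
  unfolding mat_fun_def
proof (intro conjI allI impI)
  fix i j assume ij: "i < N" "j < N"
  have "(f t + g t) $$ (i, j) = f t $$ (i, j) + g t $$ (i, j)" for t
    using mat_funD(1)[OF assms(1), of t] mat_funD(1)[OF assms(2), of t] ij by simp
  then show "continuous_on UNIV (\<lambda>t. (f t + g t) $$ (i, j))"
    using mat_funD(2)[OF assms(1) ij] mat_funD(2)[OF assms(2) ij] by (simp add: continuous_on_add)
qed (use mat_funD(1)[OF assms(1)] mat_funD(1)[OF assms(2)] in auto)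

lemma mat_fun_smult: assumes "mat_fun N f" shows "mat_fun N (\<lambda>t. c \<cdot>\<^sub>m f t)"
  unfolding mat_fun_def
proof (intro conjI allI impI)
  fix i j assume ij: "i < N" "j < N"
  have "(c \<cdot>\<^sub>m f t) $$ (i, j) = c * f t $$ (i, j)" for t
    using mat_funD(1)[OF assms, of t] ij by simp
  then show "continuous_on UNIV (\<lambda>t. (c \<cdot>\<^sub>m f t) $$ (i, j))"
    using mat_funD(2)[OF assms ij] by (simp add: continuous_on_mult_left)
qed (use mat_funD(1)[OF assms] in auto)

lemma mat_fun_mult: assumes "mat_fun N f" "mat_fun N g" shows "mat_fun N (\<lambda>t. f t * g t)"
  unfolding mat_fun_def
proof (intro conjI allI impI)
  note m = mat_funD(1)[OF assms(1)] mat_funD(1)[OF assms(2)]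
  show "f t * g t \<in> carrier_mat N N" for t by (rule mult_carrier_mat[OF m])
  fix i j assume ij: "i < N" "j < N"
  have "(\<lambda>t. (f t * g t) $$ (i, j)) = (\<lambda>t. \<Sum>l<N. f t $$ (i, l) * g t $$ (l, j))"
    by (intro ext mult_mat_index[OF m ij])
  moreover have "continuous_on UNIV (\<lambda>t. \<Sum>l<N. f t $$ (i, l) * g t $$ (l, j))"
    using ij by (intro continuous_on_sum continuous_on_mult mat_funD(2)[OF assms(1)] mat_funD(2)[OF assms(2)]) auto
  ultimately show "continuous_on UNIV (\<lambda>t. (f t * g t) $$ (i, j))" by (simp only:)
qed

lemma mat_fun_adjoint: assumes "mat_fun N f" shows "mat_fun N (\<lambda>t. mat_adjoint (f t))"
  unfolding mat_fun_def
proof (intro conjI allI impI)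
  fix i j assume ij: "i < N" "j < N"
  have "(\<lambda>t. mat_adjoint (f t) $$ (i, j)) = (\<lambda>t. cnj (f t $$ (j, i)))"
    by (intro ext adjoint_index[OF mat_funD(1)[OF assms] ij])
  then show "continuous_on UNIV (\<lambda>t. mat_adjoint (f t) $$ (i, j))"
    using mat_funD(2)[OF assms ij(2,1)] by (simp only: continuous_on_cnj)
qed (use mat_funD(1)[OF assms] in auto)

lemma mat_fun_const: "M \<in> carrier_mat N N \<Longrightarrow> mat_fun N (\<lambda>t. M)"
  by (simp add: mat_fun_def)

lemma mat_fun_compose:
  assumes f: "mat_fun N f" and g: "continuous_on UNIV (g :: real \<Rightarrow> real)" shows "mat_fun N (\<lambda>t. f (g t))"
  unfolding mat_fun_def
  using mat_funD(1)[OF f] continuous_on_compose2[OF mat_funD(2)[OF f] g] by auto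

lemma mat_fun_fourier: "mat_fun (k * b) (fourier k b)"
  unfolding mat_fun_def
proof (intro conjI allI impI fourier_mem)
  fix p q assume pq: "p < k * b" "q < k * b"
  have k: "k \<noteq> 0" using pq(1) by (cases k) simp_all
  from pq have e: "(\<lambda>t. fourier k b t $$ (p, q)) =
      (\<lambda>t. if p mod b = q mod b then z_entry k (Suc (p div b)) (Suc (q div b)) t else 0)"
    by (simp add: fourier_index)
  show "continuous_on UNIV (\<lambda>t. fourier k b t $$ (p, q))"
    unfolding e z_entry_def using k by (cases "p mod b = q mod b") (auto intro!: continuous_intros)
qed

definition cpf :: "nat \<Rightarrow> (real \<Rightarrow> complex Matrix.mat) set" where
  "cpf N = {f. mat_fun N f \<and> (\<forall>t. f (t + 1) = f t)}"

definition sup_norm :: "(real \<Rightarrow> complex Matrix.mat) \<Rightarrow> real" where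
  "sup_norm f = (SUP t. op_norm (f t))"

lemma CP_simps [simp]:
  "carrier (CP \<sigma> m) = cpf (boxtimes \<sigma> m)"
  "a \<otimes>\<^bsub>CP \<sigma> m\<^esub> b = (\<lambda>t. a t * b t)"
  "\<one>\<^bsub>CP \<sigma> m\<^esub> = (\<lambda>t. 1\<^sub>m (boxtimes \<sigma> m))"
  "\<zero>\<^bsub>CP \<sigma> m\<^esub> = (\<lambda>t. 0\<^sub>m (boxtimes \<sigma> m) (boxtimes \<sigma> m))"
  "a \<oplus>\<^bsub>CP \<sigma> m\<^esub> b = (\<lambda>t. a t + b t)"
  "c \<odot>\<^bsub>CP \<sigma> m\<^esub> a = (\<lambda>t. c \<cdot>\<^sub>m a t)"
  "star (CP \<sigma> m) a = (\<lambda>t. mat_adjoint (a t))"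
  "nrm (CP \<sigma> m) a = sup_norm a"
  by (auto simp: CP_def Let_def cpf_def mat_fun_def sup_norm_def)

lemma cpfD: "f \<in> cpf N \<Longrightarrow> mat_fun N f" "f \<in> cpf N \<Longrightarrow> f (t + 1) = f t" "f \<in> cpf N \<Longrightarrow> f t \<in> carrier_mat N N"
  by (auto simp: cpf_def mat_fun_def)

lemma cpf_frac: assumes f: "f \<in> cpf N" shows "f t = f (frac t)"
proof -
  interpret periodic_fun_simple' f by unfold_locales (rule cpfD(2)[OF f])
  have "f t = f (frac t + of_int \<lfloor>t\<rfloor>)" by (simp add: frac_def)
  then show ?thesis by (simp only: plus_of_int)
qed

lemma cpf_bdd: assumes f: "f \<in> cpf N" shows "bdd_above (range (\<lambda>t. op_norm (f t)))"
proof -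
  let ?h = "\<lambda>t. \<Sum>i<N. \<Sum>j<N. cmod (f t $$ (i, j))"
  have c: "continuous_on {0..1} ?h"
    by (intro continuous_on_sum continuous_on_norm continuous_on_subset[OF mat_funD(2)[OF cpfD(1)[OF f]]]) auto
  have "\<exists>x\<in>{0..1}. \<forall>t\<in>{0..1}. ?h t \<le> ?h x"
    by (rule continuous_attains_sup[OF compact_Icc _ c]) simp
  then obtain x where x: "\<forall>t\<in>{0..1}. ?h t \<le> ?h x" by (elim bexE)
  show ?thesis
  proof (rule bdd_aboveI2)
    fix t
    have "op_norm (f t) \<le> ?h (frac t)"
      using op_norm_le_sum[OF cpfD(3)[OF f, of "frac t"]] cpf_frac[OF f, of t] by simp
    also have "\<dots> \<le> ?h x" using frac_lt_1[of t] by (intro x[rule_format]) (auto simp: less_imp_le)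
    finally show "op_norm (f t) \<le> ?h x" .
  qed
qed

lemma op_norm_le_sup_norm: "f \<in> cpf N \<Longrightarrow> op_norm (f t) \<le> sup_norm f"
  unfolding sup_norm_def by (rule cSUP_upper[OF UNIV_I cpf_bdd])

lemma sup_norm_leI: "(\<And>t. op_norm (f t) \<le> r) \<Longrightarrow> sup_norm f \<le> r"
  unfolding sup_norm_def by (rule cSUP_least) auto

lemma cpf_add: "f \<in> cpf N \<Longrightarrow> g \<in> cpf N \<Longrightarrow> (\<lambda>t. f t + g t) \<in> cpf N"
  and cpf_mult: "f \<in> cpf N \<Longrightarrow> g \<in> cpf N \<Longrightarrow> (\<lambda>t. f t * g t) \<in> cpf N"
  and cpf_smult: "f \<in> cpf N \<Longrightarrow> (\<lambda>t. c \<cdot>\<^sub>m f t) \<in> cpf N"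
  and cpf_adjoint: "f \<in> cpf N \<Longrightarrow> (\<lambda>t. mat_adjoint (f t)) \<in> cpf N"
  and cpf_const: "M \<in> carrier_mat N N \<Longrightarrow> (\<lambda>t. M) \<in> cpf N"
  by (auto simp: cpf_def mat_fun_add mat_fun_mult mat_fun_smult mat_fun_adjoint mat_fun_const)

lemma minus_mat_eq: "M \<in> carrier_mat n m \<Longrightarrow> M' \<in> carrier_mat n m \<Longrightarrow> M - M' = M + (-1) \<cdot>\<^sub>m (M' :: complex Matrix.mat)"
  by (intro eq_matI) auto

lemma neg_add_mat: "M \<in> carrier_mat n m \<Longrightarrow> (-1) \<cdot>\<^sub>m M + M = 0\<^sub>m n m" for M :: "complex Matrix.mat"
  by (intro eq_matI) auto

lemma cpf_minus: assumes "f \<in> cpf N" "g \<in> cpf N" shows "(\<lambda>t. f t - g t) \<in> cpf N"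
  using cpf_add[OF assms(1) cpf_smult[OF assms(2), of "-1"]] minus_mat_eq[OF cpfD(3)[OF assms(1)] cpfD(3)[OF assms(2)]]
  by simp

definition pure_states :: "nat \<Rightarrow> ((real \<Rightarrow> complex Matrix.mat) \<Rightarrow> real) set" where
  "pure_states N = {\<lambda>a. numr (a t) v | t v. v \<in> carrier_vec N \<and> vec_norm v = 1}"

lemma numr_add:
  "M \<in> carrier_mat n n \<Longrightarrow> M' \<in> carrier_mat n n \<Longrightarrow> v \<in> carrier_vec n \<Longrightarrow> numr (M + M') v = numr M v + numr M' v"
  by (simp add: numr_def add_mult_distrib_mat_vec ip_add_left)

lemma numr_smult_mat:
  assumes M: "M \<in> carrier_mat n n" and v: "v \<in> carrier_vec n"
  shows "numr (complex_of_real r \<cdot>\<^sub>m M) v = r * numr M v"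
proof -
  have "(complex_of_real r \<cdot>\<^sub>m M) *\<^sub>v v = complex_of_real r \<cdot>\<^sub>v (M *\<^sub>v v)"
    using M v by (intro eq_vecI) (auto simp: scalar_prod_def sum_distrib_left mult.assoc)
  then show ?thesis by (simp add: numr_def ip_smult_left)
qed

lemma ring_CP: "ring (CP \<sigma> m)"
proof (rule ringI)
  let ?N = "boxtimes \<sigma> m"
  show "abelian_group (CP \<sigma> m)"
  proof (rule abelian_groupI)
    fix a assume "a \<in> carrier (CP \<sigma> m)"
    then have a: "a \<in> cpf ?N" by simp
    have "(\<lambda>t. (-1) \<cdot>\<^sub>m a t) \<oplus>\<^bsub>CP \<sigma> m\<^esub> a = \<zero>\<^bsub>CP \<sigma> m\<^esub>"
      using neg_add_mat[OF cpfD(3)[OF a]] by simp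
    then show "\<exists>y\<in>carrier (CP \<sigma> m). y \<oplus>\<^bsub>CP \<sigma> m\<^esub> a = \<zero>\<^bsub>CP \<sigma> m\<^esub>"
      using cpf_smult[OF a, of "-1"] by (intro bexI) auto
  next
    fix a b c assume "a \<in> carrier (CP \<sigma> m)" "b \<in> carrier (CP \<sigma> m)" "c \<in> carrier (CP \<sigma> m)"
    then have a: "\<And>t. a t \<in> carrier_mat ?N ?N" "\<And>t. b t \<in> carrier_mat ?N ?N" "\<And>t. c t \<in> carrier_mat ?N ?N"
      by (simp_all add: cpfD)
    show "a \<oplus>\<^bsub>CP \<sigma> m\<^esub> b \<oplus>\<^bsub>CP \<sigma> m\<^esub> c = a \<oplus>\<^bsub>CP \<sigma> m\<^esub> (b \<oplus>\<^bsub>CP \<sigma> m\<^esub> c)"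
      by (simp add: assoc_add_mat[OF a])
  next
    fix a b assume "a \<in> carrier (CP \<sigma> m)" "b \<in> carrier (CP \<sigma> m)"
    then have a: "\<And>t. a t \<in> carrier_mat ?N ?N" "\<And>t. b t \<in> carrier_mat ?N ?N" by (simp_all add: cpfD)
    show "a \<oplus>\<^bsub>CP \<sigma> m\<^esub> b = b \<oplus>\<^bsub>CP \<sigma> m\<^esub> a" by (simp add: comm_add_mat[OF a])
  qed (auto simp: cpf_add cpf_const cpfD intro!: ext left_add_zero_mat)
  show "monoid (CP \<sigma> m)"
  proof (rule monoidI)
    fix a b c assume "a \<in> carrier (CP \<sigma> m)" "b \<in> carrier (CP \<sigma> m)" "c \<in> carrier (CP \<sigma> m)"
    then have a: "\<And>t. a t \<in> carrier_mat ?N ?N" "\<And>t. b t \<in> carrier_mat ?N ?N" "\<And>t. c t \<in> carrier_mat ?N ?N"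
      by (simp_all add: cpfD)
    show "a \<otimes>\<^bsub>CP \<sigma> m\<^esub> b \<otimes>\<^bsub>CP \<sigma> m\<^esub> c = a \<otimes>\<^bsub>CP \<sigma> m\<^esub> (b \<otimes>\<^bsub>CP \<sigma> m\<^esub> c)"
      by (simp add: assoc_mult_mat[OF a])
  qed (auto simp: cpf_mult cpf_const left_mult_one_mat[OF cpfD(3)] right_mult_one_mat[OF cpfD(3)])
next
  let ?N = "boxtimes \<sigma> m"
  fix a b c assume "a \<in> carrier (CP \<sigma> m)" "b \<in> carrier (CP \<sigma> m)" "c \<in> carrier (CP \<sigma> m)"
  then have a: "\<And>t. a t \<in> carrier_mat ?N ?N" "\<And>t. b t \<in> carrier_mat ?N ?N" "\<And>t. c t \<in> carrier_mat ?N ?N"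
    by (simp_all add: cpfD)
  show "(a \<oplus>\<^bsub>CP \<sigma> m\<^esub> b) \<otimes>\<^bsub>CP \<sigma> m\<^esub> c = a \<otimes>\<^bsub>CP \<sigma> m\<^esub> c \<oplus>\<^bsub>CP \<sigma> m\<^esub> b \<otimes>\<^bsub>CP \<sigma> m\<^esub> c"
    by (simp add: add_mult_distrib_mat[OF a])
  show "c \<otimes>\<^bsub>CP \<sigma> m\<^esub> (a \<oplus>\<^bsub>CP \<sigma> m\<^esub> b) = c \<otimes>\<^bsub>CP \<sigma> m\<^esub> a \<oplus>\<^bsub>CP \<sigma> m\<^esub> c \<otimes>\<^bsub>CP \<sigma> m\<^esub> b"
    by (simp add: mult_add_distrib_mat[OF a(3,1,2)])
qed

lemma CP_minus:
  assumes a: "a \<in> cpf (boxtimes \<sigma> m)" and b: "b \<in> cpf (boxtimes \<sigma> m)"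
  shows "a \<ominus>\<^bsub>CP \<sigma> m\<^esub> b = (\<lambda>t. a t - b t)"
proof -
  interpret ring "CP \<sigma> m" by (rule ring_CP)
  have "(\<lambda>t. (-1) \<cdot>\<^sub>m b t) \<oplus>\<^bsub>CP \<sigma> m\<^esub> b = \<zero>\<^bsub>CP \<sigma> m\<^esub>"
    using neg_add_mat[OF cpfD(3)[OF b]] by simp
  then have "\<ominus>\<^bsub>CP \<sigma> m\<^esub> b = (\<lambda>t. (-1) \<cdot>\<^sub>m b t)"
    using b cpf_smult[OF b, of "-1"] by (intro minus_equality) simp_all
  then show ?thesis
    by (simp add: a_minus_def minus_mat_eq[OF cpfD(3)[OF a] cpfD(3)[OF b]])
qed

text \<open>Uniform limits of the entries of a Cauchy sequence form the entries of its limit.\<close>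

lemma cpf_complete:
  assumes N: "0 < N" and x: "\<And>n. x n \<in> cpf N"
    and cauchy: "\<forall>e>0. \<exists>M. \<forall>m\<ge>M. \<forall>n\<ge>M. sup_norm (\<lambda>t. x m t - x n t) < e"
  shows "\<exists>l\<in>cpf N. (\<lambda>n. sup_norm (\<lambda>t. x n t - l t)) \<longlonglongrightarrow> 0"
proof -
  note xm = cpfD(3)[OF x]
  have ent: "cmod (x m t $$ (i, j) - x n t $$ (i, j)) \<le> sup_norm (\<lambda>t. x m t - x n t)"
    if "i < N" "j < N" for m n t i j
  proof -
    have d: "x m t - x n t \<in> carrier_mat N N" using cpfD(3)[OF cpf_minus[OF x[of m] x[of n]], of t] by simp
    have "(x m t - x n t) $$ (i, j) = x m t $$ (i, j) - x n t $$ (i, j)"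
      using that xm[of n t] by simp
    then show ?thesis
      using entry_le_op_norm[OF d that] op_norm_le_sup_norm[OF cpf_minus[OF x[of m] x[of n]], of t] by simp
  qed
  define l where "l t = Matrix.mat N N (\<lambda>(i, j). lim (\<lambda>n. x n t $$ (i, j)))" for t
  have lm: "l t \<in> carrier_mat N N" for t by (simp add: l_def)
  have conv: "(\<lambda>n. x n (t :: real) $$ (i, j)) \<longlonglongrightarrow> l t $$ (i, j)" if ij: "i < N" "j < N" for i j t
  proof -
    have "Cauchy (\<lambda>n. x n t $$ (i, j))"
    proof (unfold Cauchy_def, intro allI impI)
      fix e :: real assume "0 < e"
      then obtain M where M: "\<forall>m\<ge>M. \<forall>n\<ge>M. sup_norm (\<lambda>t. x m t - x n t) < e" using cauchy by blast
      show "\<exists>M. \<forall>m\<ge>M. \<forall>n\<ge>M. dist (x m t $$ (i, j)) (x n t $$ (i, j)) < e"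
        unfolding dist_norm
        by (intro exI[of _ M] allI impI) (rule le_less_trans[OF ent[OF ij] M[rule_format]])
    qed
    then show ?thesis using ij by (simp add: l_def Cauchy_convergent_iff convergent_LIMSEQ_iff)
  qed
  have unif: "\<exists>M. \<forall>n\<ge>M. \<forall>t. \<forall>i<N. \<forall>j<N. cmod (x n t $$ (i, j) - l t $$ (i, j)) \<le> e" if "0 < e" for e
  proof -
    obtain M where M: "\<forall>m\<ge>M. \<forall>n\<ge>M. sup_norm (\<lambda>t. x m t - x n t) < e" using cauchy \<open>0 < e\<close> by blast
    show ?thesis
    proof (intro exI[of _ M] allI impI)
      fix n t i j assume n: "M \<le> n" and ij: "i < N" "j < N"
      have "(\<lambda>m. cmod (x n t $$ (i, j) - x m t $$ (i, j))) \<longlonglongrightarrow> cmod (x n t $$ (i, j) - l t $$ (i, j))"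
        by (rule tendsto_norm[OF tendsto_diff[OF tendsto_const conv[OF ij]]])
      moreover have "\<forall>m\<ge>M. cmod (x n t $$ (i, j) - x m t $$ (i, j)) \<le> e"
        using ent[OF ij] M[rule_format, OF n] by (meson less_imp_le order_trans)
      ultimately show "cmod (x n t $$ (i, j) - l t $$ (i, j)) \<le> e" by (intro LIMSEQ_le_const2) auto
    qed
  qed
  have cont: "continuous_on UNIV (\<lambda>t. l t $$ (i, j))" if ij: "i < N" "j < N" for i j
  proof (rule uniform_limit_theorem[where F = sequentially and f = "\<lambda>n t. x n t $$ (i, j)"])
    show "\<forall>\<^sub>F n in sequentially. continuous_on UNIV (\<lambda>t. x n t $$ (i, j))"
      by (intro always_eventually allI mat_funD(2)[OF cpfD(1)[OF x] ij])
    show "uniform_limit UNIV (\<lambda>n t. x n t $$ (i, j)) (\<lambda>t. l t $$ (i, j)) sequentially"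
    proof (rule uniform_limitI)
      fix e :: real assume "0 < e"
      then obtain M where M: "\<forall>n\<ge>M. \<forall>t. \<forall>i<N. \<forall>j<N. cmod (x n t $$ (i, j) - l t $$ (i, j)) \<le> e / 2"
        using unif[of "e / 2"] by auto
      show "\<forall>\<^sub>F n in sequentially. \<forall>t\<in>UNIV. dist (x n t $$ (i, j)) (l t $$ (i, j)) < e"
        unfolding eventually_sequentially dist_norm
      proof (intro exI[of _ M] allI impI ballI)
        fix n and t :: real assume "M \<le> n"
        then have "cmod (x n t $$ (i, j) - l t $$ (i, j)) \<le> e / 2" by (rule M[rule_format, OF _ ij])
        then show "cmod (x n t $$ (i, j) - l t $$ (i, j)) < e" using \<open>0 < e\<close> by simp
      qed
    qed
  qed simp
  have l: "l \<in> cpf N" unfolding cpf_def mat_fun_def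
    using lm cont cpfD(2)[OF x] by (auto simp: l_def)
  have "(\<lambda>n. sup_norm (\<lambda>t. x n t - l t)) \<longlonglongrightarrow> 0"
  proof (rule LIMSEQ_I)
    fix r :: real assume r: "0 < r"
    define e where "e = r / (2 * (real N * real N))"
    have e: "0 < e" "real N * (real N * e) < r" using r N by (auto simp: e_def)
    obtain M where M: "\<forall>n\<ge>M. \<forall>t. \<forall>i<N. \<forall>j<N. cmod (x n t $$ (i, j) - l t $$ (i, j)) \<le> e"
      using unif[OF e(1)] by blast
    show "\<exists>M. \<forall>n\<ge>M. norm (sup_norm (\<lambda>t. x n t - l t) - 0) < r"
    proof (intro exI[of _ M] allI impI)
      fix n assume n: "M \<le> n"
      have "sup_norm (\<lambda>t. x n t - l t) \<le> real N * (real N * e)"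
      proof (rule sup_norm_leI)
        fix t
        have d: "x n t - l t \<in> carrier_mat N N" using cpfD(3)[OF cpf_minus[OF x[of n] l], of t] by simp
        have "op_norm (x n t - l t) \<le> (\<Sum>i<N. \<Sum>j<N. cmod ((x n t - l t) $$ (i, j)))"
          by (rule op_norm_le_sum[OF d])
        also have "\<dots> \<le> (\<Sum>i<N. \<Sum>j<N. e)"
        proof (intro sum_mono)
          fix i j assume "i \<in> {..<N}" "j \<in> {..<N}"
          then show "cmod ((x n t - l t) $$ (i, j)) \<le> e"
            using M[rule_format, OF n, of i j t] lm[of t] by simp
        qed
        finally show "op_norm (x n t - l t) \<le> real N * (real N * e)" by simp
      qed
      moreover have "0 \<le> sup_norm (\<lambda>t. x n t - l t)"
        using op_norm_le_sup_norm[OF cpf_minus[OF x[of n] l], of 0] op_norm_nonneg[OF cpfD(3)[OF cpf_minus[OF x[of n] l]], of 0]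
        by linarith
      ultimately show "norm (sup_norm (\<lambda>t. x n t - l t) - 0) < r" using e(2) by simp
    qed
  qed
  then show ?thesis by (rule bexI[OF _ l])
qed

text \<open>The norm of a self-adjoint matrix is its numerical radius, so the vector states at the points
  of the circle are norming.\<close>

lemma state_star_algebra_CP:
  assumes N: "0 < boxtimes \<sigma> m" shows "state_star_algebra (CP \<sigma> m) (pure_states (boxtimes \<sigma> m))"
proof -
  let ?N = "boxtimes \<sigma> m"
  interpret ring "CP \<sigma> m" by (rule ring_CP)
  have nn: "0 \<le> sup_norm f" if "f \<in> cpf ?N" for f
    using op_norm_le_sup_norm[OF that, of 0] op_norm_nonneg[OF cpfD(3)[OF that], of 0] by linarith
  show ?thesis
  proof (unfold_locales)
    fix a b :: "real \<Rightarrow> complex Matrix.mat" and c d :: complex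
    assume "a \<in> carrier (CP \<sigma> m)" "b \<in> carrier (CP \<sigma> m)"
    then have a: "a \<in> cpf ?N" and b: "b \<in> cpf ?N" by simp_all
    note am = cpfD(3)[OF a] note bm = cpfD(3)[OF b]
    show "c \<odot>\<^bsub>CP \<sigma> m\<^esub> (a \<oplus>\<^bsub>CP \<sigma> m\<^esub> b) = c \<odot>\<^bsub>CP \<sigma> m\<^esub> a \<oplus>\<^bsub>CP \<sigma> m\<^esub> c \<odot>\<^bsub>CP \<sigma> m\<^esub> b"
      by (simp add: add_smult_distrib_left_mat[OF am bm])
    show "(c \<odot>\<^bsub>CP \<sigma> m\<^esub> a) \<otimes>\<^bsub>CP \<sigma> m\<^esub> b = c \<odot>\<^bsub>CP \<sigma> m\<^esub> (a \<otimes>\<^bsub>CP \<sigma> m\<^esub> b)"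
      by (simp add: mult_smult_assoc_mat[OF am bm])
    show "a \<otimes>\<^bsub>CP \<sigma> m\<^esub> (c \<odot>\<^bsub>CP \<sigma> m\<^esub> b) = c \<odot>\<^bsub>CP \<sigma> m\<^esub> (a \<otimes>\<^bsub>CP \<sigma> m\<^esub> b)"
      by (simp add: mult_smult_distrib[OF am bm])
    show "star (CP \<sigma> m) (a \<oplus>\<^bsub>CP \<sigma> m\<^esub> b) = star (CP \<sigma> m) a \<oplus>\<^bsub>CP \<sigma> m\<^esub> star (CP \<sigma> m) b"
      by (simp add: adjoint_add[OF am bm])
    show "star (CP \<sigma> m) (a \<otimes>\<^bsub>CP \<sigma> m\<^esub> b) = star (CP \<sigma> m) b \<otimes>\<^bsub>CP \<sigma> m\<^esub> star (CP \<sigma> m) a"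
      by (simp add: adjoint_mult[OF am bm])
    show "nrm (CP \<sigma> m) (a \<oplus>\<^bsub>CP \<sigma> m\<^esub> b) \<le> nrm (CP \<sigma> m) a + nrm (CP \<sigma> m) b"
      using op_norm_le_sup_norm[OF a] op_norm_le_sup_norm[OF b]
      by (simp, intro sup_norm_leI) (metis add_mono op_norm_add[OF am bm] order_trans)
    show "nrm (CP \<sigma> m) (a \<otimes>\<^bsub>CP \<sigma> m\<^esub> b) \<le> nrm (CP \<sigma> m) a * nrm (CP \<sigma> m) b"
      using op_norm_le_sup_norm[OF a] op_norm_le_sup_norm[OF b]
      by (simp, intro sup_norm_leI)
        (meson mult_mono op_norm_mult[OF am bm] op_norm_nonneg[OF bm] nn[OF a] order_trans)
  next
    fix a :: "real \<Rightarrow> complex Matrix.mat" and c d :: complex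
    assume "a \<in> carrier (CP \<sigma> m)"
    then have a: "a \<in> cpf ?N" by simp
    note am = cpfD(3)[OF a]
    show "(c + d) \<odot>\<^bsub>CP \<sigma> m\<^esub> a = c \<odot>\<^bsub>CP \<sigma> m\<^esub> a \<oplus>\<^bsub>CP \<sigma> m\<^esub> d \<odot>\<^bsub>CP \<sigma> m\<^esub> a"
      by (simp add: add_smult_distrib_right_mat[OF am])
    show "c \<odot>\<^bsub>CP \<sigma> m\<^esub> (d \<odot>\<^bsub>CP \<sigma> m\<^esub> a) = (c * d) \<odot>\<^bsub>CP \<sigma> m\<^esub> a"
      using am by (auto intro!: ext eq_matI)
    show "1 \<odot>\<^bsub>CP \<sigma> m\<^esub> a = a" using am by (auto intro!: ext eq_matI)
    show "c \<odot>\<^bsub>CP \<sigma> m\<^esub> a \<in> carrier (CP \<sigma> m)" using cpf_smult[OF a] by simp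
    show "star (CP \<sigma> m) a \<in> carrier (CP \<sigma> m)" using cpf_adjoint[OF a] by simp
    show "star (CP \<sigma> m) (c \<odot>\<^bsub>CP \<sigma> m\<^esub> a) = cnj c \<odot>\<^bsub>CP \<sigma> m\<^esub> star (CP \<sigma> m) a"
      by (simp add: adjoint_smult)
    show "a = \<zero>\<^bsub>CP \<sigma> m\<^esub>" if z: "nrm (CP \<sigma> m) a = 0"
    proof (simp, rule ext)
      fix t
      have "op_norm (a t) = 0"
        using op_norm_le_sup_norm[OF a, of t] op_norm_nonneg[OF am, of t] z by simp
      then show "a t = 0\<^sub>m ?N ?N" by (rule op_norm_zero_imp[OF am])
    qed
    show "nrm (CP \<sigma> m) (c \<odot>\<^bsub>CP \<sigma> m\<^esub> a) = cmod c * nrm (CP \<sigma> m) a"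
    proof (simp, rule antisym)
      show le: "sup_norm (\<lambda>t. c \<cdot>\<^sub>m a t) \<le> cmod c * sup_norm a" for c
        by (intro sup_norm_leI) (simp add: op_norm_smult[OF am] mult_left_mono op_norm_le_sup_norm[OF a])
      show "cmod c * sup_norm a \<le> sup_norm (\<lambda>t. c \<cdot>\<^sub>m a t)"
      proof (cases "c = 0")
        case True
        then show ?thesis using nn[OF cpf_smult[OF a]] by simp
      next
        case False
        have "sup_norm a \<le> sup_norm (\<lambda>t. c \<cdot>\<^sub>m a t) / cmod c"
        proof (rule sup_norm_leI)
          fix t
          show "op_norm (a t) \<le> sup_norm (\<lambda>t. c \<cdot>\<^sub>m a t) / cmod c"
            using op_norm_le_sup_norm[OF cpf_smult[OF a], of c t] False
            by (simp add: op_norm_smult[OF am] field_simps)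
        qed
        then show ?thesis using False by (simp add: field_simps)
      qed
    qed
    show "nrm (CP \<sigma> m) (star (CP \<sigma> m) a) = nrm (CP \<sigma> m) a"
      by (simp add: sup_norm_def op_norm_adjoint[OF am])
    show "nrm (CP \<sigma> m) a \<le> r"
      if s: "star (CP \<sigma> m) a = a" and r: "0 \<le> r" and w: "\<And>w. w \<in> pure_states ?N \<Longrightarrow> \<bar>w a\<bar> \<le> r" for r
    proof (simp, rule sup_norm_leI, rule op_norm_le_numr[OF am _ r])
      fix t and v :: "complex Matrix.vec" assume "v \<in> carrier_vec ?N" "vec_norm v = 1"
      then show "\<bar>numr (a t) v\<bar> \<le> r" by (intro w) (auto simp: pure_states_def)
    next
      fix t show "mat_adjoint (a t) = a t" using fun_cong[OF s, of t] by simp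
    qed
  next
    show "star (CP \<sigma> m) \<one>\<^bsub>CP \<sigma> m\<^esub> = \<one>\<^bsub>CP \<sigma> m\<^esub>" by (simp add: adjoint_one)
    show "nrm (CP \<sigma> m) \<one>\<^bsub>CP \<sigma> m\<^esub> = 1" using N by (simp add: sup_norm_def op_norm_one)
    show "pure_states ?N \<noteq> {}" using N vec_norm_unit[of 0 ?N]
      unfolding pure_states_def by (auto intro!: exI[of _ "unit_vec ?N 0"])
  next
    fix x :: "nat \<Rightarrow> real \<Rightarrow> complex Matrix.mat" assume x: "\<And>n. x n \<in> carrier (CP \<sigma> m)"
      and c: "\<forall>e>0. \<exists>N. \<forall>k\<ge>N. \<forall>n\<ge>N. nrm (CP \<sigma> m) (x k \<ominus>\<^bsub>CP \<sigma> m\<^esub> x n) < e"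
    have x': "x n \<in> cpf ?N" for n using x by simp
    have "\<exists>l\<in>cpf ?N. (\<lambda>n. sup_norm (\<lambda>t. x n t - l t)) \<longlonglongrightarrow> 0"
      by (rule cpf_complete[OF N x']) (use c in \<open>simp only: CP_minus[OF x' x'] CP_simps\<close>)
    then show "\<exists>l\<in>carrier (CP \<sigma> m). (\<lambda>n. nrm (CP \<sigma> m) (x n \<ominus>\<^bsub>CP \<sigma> m\<^esub> l)) \<longlonglongrightarrow> 0"
      by (auto simp: CP_minus[OF x'])
  next
    fix w :: "(real \<Rightarrow> complex Matrix.mat) \<Rightarrow> real" assume "w \<in> pure_states ?N"
    then obtain t v where w: "w = (\<lambda>a. numr (a t) v)" and v: "v \<in> carrier_vec ?N" "vec_norm v = 1"
      by (auto simp: pure_states_def)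
    show "w \<one>\<^bsub>CP \<sigma> m\<^esub> = 1" using v by (simp add: w numr_def ip_self)
    fix a assume "a \<in> carrier (CP \<sigma> m)"
    then have a: "a \<in> cpf ?N" by simp
    note am = cpfD(3)[OF a]
    show "w (complex_of_real r \<odot>\<^bsub>CP \<sigma> m\<^esub> a) = r * w a" for r
      by (simp add: w numr_smult_mat[OF am v(1)])
    show "0 \<le> w (star (CP \<sigma> m) a \<otimes>\<^bsub>CP \<sigma> m\<^esub> a)" by (simp add: w numr_square[OF am v(1)])
    show "\<bar>w a\<bar> \<le> nrm (CP \<sigma> m) a"
      using numr_le_op_norm[OF am v(1), of t] op_norm_le_sup_norm[OF a, of t] v(2) by (simp add: w)
    fix b assume "b \<in> carrier (CP \<sigma> m)"
    then have "b t \<in> carrier_mat ?N ?N" by (simp add: cpfD(3))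
    then show "w (a \<oplus>\<^bsub>CP \<sigma> m\<^esub> b) = w a + w b" by (simp add: w numr_add[OF am _ v(1)])
  qed
qed

section \<open>The connecting maps and their retractions\<close>

locale bunce_deddens =
  fixes \<sigma> :: "nat \<Rightarrow> nat" assumes baire: "\<sigma> \<in> baire"
begin

abbreviation N :: "nat \<Rightarrow> nat" where "N \<equiv> boxtimes \<sigma>"

lemma factor_ge_2: "2 \<le> \<sigma> (Suc m)"
  using baire by (auto simp: baire_def)

lemma factor_pos: "0 < \<sigma> (Suc m)"
  using factor_ge_2[of m] by simp

lemma N_Suc: "N (Suc m) = \<sigma> (Suc m) * N m"
  by (simp add: boxtimes_def mult.commute)

lemma N_pos: "0 < N m"
  by (induction m) (auto simp: boxtimes_def[of _ 0] N_Suc intro: factor_pos)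

lemma U_eq_fourier: "U \<sigma> (Suc m) = fourier (\<sigma> (Suc m)) (N m)"
  by (rule ext) (simp add: fourier_def N_Suc Let_def)

lemma unitary_U: "unitary_mat (N m) (U \<sigma> m t)"
proof (cases m)
  case 0
  then show ?thesis by (simp add: unitary_mat_def boxtimes_def adjoint_one)
next
  case (Suc n)
  then show ?thesis by (simp add: U_eq_fourier N_Suc unitary_fourier factor_pos N_pos)
qed

lemma mat_fun_U: "mat_fun (N m) (U \<sigma> m)"
proof (cases m)
  case 0
  have "U \<sigma> 0 = (\<lambda>t. 1\<^sub>m 1)" by (rule ext) simp
  then show ?thesis using 0 mat_fun_const[of "1\<^sub>m 1" 1] by (simp add: boxtimes_def)
next
  case (Suc n)
  then show ?thesis by (simp add: U_eq_fourier N_Suc mat_fun_fourier)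
qed

declare U.simps(2) [simp del]

definition twist :: "nat \<Rightarrow> (real \<Rightarrow> complex Matrix.mat) \<Rightarrow> real \<Rightarrow> complex Matrix.mat" where
  "twist m a t = conjug (mat_adjoint (U \<sigma> m t)) (a t)"

lemma twist_eq: "twist m a t = mat_adjoint (U \<sigma> m t) * a t * U \<sigma> m t"
  by (simp add: twist_def conjug_def adjoint_adjoint)

lemma twist_mem: "a t \<in> carrier_mat (N m) (N m) \<Longrightarrow> twist m a t \<in> carrier_mat (N m) (N m)"
  unfolding twist_def by (rule conjug_mem[OF unitary_adjoint[OF unitary_U]])

lemma mat_fun_twist: "mat_fun (N m) a \<Longrightarrow> mat_fun (N m) (twist m a)"
  unfolding twist_eq[abs_def] by (intro mat_fun_mult mat_fun_adjoint mat_fun_U)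

lemma conjug_twist: "a t \<in> carrier_mat (N m) (N m) \<Longrightarrow> conjug (U \<sigma> m t) (twist m a t) = a t"
  unfolding twist_def by (rule conjug_inverse'[OF unitary_U])

text \<open>
  Fibrewise, the algebra of the next level consists of functions of a variable on a circle that
  is wound around the previous one; the twist turns this winding into a cyclic permutation of
  the diagonal blocks, so that a single block, read along the longer circle, already
  determines all of them.
\<close>

definition retr :: "nat \<Rightarrow> (real \<Rightarrow> complex Matrix.mat) \<Rightarrow> real \<Rightarrow> complex Matrix.mat" where
  "retr m a s = block (N m) (twist (Suc m) a (real (\<sigma> (Suc m)) * s)) 0 0"

lemma twist_shift:
  assumes a: "a \<in> cpf (N (Suc m))" and pq: "p < N (Suc m)" "q < N (Suc m)"
  shows "twist (Suc m) a (t + 1) $$ (p, q) =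
    twist (Suc m) a t $$ (shift (\<sigma> (Suc m)) (N m) p, shift (\<sigma> (Suc m)) (N m) q)"
proof -
  have am: "a t \<in> carrier_mat (\<sigma> (Suc m) * N m) (\<sigma> (Suc m) * N m)"
    using cpfD(3)[OF a, of t] by (simp add: N_Suc)
  show ?thesis
    unfolding twist_def U_eq_fourier cpfD(2)[OF a]
    by (rule conjug_fourier_shift[OF am]) (use pq in \<open>simp_all add: N_Suc\<close>)
qed

lemma twist_shift_nat:
  assumes a: "a \<in> cpf (N (Suc m))" and j: "j < \<sigma> (Suc m)" and pq: "p < N m" "q < N m"
  shows "twist (Suc m) a (t + real j) $$ (p, q) = twist (Suc m) a t $$ (j * N m + p, j * N m + q)"
  using j
proof (induction j arbitrary: t)
  case (Suc j)
  let ?k = "\<sigma> (Suc m)"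
  have b: "j * N m + p < N (Suc m)" "j * N m + q < N (Suc m)"
    unfolding N_Suc using Suc.prems pq by (simp_all add: block_pos)
  have e: "t + real (Suc j) = (t + 1) + real j" by simp
  have "twist (Suc m) a (t + real (Suc j)) $$ (p, q) = twist (Suc m) a (t + 1) $$ (j * N m + p, j * N m + q)"
    unfolding e by (rule Suc.IH) (use Suc.prems in simp)
  also have "\<dots> = twist (Suc m) a t $$ (Suc j * N m + p, Suc j * N m + q)"
    unfolding twist_shift[OF a b] using Suc.prems pq by (simp add: shift_def)
  finally show ?case .
qed simp

lemma twist_period:
  assumes a: "a \<in> cpf (N (Suc m))" and pq: "p < N m" "q < N m"
  shows "twist (Suc m) a (t + real (\<sigma> (Suc m))) $$ (p, q) = twist (Suc m) a t $$ (p, q)"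
proof -
  obtain j where j: "\<sigma> (Suc m) = Suc j" using factor_pos[of m] by (cases "\<sigma> (Suc m)") auto
  have b: "j * N m + p < N (Suc m)" "j * N m + q < N (Suc m)"
    unfolding N_Suc using j pq by (simp_all add: block_pos)
  have e: "t + real (\<sigma> (Suc m)) = (t + 1) + real j" by (simp add: j)
  have "twist (Suc m) a (t + real (\<sigma> (Suc m))) $$ (p, q) = twist (Suc m) a (t + 1) $$ (j * N m + p, j * N m + q)"
    unfolding e by (rule twist_shift_nat[OF a _ pq]) (simp add: j)
  also have "\<dots> = twist (Suc m) a t $$ (p, q)"
    unfolding twist_shift[OF a b] using pq by (simp add: shift_def j)
  finally show ?thesis .
qed

lemma retr_fibre:
  assumes a: "a \<in> cpf (N (Suc m))" and j: "j < \<sigma> (Suc m)"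
  shows "retr m a ((t + real j) / real (\<sigma> (Suc m))) = block (N m) (twist (Suc m) a t) j j"
proof -
  have k: "real (\<sigma> (Suc m)) \<noteq> 0" using factor_pos[of m] by simp
  show ?thesis
    by (rule eq_matI) (use k twist_shift_nat[OF a j] in \<open>simp_all add: retr_def block_def\<close>)
qed

lemma mat_fun_block:
  assumes f: "mat_fun (k * b) f" and j: "j < k" shows "mat_fun b (\<lambda>t. block b (f t) j j)"
  unfolding mat_fun_def block_def using mat_funD(2)[OF f] j by (auto simp: block_pos)

lemma retr_cpf: assumes a: "a \<in> cpf (N (Suc m))" shows "retr m a \<in> cpf (N m)"
proof -
  have "mat_fun (\<sigma> (Suc m) * N m) (\<lambda>s. twist (Suc m) a (real (\<sigma> (Suc m)) * s))"
    using mat_fun_compose[OF mat_fun_twist[OF cpfD(1)[OF a]], of "\<lambda>s. real (\<sigma> (Suc m)) * s"]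
    by (simp add: N_Suc continuous_on_mult_left)
  then have "mat_fun (N m) (retr m a)"
    unfolding retr_def[abs_def] by (rule mat_fun_block[OF _ factor_pos])
  moreover have "retr m a (s + 1) = retr m a s" for s
  proof -
    have e: "real (\<sigma> (Suc m)) * (s + 1) = real (\<sigma> (Suc m)) * s + real (\<sigma> (Suc m))" by (simp add: algebra_simps)
    show ?thesis unfolding retr_def block_def e by (rule cong_mat) (simp_all add: twist_period[OF a])
  qed
  ultimately show ?thesis by (simp add: cpf_def)
qed

definition fibres :: "nat \<Rightarrow> (real \<Rightarrow> complex Matrix.mat) \<Rightarrow> real \<Rightarrow> complex Matrix.mat" where
  "fibres m a t = blocks (\<sigma> (Suc m)) (N m) (\<lambda>j. a ((t + real j) / real (\<sigma> (Suc m))))"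

lemma fibres_mem: "fibres m a t \<in> carrier_mat (N (Suc m)) (N (Suc m))"
  by (simp add: fibres_def N_Suc)

lemma alpha_eq: "a \<in> cpf (N m) \<Longrightarrow> alpha \<sigma> m a = (\<lambda>t. conjug (U \<sigma> (Suc m) t) (fibres m a t))"
  unfolding alpha_def conjug_def fibres_def
  by (rule ext, subst diag_block_mat_eq_blocks[OF N_pos]) (auto intro: cpfD(3))

lemma twist_alpha: "a \<in> cpf (N m) \<Longrightarrow> twist (Suc m) (alpha \<sigma> m a) t = fibres m a t"
  unfolding twist_def alpha_eq by (rule conjug_inverse[OF unitary_U fibres_mem])

lemma fibres_shift:
  assumes a: "a \<in> cpf (N m)" and pq: "p < N (Suc m)" "q < N (Suc m)"
  shows "fibres m a (t + 1) $$ (p, q) = fibres m a t $$ (shift (\<sigma> (Suc m)) (N m) p, shift (\<sigma> (Suc m)) (N m) q)"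
proof -
  let ?k = "\<sigma> (Suc m)"
  have pq': "p < ?k * N m" "q < ?k * N m" using pq by (simp_all add: N_Suc)
  have ae: "a ((t + 1 + real (p div N m)) / real ?k) =
      a ((t + real (if Suc (p div N m) = ?k then 0 else Suc (p div N m))) / real ?k)"
  proof (cases "Suc (p div N m) = ?k")
    case True
    then have "t + 1 + real (p div N m) = t + real ?k" by (metis add.assoc add.commute of_nat_Suc)
    then have "(t + 1 + real (p div N m)) / real ?k = (t + real ?k) / real ?k" by (simp only:)
    also have "\<dots> = t / real ?k + 1" using factor_pos[of m] by (simp add: add_divide_distrib)
    finally have "(t + 1 + real (p div N m)) / real ?k = t / real ?k + 1" .
    then show ?thesis using True cpfD(2)[OF a, of "t / real ?k"] by simp
  qed (simp add: add_ac)
  have sh: "(shift ?k (N m) p div N m = shift ?k (N m) q div N m) = (p div N m = q div N m)"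
    unfolding shift_div_mod[OF pq'(1)] shift_div_mod[OF pq'(2)] by auto
  show ?thesis
    unfolding fibres_def blocks_index[OF pq'] blocks_index[OF shift_bound[OF pq'(1)] shift_bound[OF pq'(2)]] sh
    unfolding shift_div_mod[OF pq'(1)] shift_div_mod(2)[OF pq'(2)] ae ..
qed

lemma mat_fun_fibres: assumes a: "mat_fun (N m) a" shows "mat_fun (N (Suc m)) (fibres m a)"
  unfolding mat_fun_def
proof (intro conjI allI impI fibres_mem)
  fix p q assume "p < N (Suc m)" "q < N (Suc m)"
  then have pq: "p < \<sigma> (Suc m) * N m" "q < \<sigma> (Suc m) * N m" by (simp_all add: N_Suc)
  have e: "(\<lambda>t. fibres m a t $$ (p, q)) = (\<lambda>t. if p div N m = q div N m
      then a ((t + real (p div N m)) / real (\<sigma> (Suc m))) $$ (p mod N m, q mod N m) else 0)"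
    using pq by (simp add: fibres_def blocks_index)
  have "continuous_on UNIV (\<lambda>t. (t + real (p div N m)) / real (\<sigma> (Suc m)))"
    using factor_pos[of m] by (intro continuous_intros) auto
  from mat_fun_compose[OF a this]
  show "continuous_on UNIV (\<lambda>t. fibres m a t $$ (p, q))"
    unfolding e using block_index_bounds[OF pq(1)] block_index_bounds[OF pq(2)]
    by (cases "p div N m = q div N m") (auto intro: mat_funD(2))
qed

text \<open>
  A twisted constant function changes under a period exactly as the fibre values do, so twisting a
  fixed value of the image again gives the fibre values one period later.
\<close>

lemma alpha_cpf: assumes a: "a \<in> cpf (N m)" shows "alpha \<sigma> m a \<in> cpf (N (Suc m))"
proof -
  have "mat_fun (N (Suc m)) (alpha \<sigma> m a)"
    unfolding alpha_eq[OF a] conjug_def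
    by (intro mat_fun_mult mat_fun_adjoint mat_fun_U mat_fun_fibres cpfD(1)[OF a])
  moreover have "alpha \<sigma> m a (t + 1) = alpha \<sigma> m a t" for t
  proof -
    let ?X = "alpha \<sigma> m a t"
    have Xm: "?X \<in> carrier_mat (N (Suc m)) (N (Suc m))"
      unfolding alpha_eq[OF a] by (rule conjug_mem[OF unitary_U fibres_mem])
    have c: "(\<lambda>s. ?X) \<in> cpf (N (Suc m))" by (rule cpf_const[OF Xm])
    have "twist (Suc m) (\<lambda>s. ?X) (t + 1) = fibres m a (t + 1)"
    proof (rule eq_matI)
      fix p q assume "p < dim_row (fibres m a (t + 1))" "q < dim_col (fibres m a (t + 1))"
      then have pq: "p < N (Suc m)" "q < N (Suc m)" using fibres_mem[of m a "t + 1"] by auto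
      have "twist (Suc m) (\<lambda>s. ?X) t = fibres m a t"
        using twist_alpha[OF a, of t] by (simp add: twist_def)
      then show "twist (Suc m) (\<lambda>s. ?X) (t + 1) $$ (p, q) = fibres m a (t + 1) $$ (p, q)"
        by (simp add: twist_shift[OF c pq] fibres_shift[OF a pq])
    qed (use carrier_matD[OF fibres_mem[of m a "t + 1"]] carrier_matD[OF twist_mem[of "\<lambda>s. ?X", OF Xm]] in auto)
    then have "alpha \<sigma> m a (t + 1) = conjug (U \<sigma> (Suc m) (t + 1)) (twist (Suc m) (\<lambda>s. ?X) (t + 1))"
      by (simp add: alpha_eq[OF a])
    also have "\<dots> = ?X" using conjug_twist[where a = "\<lambda>s. ?X" and t = "t + 1"] Xm by simp
    finally show ?thesis .
  qed
  ultimately show ?thesis by (simp add: cpf_def)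
qed

lemma retr_alpha: assumes a: "a \<in> cpf (N m)" shows "retr m (alpha \<sigma> m a) = a"
proof (rule ext)
  fix s
  have "retr m (alpha \<sigma> m a) s = block (N m) (fibres m a (real (\<sigma> (Suc m)) * s)) 0 0"
    by (simp add: retr_def twist_alpha[OF a])
  also have "\<dots> = a ((real (\<sigma> (Suc m)) * s + real 0) / real (\<sigma> (Suc m)))"
    unfolding fibres_def by (rule block_blocks[OF factor_pos cpfD(3)[OF a]])
  also have "\<dots> = a s" using factor_pos[of m] by simp
  finally show "retr m (alpha \<sigma> m a) s = a s" .
qed

lemma cond_exp_eq: assumes a: "a \<in> cpf (N (Suc m))" shows "cond_exp \<sigma> (Suc m) a = alpha \<sigma> m (retr m a)"
proof (rule ext)
  fix t
  have "block_diag \<sigma> (Suc m) (twist (Suc m) a t) = blocks (\<sigma> (Suc m)) (N m) (\<lambda>j. block (N m) (twist (Suc m) a t) j j)"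
    unfolding block_diag_def by (simp add: diag_block_mat_eq_blocks[OF N_pos])
  also have "\<dots> = fibres m (retr m a) t"
    unfolding fibres_def by (rule blocks_cong) (simp add: retr_fibre[OF a])
  finally have "block_diag \<sigma> (Suc m) (twist (Suc m) a t) = fibres m (retr m a) t" .
  then show "cond_exp \<sigma> (Suc m) a t = alpha \<sigma> m (retr m a) t"
    by (simp add: cond_exp_def alpha_eq[OF retr_cpf[OF a]] conjug_def twist_eq)
qed

lemma op_norm_twist_le: "a t \<in> carrier_mat (N m) (N m) \<Longrightarrow> op_norm (twist m a t) \<le> op_norm (a t)"
  unfolding twist_def by (rule op_norm_conjug_le[OF unitary_adjoint[OF unitary_U]])

lemma retr_norm_le: assumes a: "a \<in> cpf (N (Suc m))" shows "sup_norm (retr m a) \<le> sup_norm a"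
proof (rule sup_norm_leI)
  fix s
  let ?t = "real (\<sigma> (Suc m)) * s"
  have "op_norm (retr m a s) \<le> op_norm (twist (Suc m) a ?t)"
    unfolding retr_def by (rule op_norm_block_le[OF factor_pos]) (use twist_mem[OF cpfD(3)[OF a]] in \<open>simp add: N_Suc\<close>)
  also have "\<dots> \<le> op_norm (a ?t)" by (rule op_norm_twist_le[OF cpfD(3)[OF a]])
  also have "\<dots> \<le> sup_norm a" by (rule op_norm_le_sup_norm[OF a])
  finally show "op_norm (retr m a s) \<le> sup_norm a" .
qed

lemma alpha_norm: assumes a: "a \<in> cpf (N m)" shows "sup_norm (alpha \<sigma> m a) = sup_norm a"
proof (rule antisym)
  show "sup_norm (alpha \<sigma> m a) \<le> sup_norm a"
  proof (rule sup_norm_leI)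
    fix t
    have "0 \<le> sup_norm a" using op_norm_nonneg[OF cpfD(3)[OF a]] op_norm_le_sup_norm[OF a] order_trans by blast
    then have "op_norm (fibres m a t) \<le> sup_norm a"
      unfolding fibres_def by (intro op_norm_blocks_le cpfD(3)[OF a] op_norm_le_sup_norm[OF a])
    then show "op_norm (alpha \<sigma> m a t) \<le> sup_norm a"
      unfolding alpha_eq[OF a] using op_norm_conjug_le[OF unitary_U fibres_mem] order_trans by blast
  qed
  show "sup_norm a \<le> sup_norm (alpha \<sigma> m a)"
    using retr_norm_le[OF alpha_cpf[OF a]] unfolding retr_alpha[OF a] .
qed

lemma retract_system_CP: "retract_system (CP \<sigma>) (\<lambda>m. pure_states (N m)) (alpha \<sigma>) retr"
proof (rule retract_system.intro)
  show "state_star_algebra (CP \<sigma> m) (pure_states (N m))" for m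
    by (rule state_star_algebra_CP[OF N_pos])
  fix m
  show "alpha \<sigma> m \<one>\<^bsub>CP \<sigma> m\<^esub> = \<one>\<^bsub>CP \<sigma> (Suc m)\<^esub>"
    using blocks_one[OF N_pos, of "\<sigma> (Suc m)" m] conjug_one[OF unitary_U, of "Suc m"]
    by (simp add: alpha_eq[OF cpf_const[OF one_carrier_mat]] fibres_def N_Suc)
  fix a b :: "real \<Rightarrow> complex Matrix.mat" and c :: complex
  {
    assume "a \<in> carrier (CP \<sigma> m)"
    then have a: "a \<in> cpf (N m)" by simp
    note am = cpfD(3)[OF a]
    show "alpha \<sigma> m a \<in> carrier (CP \<sigma> (Suc m))" using alpha_cpf[OF a] by simp
    show "alpha \<sigma> m (c \<odot>\<^bsub>CP \<sigma> m\<^esub> a) = c \<odot>\<^bsub>CP \<sigma> (Suc m)\<^esub> alpha \<sigma> m a"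
    proof -
      have "fibres m (\<lambda>t. c \<cdot>\<^sub>m a t) t = c \<cdot>\<^sub>m fibres m a t" for t
        unfolding fibres_def by (rule blocks_smult[OF am])
      then show ?thesis
        by (simp add: alpha_eq[OF a] alpha_eq[OF cpf_smult[OF a]] conjug_smult[OF unitary_U fibres_mem])
    qed
    show "alpha \<sigma> m (star (CP \<sigma> m) a) = star (CP \<sigma> (Suc m)) (alpha \<sigma> m a)"
    proof -
      have "fibres m (\<lambda>t. mat_adjoint (a t)) t = mat_adjoint (fibres m a t)" for t
        unfolding fibres_def by (rule blocks_adjoint[OF am])
      then show ?thesis
        by (simp add: alpha_eq[OF a] alpha_eq[OF cpf_adjoint[OF a]] conjug_adjoint[OF unitary_U fibres_mem])
    qed
    show "nrm (CP \<sigma> (Suc m)) (alpha \<sigma> m a) = nrm (CP \<sigma> m) a" using alpha_norm[OF a] by simp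
    show "retr m (alpha \<sigma> m a) = a" by (rule retr_alpha[OF a])
    assume "b \<in> carrier (CP \<sigma> m)"
    then have b: "b \<in> cpf (N m)" by simp
    note bm = cpfD(3)[OF b]
    have f: "fibres m (\<lambda>t. a t + b t) t = fibres m a t + fibres m b t"
      "fibres m (\<lambda>t. a t * b t) t = fibres m a t * fibres m b t" for t
      unfolding fibres_def by (rule blocks_add[OF am bm], rule blocks_mult[OF am bm, symmetric])
    show "alpha \<sigma> m (a \<oplus>\<^bsub>CP \<sigma> m\<^esub> b) = alpha \<sigma> m a \<oplus>\<^bsub>CP \<sigma> (Suc m)\<^esub> alpha \<sigma> m b"
      by (simp add: alpha_eq[OF a] alpha_eq[OF b] alpha_eq[OF cpf_add[OF a b]] f
          conjug_add[OF unitary_U fibres_mem fibres_mem])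
    show "alpha \<sigma> m (a \<otimes>\<^bsub>CP \<sigma> m\<^esub> b) = alpha \<sigma> m a \<otimes>\<^bsub>CP \<sigma> (Suc m)\<^esub> alpha \<sigma> m b"
      by (simp add: alpha_eq[OF a] alpha_eq[OF b] alpha_eq[OF cpf_mult[OF a b]] f
          conjug_mult[OF unitary_U fibres_mem fibres_mem])
  }
  assume "a \<in> carrier (CP \<sigma> (Suc m))"
  then have a: "a \<in> cpf (N (Suc m))" by simp
  note am = cpfD(3)[OF a]
  note W = unitary_adjoint[OF unitary_U]
  have tm: "twist (Suc m) a t \<in> carrier_mat (\<sigma> (Suc m) * N m) (\<sigma> (Suc m) * N m)" for t
    using twist_mem[OF am] by (simp add: N_Suc)
  show "retr m a \<in> carrier (CP \<sigma> m)" using retr_cpf[OF a] by simp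
  show "nrm (CP \<sigma> m) (retr m a) \<le> nrm (CP \<sigma> (Suc m)) a" using retr_norm_le[OF a] by simp
  show "retr m (c \<odot>\<^bsub>CP \<sigma> (Suc m)\<^esub> a) = c \<odot>\<^bsub>CP \<sigma> m\<^esub> retr m a"
  proof (simp, rule ext)
    fix s
    have "twist (Suc m) (\<lambda>t. c \<cdot>\<^sub>m a t) t = c \<cdot>\<^sub>m twist (Suc m) a t" for t
      unfolding twist_def by (rule conjug_smult[OF W am])
    then show "retr m (\<lambda>t. c \<cdot>\<^sub>m a t) s = c \<cdot>\<^sub>m retr m a s"
      by (simp add: retr_def block_smult[OF tm factor_pos])
  qed
  show "retr m (star (CP \<sigma> (Suc m)) a) = star (CP \<sigma> m) (retr m a)"
  proof (simp, rule ext)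
    fix s
    have "twist (Suc m) (\<lambda>t. mat_adjoint (a t)) t = mat_adjoint (twist (Suc m) a t)" for t
      unfolding twist_def by (rule conjug_adjoint[OF W am])
    then show "retr m (\<lambda>t. mat_adjoint (a t)) s = mat_adjoint (retr m a s)"
      by (simp add: retr_def block_adjoint[OF tm factor_pos])
  qed
  assume "b \<in> carrier (CP \<sigma> (Suc m))"
  then have b: "b \<in> cpf (N (Suc m))" by simp
  note bm = cpfD(3)[OF b]
  have tm': "twist (Suc m) b t \<in> carrier_mat (\<sigma> (Suc m) * N m) (\<sigma> (Suc m) * N m)" for t
    using twist_mem[OF bm] by (simp add: N_Suc)
  show "retr m (a \<oplus>\<^bsub>CP \<sigma> (Suc m)\<^esub> b) = retr m a \<oplus>\<^bsub>CP \<sigma> m\<^esub> retr m b"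
  proof (simp, rule ext)
    fix s
    have "twist (Suc m) (\<lambda>t. a t + b t) t = twist (Suc m) a t + twist (Suc m) b t" for t
      unfolding twist_def by (rule conjug_add[OF W am bm])
    then show "retr m (\<lambda>t. a t + b t) s = retr m a s + retr m b s"
      by (simp add: retr_def block_add[OF tm tm' factor_pos])
  qed
next
  fix w m assume "w \<in> pure_states (N m)"
  then obtain s v where w: "w = (\<lambda>a. numr (a s) v)" and v: "v \<in> carrier_vec (N m)" "vec_norm v = 1"
    by (auto simp: pure_states_def)
  let ?t = "real (\<sigma> (Suc m)) * s" and ?p = "pad (\<sigma> (Suc m)) (N m) v"
  let ?V = "U \<sigma> (Suc m) ?t"
  have p: "?p \<in> carrier_vec (N (Suc m))" by (simp add: N_Suc)
  note Vm = unitary_mem[OF unitary_U[of "Suc m" ?t]]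
  have VV: "mat_adjoint ?V * ?V = 1\<^sub>m (N (Suc m))" using unitary_U[of "Suc m" ?t] by (simp only: unitary_mat_def)
  have Vp: "?V *\<^sub>v ?p \<in> carrier_vec (N (Suc m))" by (rule mult_mat_vec_carrier[OF Vm p])
  have "vec_norm (?V *\<^sub>v ?p) = 1"
    using op_norm_isometry[OF Vm VV p] vec_norm_pad[OF factor_pos v(1), of m] v(2) by simp
  then have st: "(\<lambda>a. numr (a ?t) (?V *\<^sub>v ?p)) \<in> pure_states (N (Suc m))"
    unfolding pure_states_def using Vp by blast
  have ev: "w (retr m a) = numr (a ?t) (?V *\<^sub>v ?p)" if "a \<in> carrier (CP \<sigma> (Suc m))" for a
  proof -
    have am: "a ?t \<in> carrier_mat (N (Suc m)) (N (Suc m))" using that by (simp add: cpfD(3))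
    note Va = adjoint_mem[OF Vm]
    have tm: "twist (Suc m) a ?t \<in> carrier_mat (\<sigma> (Suc m) * N m) (\<sigma> (Suc m) * N m)"
      using twist_mem[where a = a and t = ?t, OF am] by (simp add: N_Suc)
    have "w (retr m a) = numr (twist (Suc m) a ?t) ?p"
      unfolding w retr_def by (rule numr_block[OF factor_pos tm v(1)])
    then have "w (retr m a) = Re (ip (twist (Suc m) a ?t *\<^sub>v ?p) ?p)" by (simp only: numr_def)
    also have "twist (Suc m) a ?t *\<^sub>v ?p = mat_adjoint ?V *\<^sub>v (a ?t *\<^sub>v (?V *\<^sub>v ?p))"
      unfolding twist_eq assoc_mult_mat_vec[OF mult_carrier_mat[OF Va am] Vm p]
      by (rule assoc_mult_mat_vec[OF Va am Vp])
    also have "ip (mat_adjoint ?V *\<^sub>v (a ?t *\<^sub>v (?V *\<^sub>v ?p))) ?p = ip (a ?t *\<^sub>v (?V *\<^sub>v ?p)) (?V *\<^sub>v ?p)"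
      unfolding ip_adjoint[OF Va mult_mat_vec_carrier[OF am Vp] p] adjoint_adjoint ..
    finally show ?thesis by (simp only: numr_def)
  qed
  show "\<exists>v\<in>pure_states (N (Suc m)). \<forall>a\<in>carrier (CP \<sigma> (Suc m)). w (retr m a) = v a"
    by (rule bexI[OF _ st]) (intro ballI ev)
qed

end

section \<open>Lipschitz matrix functions\<close>

lemma op_norm_minus_self: "M \<in> carrier_mat n m \<Longrightarrow> op_norm (M - M) = 0"
proof -
  assume M: "M \<in> carrier_mat n m"
  then have "M - M = 0 \<cdot>\<^sub>m M" by (intro eq_matI) auto
  then show ?thesis using op_norm_smult[OF M, of 0] by simp
qed

lemma op_norm_minus_triangle:
  assumes "M \<in> carrier_mat n m" "M' \<in> carrier_mat n m" "M'' \<in> carrier_mat n m"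
  shows "op_norm (M - M'') \<le> op_norm (M - M') + op_norm (M' - M'')"
proof -
  have "M - M'' = (M - M') + (M' - M'')" using assms by (intro eq_matI) auto
  then show ?thesis
    using op_norm_add[OF minus_carrier_mat[OF assms(2), of M] minus_carrier_mat[OF assms(3), of M']] by simp
qed

lemma op_norm_minus_le:
  assumes "M \<in> carrier_mat n m" "M' \<in> carrier_mat n m"
  shows "op_norm (M - M') \<le> op_norm M + op_norm M'"
  using op_norm_add[OF assms(1), of "(-1) \<cdot>\<^sub>m M'"] assms
  by (simp add: minus_mat_eq[OF assms] op_norm_smult[OF assms(2)])

lemma minus_add_minus_mat:
  "M \<in> carrier_mat n m \<Longrightarrow> M' \<in> carrier_mat n m \<Longrightarrow> M'' \<in> carrier_mat n m \<Longrightarrow> M - M'' = (M - M') + (M' - M'')"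
  for M :: "complex Matrix.mat"
  by (intro eq_matI) auto

lemma add_minus_add_mat:
  "A \<in> carrier_mat n m \<Longrightarrow> B \<in> carrier_mat n m \<Longrightarrow> C \<in> carrier_mat n m \<Longrightarrow> D \<in> carrier_mat n m \<Longrightarrow>
    (A + B) - (C + D) = (A - C) + (B - D)" for A :: "complex Matrix.mat"
  by (intro eq_matI) auto

lemma smult_minus_mat:
  "A \<in> carrier_mat n m \<Longrightarrow> B \<in> carrier_mat n m \<Longrightarrow> c \<cdot>\<^sub>m A - c \<cdot>\<^sub>m B = c \<cdot>\<^sub>m (A - B)" for A :: "complex Matrix.mat"
  by (intro eq_matI) (auto simp: right_diff_distrib)

lemma minus_minus_mat:
  "A \<in> carrier_mat n m \<Longrightarrow> B \<in> carrier_mat n m \<Longrightarrow> C \<in> carrier_mat n m \<Longrightarrow> (A - C) - (B - C) = A - B"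
  for A :: "complex Matrix.mat"
  by (intro eq_matI) auto

definition lipschitz_mat :: "real \<Rightarrow> (real \<Rightarrow> complex Matrix.mat) \<Rightarrow> bool" where
  "lipschitz_mat K f \<longleftrightarrow> (\<forall>x y. op_norm (f x - f y) \<le> K * \<bar>x - y\<bar>)"

lemma lip_le_iff:
  assumes f: "\<And>t. f t \<in> carrier_mat n n" shows "lip f \<le> ereal K \<longleftrightarrow> lipschitz_mat K f"
proof
  assume l: "lip f \<le> ereal K"
  show "lipschitz_mat K f" unfolding lipschitz_mat_def
  proof (intro allI)
    fix x y
    show "op_norm (f x - f y) \<le> K * \<bar>x - y\<bar>"
    proof (cases "x = y")
      case False
      then have "ereal (op_norm (f x - f y) / \<bar>x - y\<bar>) \<le> lip f"
        unfolding lip_def by (intro SUP_upper2[of "(x, y)"]) auto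
      then have "op_norm (f x - f y) / \<bar>x - y\<bar> \<le> K" using l order_trans by fastforce
      then show ?thesis using False by (simp add: divide_le_eq)
    qed (simp add: op_norm_minus_self[OF f])
  qed
next
  assume "lipschitz_mat K f"
  then show "lip f \<le> ereal K"
    unfolding lip_def lipschitz_mat_def by (intro SUP_least) (auto simp: divide_le_eq)
qed

lemma lip_nonneg:
  assumes f: "\<And>t. f t \<in> carrier_mat n n" shows "0 \<le> lip f"
proof -
  have "0 \<le> op_norm (f 0 - f 1)" by (rule op_norm_nonneg[OF minus_carrier_mat[OF f]])
  also have "ereal (op_norm (f 0 - f 1)) \<le> lip f"
    unfolding lip_def by (intro SUP_upper2[of "(0, 1)"]) auto
  finally show ?thesis by (simp add: zero_ereal_def)
qed

lemma lipschitz_mat_mult: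
  assumes f: "\<And>t. f t \<in> carrier_mat n n" "lipschitz_mat K f" "\<And>t. op_norm (f t) \<le> A"
    and g: "\<And>t. g t \<in> carrier_mat n n" "lipschitz_mat L g" "\<And>t. op_norm (g t) \<le> B"
  shows "lipschitz_mat (K * B + A * L) (\<lambda>t. f t * g t)"
  unfolding lipschitz_mat_def
proof (intro allI)
  fix x y
  have d: "f x - f y \<in> carrier_mat n n" "g x - g y \<in> carrier_mat n n"
    by (rule minus_carrier_mat[OF f(1)], rule minus_carrier_mat[OF g(1)])
  have "f x * g x - f y * g y = (f x - f y) * g x + f y * (g x - g y)"
  proof -
    have c: "f x * g x \<in> carrier_mat n n" "f y * g x \<in> carrier_mat n n" "f y * g y \<in> carrier_mat n n"
      by (rule mult_carrier_mat[OF f(1) g(1)])+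
    show ?thesis
      unfolding minus_mult_distrib_mat[OF f(1) f(1) g(1)] mult_minus_distrib_mat[OF f(1) g(1) g(1)]
      by (rule minus_add_minus_mat[OF c(1,2,3)])
  qed
  then have "op_norm (f x * g x - f y * g y) \<le> op_norm ((f x - f y) * g x) + op_norm (f y * (g x - g y))"
    using op_norm_add[OF mult_carrier_mat[OF d(1) g(1)[of x]] mult_carrier_mat[OF f(1)[of y] d(2)]] by simp
  also have "\<dots> \<le> op_norm (f x - f y) * op_norm (g x) + op_norm (f y) * op_norm (g x - g y)"
    by (intro add_mono op_norm_mult[OF d(1) g(1)] op_norm_mult[OF f(1) d(2)])
  also have "\<dots> \<le> (K * \<bar>x - y\<bar>) * B + A * (L * \<bar>x - y\<bar>)"
  proof (intro add_mono mult_mono f(3) g(3))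
    show "op_norm (f x - f y) \<le> K * \<bar>x - y\<bar>" using f(2) by (simp add: lipschitz_mat_def)
    then show "0 \<le> K * \<bar>x - y\<bar>" using op_norm_nonneg[OF d(1)] by simp
    show "op_norm (g x - g y) \<le> L * \<bar>x - y\<bar>" using g(2) by (simp add: lipschitz_mat_def)
    show "0 \<le> A" using op_norm_nonneg[OF f(1)[of x]] f(3)[of x] by simp
  qed (use op_norm_nonneg[OF g(1)] op_norm_nonneg[OF d(2)] in auto)
  finally show "op_norm (f x * g x - f y * g y) \<le> (K * B + A * L) * \<bar>x - y\<bar>" by (simp add: algebra_simps)
qed

lemma lipschitz_mat_adjoint:
  assumes f: "\<And>t. f t \<in> carrier_mat n n" "lipschitz_mat K f"
  shows "lipschitz_mat K (\<lambda>t. mat_adjoint (f t))"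
proof -
  have "mat_adjoint (f x) - mat_adjoint (f y) = mat_adjoint (f x - f y)" for x y
    using f(1)[of x] f(1)[of y] by (intro eq_matI) (auto simp: adjoint_eq)
  then show ?thesis using f(2) op_norm_adjoint[OF minus_carrier_mat[OF f(1)]]
    by (simp add: lipschitz_mat_def)
qed

lemma lipschitz_mat_entries:
  assumes f: "\<And>t. f t \<in> carrier_mat n n"
    and e: "\<And>i j x y. i < n \<Longrightarrow> j < n \<Longrightarrow> cmod (f x $$ (i, j) - f y $$ (i, j)) \<le> C i j * \<bar>x - y\<bar>"
  shows "lipschitz_mat (\<Sum>i<n. \<Sum>j<n. C i j) f"
  unfolding lipschitz_mat_def
proof (intro allI)
  fix x y
  have "op_norm (f x - f y) \<le> (\<Sum>i<n. \<Sum>j<n. cmod ((f x - f y) $$ (i, j)))"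
    by (rule op_norm_le_sum[OF minus_carrier_mat[OF f]])
  also have "\<dots> \<le> (\<Sum>i<n. \<Sum>j<n. C i j * \<bar>x - y\<bar>)"
    using e f[of x] f[of y] by (intro sum_mono) auto
  finally show "op_norm (f x - f y) \<le> (\<Sum>i<n. \<Sum>j<n. C i j) * \<bar>x - y\<bar>" by (simp add: sum_distrib_right)
qed

lemma cis_lipschitz: "cmod (cis x - cis y) \<le> 2 * \<bar>x - y\<bar>"
proof -
  have "\<bar>cos x - cos y\<bar> \<le> \<bar>x - y\<bar>" "\<bar>sin x - sin y\<bar> \<le> \<bar>x - y\<bar>"
  proof -
    have s: "\<bar>sin ((x - y) / 2)\<bar> \<le> \<bar>x - y\<bar> / 2" "\<bar>sin ((y - x) / 2)\<bar> \<le> \<bar>x - y\<bar> / 2"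
      using abs_sin_x_le_abs_x[of "(x - y) / 2"] abs_sin_x_le_abs_x[of "(y - x) / 2"] by auto
    have "\<bar>sin x - sin y\<bar> = 2 * (\<bar>sin ((x - y) / 2)\<bar> * \<bar>cos ((x + y) / 2)\<bar>)"
      unfolding sin_diff_sin by (simp add: abs_mult)
    also have "\<dots> \<le> 2 * (\<bar>x - y\<bar> / 2 * 1)" using s(1) by (intro mult_left_mono mult_mono) auto
    finally show "\<bar>sin x - sin y\<bar> \<le> \<bar>x - y\<bar>" by simp
    have "\<bar>cos x - cos y\<bar> = 2 * (\<bar>sin ((x + y) / 2)\<bar> * \<bar>sin ((y - x) / 2)\<bar>)"
      unfolding cos_diff_cos by (simp add: abs_mult)
    also have "\<dots> \<le> 2 * (1 * (\<bar>x - y\<bar> / 2))" using s(2) by (intro mult_left_mono mult_mono) auto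
    finally show "\<bar>cos x - cos y\<bar> \<le> \<bar>x - y\<bar>" by simp
  qed
  then show ?thesis using cmod_le[of "cis x - cis y"] by simp
qed

lemma fourier_lipschitz: assumes k: "0 < k" shows "\<exists>K. lipschitz_mat K (fourier k b)"
proof (intro exI, rule lipschitz_mat_entries[where n = "k * b" and C = "\<lambda>_ _. 4 * pi"], rule fourier_mem)
  fix p q x y assume pq: "p < k * b" "q < k * b"
  show "cmod (fourier k b x $$ (p, q) - fourier k b y $$ (p, q)) \<le> 4 * pi * \<bar>x - y\<bar>"
  proof (cases "p mod b = q mod b")
    case True
    let ?c = "(real k - 1 - real (p div b)) / real k"
    have "p div b < k" using block_index_bounds[OF pq(1)] by simp
    then have "real (p div b) + 1 \<le> real k" by linarith
    then have c: "\<bar>?c\<bar> \<le> 1" using k by (simp add: abs_if field_simps)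
    have r: "1 / sqrt (real k) \<le> 1" using k by simp
    have e: "2 * pi * ((real k - 1 - real (p div b)) * (t + real (q div b)) / real k) = 2 * pi * (?c * (t + real (q div b)))" for t
      by simp
    have "fourier k b x $$ (p, q) - fourier k b y $$ (p, q) = complex_of_real (1 / sqrt (real k)) *
        (cis (2 * pi * (?c * (x + real (q div b)))) - cis (2 * pi * (?c * (y + real (q div b)))))"
      using True by (simp only: fourier_index[OF pq] z_entry_eq_cis e right_diff_distrib if_True simp_thms)
    then have "cmod (fourier k b x $$ (p, q) - fourier k b y $$ (p, q)) =
        1 / sqrt (real k) * cmod (cis (2 * pi * (?c * (x + real (q div b)))) - cis (2 * pi * (?c * (y + real (q div b)))))"
      by (simp only: norm_mult norm_of_real) simp
    also have "\<dots> \<le> 1 * (2 * \<bar>2 * pi * (?c * (x + real (q div b))) - 2 * pi * (?c * (y + real (q div b)))\<bar>)"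
      using r by (intro mult_mono cis_lipschitz) auto
    also have "2 * pi * (?c * (x + real (q div b))) - 2 * pi * (?c * (y + real (q div b))) = 2 * pi * ?c * (x - y)"
      by (simp only: right_diff_distrib[symmetric] mult.assoc) (simp only: add_diff_cancel_right mult.assoc)
    also have "1 * (2 * \<bar>2 * pi * ?c * (x - y)\<bar>) = 4 * pi * (\<bar>?c\<bar> * \<bar>x - y\<bar>)"
      by (simp only: abs_mult) simp
    also have "\<dots> \<le> 4 * pi * (1 * \<bar>x - y\<bar>)" using c by (intro mult_left_mono mult_right_mono) auto
    finally show ?thesis by simp
  qed (simp add: fourier_index[OF pq])
qed

section \<open>The normalised trace\<close>

lemma mat_trace_eq: "M \<in> carrier_mat n n \<Longrightarrow> mat_trace M = (\<Sum>i<n. M $$ (i, i))"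
  by (simp add: mat_trace_def)

lemma mat_trace_add: "M \<in> carrier_mat n n \<Longrightarrow> M' \<in> carrier_mat n n \<Longrightarrow> mat_trace (M + M') = mat_trace M + mat_trace M'"
  by (simp add: mat_trace_def sum.distrib)

lemma mat_trace_smult: "M \<in> carrier_mat n n \<Longrightarrow> mat_trace (c \<cdot>\<^sub>m M) = c * mat_trace M"
  by (simp add: mat_trace_def sum_distrib_left)

lemma mat_trace_adjoint: "M \<in> carrier_mat n n \<Longrightarrow> mat_trace (mat_adjoint M) = cnj (mat_trace M)"
  by (simp add: mat_trace_def adjoint_eq)

lemma mat_trace_commute:
  assumes "M \<in> carrier_mat n n" "M' \<in> carrier_mat n n" shows "mat_trace (M * M') = mat_trace (M' * M)"
proof -
  have "mat_trace (M * M') = (\<Sum>i<n. \<Sum>l<n. M $$ (i, l) * M' $$ (l, i))"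
    unfolding mat_trace_eq[OF mult_carrier_mat[OF assms]] by (intro sum.cong refl mult_mat_index[OF assms]) auto
  also have "\<dots> = (\<Sum>l<n. \<Sum>i<n. M' $$ (l, i) * M $$ (i, l))" by (subst sum.swap) (simp only: mult.commute)
  also have "\<dots> = mat_trace (M' * M)"
    unfolding mat_trace_eq[OF mult_carrier_mat[OF assms(2,1)]]
    by (intro sum.cong refl mult_mat_index[OF assms(2,1), symmetric]) auto
  finally show ?thesis .
qed

lemma mat_trace_conjug:
  assumes V: "unitary_mat n V" and X: "X \<in> carrier_mat n n" shows "mat_trace (conjug V X) = mat_trace X"
proof -
  note Vm = unitary_mem[OF V] and Va = adjoint_mem[OF unitary_mem[OF V]]
  have "mat_trace (conjug V X) = mat_trace (mat_adjoint V * (V * X))"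
    unfolding conjug_def by (rule mat_trace_commute[OF mult_carrier_mat[OF Vm X] Va])
  also have "mat_adjoint V * (V * X) = X"
    using V X by (simp add: assoc_mult_mat[OF Va Vm X, symmetric]) (simp add: unitary_mat_def)
  finally show ?thesis .
qed

lemma mat_trace_blocks:
  assumes "\<And>j. j < k \<Longrightarrow> f j \<in> carrier_mat b b" shows "mat_trace (blocks k b f) = (\<Sum>j<k. mat_trace (f j))"
  unfolding mat_trace_eq[OF blocks_mem] sum_blocks
  by (intro sum.cong refl) (simp add: mat_trace_eq[OF assms] blocks_index block_pos)

lemma cmod_trace_le:
  assumes M: "M \<in> carrier_mat n n" shows "cmod (mat_trace M) \<le> real n * op_norm M"
proof -
  have "cmod (mat_trace M) \<le> (\<Sum>i<n. cmod (M $$ (i, i)))" unfolding mat_trace_eq[OF M] by (rule norm_sum)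
  also have "\<dots> \<le> (\<Sum>i<n. op_norm M)" by (intro sum_mono entry_le_op_norm[OF M]) auto
  finally show ?thesis by simp
qed

lemma integral_over_fibres:
  fixes g :: "real \<Rightarrow> complex"
  assumes g: "continuous_on UNIV g" and k: "0 < k"
  shows "(\<Sum>j<k. integral {0..1} (\<lambda>t. g ((t + real j) / real k))) = of_nat k * integral {0..1} g"
proof -
  have int: "g integrable_on {a..b}" for a b
    by (intro integrable_continuous_interval continuous_on_subset[OF g]) auto
  have sub: "integral {0..1} (\<lambda>t. g ((t + real j) / real k)) = of_nat k * integral {real j / real k..real (Suc j) / real k} g" for j
  proof -
    have "((\<lambda>t. (1 / real k) *\<^sub>R g ((t + real j) / real k)) has_integral
        integral {(0 + real j) / real k..(1 + real j) / real k} g) {0..1}"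
      by (rule has_integral_substitution[where c = "real j / real k" and d = "(1 + real j) / real k"])
        (use k in \<open>auto simp: divide_right_mono intro!: continuous_on_subset[OF g] derivative_eq_intros\<close>)
    then have "integral {0..1} (\<lambda>t. (1 / real k) *\<^sub>R g ((t + real j) / real k)) =
        integral {(0 + real j) / real k..(1 + real j) / real k} g" by (rule integral_unique)
    moreover have "integral {0..1} (\<lambda>t. (1 / real k) *\<^sub>R g ((t + real j) / real k)) =
        (1 / real k) *\<^sub>R integral {0..1} (\<lambda>t. g ((t + real j) / real k))" by (rule integral_cmul)
    ultimately show ?thesis using k by (simp add: scaleR_conv_of_real field_simps)
  qed
  have "n \<le> k \<Longrightarrow> (\<Sum>j<n. integral {real j / real k..real (Suc j) / real k} g) = integral {0..real n / real k} g" for n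
  proof (induction n)
    case (Suc n)
    have "integral {0..real n / real k} g + integral {real n / real k..real (Suc n) / real k} g =
        integral {0..real (Suc n) / real k} g"
      by (rule Henstock_Kurzweil_Integration.integral_combine) (auto intro: int divide_right_mono)
    then show ?case using Suc by simp
  qed simp
  from this[of k] show ?thesis unfolding sub sum_distrib_left[symmetric] using k by simp
qed

section \<open>Lipschitz approximation of periodic functions\<close>

text \<open>The largest function below \<open>f\<close> with Lipschitz constant \<open>K\<close> is uniformly close to \<open>f\<close> when \<open>K\<close> is large.\<close>

lemma lipschitz_approx_real:
  fixes f :: "real \<Rightarrow> real"
  assumes cont: "continuous_on UNIV f" and per: "\<And>t. f (t + 1) = f t" and e: "0 < e"
  shows "\<exists>g K. (\<forall>t. g (t + 1) = g t) \<and> (\<forall>x y. \<bar>g x - g y\<bar> \<le> K * \<bar>x - y\<bar>) \<and> (\<forall>t. \<bar>f t - g t\<bar> \<le> e)"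
proof -
  interpret periodic_fun_simple' f by unfold_locales (rule per)
  have "\<exists>x\<in>{0..1}. \<forall>t\<in>{0..1}. \<bar>f t\<bar> \<le> \<bar>f x\<bar>"
    by (rule continuous_attains_sup) (auto intro!: continuous_intros continuous_on_subset[OF cont])
  then obtain x0 where x0: "\<forall>t\<in>{0..1}. \<bar>f t\<bar> \<le> \<bar>f x0\<bar>" by (elim bexE)
  define B where "B = \<bar>f x0\<bar>"
  have B: "\<bar>f t\<bar> \<le> B" for t
  proof -
    have "f t = f (frac t + of_int \<lfloor>t\<rfloor>)" by (simp add: frac_def)
    then have "f t = f (frac t)" by (simp only: plus_of_int)
    then show ?thesis using x0[rule_format, of "frac t"] frac_lt_1[of t] by (simp add: B_def)
  qed
  have "uniformly_continuous_on {-1..2} f"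
    by (intro compact_uniformly_continuous continuous_on_subset[OF cont]) auto
  then obtain d where d: "0 < d" "\<forall>x\<in>{-1..2}. \<forall>x'\<in>{-1..2}. dist x' x < d \<longrightarrow> dist (f x') (f x) < e"
    unfolding uniformly_continuous_on_def using e by blast
  define \<delta> where "\<delta> = min d 1"
  have \<delta>: "0 < \<delta>" using d by (simp add: \<delta>_def)
  have near: "f t \<le> f s + e" if "\<bar>t - s\<bar> < \<delta>" for s t
  proof -
    let ?n = "of_int \<lfloor>t\<rfloor> :: real"
    have f: "0 \<le> t - ?n" "t - ?n < 1" by linarith+
    have st: "\<bar>t - s\<bar> < d" "\<bar>t - s\<bar> < 1" using that by (simp_all add: \<delta>_def)
    have m: "s - ?n \<in> {-1..2}" "t - ?n \<in> {-1..2}"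
      unfolding atLeastAtMost_iff using f st(2)[unfolded abs_less_iff] by linarith+
    have "dist (t - ?n) (s - ?n) < d" using st(1) by (simp add: dist_real_def)
    from d(2)[rule_format, OF m this] have "dist (f t) (f s) < e" by (simp only: minus_of_int)
    then have "\<bar>f t - f s\<bar> < e" by (simp only: dist_real_def)
    then show ?thesis by linarith
  qed
  define K where "K = 2 * B / \<delta>"
  have K: "0 \<le> K" using B[of 0] \<delta> by (simp add: K_def)
  define g where "g t = (INF s. f s + K * \<bar>t - s\<bar>)" for t
  have bdd: "bdd_below (range (\<lambda>s. f s + K * \<bar>t - s\<bar>))" for t
  proof (rule bdd_belowI2)
    fix s show "- B \<le> f s + K * \<bar>t - s\<bar>" using B[of s] mult_nonneg_nonneg[OF K, of "\<bar>t - s\<bar>"] by simp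
  qed
  have low: "g t \<le> f s + K * \<bar>t - s\<bar>" for s t unfolding g_def by (rule cINF_lower[OF bdd UNIV_I])
  have great: "r \<le> g t" if "\<And>s. r \<le> f s + K * \<bar>t - s\<bar>" for r t unfolding g_def using that by (intro cINF_greatest) auto
  have "g (t + 1) = g t" for t
  proof (rule antisym)
    show "g (t + 1) \<le> g t"
    proof (rule great)
      fix s show "g (t + 1) \<le> f s + K * \<bar>t - s\<bar>" using low[of "t + 1" "s + 1"] per[of s] by simp
    qed
    show "g t \<le> g (t + 1)"
    proof (rule great)
      fix s
      have e: "t - (s - 1) = t + 1 - s" by simp
      show "g t \<le> f s + K * \<bar>t + 1 - s\<bar>" using low[of t "s - 1", unfolded e] per[of "s - 1"] by simp
    qed
  qed
  moreover have gl: "g x \<le> g y + K * \<bar>x - y\<bar>" for x y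
  proof -
    have "g x - K * \<bar>x - y\<bar> \<le> g y"
    proof (rule great)
      fix s
      have "K * \<bar>x - s\<bar> \<le> K * (\<bar>y - s\<bar> + \<bar>x - y\<bar>)" by (intro mult_left_mono K) auto
      then show "g x - K * \<bar>x - y\<bar> \<le> f s + K * \<bar>y - s\<bar>" using low[of x s] by (simp add: algebra_simps)
    qed
    then show ?thesis by simp
  qed
  moreover have "\<bar>g x - g y\<bar> \<le> K * \<bar>x - y\<bar>" for x y
    using gl[of x y] gl[of y x] by (simp add: abs_le_iff abs_minus_commute)
  moreover have "\<bar>f t - g t\<bar> \<le> e" for t
  proof -
    have "f t - e \<le> g t"
    proof (rule great)
      fix s
      show "f t - e \<le> f s + K * \<bar>t - s\<bar>"
      proof (cases "\<bar>t - s\<bar> < \<delta>")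
        case True
        then show ?thesis using near[OF True] mult_nonneg_nonneg[OF K, of "\<bar>t - s\<bar>"] by simp
      next
        case False
        then have "K * \<delta> \<le> K * \<bar>t - s\<bar>" by (intro mult_left_mono K) simp
        then have "2 * B \<le> K * \<bar>t - s\<bar>" using \<delta> by (simp add: K_def)
        then show ?thesis using B[of t] B[of s] e by (simp add: abs_le_iff)
      qed
    qed
    then show ?thesis using low[of t t] e by (simp add: abs_le_iff)
  qed
  ultimately show ?thesis by blast
qed

lemma lipschitz_approx_complex:
  fixes f :: "real \<Rightarrow> complex"
  assumes cont: "continuous_on UNIV f" and per: "\<And>t. f (t + 1) = f t" and e: "0 < e"
  shows "\<exists>g K. (\<forall>t. g (t + 1) = g t) \<and> (\<forall>x y. cmod (g x - g y) \<le> K * \<bar>x - y\<bar>) \<and> (\<forall>t. cmod (f t - g t) \<le> e)"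
proof -
  have "continuous_on UNIV (\<lambda>t. Re (f t))" "continuous_on UNIV (\<lambda>t. Im (f t))"
    by (intro continuous_intros cont)+
  note c = this
  have p: "Re (f (t + 1)) = Re (f t)" "Im (f (t + 1)) = Im (f t)" for t by (simp_all add: per)
  obtain g1 K1 where g1: "\<forall>t. g1 (t + 1) = g1 t" "\<forall>x y. \<bar>g1 x - g1 y\<bar> \<le> K1 * \<bar>x - y\<bar>" "\<forall>t. \<bar>Re (f t) - g1 t\<bar> \<le> e / 2"
    using lipschitz_approx_real[OF c(1) p(1) half_gt_zero[OF e]] by (elim exE conjE) (rule that)
  obtain g2 K2 where g2: "\<forall>t. g2 (t + 1) = g2 t" "\<forall>x y. \<bar>g2 x - g2 y\<bar> \<le> K2 * \<bar>x - y\<bar>" "\<forall>t. \<bar>Im (f t) - g2 t\<bar> \<le> e / 2"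
    using lipschitz_approx_real[OF c(2) p(2) half_gt_zero[OF e]] by (elim exE conjE) (rule that)
  show ?thesis
  proof (intro exI[of _ "\<lambda>t. Complex (g1 t) (g2 t)"] exI[of _ "K1 + K2"] conjI allI)
    fix x y t
    show "Complex (g1 (t + 1)) (g2 (t + 1)) = Complex (g1 t) (g2 t)" using g1(1) g2(1) by simp
    show "cmod (Complex (g1 x) (g2 x) - Complex (g1 y) (g2 y)) \<le> (K1 + K2) * \<bar>x - y\<bar>"
      using cmod_le[of "Complex (g1 x) (g2 x) - Complex (g1 y) (g2 y)"] g1(2)[rule_format, of x y] g2(2)[rule_format, of x y]
      by (simp add: distrib_right)
    show "cmod (f t - Complex (g1 t) (g2 t)) \<le> e"
      using cmod_le[of "f t - Complex (g1 t) (g2 t)"] g1(3)[rule_format, of t] g2(3)[rule_format, of t] by simp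
  qed
qed

section \<open>The seminorms of the finite stages\<close>

context bunce_deddens
begin

lemma U_mem: "U \<sigma> m t \<in> carrier_mat (N m) (N m)" by (rule unitary_mem[OF unitary_U])

lemma lip_U: obtains u where "0 \<le> u" "lip (U \<sigma> m) = ereal u" "lipschitz_mat u (U \<sigma> m)"
proof -
  have "\<exists>K. lipschitz_mat K (U \<sigma> m)"
  proof (cases m)
    case 0
    have "lipschitz_mat 0 (U \<sigma> 0)" by (simp add: lipschitz_mat_def op_norm_minus_self[of _ 1 1])
    then show ?thesis using 0 by blast
  next
    case (Suc n)
    then show ?thesis using fourier_lipschitz[OF factor_pos[of n], of "N n"] by (simp add: U_eq_fourier)
  qed
  then obtain K where "lipschitz_mat K (U \<sigma> m)" by (elim exE)
  then have K: "lip (U \<sigma> m) \<le> ereal K" by (rule iffD2[OF lip_le_iff[of "U \<sigma> m" "N m", OF U_mem]])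
  have nn: "0 \<le> lip (U \<sigma> m)" by (rule lip_nonneg[of "U \<sigma> m" "N m", OF U_mem])
  obtain u where u: "lip (U \<sigma> m) = ereal u"
    using K nn by (cases "lip (U \<sigma> m)") auto
  have "lipschitz_mat u (U \<sigma> m)"
    by (rule iffD1[OF lip_le_iff[of "U \<sigma> m" "N m", OF U_mem]]) (simp add: u)
  then show thesis using nn unfolding u by (intro that[OF _ u]) simp_all
qed

lemma k_fac_eq: "lip (U \<sigma> m) = ereal u \<Longrightarrow> k_fac \<sigma> (Suc m) = ereal (max 1 ((1 + 2 * u) / real (\<sigma> (Suc m))))"
  using factor_pos[of m] by (simp add: k_fac_def max_def one_ereal_def numeral_eq_ereal)

lemma kappa_Suc: "kappa \<sigma> (Suc m) = kappa \<sigma> m / k_fac \<sigma> (Suc m)"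
proof (cases m)
  case 0
  have "lipschitz_mat 0 (U \<sigma> 0)" by (simp add: lipschitz_mat_def op_norm_minus_self[of _ 1 1])
  then have "lip (U \<sigma> 0) \<le> ereal 0" using lip_le_iff[of "U \<sigma> 0" "N 0", OF U_mem, of 0] by simp
  then have "lip (U \<sigma> 0) = ereal 0"
    using lip_nonneg[of "U \<sigma> 0" "N 0", OF U_mem] unfolding zero_ereal_def by (rule antisym)
  from k_fac_eq[OF this] have "k_fac \<sigma> (Suc 0) = ereal 1" using factor_pos[of 0] by (simp add: max_def divide_le_eq)
  then show ?thesis using 0 by (simp add: one_ereal_def)
qed simp

lemma kappa_real: "\<exists>c>0. kappa \<sigma> m = ereal c"
proof (induction m)
  case 0
  show ?case by (intro exI[of _ 1]) (simp add: one_ereal_def)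
next
  case (Suc m)
  then obtain c where c: "0 < c" "kappa \<sigma> m = ereal c" by blast
  obtain u where "0 \<le> u" and u: "lip (U \<sigma> m) = ereal u" and "lipschitz_mat u (U \<sigma> m)" by (rule lip_U[of m])
  define k where "k = max 1 ((1 + 2 * u) / real (\<sigma> (Suc m)))"
  have "0 < k" by (simp add: k_def)
  then show ?case unfolding kappa_Suc k_fac_eq[OF u] c(2) k_def[symmetric] using c(1)
    by (intro exI[of _ "c / k"]) simp
qed

lemma kappa_pos: obtains c where "0 < c" "kappa \<sigma> m = ereal c"
  using kappa_real[of m] by (elim exE conjE) (rule that)

lemma continuous_trace:
  assumes a: "mat_fun n a" shows "continuous_on S (\<lambda>t. mat_trace (a t))"
  unfolding mat_trace_eq[OF mat_funD(1)[OF a]]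
  by (intro continuous_on_sum continuous_on_subset[OF mat_funD(2)[OF a]]) auto

lemma trace_integrable: "mat_fun n a \<Longrightarrow> (\<lambda>t. c * mat_trace (a t)) integrable_on {0..1}"
  by (intro integrable_continuous_interval continuous_on_mult_left continuous_trace)

lemma tau_add: assumes "a \<in> cpf (N m)" "b \<in> cpf (N m)" shows "tau \<sigma> m (\<lambda>t. a t + b t) = tau \<sigma> m a + tau \<sigma> m b"
  unfolding tau_def mat_trace_add[OF cpfD(3)[OF assms(1)] cpfD(3)[OF assms(2)]] distrib_left
  by (intro integral_add trace_integrable[OF cpfD(1)[OF assms(1)]] trace_integrable[OF cpfD(1)[OF assms(2)]])

lemma tau_smult: assumes "a \<in> cpf (N m)" shows "tau \<sigma> m (\<lambda>t. c \<cdot>\<^sub>m a t) = c * tau \<sigma> m a"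
proof -
  have "tau \<sigma> m (\<lambda>t. c \<cdot>\<^sub>m a t) = integral {0..1} (\<lambda>t. c * (1 / of_nat (N m) * mat_trace (a t)))"
    unfolding tau_def mat_trace_smult[OF cpfD(3)[OF assms]] by (simp only: mult.left_commute)
  then show ?thesis unfolding tau_def by (simp only: integral_mult_right)
qed

lemma tau_one: "tau \<sigma> m (\<lambda>t. 1\<^sub>m (N m)) = 1"
  using N_pos[of m] by (simp add: tau_def mat_trace_def)

lemma tau_adjoint: assumes "a \<in> cpf (N m)" shows "tau \<sigma> m (\<lambda>t. mat_adjoint (a t)) = cnj (tau \<sigma> m a)"
  by (simp add: tau_def mat_trace_adjoint[OF cpfD(3)[OF assms]] Henstock_Kurzweil_Integration.integral_cnj)

lemma tau_real:
  assumes "a \<in> cpf (N m)" "(\<lambda>t. mat_adjoint (a t)) = a" shows "complex_of_real (Re (tau \<sigma> m a)) = tau \<sigma> m a"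
proof -
  have "cnj (tau \<sigma> m a) = tau \<sigma> m a" using tau_adjoint[OF assms(1)] unfolding assms(2) by simp
  then show ?thesis by (simp add: complex_eq_iff)
qed

lemma cmod_tau_le: assumes a: "a \<in> cpf (N m)" shows "cmod (tau \<sigma> m a) \<le> sup_norm a"
proof -
  have "cmod (tau \<sigma> m a) \<le> sup_norm a * (1 - 0)"
    unfolding tau_def
  proof (rule integral_bound)
    fix t
    have "cmod (mat_trace (a t)) \<le> real (N m) * sup_norm a"
      using cmod_trace_le[OF cpfD(3)[OF a], of t] mult_left_mono[OF op_norm_le_sup_norm[OF a, of t], of "real (N m)"] by simp
    then show "norm (1 / of_nat (N m) * mat_trace (a t)) \<le> sup_norm a"
      using N_pos[of m] by (simp add: norm_mult norm_divide divide_le_eq mult.commute)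
  qed (simp_all only: zero_le_one continuous_on_mult_left[OF continuous_trace[OF cpfD(1)[OF a]]])
  then show ?thesis by simp
qed

lemma tau_alpha: assumes a: "a \<in> cpf (N m)" shows "tau \<sigma> (Suc m) (alpha \<sigma> m a) = tau \<sigma> m a"
proof -
  let ?k = "\<sigma> (Suc m)" and ?g = "\<lambda>t. mat_trace (a t)"
  have k: "0 < ?k" by (rule factor_pos)
  have g: "continuous_on UNIV ?g" by (rule continuous_trace[OF cpfD(1)[OF a]])
  have int: "(\<lambda>t. ?g ((t + real j) / real ?k)) integrable_on {0..1}" for j
    using k by (intro integrable_continuous_interval continuous_on_compose2[OF g] continuous_intros) auto
  have "mat_trace (alpha \<sigma> m a t) = (\<Sum>j<?k. ?g ((t + real j) / real ?k))" for t
    unfolding alpha_eq[OF a] mat_trace_conjug[OF unitary_U fibres_mem]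
    unfolding fibres_def
    by (rule mat_trace_blocks[OF cpfD(3)[OF a]])
  then have "tau \<sigma> (Suc m) (alpha \<sigma> m a) =
      1 / of_nat (N (Suc m)) * integral {0..1} (\<lambda>t. \<Sum>j<?k. ?g ((t + real j) / real ?k))"
    by (simp only: tau_def integral_mult_right)
  also have "integral {0..1} (\<lambda>t. \<Sum>j<?k. ?g ((t + real j) / real ?k)) = of_nat ?k * integral {0..1} ?g"
    unfolding integral_over_fibres[OF g k, symmetric] by (rule Henstock_Kurzweil_Integration.integral_sum) (auto intro: int)
  also have "1 / of_nat (N (Suc m)) * (of_nat ?k * integral {0..1} ?g) = 1 / of_nat (N m) * integral {0..1} ?g"
    using k by (simp add: N_Suc)
  finally show ?thesis by (simp only: tau_def integral_mult_right)
qed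

definition centred :: "nat \<Rightarrow> (real \<Rightarrow> complex Matrix.mat) \<Rightarrow> real \<Rightarrow> complex Matrix.mat" where
  "centred m a t = a t - tau \<sigma> m a \<cdot>\<^sub>m 1\<^sub>m (N m)"

lemma centred_cpf: "a \<in> cpf (N m) \<Longrightarrow> centred m a \<in> cpf (N m)"
  unfolding centred_def[abs_def] by (intro cpf_minus cpf_const smult_carrier_mat one_carrier_mat)

text \<open>
  The seminorm of a finite stage is the supremum of the following functionals, each of which is
  a continuous seminorm vanishing at the unit.
\<close>

definition lip_terms :: "nat \<Rightarrow> ((real \<Rightarrow> complex Matrix.mat) \<Rightarrow> real) set" where
  "lip_terms m = insert (\<lambda>a. sup_norm (centred m a))
     {\<lambda>a. op_norm (twist m a x - twist m a y) / \<bar>x - y\<bar> | x y. x \<noteq> y}"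

lemma L_CP_le_iff: "L_CP \<sigma> m a \<le> M \<longleftrightarrow> (\<forall>q\<in>lip_terms m. ereal (q a) \<le> M)"
  unfolding L_CP_def lip_def twist_eq[symmetric] lip_terms_def centred_def[abs_def]
  by (auto simp: SUP_le_iff)

lemma lip_term_le: "q \<in> lip_terms m \<Longrightarrow> ereal (q a) \<le> L_CP \<sigma> m a"
  by (rule iffD1[OF L_CP_le_iff order_refl, rule_format])

lemma L_CP_le_real_iff:
  assumes a: "a \<in> cpf (N m)"
  shows "L_CP \<sigma> m a \<le> ereal K \<longleftrightarrow> lipschitz_mat K (twist m a) \<and> sup_norm (centred m a) \<le> K"
  unfolding L_CP_def twist_eq[symmetric] using lip_le_iff[of "twist m a", OF twist_mem[where a = a, OF cpfD(3)[OF a]]]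
  by (simp add: centred_def[abs_def])

lemma L_CP_nonneg: assumes a: "a \<in> cpf (N m)" shows "0 \<le> L_CP \<sigma> m a"
proof -
  have "0 \<le> sup_norm (centred m a)"
    using op_norm_nonneg[OF cpfD(3)[OF centred_cpf[OF a]], of 0] op_norm_le_sup_norm[OF centred_cpf[OF a], of 0] by linarith
  then show ?thesis using lip_term_le[of "\<lambda>a. sup_norm (centred m a)" m a]
    by (simp add: lip_terms_def order_trans[of 0 "ereal _"])
qed

lemma lip_terms_seminorm:
  assumes q: "q \<in> lip_terms m"
  shows "a \<in> cpf (N m) \<Longrightarrow> b \<in> cpf (N m) \<Longrightarrow> q (\<lambda>t. a t + b t) \<le> q a + q b"
    and "a \<in> cpf (N m) \<Longrightarrow> q (\<lambda>t. c \<cdot>\<^sub>m a t) = cmod c * q a"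
    and "\<exists>C. \<forall>a\<in>cpf (N m). q a \<le> C * sup_norm a"
    and "q (\<lambda>t. 1\<^sub>m (N m)) = 0"
proof -
  interpret C: state_star_algebra "CP \<sigma> m" "pure_states (N m)" by (rule state_star_algebra_CP[OF N_pos])
  note W = unitary_adjoint[OF unitary_U]
  from q consider (c) "q = (\<lambda>a. sup_norm (centred m a))"
    | (t) x y where "x \<noteq> y" "q = (\<lambda>a. op_norm (twist m a x - twist m a y) / \<bar>x - y\<bar>)"
    by (auto simp: lip_terms_def)
  note cs = this
  {
    fix a b assume a: "a \<in> cpf (N m)" and b: "b \<in> cpf (N m)"
    note am = cpfD(3)[OF a] and bm = cpfD(3)[OF b]
    show "q (\<lambda>t. a t + b t) \<le> q a + q b"
    proof (cases rule: cs)
      case c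
      have "centred m (\<lambda>t. a t + b t) = (\<lambda>t. centred m a t + centred m b t)"
      proof (rule ext, rule eq_matI)
        fix t i j assume "i < dim_row (centred m a t + centred m b t)" "j < dim_col (centred m a t + centred m b t)"
        then show "centred m (\<lambda>t. a t + b t) t $$ (i, j) = (centred m a t + centred m b t) $$ (i, j)"
          using am[of t] bm[of t] by (auto simp: centred_def tau_add[OF a b])
      qed (auto simp: centred_def)
      then show ?thesis using C.nrm_add[of "centred m a" "centred m b"] centred_cpf[OF a] centred_cpf[OF b]
        by (simp add: c)
    next
      case (t x y)
      have tm: "twist m a s \<in> carrier_mat (N m) (N m)" "twist m b s \<in> carrier_mat (N m) (N m)" for s
        by (rule twist_mem[where a = a, OF am], rule twist_mem[where a = b, OF bm])
      have ta: "twist m (\<lambda>t. a t + b t) s = twist m a s + twist m b s" for s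
        unfolding twist_def by (rule conjug_add[OF W am bm])
      have "twist m (\<lambda>t. a t + b t) x - twist m (\<lambda>t. a t + b t) y =
          (twist m a x - twist m a y) + (twist m b x - twist m b y)"
        unfolding ta by (rule add_minus_add_mat[OF tm tm])
      then show ?thesis
        using op_norm_add[OF minus_carrier_mat[OF tm(1)[of y], of "twist m a x"] minus_carrier_mat[OF tm(2)[of y], of "twist m b x"]] t
        by (simp add: add_divide_distrib[symmetric] divide_right_mono)
    qed
  }
  {
    fix a and c :: complex assume a: "a \<in> cpf (N m)"
    note am = cpfD(3)[OF a]
    show "q (\<lambda>t. c \<cdot>\<^sub>m a t) = cmod c * q a"
    proof (cases rule: cs)
      case c': c
      have "centred m (\<lambda>t. c \<cdot>\<^sub>m a t) = (\<lambda>t. c \<cdot>\<^sub>m centred m a t)"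
      proof (rule ext, rule eq_matI)
        fix t i j assume "i < dim_row (c \<cdot>\<^sub>m centred m a t)" "j < dim_col (c \<cdot>\<^sub>m centred m a t)"
        then show "centred m (\<lambda>t. c \<cdot>\<^sub>m a t) t $$ (i, j) = (c \<cdot>\<^sub>m centred m a t) $$ (i, j)"
          using am[of t] by (auto simp: centred_def tau_smult[OF a] right_diff_distrib)
      qed (auto simp: centred_def)
      then show ?thesis using C.nrm_smult[of "centred m a" c] centred_cpf[OF a] by (simp add: c')
    next
      case (t x y)
      have tm: "twist m a s \<in> carrier_mat (N m) (N m)" for s by (rule twist_mem[where a = a, OF am])
      have ta: "twist m (\<lambda>t. c \<cdot>\<^sub>m a t) s = c \<cdot>\<^sub>m twist m a s" for s
        unfolding twist_def by (rule conjug_smult[OF W am])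
      have "twist m (\<lambda>t. c \<cdot>\<^sub>m a t) x - twist m (\<lambda>t. c \<cdot>\<^sub>m a t) y = c \<cdot>\<^sub>m (twist m a x - twist m a y)"
        unfolding ta by (rule smult_minus_mat[OF tm tm])
      then show ?thesis
        using op_norm_smult[OF minus_carrier_mat[OF tm[of y], of "twist m a x"], of c] t by simp
    qed
  }
  show "\<exists>C. \<forall>a\<in>cpf (N m). q a \<le> C * sup_norm a"
  proof (cases rule: cs)
    case c
    show ?thesis
    proof (intro exI[of _ 2] ballI)
      fix a assume a: "a \<in> cpf (N m)"
      show "q a \<le> 2 * sup_norm a" unfolding c
      proof (rule sup_norm_leI)
        fix t
        have "op_norm (centred m a t) \<le> op_norm (a t) + op_norm (tau \<sigma> m a \<cdot>\<^sub>m 1\<^sub>m (N m))"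
          unfolding centred_def by (intro op_norm_minus_le[OF cpfD(3)[OF a]]) auto
        also have "op_norm (tau \<sigma> m a \<cdot>\<^sub>m 1\<^sub>m (N m)) = cmod (tau \<sigma> m a)"
          using op_norm_smult[OF one_carrier_mat, of "tau \<sigma> m a" "N m"] op_norm_one[OF N_pos] by simp
        finally show "op_norm (centred m a t) \<le> 2 * sup_norm a"
          using op_norm_le_sup_norm[OF a, of t] cmod_tau_le[OF a] by simp
      qed
    qed
  next
    case (t x y)
    show ?thesis
    proof (intro exI[of _ "2 / \<bar>x - y\<bar>"] ballI)
      fix a assume a: "a \<in> cpf (N m)"
      have tm: "twist m a s \<in> carrier_mat (N m) (N m)" for s by (rule twist_mem[where a = a, OF cpfD(3)[OF a]])
      have "op_norm (twist m a s) \<le> sup_norm a" for s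
        by (rule order_trans[OF op_norm_twist_le[where a = a, OF cpfD(3)[OF a]] op_norm_le_sup_norm[OF a]])
      from this[of x] this[of y] have "op_norm (twist m a x - twist m a y) \<le> 2 * sup_norm a"
        using op_norm_minus_le[OF tm[of x] tm[of y]] by linarith
      then show "q a \<le> 2 / \<bar>x - y\<bar> * sup_norm a" using t(1) unfolding t(2) by (simp add: divide_right_mono)
    qed
  qed
  show "q (\<lambda>t. 1\<^sub>m (N m)) = 0"
  proof (cases rule: cs)
    case c
    have "centred m (\<lambda>t. 1\<^sub>m (N m)) = \<zero>\<^bsub>CP \<sigma> m\<^esub>"
      by (rule ext, rule eq_matI) (auto simp: centred_def tau_one)
    then show ?thesis using C.nrm_smult[of "\<zero>\<^bsub>CP \<sigma> m\<^esub>" 0] C.smult_zero[of "\<zero>\<^bsub>CP \<sigma> m\<^esub>"]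
      by (simp add: c cpf_const)
  next
    case (t x y)
    show ?thesis unfolding t(2) twist_def conjug_one[OF W] by (simp add: op_norm_minus_self[OF one_carrier_mat])
  qed
qed

lemma L_CP_lipschitz:
  assumes a: "a \<in> cpf (N m)" and K: "lipschitz_mat K a" shows "L_CP \<sigma> m a < \<infinity>"
proof -
  obtain u where u1: "0 \<le> u" and "lip (U \<sigma> m) = ereal u" and u2: "lipschitz_mat u (U \<sigma> m)" by (rule lip_U[of m])
  note u = u1 u2
  note Ua = lipschitz_mat_adjoint[OF U_mem u(2)]
  have n: "op_norm (U \<sigma> m t) \<le> 1" "op_norm (mat_adjoint (U \<sigma> m t)) \<le> 1" for t
    using op_norm_unitary_le[OF unitary_U] op_norm_unitary_le[OF unitary_adjoint[OF unitary_U]] by auto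
  note l1 = lipschitz_mat_mult[OF adjoint_mem[OF U_mem] Ua n(2) cpfD(3)[OF a] K op_norm_le_sup_norm[OF a]]
  have n2: "op_norm (mat_adjoint (U \<sigma> m t) * a t) \<le> 1 * sup_norm a" for t
    using op_norm_mult[OF adjoint_mem[OF U_mem[of m t]] cpfD(3)[OF a, of t]]
      mult_mono[OF n(2)[of t] op_norm_le_sup_norm[OF a, of t] _ op_norm_nonneg[OF cpfD(3)[OF a]]] by simp
  obtain K' where K': "lipschitz_mat K' (twist m a)"
    using lipschitz_mat_mult[OF mult_carrier_mat[OF adjoint_mem[OF U_mem] cpfD(3)[OF a]] l1 n2 U_mem u(2) n(1)]
    unfolding twist_eq[symmetric] by blast
  have "\<exists>M. L_CP \<sigma> m a \<le> ereal M"
  proof (rule exI)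
  show "L_CP \<sigma> m a \<le> ereal (max K' (sup_norm (centred m a)))"
    unfolding L_CP_le_real_iff[OF a]
  proof
    have le: "K' * \<bar>x - y\<bar> \<le> max K' (sup_norm (centred m a)) * \<bar>x - y\<bar>" for x y :: real
      by (intro mult_right_mono) auto
    show "lipschitz_mat (max K' (sup_norm (centred m a))) (twist m a)"
      unfolding lipschitz_mat_def by (intro allI order_trans[OF K'[unfolded lipschitz_mat_def, rule_format] le])
  qed simp
  qed
  then obtain M where "L_CP \<sigma> m a \<le> ereal M" by (elim exE)
  then show ?thesis by (cases "L_CP \<sigma> m a") auto
qed

text \<open>
  Undoing the twist multiplies by the unitary on both sides, which costs its Lipschitz constant
  twice; the other factor is the norm of the centred function, which the seminorm controls.
\<close>

lemma lipschitz_of_L_CP: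
  assumes a: "a \<in> cpf (N m)" and K: "L_CP \<sigma> m a \<le> ereal K" and u: "0 \<le> u" "lipschitz_mat u (U \<sigma> m)"
  shows "lipschitz_mat ((1 + 2 * u) * K) a"
proof -
  let ?c = "centred m a"
  note c = centred_cpf[OF a] and am = cpfD(3)[OF a]
  note cm = cpfD(3)[OF c]
  have Kl: "lipschitz_mat K (twist m a)" "sup_norm ?c \<le> K" using K by (auto simp: L_CP_le_real_iff[OF a])
  have tm: "twist m a t \<in> carrier_mat (N m) (N m)" for t by (rule twist_mem[where a = a, OF am])
  have wm: "twist m ?c t \<in> carrier_mat (N m) (N m)" for t by (rule twist_mem[where a = ?c, OF cm])
  have tc: "twist m ?c t = twist m a t - tau \<sigma> m a \<cdot>\<^sub>m 1\<^sub>m (N m)" for t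
  proof -
    note W = unitary_adjoint[OF unitary_U[of m t]]
    have "?c t = a t + (- tau \<sigma> m a) \<cdot>\<^sub>m 1\<^sub>m (N m)"
      unfolding centred_def using am[of t] by (intro eq_matI) auto
    then have "twist m ?c t = twist m a t + (- tau \<sigma> m a) \<cdot>\<^sub>m 1\<^sub>m (N m)"
      unfolding twist_def using conjug_add[OF W am[of t] smult_carrier_mat[OF one_carrier_mat]]
        conjug_smult[OF W one_carrier_mat] conjug_one[OF W] by simp
    then show ?thesis using tm[of t] by (simp, intro eq_matI) auto
  qed
  have wl: "lipschitz_mat K (twist m ?c)"
  proof -
    have "twist m ?c x - twist m ?c y = twist m a x - twist m a y" for x y
      unfolding tc by (rule minus_minus_mat[OF tm tm smult_carrier_mat[OF one_carrier_mat]])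
    then show ?thesis using Kl(1) by (simp add: lipschitz_mat_def)
  qed
  have wn: "op_norm (twist m ?c t) \<le> K" for t
    using op_norm_twist_le[where a = ?c and m = m, OF cm, of t] op_norm_le_sup_norm[OF c, of t] Kl(2) by simp
  have n: "op_norm (U \<sigma> m t) \<le> 1" "op_norm (mat_adjoint (U \<sigma> m t)) \<le> 1" for t
    using op_norm_unitary_le[OF unitary_U] op_norm_unitary_le[OF unitary_adjoint[OF unitary_U]] by auto
  note l1 = lipschitz_mat_mult[OF U_mem u(2) n(1) wm wl wn]
  have n2: "op_norm (U \<sigma> m t * twist m ?c t) \<le> 1 * K" for t
    using op_norm_mult[OF U_mem[of m t] wm[of t]] mult_mono[OF n(1)[of t] wn[of t] _ op_norm_nonneg[OF wm]] by simp
  have "U \<sigma> m t * twist m ?c t * mat_adjoint (U \<sigma> m t) = ?c t" for t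
    using conjug_twist[where a = ?c and m = m, OF cm, of t] by (simp add: conjug_def)
  then have "lipschitz_mat ((u * K + 1 * K) * 1 + 1 * K * u) ?c"
    using lipschitz_mat_mult[OF mult_carrier_mat[OF U_mem wm] l1 n2 adjoint_mem[OF U_mem] lipschitz_mat_adjoint[OF U_mem u(2)] n(2)]
    by simp
  moreover have "?c x - ?c y = a x - a y" for x y
    unfolding centred_def by (rule minus_minus_mat[OF am am smult_carrier_mat[OF one_carrier_mat]])
  ultimately show ?thesis by (simp add: lipschitz_mat_def algebra_simps)
qed

lemma centred_alpha:
  assumes a: "a \<in> cpf (N m)" shows "centred (Suc m) (alpha \<sigma> m a) = alpha \<sigma> m (centred m a)"
proof -
  interpret retract_system "CP \<sigma>" "\<lambda>m. pure_states (N m)" "alpha \<sigma>" retr by (rule retract_system_CP)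
  have one: "(\<lambda>t. 1\<^sub>m (N m)) \<in> cpf (N m)" by (rule cpf_const[OF one_carrier_mat])
  have c: "centred m a = (\<lambda>t. a t + (- tau \<sigma> m a) \<cdot>\<^sub>m 1\<^sub>m (N m))"
    unfolding centred_def[abs_def] using cpfD(3)[OF a] by (intro ext eq_matI) (auto dest: carrier_matD)
  have "alpha \<sigma> m (centred m a) = (\<lambda>t. alpha \<sigma> m a t + (- tau \<sigma> m a) \<cdot>\<^sub>m 1\<^sub>m (N (Suc m)))"
    unfolding c using incl_add[of a m "\<lambda>t. (- tau \<sigma> m a) \<cdot>\<^sub>m 1\<^sub>m (N m)"] incl_smult[of "\<lambda>t. 1\<^sub>m (N m)" m "- tau \<sigma> m a"] incl_one[of m]
    by (simp add: a one cpf_smult[OF one])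
  also have "\<dots> = centred (Suc m) (alpha \<sigma> m a)"
  proof (rule ext, rule eq_matI)
    fix t i j
    assume "i < dim_row (centred (Suc m) (alpha \<sigma> m a) t)" "j < dim_col (centred (Suc m) (alpha \<sigma> m a) t)"
    then show "(alpha \<sigma> m a t + (- tau \<sigma> m a) \<cdot>\<^sub>m 1\<^sub>m (N (Suc m))) $$ (i, j) = centred (Suc m) (alpha \<sigma> m a) t $$ (i, j)"
      using cpfD(3)[OF alpha_cpf[OF a], of t] by (auto simp: centred_def tau_alpha[OF a])
  qed (use carrier_matD[OF cpfD(3)[OF alpha_cpf[OF a]]] in \<open>auto simp: centred_def\<close>)
  finally show ?thesis by simp
qed

text \<open>
  Twisting the image of a function undoes the conjugation and leaves its values along the
  fibre, where the variable is divided by the winding number.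
\<close>

lemma L_CP_alpha:
  assumes a: "a \<in> cpf (N m)" and K: "L_CP \<sigma> m a \<le> ereal K" and u: "0 \<le> u" "lipschitz_mat u (U \<sigma> m)"
  shows "L_CP \<sigma> (Suc m) (alpha \<sigma> m a) \<le> ereal (max 1 ((1 + 2 * u) / real (\<sigma> (Suc m))) * K)"
proof -
  let ?k = "real (\<sigma> (Suc m))" and ?M = "max 1 ((1 + 2 * u) / real (\<sigma> (Suc m)))"
  have k: "0 < ?k" using factor_pos by simp
  note am = cpfD(3)[OF a]
  have K0: "0 \<le> K" using order_trans[OF L_CP_nonneg[OF a] K] by simp
  have la: "lipschitz_mat ((1 + 2 * u) * K) a" by (rule lipschitz_of_L_CP[OF a K u])
  show ?thesis
    unfolding L_CP_le_real_iff[OF alpha_cpf[OF a]]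
  proof
    show "lipschitz_mat (?M * K) (twist (Suc m) (alpha \<sigma> m a))"
      unfolding lipschitz_mat_def
    proof (intro allI)
      fix x y
      let ?a = "\<lambda>s j. a ((s + real j) / ?k)"
      have "fibres m a x - fibres m a y = blocks (\<sigma> (Suc m)) (N m) (\<lambda>j. ?a x j + (-1) \<cdot>\<^sub>m ?a y j)"
        using minus_mat_eq[OF fibres_mem[of m a x] fibres_mem[of m a y]]
        by (simp only: fibres_def blocks_add[of _ "?a x" _ "\<lambda>j. (-1) \<cdot>\<^sub>m ?a y j", OF am smult_carrier_mat[OF am]]
            blocks_smult[of _ "?a y", OF am])
      also have "\<dots> = blocks (\<sigma> (Suc m)) (N m) (\<lambda>j. ?a x j - ?a y j)"
        by (simp only: minus_mat_eq[OF am am])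
      finally have e: "fibres m a x - fibres m a y = blocks (\<sigma> (Suc m)) (N m) (\<lambda>j. ?a x j - ?a y j)" .
      have "op_norm (fibres m a x - fibres m a y) \<le> (1 + 2 * u) * K * (\<bar>x - y\<bar> / ?k)"
        unfolding e
      proof (rule op_norm_blocks_le)
        fix j
        show "?a x j - ?a y j \<in> carrier_mat (N m) (N m)" by (rule minus_carrier_mat[OF am])
        have "(x + real j) / ?k - (y + real j) / ?k = (x - y) / ?k" by (simp add: diff_divide_distrib add_divide_distrib)
        then have "\<bar>(x + real j) / ?k - (y + real j) / ?k\<bar> = \<bar>x - y\<bar> / ?k" using k by simp
        then show "op_norm (?a x j - ?a y j) \<le> (1 + 2 * u) * K * (\<bar>x - y\<bar> / ?k)"
          using la[unfolded lipschitz_mat_def, rule_format, of "(x + real j) / ?k" "(y + real j) / ?k"] by simp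
      qed (use u K0 k in auto)
      also have "\<dots> = (1 + 2 * u) / ?k * (K * \<bar>x - y\<bar>)" by simp
      also have "\<dots> \<le> ?M * (K * \<bar>x - y\<bar>)" using K0 by (intro mult_right_mono) auto
      finally show "op_norm (twist (Suc m) (alpha \<sigma> m a) x - twist (Suc m) (alpha \<sigma> m a) y) \<le> ?M * K * \<bar>x - y\<bar>"
        by (simp add: twist_alpha[OF a] mult.assoc)
    qed
    have "sup_norm (centred (Suc m) (alpha \<sigma> m a)) = sup_norm (centred m a)"
      by (simp add: centred_alpha[OF a] alpha_norm[OF centred_cpf[OF a]])
    also have "\<dots> \<le> K" using K by (simp add: L_CP_le_real_iff[OF a])
    also have "\<dots> \<le> ?M * K" using K0 mult_right_mono[of 1 ?M K] by simp
    finally show "sup_norm (centred (Suc m) (alpha \<sigma> m a)) \<le> ?M * K" .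
  qed
qed

end

section \<open>The Bunce-Deddens algebras as limits of Lipschitz systems\<close>

text \<open>
  Rounding the values of the centred function on a sufficiently fine grid; by the Lipschitz
  bound finitely many such codes determine the function up to a small error.
\<close>

lemma (in bunce_deddens) CP_precompact:
  assumes e: "0 < e"
  shows "\<exists>F. finite F \<and> F \<subseteq> carrier (sa (CP \<sigma> m)) \<and>
    (\<forall>a\<in>carrier (sa (CP \<sigma> m)). L_CP \<sigma> m a \<le> ereal C \<longrightarrow>
      (\<exists>f\<in>F. \<exists>r. sup_norm (\<lambda>t. a t - (f t + complex_of_real r \<cdot>\<^sub>m 1\<^sub>m (N m))) \<le> e))"
proof -
  obtain u where u1: "0 \<le> u" and "lip (U \<sigma> m) = ereal u" and u2: "lipschitz_mat u (U \<sigma> m)" by (rule lip_U[of m])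
  let ?n = "N m"
  define K where "K = \<bar>(1 + 2 * u) * C\<bar> + 1"
  define d where "d = e / (4 * (real ?n * real ?n))"
  have n: "0 < real ?n" using N_pos by simp
  have d: "0 < d" using e n by (simp add: d_def)
  obtain M where M: "4 * K / e < real M" using reals_Archimedean2 by blast
  have K1: "1 \<le> K" by (simp add: K_def)
  have "0 < 4 * K / e" using e K1 by simp
  then have M0: "0 < real M" using M by linarith
  define T where "T = {a \<in> carrier (sa (CP \<sigma> m)). L_CP \<sigma> m a \<le> ereal C}"
  define code where "code a = (\<lambda>(p, i, j) \<in> {..<M} \<times> {..<?n} \<times> {..<?n}.
    (\<lfloor>Re (centred m a (real p / real M) $$ (i, j)) / d\<rfloor>, \<lfloor>Im (centred m a (real p / real M) $$ (i, j)) / d\<rfloor>))" for a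
  define B where "B = \<lceil>C / d\<rceil> + 1"
  have T: "a \<in> cpf ?n" "(\<lambda>t. mat_adjoint (a t)) = a" "sup_norm (centred m a) \<le> C" "lipschitz_mat ((1 + 2 * u) * C) a"
    if "a \<in> T" for a
  proof -
    show a: "a \<in> cpf ?n" "(\<lambda>t. mat_adjoint (a t)) = a" using that by (auto simp: T_def)
    have L: "L_CP \<sigma> m a \<le> ereal C" using that by (simp add: T_def)
    then show "sup_norm (centred m a) \<le> C" by (simp add: L_CP_le_real_iff[OF a(1)])
    show "lipschitz_mat ((1 + 2 * u) * C) a" by (rule lipschitz_of_L_CP[OF a(1) L u1 u2])
  qed
  have lc: "op_norm (centred m a x - centred m a y) \<le> K * \<bar>x - y\<bar>" if "a \<in> T" for a x y
  proof -
    have "centred m a x - centred m a y = a x - a y"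
      unfolding centred_def
      by (rule minus_minus_mat[OF cpfD(3)[OF T(1)[OF that]] cpfD(3)[OF T(1)[OF that]] smult_carrier_mat[OF one_carrier_mat]])
    then have "op_norm (centred m a x - centred m a y) \<le> (1 + 2 * u) * C * \<bar>x - y\<bar>"
      using T(4)[OF that] by (simp add: lipschitz_mat_def)
    also have "\<dots> \<le> K * \<bar>x - y\<bar>" by (intro mult_right_mono) (auto simp: K_def)
    finally show ?thesis .
  qed
  have fl: "\<lfloor>r / d\<rfloor> \<in> {- B..B}" if "\<bar>r\<bar> \<le> C" for r
  proof -
    have "r \<le> C" "- C \<le> r" using that by linarith+
    then have "r / d \<le> C / d" "(- C) / d \<le> r / d" using d by (intro divide_right_mono; simp)+
    then have "r / d \<le> C / d" "- (C / d) \<le> r / d" by simp_all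
    then show ?thesis unfolding B_def atLeastAtMost_iff by linarith
  qed
  have codeT: "code ` T \<subseteq> ({..<M} \<times> {..<?n} \<times> {..<?n}) \<rightarrow>\<^sub>E ({- B..B} \<times> {- B..B})"
  proof (rule image_subsetI)
    fix a assume a: "a \<in> T"
    have ent: "cmod (centred m a s $$ (i, j)) \<le> C" if "i < ?n" "j < ?n" for s i j
      using entry_le_op_norm[OF cpfD(3)[OF centred_cpf[OF T(1)[OF a]]] that, of s]
        op_norm_le_sup_norm[OF centred_cpf[OF T(1)[OF a]], of s] T(3)[OF a] by linarith
    show "code a \<in> ({..<M} \<times> {..<?n} \<times> {..<?n}) \<rightarrow>\<^sub>E ({- B..B} \<times> {- B..B})"
      unfolding code_def
    proof (rule restrict_PiE_iff[THEN iffD2], rule ballI)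
      fix z assume "z \<in> {..<M} \<times> {..<?n} \<times> {..<?n}"
      then obtain p i j where z: "z = (p, i, j)" and ij: "i < ?n" "j < ?n" by auto
      let ?z = "centred m a (real p / real M) $$ (i, j)"
      have "\<lfloor>Re ?z / d\<rfloor> \<in> {- B..B}" "\<lfloor>Im ?z / d\<rfloor> \<in> {- B..B}"
        by (rule fl[OF order_trans[OF abs_Re_le_cmod ent[OF ij]]], rule fl[OF order_trans[OF abs_Im_le_cmod ent[OF ij]]])
      then show "(case z of (p, i, j) \<Rightarrow> (\<lfloor>Re (centred m a (real p / real M) $$ (i, j)) / d\<rfloor>,
          \<lfloor>Im (centred m a (real p / real M) $$ (i, j)) / d\<rfloor>)) \<in> {- B..B} \<times> {- B..B}"
        unfolding z by simp
    qed
  qed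
  have fin: "finite (code ` T)"
    by (rule finite_subset[OF codeT]) (intro finite_PiE finite_SigmaI finite_lessThan finite_atLeastAtMost_int)
  define r where "r c = (SOME a. a \<in> T \<and> code a = c)" for c
  have r: "r (code a) \<in> T" "code (r (code a)) = code a" if "a \<in> T" for a
    using someI[of "\<lambda>a'. a' \<in> T \<and> code a' = code a" a] that by (auto simp: r_def)
  let ?F = "(\<lambda>c. centred m (r c)) ` code ` T"
  have close: "sup_norm (\<lambda>t. centred m a t - centred m b t) \<le> e" if a: "a \<in> T" and b: "b \<in> T" and ab: "code a = code b" for a b
  proof -
    let ?a = "centred m a" and ?b = "centred m b"
    note ac = centred_cpf[OF T(1)[OF a]] and bc = centred_cpf[OF T(1)[OF b]]
    note am = cpfD(3)[OF ac] and bm = cpfD(3)[OF bc]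
    have flr: "\<bar>x - y\<bar> \<le> d" if "\<lfloor>x / d\<rfloor> = \<lfloor>y / d\<rfloor>" for x y
    proof -
      have "x / d - y / d < 1" "y / d - x / d < 1" using that by linarith+
      then have "x - y < d" "y - x < d" using d by (simp_all add: diff_divide_distrib[symmetric] divide_less_eq)
      then show ?thesis by linarith
    qed
    have grid: "op_norm (?a (real p / real M) - ?b (real p / real M)) \<le> e / 2" if p: "p < M" for p
    proof -
      let ?s = "real p / real M"
      have "op_norm (?a ?s - ?b ?s) \<le> (\<Sum>i<?n. \<Sum>j<?n. cmod ((?a ?s - ?b ?s) $$ (i, j)))"
        by (rule op_norm_le_sum[OF minus_carrier_mat[OF bm]])
      also have "\<dots> \<le> (\<Sum>i<?n. \<Sum>j<?n. 2 * d)"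
      proof (intro sum_mono)
        fix i j assume "i \<in> {..<?n}" "j \<in> {..<?n}"
        then have ij: "i < ?n" "j < ?n" by auto
        have "code a (p, i, j) = code b (p, i, j)" by (simp only: ab)
        then have "\<lfloor>Re (?a ?s $$ (i, j)) / d\<rfloor> = \<lfloor>Re (?b ?s $$ (i, j)) / d\<rfloor>" "\<lfloor>Im (?a ?s $$ (i, j)) / d\<rfloor> = \<lfloor>Im (?b ?s $$ (i, j)) / d\<rfloor>"
          using p ij by (simp_all add: code_def)
        from flr[OF this(1)] flr[OF this(2)] have "cmod (?a ?s $$ (i, j) - ?b ?s $$ (i, j)) \<le> 2 * d"
          using cmod_le[of "?a ?s $$ (i, j) - ?b ?s $$ (i, j)"] by simp
        then show "cmod ((?a ?s - ?b ?s) $$ (i, j)) \<le> 2 * d" using ij bm[of ?s] by simp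
      qed
      also have "\<dots> = e / 2" using n by (simp add: d_def)
      finally show ?thesis .
    qed
    show ?thesis
    proof (rule sup_norm_leI)
      fix t :: real
      let ?t = "frac t"
      define p where "p = nat \<lfloor>?t * real M\<rfloor>"
      have t: "0 \<le> ?t" "?t < 1" using frac_lt_1 by auto
      have tM: "0 \<le> ?t * real M" "?t * real M < real M" using t M0 by auto
      have p: "real p \<le> ?t * real M" "?t * real M < real p + 1" using tM(1) unfolding p_def by linarith+
      have pM: "p < M" using p(1) tM(2) by linarith
      let ?s = "real p / real M"
      have "?t - ?s = (?t * real M - real p) / real M" using M0 by (simp add: field_simps)
      then have "\<bar>?t - ?s\<bar> \<le> 1 / real M" using p M0 by (simp add: abs_le_iff divide_right_mono)
      then have "K * \<bar>?t - ?s\<bar> \<le> K * (1 / real M)" using K1 by (intro mult_left_mono) auto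
      also have "\<dots> \<le> e / 4" using M M0 e by (simp add: field_simps)
      finally have Ks: "K * \<bar>?t - ?s\<bar> \<le> e / 4" "K * \<bar>?s - ?t\<bar> \<le> e / 4" by (simp_all add: abs_minus_commute)
      have "op_norm (?a ?t - ?b ?t) \<le> op_norm (?a ?t - ?a ?s) + (op_norm (?a ?s - ?b ?s) + op_norm (?b ?s - ?b ?t))"
        using op_norm_minus_triangle[OF am[of ?t] am[of ?s] bm[of ?t]] op_norm_minus_triangle[OF am[of ?s] bm[of ?s] bm[of ?t]]
        by linarith
      also have "\<dots> \<le> e / 4 + (e / 2 + e / 4)"
        by (intro add_mono grid[OF pM] order_trans[OF lc[OF a] Ks(1)] order_trans[OF lc[OF b] Ks(2)])
      finally show "op_norm (?a t - ?b t) \<le> e" unfolding cpf_frac[OF ac, of t] cpf_frac[OF bc, of t] by simp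
    qed
  qed
  show ?thesis
  proof (intro exI[of _ ?F] conjI ballI impI)
    show "finite ?F" using fin by (rule finite_imageI)
    show "?F \<subseteq> carrier (sa (CP \<sigma> m))"
    proof (intro subsetI, elim imageE, hypsubst)
      fix a assume "a \<in> T"
      then have b: "r (code a) \<in> T" by (rule r)
      let ?b = "r (code a)"
      have "mat_adjoint (centred m ?b t) = centred m ?b t" for t
      proof -
        have "?b t \<in> carrier_mat ?n ?n" by (rule cpfD(3)[OF T(1)[OF b]])
        moreover have "mat_adjoint (?b t) = ?b t" using fun_cong[OF T(2)[OF b]] .
        moreover have "cnj (tau \<sigma> m ?b) = tau \<sigma> m ?b"
          using tau_real[OF T(1,2)[OF b]] by (metis complex_cnj_complex_of_real)
        ultimately show ?thesis
          using minus_mat_eq[of "?b t" ?n ?n "tau \<sigma> m ?b \<cdot>\<^sub>m 1\<^sub>m ?n"]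
          by (simp add: centred_def adjoint_add[of _ ?n ?n] adjoint_smult adjoint_one)
      qed
      then show "centred m ?b \<in> carrier (sa (CP \<sigma> m))" using centred_cpf[OF T(1)[OF b]] by simp
    qed
    fix a assume "a \<in> carrier (sa (CP \<sigma> m))" "L_CP \<sigma> m a \<le> ereal C"
    then have a: "a \<in> T" by (simp add: T_def)
    let ?b = "r (code a)"
    have "a t - (centred m ?b t + complex_of_real (Re (tau \<sigma> m a)) \<cdot>\<^sub>m 1\<^sub>m ?n) = centred m a t - centred m ?b t" for t
      unfolding tau_real[OF T(1,2)[OF a]]
      using cpfD(3)[OF T(1)[OF a], of t] cpfD(3)[OF centred_cpf[OF T(1)[OF r(1)[OF a]]], of t]
      by (intro eq_matI) (auto simp: centred_def[of m a])
    then have "sup_norm (\<lambda>t. a t - (centred m ?b t + complex_of_real (Re (tau \<sigma> m a)) \<cdot>\<^sub>m 1\<^sub>m ?n)) \<le> e"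
      using close[OF a r(1)[OF a] r(2)[OF a, symmetric]] by simp
    then show "\<exists>f\<in>?F. \<exists>r. sup_norm (\<lambda>t. a t - (f t + complex_of_real r \<cdot>\<^sub>m 1\<^sub>m ?n)) \<le> e"
      by (intro bexI[of _ "centred m ?b"] exI[of _ "Re (tau \<sigma> m a)"]) (use a in auto)
  qed
qed

text \<open>
  The entries are replaced by Lipschitz functions close to them; averaging with the adjoint
  restores self-adjointness and moves the result no further away.
\<close>

lemma (in bunce_deddens) CP_lipschitz_dense:
  assumes a: "a \<in> cpf (N m)" "(\<lambda>t. mat_adjoint (a t)) = a" and e: "0 < e"
  shows "\<exists>b\<in>carrier (sa (CP \<sigma> m)). L_CP \<sigma> m b < \<infinity> \<and> sup_norm (\<lambda>t. a t - b t) < e"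
proof -
  let ?n = "N m"
  note am = cpfD(3)[OF a(1)]
  have n: "0 < real ?n" using N_pos by simp
  define d where "d = e / (2 * (real ?n * real ?n))"
  have d: "0 < d" using e n by (simp add: d_def)
  have "\<exists>g K. i < ?n \<longrightarrow> j < ?n \<longrightarrow> (\<forall>t. g (t + 1) = g t) \<and> (\<forall>x y. cmod (g x - g y) \<le> K * \<bar>x - y\<bar>) \<and>
      (\<forall>t. cmod (a t $$ (i, j) - g t) \<le> d)" for i j
  proof (cases "i < ?n \<and> j < ?n")
    case True
    have "a (t + 1) $$ (i, j) = a t $$ (i, j)" for t by (simp add: cpfD(2)[OF a(1)])
    note per = this
    have ij: "i < ?n" "j < ?n" using True by auto
    obtain g K where gK: "\<forall>t. g (t + 1) = g t" "\<forall>x y. cmod (g x - g y) \<le> K * \<bar>x - y\<bar>" "\<forall>t. cmod (a t $$ (i, j) - g t) \<le> d"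
      using lipschitz_approx_complex[OF mat_funD(2)[OF cpfD(1)[OF a(1)] ij] per d] by (elim exE conjE) (rule that)
    show ?thesis by (intro exI[of _ g] exI[of _ K] impI conjI gK)
  qed auto
  then obtain g K where g: "\<And>i j. i < ?n \<Longrightarrow> j < ?n \<Longrightarrow> (\<forall>t. g i j (t + 1) = g i j t) \<and>
      (\<forall>x y. cmod (g i j x - g i j y) \<le> K i j * \<bar>x - y\<bar>) \<and> (\<forall>t. cmod (a t $$ (i, j) - g i j t) \<le> d)"
    by metis
  define b where "b t = Matrix.mat ?n ?n (\<lambda>(i, j). (g i j t + cnj (g j i t)) / 2)" for t
  have bm: "b t \<in> carrier_mat ?n ?n" for t by (simp add: b_def)
  have sab: "(\<lambda>t. mat_adjoint (b t)) = b"
    by (rule ext, rule eq_matI) (auto simp: b_def adjoint_eq add.commute)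
  have Kb: "cmod (b x $$ (i, j) - b y $$ (i, j)) \<le> (K i j + K j i) / 2 * \<bar>x - y\<bar>" if ij: "i < ?n" "j < ?n" for i j x y
  proof -
    have "b x $$ (i, j) - b y $$ (i, j) = ((g i j x - g i j y) + cnj (g j i x - g j i y)) / 2"
      using ij by (simp add: b_def add_divide_distrib diff_divide_distrib)
    then have "cmod (b x $$ (i, j) - b y $$ (i, j)) \<le> (cmod (g i j x - g i j y) + cmod (cnj (g j i x - g j i y))) / 2"
      by (simp only: norm_divide norm_numeral) (intro divide_right_mono norm_triangle_ineq, simp)
    also have "\<dots> \<le> (K i j * \<bar>x - y\<bar> + K j i * \<bar>x - y\<bar>) / 2"
      unfolding complex_mod_cnj using g[OF ij] g[OF ij(2,1)] by (intro divide_right_mono add_mono) auto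
    finally show ?thesis by (simp add: distrib_right)
  qed
  note lb = lipschitz_mat_entries[of b, OF bm Kb]
  have cont: "continuous_on UNIV (\<lambda>t. b t $$ (i, j))" if ij: "i < ?n" "j < ?n" for i j
  proof (rule lipschitz_on_continuous_on, rule lipschitz_onI)
    fix x y :: real
    have le: "(K i j + K j i) / 2 * \<bar>x - y\<bar> \<le> \<bar>(K i j + K j i) / 2\<bar> * \<bar>x - y\<bar>" by (rule mult_right_mono[OF abs_ge_self abs_ge_zero])
    show "dist (b x $$ (i, j)) (b y $$ (i, j)) \<le> \<bar>(K i j + K j i) / 2\<bar> * dist x y"
      unfolding dist_norm real_norm_def by (rule order_trans[OF Kb[OF ij] le])
  qed (rule abs_ge_zero)
  have "b (t + 1) = b t" for t
    by (rule eq_matI) (use g in \<open>auto simp: b_def\<close>)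
  then have b: "b \<in> cpf ?n" using cont bm by (simp add: cpf_def mat_fun_def)
  have "op_norm (a t - b t) \<le> e / 2" for t
  proof -
    have "op_norm (a t - b t) \<le> (\<Sum>i<?n. \<Sum>j<?n. cmod ((a t - b t) $$ (i, j)))"
      by (rule op_norm_le_sum[OF minus_carrier_mat[OF bm]])
    also have "\<dots> \<le> (\<Sum>i<?n. \<Sum>j<?n. d)"
    proof (intro sum_mono)
      fix i j assume "i \<in> {..<?n}" "j \<in> {..<?n}"
      then have ij: "i < ?n" "j < ?n" by auto
      have h: "a t $$ (i, j) = cnj (a t $$ (j, i))"
        using adjoint_index[OF am[of t] ij] fun_cong[OF a(2), of t] by simp
      have "(a t - b t) $$ (i, j) = ((a t $$ (i, j) - g i j t) + cnj (a t $$ (j, i) - g j i t)) / 2"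
        using ij am[of t] h by (simp add: b_def field_simps)
      then have "cmod ((a t - b t) $$ (i, j)) \<le> (cmod (a t $$ (i, j) - g i j t) + cmod (cnj (a t $$ (j, i) - g j i t))) / 2"
        by (simp only: norm_divide norm_numeral) (intro divide_right_mono norm_triangle_ineq, simp)
      also have "\<dots> \<le> (d + d) / 2"
        unfolding complex_mod_cnj using g[OF ij] g[OF ij(2,1)] by (intro divide_right_mono add_mono) auto
      finally show "cmod ((a t - b t) $$ (i, j)) \<le> d" by simp
    qed
    also have "\<dots> = e / 2" using n by (simp add: d_def)
    finally show ?thesis .
  qed
  then have "sup_norm (\<lambda>t. a t - b t) \<le> e / 2" by (rule sup_norm_leI)
  moreover have "L_CP \<sigma> m b < \<infinity>" by (rule L_CP_lipschitz[OF b lb])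
  ultimately show ?thesis using e b sab by (intro bexI[of _ b]) auto
qed

lemma (in bunce_deddens) lip_system_CP:
  "lip_system (CP \<sigma>) (\<lambda>m. pure_states (N m)) (alpha \<sigma>) retr (\<lambda>m a. kappa \<sigma> m * L_CP \<sigma> m a)"
proof (intro lip_system.intro retract_system_CP lip_system_axioms.intro)
  fix m
  obtain c where c: "0 < c" "kappa \<sigma> m = ereal c" by (rule kappa_pos[of m])
  have c': "0 \<le> ereal c" "ereal c \<noteq> \<infinity>" "0 < ereal c" using c by auto
  have one: "(\<lambda>t. 1\<^sub>m (N m)) \<in> cpf (N m)" by (rule cpf_const[OF one_carrier_mat])
  have cL: "L_CP \<sigma> m a < \<infinity>" if "kappa \<sigma> m * L_CP \<sigma> m a < \<infinity>" for a
    using that c by (cases "L_CP \<sigma> m a") auto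
  show "kappa \<sigma> m * L_CP \<sigma> m \<one>\<^bsub>CP \<sigma> m\<^esub> = 0"
  proof -
    have "L_CP \<sigma> m (\<lambda>t. 1\<^sub>m (N m)) \<le> 0" unfolding L_CP_le_iff by (simp add: lip_terms_seminorm(4))
    then have "L_CP \<sigma> m (\<lambda>t. 1\<^sub>m (N m)) = 0" using L_CP_nonneg[OF one] by (rule antisym)
    then show ?thesis by simp
  qed
  fix e :: real assume e: "0 < e"
  show "\<exists>F. finite F \<and> F \<subseteq> carrier (sa (CP \<sigma> m)) \<and> (\<forall>a\<in>carrier (sa (CP \<sigma> m)). kappa \<sigma> m * L_CP \<sigma> m a \<le> 1 \<longrightarrow>
      (\<exists>f\<in>F. \<exists>r. nrm (CP \<sigma> m) (a \<ominus>\<^bsub>CP \<sigma> m\<^esub> (f \<oplus>\<^bsub>CP \<sigma> m\<^esub> complex_of_real r \<odot>\<^bsub>CP \<sigma> m\<^esub> \<one>\<^bsub>CP \<sigma> m\<^esub>)) \<le> e))"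
  proof -
    obtain F where F: "finite F" "F \<subseteq> carrier (sa (CP \<sigma> m))"
      "\<forall>a\<in>carrier (sa (CP \<sigma> m)). L_CP \<sigma> m a \<le> ereal (1 / c) \<longrightarrow>
        (\<exists>f\<in>F. \<exists>r. sup_norm (\<lambda>t. a t - (f t + complex_of_real r \<cdot>\<^sub>m 1\<^sub>m (N m))) \<le> e)"
      using CP_precompact[OF e, of m "1 / c"] by (elim exE conjE) (rule that)
    show ?thesis
    proof (intro exI[of _ F] conjI F(1,2) ballI impI)
      fix a assume a: "a \<in> carrier (sa (CP \<sigma> m))" and L: "kappa \<sigma> m * L_CP \<sigma> m a \<le> 1"
      have "1 / ereal c = ereal (1 / c)" using c(1) by (simp add: one_ereal_def)
      moreover have "L_CP \<sigma> m a \<le> 1 / ereal c" using L by (simp only: c(2) ereal_le_divide_pos[OF c'(3) c'(2)])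
      ultimately have "L_CP \<sigma> m a \<le> ereal (1 / c)" by (simp only:)
      from F(3)[rule_format, OF a this]
      obtain f r where f: "f \<in> F" "sup_norm (\<lambda>t. a t - (f t + complex_of_real r \<cdot>\<^sub>m 1\<^sub>m (N m))) \<le> e"
        by (elim bexE exE) (rule that)
      have fc: "f \<in> cpf (N m)" using subsetD[OF F(2) f(1)] by simp
      have ac: "a \<in> cpf (N m)" using a by simp
      show "\<exists>f\<in>F. \<exists>r. nrm (CP \<sigma> m) (a \<ominus>\<^bsub>CP \<sigma> m\<^esub> (f \<oplus>\<^bsub>CP \<sigma> m\<^esub> complex_of_real r \<odot>\<^bsub>CP \<sigma> m\<^esub> \<one>\<^bsub>CP \<sigma> m\<^esub>)) \<le> e"
        by (intro bexI[OF _ f(1)] exI[of _ r]) (simp add: CP_minus[OF ac cpf_add[OF fc cpf_smult[OF one]]] f(2))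
    qed
  qed
next
  fix m and a :: "real \<Rightarrow> complex Matrix.mat"
  assume as: "a \<in> carrier (sa (CP \<sigma> m))"
  then have a: "a \<in> cpf (N m)" "(\<lambda>t. mat_adjoint (a t)) = a" by auto
  obtain c where c: "0 < c" "kappa \<sigma> m = ereal c" by (rule kappa_pos[of m])
  have c': "0 \<le> ereal c" using c by auto
  show "0 \<le> kappa \<sigma> m * L_CP \<sigma> m a" unfolding c(2) using L_CP_nonneg[OF a(1)] c by simp
  show "kappa \<sigma> m * L_CP \<sigma> m (complex_of_real r \<odot>\<^bsub>CP \<sigma> m\<^esub> a) \<le> ereal \<bar>r\<bar> * (kappa \<sigma> m * L_CP \<sigma> m a)" for r
  proof -
    have "L_CP \<sigma> m (\<lambda>t. complex_of_real r \<cdot>\<^sub>m a t) \<le> ereal \<bar>r\<bar> * L_CP \<sigma> m a"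
      unfolding L_CP_le_iff
    proof
      fix q assume q: "q \<in> lip_terms m"
      have "ereal (q (\<lambda>t. complex_of_real r \<cdot>\<^sub>m a t)) = ereal \<bar>r\<bar> * ereal (q a)"
        by (simp add: lip_terms_seminorm(2)[OF q a(1)])
      also have "\<dots> \<le> ereal \<bar>r\<bar> * L_CP \<sigma> m a" by (intro ereal_mult_left_mono lip_term_le[OF q]) simp
      finally show "ereal (q (\<lambda>t. complex_of_real r \<cdot>\<^sub>m a t)) \<le> ereal \<bar>r\<bar> * L_CP \<sigma> m a" .
    qed
    then have "kappa \<sigma> m * L_CP \<sigma> m (\<lambda>t. complex_of_real r \<cdot>\<^sub>m a t) \<le> kappa \<sigma> m * (ereal \<bar>r\<bar> * L_CP \<sigma> m a)"
      unfolding c(2) by (intro ereal_mult_left_mono c')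
    also have "\<dots> = ereal \<bar>r\<bar> * (kappa \<sigma> m * L_CP \<sigma> m a)" by (rule mult.left_commute)
    finally show ?thesis by (simp only: CP_simps)
  qed
  show "\<exists>r. a = complex_of_real r \<odot>\<^bsub>CP \<sigma> m\<^esub> \<one>\<^bsub>CP \<sigma> m\<^esub>" if z: "kappa \<sigma> m * L_CP \<sigma> m a = 0"
  proof -
    have "L_CP \<sigma> m a \<le> ereal 0" using z c by (simp add: zero_ereal_def[symmetric])
    then have s: "sup_norm (centred m a) \<le> 0" by (simp add: L_CP_le_real_iff[OF a(1)])
    have h: "a t = tau \<sigma> m a \<cdot>\<^sub>m 1\<^sub>m (N m)" for t
    proof -
      note cm = cpfD(3)[OF centred_cpf[OF a(1)], of t]
      have "op_norm (centred m a t) = 0"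
        using op_norm_le_sup_norm[OF centred_cpf[OF a(1)], of t] s op_norm_nonneg[OF cm] by linarith
      then have z: "centred m a t = 0\<^sub>m (N m) (N m)" by (rule op_norm_zero_imp[OF cm])
      show ?thesis
      proof (rule eq_matI)
        fix i j assume "i < dim_row (tau \<sigma> m a \<cdot>\<^sub>m 1\<^sub>m (N m))" "j < dim_col (tau \<sigma> m a \<cdot>\<^sub>m 1\<^sub>m (N m))"
        then have ij: "i < N m" "j < N m" by auto
        have "centred m a t $$ (i, j) = 0" using z ij by simp
        then show "a t $$ (i, j) = (tau \<sigma> m a \<cdot>\<^sub>m 1\<^sub>m (N m)) $$ (i, j)"
          using ij by (simp add: centred_def)
      qed (use cpfD(3)[OF a(1), of t] in auto)
    qed
    show ?thesis
    proof (rule exI[of _ "Re (tau \<sigma> m a)"])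
      show "a = complex_of_real (Re (tau \<sigma> m a)) \<odot>\<^bsub>CP \<sigma> m\<^esub> \<one>\<^bsub>CP \<sigma> m\<^esub>"
        unfolding tau_real[OF a] CP_simps by (rule ext) (rule h)
    qed
  qed
  show "kappa \<sigma> (Suc m) * L_CP \<sigma> (Suc m) (alpha \<sigma> m a) \<le> kappa \<sigma> m * L_CP \<sigma> m a"
  proof (cases "L_CP \<sigma> m a")
    case (real K)
    obtain u where u1: "0 \<le> u" and u: "lip (U \<sigma> m) = ereal u" and u2: "lipschitz_mat u (U \<sigma> m)" by (rule lip_U[of m])
    define k where "k = max 1 ((1 + 2 * u) / real (\<sigma> (Suc m)))"
    have k: "0 < k" by (simp add: k_def)
    have kap: "kappa \<sigma> (Suc m) = ereal (c / k)"
      unfolding kappa_Suc k_fac_eq[OF u] c(2) k_def[symmetric] using k by (simp add: ereal_divide)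
    have "L_CP \<sigma> (Suc m) (alpha \<sigma> m a) \<le> ereal (k * K)"
      unfolding k_def by (rule L_CP_alpha[OF a(1) _ u1 u2]) (simp add: real)
    then have "kappa \<sigma> (Suc m) * L_CP \<sigma> (Suc m) (alpha \<sigma> m a) \<le> ereal (c / k) * ereal (k * K)"
      unfolding kap using c(1) k by (intro ereal_mult_left_mono) auto
    also have "\<dots> = kappa \<sigma> m * L_CP \<sigma> m a" using k by (simp add: c(2) real)
    finally show ?thesis .
  next
    case PInf
    then show ?thesis using c by simp
  next
    case MInf
    then show ?thesis using L_CP_nonneg[OF a(1)] by simp
  qed
  show "\<exists>b\<in>carrier (sa (CP \<sigma> m)). kappa \<sigma> m * L_CP \<sigma> m b < \<infinity> \<and> nrm (CP \<sigma> m) (a \<ominus>\<^bsub>CP \<sigma> m\<^esub> b) < e" if "0 < e" for e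
  proof -
    obtain b where b: "b \<in> carrier (sa (CP \<sigma> m))" "L_CP \<sigma> m b < \<infinity>" "sup_norm (\<lambda>t. a t - b t) < e"
      by (rule bexE[OF CP_lipschitz_dense[OF a \<open>0 < e\<close>]]) (elim conjE, rule that)
    have bc: "b \<in> cpf (N m)" using b(1) by simp
    have "kappa \<sigma> m * L_CP \<sigma> m b < \<infinity>"
      using b(2) L_CP_nonneg[OF bc] unfolding c(2) by (cases "L_CP \<sigma> m b") auto
    then show ?thesis using b(3) by (intro bexI[OF _ b(1)]) (simp add: CP_minus[OF a(1) bc])
  qed
  show "kappa \<sigma> m * L_CP \<sigma> m (a \<oplus>\<^bsub>CP \<sigma> m\<^esub> b) \<le> kappa \<sigma> m * L_CP \<sigma> m a + kappa \<sigma> m * L_CP \<sigma> m b"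
    if "b \<in> carrier (sa (CP \<sigma> m))" for b
  proof -
    have b: "b \<in> cpf (N m)" using that by simp
    have "L_CP \<sigma> m (\<lambda>t. a t + b t) \<le> L_CP \<sigma> m a + L_CP \<sigma> m b"
      unfolding L_CP_le_iff
    proof
      fix q assume q: "q \<in> lip_terms m"
      have "ereal (q (\<lambda>t. a t + b t)) \<le> ereal (q a) + ereal (q b)"
        using lip_terms_seminorm(1)[OF q a(1) b] by simp
      also have "\<dots> \<le> L_CP \<sigma> m a + L_CP \<sigma> m b" by (intro add_mono lip_term_le[OF q])
      finally show "ereal (q (\<lambda>t. a t + b t)) \<le> L_CP \<sigma> m a + L_CP \<sigma> m b" .
    qed
    then have "kappa \<sigma> m * L_CP \<sigma> m (\<lambda>t. a t + b t) \<le> kappa \<sigma> m * (L_CP \<sigma> m a + L_CP \<sigma> m b)"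
      unfolding c(2) by (intro ereal_mult_left_mono c')
    also have "\<dots> = kappa \<sigma> m * L_CP \<sigma> m a + kappa \<sigma> m * L_CP \<sigma> m b"
      by (rule ereal_right_distrib[OF L_CP_nonneg[OF a(1)] L_CP_nonneg[OF b]])
    finally show ?thesis by (simp only: CP_simps)
  qed
  show "kappa \<sigma> m * L_CP \<sigma> m a \<le> M"
    if x: "\<And>k. x k \<in> carrier (sa (CP \<sigma> m))" and M: "\<And>k. kappa \<sigma> m * L_CP \<sigma> m (x k) \<le> M"
      and lim: "(\<lambda>k. nrm (CP \<sigma> m) (x k \<ominus>\<^bsub>CP \<sigma> m\<^esub> a)) \<longlonglongrightarrow> 0" for x :: "nat \<Rightarrow> real \<Rightarrow> complex Matrix.mat" and M
  proof -
    have xc: "x k \<in> cpf (N m)" for k using x[of k] by simp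
    have lim': "(\<lambda>k. sup_norm (\<lambda>t. x k t - a t)) \<longlonglongrightarrow> 0" using lim by (simp add: CP_minus[OF xc a(1)])
    have pos: "0 < ereal c" "ereal c \<noteq> \<infinity>" using c by auto
    have "L_CP \<sigma> m a \<le> M / ereal c"
      unfolding L_CP_le_iff
    proof
      fix q assume q: "q \<in> lip_terms m"
      obtain C where "\<forall>b\<in>cpf (N m). q b \<le> C * sup_norm b" using lip_terms_seminorm(3)[OF q] by (elim exE)
      note C = this[rule_format]
      have bound: "ereal (c * (q a - C * sup_norm (\<lambda>t. x k t - a t))) \<le> M" for k
      proof -
        let ?d = "\<lambda>t. x k t - a t"
        have d: "?d \<in> cpf (N m)" by (rule cpf_minus[OF xc a(1)])
        have "a = (\<lambda>t. x k t + (-1) \<cdot>\<^sub>m ?d t)"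
          using cpfD(3)[OF xc[of k]] cpfD(3)[OF a(1)] by (intro ext eq_matI) (auto dest: carrier_matD)
        then have "q a = q (\<lambda>t. x k t + (-1) \<cdot>\<^sub>m ?d t)" by (rule arg_cong)
        also have "\<dots> \<le> q (x k) + q (\<lambda>t. (-1) \<cdot>\<^sub>m ?d t)" by (rule lip_terms_seminorm(1)[OF q xc cpf_smult[OF d]])
        also have "q (\<lambda>t. (-1) \<cdot>\<^sub>m ?d t) = q ?d" using lip_terms_seminorm(2)[OF q d, of "-1"] by simp
        finally have "q a - C * sup_norm ?d \<le> q (x k)" using C[OF d] by linarith
        then have "ereal (c * (q a - C * sup_norm ?d)) \<le> ereal c * ereal (q (x k))" using c(1) by simp
        also have "\<dots> \<le> ereal c * L_CP \<sigma> m (x k)" by (intro ereal_mult_left_mono lip_term_le[OF q] c')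
        also have "\<dots> \<le> M" using M[of k] by (simp only: c(2))
        finally show ?thesis .
      qed
      have "(\<lambda>k. ereal (c * (q a - C * sup_norm (\<lambda>t. x k t - a t)))) \<longlonglongrightarrow> ereal (c * (q a - C * 0))"
        by (intro tendsto_ereal tendsto_intros lim')
      then have "ereal (c * (q a - C * 0)) \<le> M" by (rule LIMSEQ_le_const2) (use bound in auto)
      then have "ereal c * ereal (q a) \<le> M" by simp
      then show "ereal (q a) \<le> M / ereal c" by (simp only: ereal_le_divide_pos[OF pos])
    qed
    then show ?thesis by (simp only: c(2) ereal_le_divide_pos[OF pos])
  qed
next
  fix m and a :: "real \<Rightarrow> complex Matrix.mat"
  assume as: "a \<in> carrier (sa (CP \<sigma> (Suc m)))" and L: "kappa \<sigma> (Suc m) * L_CP \<sigma> (Suc m) a < \<infinity>"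
  then have a: "a \<in> cpf (N (Suc m))" by auto
  obtain c' where c': "0 < c'" "kappa \<sigma> (Suc m) = ereal c'" by (rule kappa_pos[of "Suc m"])
  obtain c where c: "0 < c" "kappa \<sigma> m = ereal c" by (rule kappa_pos[of m])
  obtain K where K: "L_CP \<sigma> (Suc m) a = ereal K"
    using L L_CP_nonneg[OF a] unfolding c'(2) using c'(1) by (cases "L_CP \<sigma> (Suc m) a") auto
  have lK: "lipschitz_mat K (twist (Suc m) a)"
    using L_CP_le_real_iff[OF a, of K] by (simp add: K)
  note r = retr_cpf[OF a]
  let ?k = "real (\<sigma> (Suc m))"
  have tm: "twist (Suc m) a t \<in> carrier_mat (\<sigma> (Suc m) * N m) (\<sigma> (Suc m) * N m)" for t
    using twist_mem[where a = a, OF cpfD(3)[OF a], of t] by (simp add: N_Suc)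
  have "lipschitz_mat (K * ?k) (retr m a)"
    unfolding lipschitz_mat_def
  proof (intro allI)
    fix x y
    let ?d = "twist (Suc m) a (?k * x) - twist (Suc m) a (?k * y)"
    have dm: "?d \<in> carrier_mat (\<sigma> (Suc m) * N m) (\<sigma> (Suc m) * N m)" by (rule minus_carrier_mat[OF tm])
    have "retr m a x - retr m a y = block (N m) ?d 0 0"
    proof -
      have "p < \<sigma> (Suc m) * N m" if "p < N m" for p using block_pos[OF factor_pos that, of m] by simp
      then show ?thesis using carrier_matD[OF tm]
        by (intro eq_matI) (auto simp: retr_def block_def)
    qed
    then have "op_norm (retr m a x - retr m a y) \<le> op_norm ?d"
      using op_norm_block_le[OF factor_pos dm] by simp
    also have "\<dots> \<le> K * \<bar>?k * x - ?k * y\<bar>" using lK by (simp add: lipschitz_mat_def)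
    also have "\<dots> = K * ?k * \<bar>x - y\<bar>" by (simp add: right_diff_distrib[symmetric] abs_mult)
    finally show "op_norm (retr m a x - retr m a y) \<le> K * ?k * \<bar>x - y\<bar>" .
  qed
  then have "L_CP \<sigma> m (retr m a) < \<infinity>" by (rule L_CP_lipschitz[OF r])
  then show "kappa \<sigma> m * L_CP \<sigma> m (retr m a) < \<infinity>"
    using L_CP_nonneg[OF r] unfolding c(2) by (cases "L_CP \<sigma> m (retr m a)") auto
qed

context bunce_deddens
begin

sublocale lim: lip_system "CP \<sigma>" "\<lambda>m. pure_states (N m)" "alpha \<sigma>" retr "\<lambda>m a. kappa \<sigma> m * L_CP \<sigma> m a"
  by (rule lip_system_CP)

lemma inj_alpha: "inj_on (alpha \<sigma> m) (carrier (CP \<sigma> m))"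
  by (rule inj_on_inverseI[where g = "retr m"]) (simp add: retr_alpha)

text \<open>
  The recursion over the stages in terms of retractions is the one in terms of conditional
  expectations, because the conditional expectation is the embedding after the retraction.
\<close>

lemma S_eq: "a \<in> carrier (sa (CP \<sigma> m)) \<Longrightarrow> lim.S m a = S_CP \<sigma> m a"
proof (induction m arbitrary: a)
  case (Suc m)
  then have a: "a \<in> cpf (N (Suc m))" by simp
  have r: "retr m a \<in> carrier (sa (CP \<sigma> m))" by (rule lim.retr_sa[OF Suc.prems])
  then have rc: "retr m a \<in> carrier (CP \<sigma> m)" by simp
  have "the_inv_into (carrier (CP \<sigma> m)) (alpha \<sigma> m) (cond_exp \<sigma> (Suc m) a) = retr m a"
    unfolding cond_exp_eq[OF a] by (rule the_inv_into_f_f[OF inj_alpha rc])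
  moreover have "a \<ominus>\<^bsub>CP \<sigma> (Suc m)\<^esub> alpha \<sigma> m (retr m a) = (\<lambda>t. a t - cond_exp \<sigma> (Suc m) a t)"
    unfolding cond_exp_eq[OF a] by (rule CP_minus[OF a alpha_cpf[OF retr_cpf[OF a]]])
  ultimately show ?case using Suc.IH[OF r] by ((simp only: lim.S.simps S_CP.simps) | simp)
qed simp

lemma L_BD_eq:
  assumes X: "X \<in> carrier (sa (BD \<sigma>))" shows "L_BD \<sigma> X = lim.Llim X"
proof -
  have X': "X \<in> carrier (sa (ind_lim (CP \<sigma>) (alpha \<sigma>)))" using X by (simp only: BD_def)
  have h: "max (S_CP \<sigma> n (s n)) (ereal (nrm (CP \<sigma> (Suc n)) (\<lambda>t. s (Suc n) t - alpha \<sigma> n (s n) t) / (4 * bridge_bound n))) =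
      max (lim.S n (s n)) (ereal (nrm (CP \<sigma> (Suc n)) (s (Suc n) \<ominus>\<^bsub>CP \<sigma> (Suc n)\<^esub> alpha \<sigma> n (s n)) / (4 * bridge_bound n)))"
    if "s \<in> approx_seqs \<sigma> X" for s n
  proof -
    have s: "s n \<in> carrier (sa (CP \<sigma> n))" for n using that by (auto simp only: approx_seqs_def mem_Collect_eq)
    then have sc: "s n \<in> cpf (N n)" for n by simp
    show ?thesis by (simp only: S_eq[OF s] CP_minus[OF sc alpha_cpf[OF sc]])
  qed
  have "L_BD \<sigma> X = (INF s \<in> approx_seqs \<sigma> X. SUP n. max (lim.S n (s n))
      (ereal (nrm (CP \<sigma> (Suc n)) (s (Suc n) \<ominus>\<^bsub>CP \<sigma> (Suc n)\<^esub> alpha \<sigma> n (s n)) / (4 * bridge_bound n))))"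
    unfolding L_BD_def by (intro INF_cong SUP_cong refl h)
  also have "\<dots> = lim.Llim X"
    using lim.Llim_eq_INF[OF X'] unfolding approx_seqs_def BD_def .
  finally show ?thesis .
qed

lemma quantum_metric_BD: "quantum_metric_ous (sa (BD \<sigma>)) (L_BD \<sigma>)"
proof -
  interpret B: lip_space "sa (BD \<sigma>)" lim.lim_states lim.Llim
    using lim.lip_space_lim unfolding BD_def .
  have "lip_space (sa (BD \<sigma>)) lim.lim_states (L_BD \<sigma>)"
  proof (rule lip_space.intro[OF B.state_separated_axioms], rule lip_space_axioms.intro)
    show "\<exists>F. finite F \<and> F \<subseteq> carrier (sa (BD \<sigma>)) \<and> (\<forall>a\<in>carrier (sa (BD \<sigma>)). L_BD \<sigma> a \<le> 1 \<longrightarrow>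
        (\<exists>f\<in>F. \<exists>r. ou_dist (sa (BD \<sigma>)) a (f \<oplus>\<^bsub>sa (BD \<sigma>)\<^esub> r \<odot>\<^bsub>sa (BD \<sigma>)\<^esub> \<one>\<^bsub>sa (BD \<sigma>)\<^esub>) \<le> e))" if "0 < e" for e
    proof -
      from B.L_precompact[OF that] obtain F where F: "finite F" "F \<subseteq> carrier (sa (BD \<sigma>))"
        "\<forall>a\<in>carrier (sa (BD \<sigma>)). lim.Llim a \<le> 1 \<longrightarrow>
        (\<exists>f\<in>F. \<exists>r. ou_dist (sa (BD \<sigma>)) a (f \<oplus>\<^bsub>sa (BD \<sigma>)\<^esub> r \<odot>\<^bsub>sa (BD \<sigma>)\<^esub> \<one>\<^bsub>sa (BD \<sigma>)\<^esub>) \<le> e)" by (elim exE conjE)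
      show ?thesis
        by (intro exI[of _ F] conjI F(1,2) ballI impI) (rule F(3)[rule_format], assumption, simp only: L_BD_eq)
    qed
    fix a assume a: "a \<in> carrier (sa (BD \<sigma>))"
    show "0 \<le> L_BD \<sigma> a" unfolding L_BD_eq[OF a] by (rule B.L_nonneg[OF a])
    show "L_BD \<sigma> (r \<odot>\<^bsub>sa (BD \<sigma>)\<^esub> a) \<le> ereal \<bar>r\<bar> * L_BD \<sigma> a" for r
      unfolding L_BD_eq[OF a] L_BD_eq[OF B.smult_mem[OF a]] by (rule B.L_smult_le[OF a])
    show "\<exists>r. a = r \<odot>\<^bsub>sa (BD \<sigma>)\<^esub> \<one>\<^bsub>sa (BD \<sigma>)\<^esub>" if "L_BD \<sigma> a = 0"
      using that unfolding L_BD_eq[OF a] by (rule B.L_kernel[OF a])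
    show "\<exists>b\<in>carrier (sa (BD \<sigma>)). L_BD \<sigma> b < \<infinity> \<and> ou_dist (sa (BD \<sigma>)) a b < e" if "0 < e" for e
    proof -
      from B.L_finite_dense[OF a that] obtain b where b: "b \<in> carrier (sa (BD \<sigma>))" "lim.Llim b < \<infinity>"
        "ou_dist (sa (BD \<sigma>)) a b < e" by (elim bexE conjE)
      show ?thesis by (intro bexI[OF _ b(1)] conjI b(3)) (simp only: L_BD_eq[OF b(1)] b(2))
    qed
    show "L_BD \<sigma> (a \<oplus>\<^bsub>sa (BD \<sigma>)\<^esub> b) \<le> L_BD \<sigma> a + L_BD \<sigma> b" if b: "b \<in> carrier (sa (BD \<sigma>))" for b
      unfolding L_BD_eq[OF a] L_BD_eq[OF b] L_BD_eq[OF B.add_mem[OF a b]] by (rule B.L_add[OF a b])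
    show "L_BD \<sigma> a \<le> 1" if "\<And>n. x n \<in> carrier (sa (BD \<sigma>))" "\<And>n. L_BD \<sigma> (x n) \<le> 1"
      "(\<lambda>n. ou_dist (sa (BD \<sigma>)) (x n) a) \<longlonglongrightarrow> 0" for x
      unfolding L_BD_eq[OF a]
      by (rule B.L_limit[OF that(1) _ a that(3)]) (use that(2) in \<open>simp only: L_BD_eq[OF that(1)]\<close>)
  next
    show "L_BD \<sigma> \<one>\<^bsub>sa (BD \<sigma>)\<^esub> = 0" unfolding L_BD_eq[OF B.one_mem] by (rule B.L_one)
    show "\<exists>l\<in>carrier (sa (BD \<sigma>)). (\<lambda>n. ou_dist (sa (BD \<sigma>)) (x n) l) \<longlonglongrightarrow> 0"
      if "\<And>n. x n \<in> carrier (sa (BD \<sigma>))" "\<forall>e>0. \<exists>N. \<forall>m\<ge>N. \<forall>n\<ge>N. ou_dist (sa (BD \<sigma>)) (x m) (x n) < e" for x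
      by (rule B.cauchy_converges[OF that])
  qed
  then show ?thesis by (rule lip_space.quantum_metric)
qed

end

section \<open>Sequences with a common initial segment\<close>

context
  fixes \<beta> \<eta> :: "nat \<Rightarrow> nat" and n :: nat
  assumes agree: "\<And>i. 1 \<le> i \<Longrightarrow> i \<le> n \<Longrightarrow> \<beta> i = \<eta> i"
begin

lemma boxtimes_agree: "m \<le> n \<Longrightarrow> boxtimes \<beta> m = boxtimes \<eta> m"
  unfolding boxtimes_def by (intro prod.cong) (auto intro: agree)

lemma CP_agree: "m \<le> n \<Longrightarrow> CP \<beta> m = CP \<eta> m"
  unfolding CP_def by (simp only: boxtimes_agree)

lemma U_agree: "m \<le> n \<Longrightarrow> U \<beta> m = U \<eta> m"
proof (cases m)
  case (Suc k)
  assume "m \<le> n"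
  then have "\<beta> (Suc k) = \<eta> (Suc k)" "boxtimes \<beta> k = boxtimes \<eta> k" "boxtimes \<beta> (Suc k) = boxtimes \<eta> (Suc k)"
    using Suc agree[of "Suc k"] boxtimes_agree[of k] boxtimes_agree[of "Suc k"] by auto
  then show ?thesis unfolding Suc by (intro ext) (simp only: U.simps)
qed (rule ext, simp)

lemma alpha_agree: "Suc m \<le> n \<Longrightarrow> alpha \<beta> m = alpha \<eta> m"
  using U_agree[of "Suc m"] agree[of "Suc m"] by (intro ext) (simp only: alpha_def)

lemma L_CP_agree: "m \<le> n \<Longrightarrow> L_CP \<beta> m = L_CP \<eta> m"
  by (intro ext) (simp only: L_CP_def tau_def U_agree boxtimes_agree CP_agree)

lemma kappa_agree: "m \<le> n \<Longrightarrow> kappa \<beta> m = kappa \<eta> m"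
proof (induction m)
  case (Suc m)
  show ?case
  proof (cases m)
    case (Suc k)
    have "\<beta> (Suc (Suc k)) = \<eta> (Suc (Suc k))" "U \<beta> (Suc k) = U \<eta> (Suc k)"
      using Suc Suc.prems agree[of "Suc (Suc k)"] U_agree[of "Suc k"] by auto
    then show ?thesis using Suc.IH Suc.prems unfolding Suc by (simp add: k_fac_def del: U.simps)
  qed simp
qed simp

lemma S_CP_agree: "m \<le> n \<Longrightarrow> S_CP \<beta> m = S_CP \<eta> m"
proof (induction m)
  case 0
  show ?case by (intro ext) (simp only: S_CP.simps L_CP_agree)
next
  case (Suc m)
  then have m: "m \<le> n" "S_CP \<beta> m = S_CP \<eta> m" by auto
  have c: "cond_exp \<beta> (Suc m) a = cond_exp \<eta> (Suc m) a" for a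
    using U_agree[OF Suc.prems] boxtimes_agree[OF m(1)] agree[of "Suc m"] Suc.prems
    by (simp add: cond_exp_def block_diag_def del: U.simps)
  show ?case
    by (intro ext) (simp only: S_CP.simps c m(2) alpha_agree[OF Suc.prems] L_CP_agree[OF Suc.prems]
        kappa_agree[OF Suc.prems] CP_agree[OF Suc.prems] CP_agree[OF m(1)])
qed

text \<open>
  Only the common stage and its seminorm enter the comparison of the two limits, so the
  disagreement of the sequences beyond it is harmless.
\<close>

lemma dist_q_agree:
  assumes \<beta>: "\<beta> \<in> baire" and \<eta>: "\<eta> \<in> baire"
  shows "dist_q (sa (BD \<beta>)) (L_BD \<beta>) (sa (BD \<eta>)) (L_BD \<eta>) \<le> ereal ((1 / 2) ^ n)"
proof -
  interpret b: bunce_deddens \<beta> by unfold_locales (rule \<beta>)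
  interpret h: bunce_deddens \<eta> by unfold_locales (rule \<eta>)
  have "lip_systems_agree (CP \<beta>) (\<lambda>m. pure_states (boxtimes \<beta> m)) (alpha \<beta>) b.retr (\<lambda>m a. kappa \<beta> m * L_CP \<beta> m a)
      (CP \<eta>) (\<lambda>m. pure_states (boxtimes \<eta> m)) (alpha \<eta>) h.retr (\<lambda>m a. kappa \<eta> m * L_CP \<eta> m a) n"
  proof (intro lip_systems_agree.intro b.lip_system_CP h.lip_system_CP lip_systems_agree_axioms.intro)
    show "CP \<beta> n = CP \<eta> n" by (rule CP_agree) simp
    show "pure_states (boxtimes \<beta> n) = pure_states (boxtimes \<eta> n)" by (simp add: boxtimes_agree)
    fix a assume a: "a \<in> carrier (sa (CP \<beta> n))"
    have a': "a \<in> carrier (sa (CP \<eta> n))" using a unfolding CP_agree[OF order_refl] .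
    show "b.lim.S n a = h.lim.S n a"
      unfolding b.S_eq[OF a] h.S_eq[OF a'] by (simp add: S_CP_agree)
  qed
  then have "dist_q (sa (BD \<beta>)) b.lim.Llim (sa (BD \<eta>)) h.lim.Llim \<le> ereal ((1 / 2) ^ n)"
    unfolding BD_def by (rule lip_systems_agree.dist_q_lim_le)
  moreover have "admissible (sa (BD \<beta>)) (L_BD \<beta>) (sa (BD \<eta>)) (L_BD \<eta>) =
      admissible (sa (BD \<beta>)) b.lim.Llim (sa (BD \<eta>)) h.lim.Llim"
    by (rule ext) (simp only: admissible_def b.L_BD_eq h.L_BD_eq cong: ball_cong)
  ultimately show ?thesis by (simp only: dist_q_def)
qed

end

theorem theorem6p16:
  shows "(\<forall>\<sigma>\<in>baire. quantum_metric_ous (sa (BD \<sigma>)) (L_BD \<sigma>)) \<and>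
    (\<forall>\<beta>\<in>baire. \<forall>\<eta>\<in>baire.
       dist_q (sa (BD \<beta>)) (L_BD \<beta>) (sa (BD \<eta>)) (L_BD \<eta>) \<le> ereal (32 * baire_dist \<beta> \<eta>))"
proof (intro conjI ballI)
  fix \<sigma> assume "\<sigma> \<in> baire"
  then show "quantum_metric_ous (sa (BD \<sigma>)) (L_BD \<sigma>)"
    by (intro bunce_deddens.quantum_metric_BD bunce_deddens.intro)
next
  fix \<beta> \<eta> assume \<beta>: "\<beta> \<in> baire" and \<eta>: "\<eta> \<in> baire"
  let ?d = "dist_q (sa (BD \<beta>)) (L_BD \<beta>) (sa (BD \<eta>)) (L_BD \<eta>)"
  show "?d \<le> ereal (32 * baire_dist \<beta> \<eta>)"
  proof (cases "\<beta> = \<eta>")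
    case True
    have le: "?d \<le> ereal ((1 / 2) ^ n)" for n
      by (rule dist_q_agree[OF _ \<beta> \<eta>]) (simp add: True)
    have lim: "(\<lambda>n. ereal ((1 / 2) ^ n)) \<longlonglongrightarrow> ereal 0"
      by (intro tendsto_ereal LIMSEQ_power_zero) simp
    have "?d \<le> ereal 0" by (rule LIMSEQ_le_const[OF lim]) (intro exI allI impI le)
    then show ?thesis using True by (simp add: baire_dist_def)
  next
    case False
    define m where "m = (LEAST m. 1 \<le> m \<and> \<beta> m \<noteq> \<eta> m)"
    have "\<exists>m. 1 \<le> m \<and> \<beta> m \<noteq> \<eta> m"
    proof (rule ccontr)
      assume n: "\<not> (\<exists>m. 1 \<le> m \<and> \<beta> m \<noteq> \<eta> m)"
      have "\<beta> = \<eta>" by (rule PiE_ext[OF \<beta>[unfolded baire_def] \<eta>[unfolded baire_def]]) (use n in auto)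
      with False show False ..
    qed
    from LeastI_ex[OF this, folded m_def] have m: "1 \<le> m" "\<beta> m \<noteq> \<eta> m" by auto
    have "\<beta> i = \<eta> i" if "1 \<le> i" "i \<le> m - 1" for i
    proof -
      have "i < m" using that(2) m(1) by linarith
      then have "\<not> (1 \<le> i \<and> \<beta> i \<noteq> \<eta> i)" unfolding m_def by (rule not_less_Least)
      then show ?thesis using that(1) by simp
    qed
    then have "?d \<le> ereal ((1 / 2) ^ (m - 1))" by (rule dist_q_agree[OF _ \<beta> \<eta>])
    also have "(1 / 2 :: real) ^ (m - 1) = 2 * (1 / 2) ^ m" using m(1) by (cases m) auto
    also have "ereal (2 * (1 / 2) ^ m) \<le> ereal (32 * baire_dist \<beta> \<eta>)"
    proof -
      have bd: "baire_dist \<beta> \<eta> = (1 / 2) ^ m" using False by (simp add: baire_dist_def m_def)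
      show ?thesis unfolding bd by simp
    qed
    finally show ?thesis .
  qed
qed

end
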